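(* Let $R$ be a given holomorphic function defined on the product domain $\Omega=(\Delta\cup\overline\Delta)\times(\Delta\cup\overline\Delta)$ associated with some Stolz angle $\Delta$. Then the following statements are equivalent: (1) There exists a bi-freely infinitely divisible law $\nu$ on $\mathbb{R}^2$ such that $R=R_\nu$ on $\Omega$. (2) There exist $\gamma_1,\gamma_2\in\mathbb{R}$, two finite positive Borel measures $\rho_1$ and $\rho_2$ on $\mathbb{R}^2$, and a finite Borel signed measure $\rho$ on $\mathbb{R}^2$ such that $$\begin{cases}\dfrac{t}{\sqrt{1+t^2}}\,d\rho_1=\dfrac{s}{\sqrt{1+s^2}}\,d\rho;\\[2mm] \dfrac{s}{\sqrt{1+s^2}}\,d\rho_2=\dfrac{t}{\sqrt{1+t^2}}\,d\rho;\\[2mm] |\rho(\{(0,0)\})|^2\le\rho_1(\{(0,0)\})\,\rho_2(\{(0,0)\}),\end{cases}$$ and the function $R$ extends analytically to $(\mathbb{C}\setminus\mathbb{R})^2$ via the formula $$R(z,w)=\gamma_1z+\gamma_2w+\int_{\mathbb{R}^2}\frac{z^2+zs}{1-zs}\,d\rho_1(s,t)+\int_{\mathbb{R}^2}\frac{w^2+wt}{1-wt}\,d\rho_2(s,t)+\int_{\mathbb{R}^2}\frac{zw\sqrt{1+s^2}\sqrt{1+t^2}}{(1-zs)(1-wt)}\,d\rho(s,t).$$ In this case, the quintuple $(\gamma_1,\gamma_2,\rho_1,\rho_2,\rho)$ is unique, and the marginal laws of $\nu$ are $\nu^{(j)}=\nu_\boxplus^{\gamma_j,\rho_j^{(j)}}$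 for $j=1,2$.
   Context: For a Borel measure $\mu$ on $\mathbb{R}^2$, its marginals are $\mu^{(j)}=\mu\circ\pi_j^{-1}$, $j=1,2$, where $\pi_1(s,t)=s$, $\pi_2(s,t)=t$ (so $\rho_j^{(j)}$ is the $j$-th marginal of $\rho_j$). For a probability measure $\mu$ on $\mathbb{R}^2$ the Cauchy transform is $G_\mu(z,w)=\int_{\mathbb{R}^2}\frac{1}{(z-s)(w-t)}\,d\mu(s,t)$ for $z,w\in\mathbb{C}\setminus\mathbb{R}$. For a probability measure $m$ on $\mathbb{R}$, $G_m(z)=\int_{\mathbb{R}}\frac{1}{z-x}\,dm(x)$, $z\notin\mathbb{R}$. For $\alpha,\beta>0$ the Stolz angle is $\Delta=\Delta_{\alpha,\beta}=\{x+iy\in\mathbb{C}: y<0,\ |x|<-\alpha y,\ y>-\beta\}$, and $\overline{\Delta}=\{\bar z:z\in\Delta\}$ is its reflection; $(\Delta\cup\overline\Delta)\times(\Delta\cup\overline\Delta)$ is the associated product domain. The one-dimensional $R$-transform $R_m$ of a probability measure $m$ on $\mathbb{R}$ is the holomorphic function on $\Delta\cup\overline\Delta$ (for a sufficiently small Stolz angle $\Delta$) with $1/z+R_m(z)\notin\mathbb{R}$, $G_m(1/z+R_m(z))=z$, and $zR_m(z)\to0$ as $z\to0$ in $\Delta\cup\overline\Delta$. The bi-free partial $R$-transform of a probability measure $\mu$ on $\mathbb{R}^2$ is $$R_\mu(z,w)=zR_{\mu^{(1)}}(z)+wR_{\mu^{(2)}}(w)+\left[1-\frac{1}{h_\mu(z,w)}\right],\quad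 h_\mu(z,w)=\frac{G_\mu\left(1/z+R_{\mu^{(1)}}(z),\,1/w+R_{\mu^{(2)}}(w)\right)}{zw},$$ which is defined and holomorphic on a product domain (with $\Delta$ small enough) on which $R_{\mu^{(1)}},R_{\mu^{(2)}}$ are defined and $h_\mu$ has no zeros; $R_\mu$ also denotes the holomorphic extension of this function to a larger product domain (or to $(\mathbb{C}\setminus\mathbb{R})^2$) whenever such an extension exists. A probability measure $\nu$ on $\mathbb{R}^2$ with $R$-transform $R_\nu$ on a product domain is bi-freely infinitely divisible if for each integer $m\ge2$ there exists a probability law $\mu_m$ on $\mathbb{R}^2$ such that $R_\nu=mR_{\mu_m}$ in that domain. For $\gamma\in\mathbb{R}$ and $\sigma$ a finite positive Borel measure on $\mathbb{R}$, $\nu_\boxplus^{\gamma,\sigma}$ is the unique law on $\mathbb{R}$, infinitely divisible with respect to free additive convolution $\boxplus$, with $R_{\nu_\boxplus^{\gamma,\sigma}}(z)=\gamma+\int_{\mathbb{R}}\frac{z+x}{1-zx}\,d\sigma(x)$, $z\notin\mathbb{R}$. *)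

theory Defs
  imports "HOL-Probability.Probability" "HOL-Complex_Analysis.Complex_Analysis"
begin

text \<open>Complex differentiability in two variables: the derivative is \<open>\<complex>\<close>-linear.
  All sets used below are open.\<close>

definition holomorphic2_on :: "(complex \<times> complex \<Rightarrow> complex) \<Rightarrow> (complex \<times> complex) set \<Rightarrow> bool"
    (infixl "holomorphic2'_on" 50) where
  "f holomorphic2_on S \<longleftrightarrow>
     (\<forall>p\<in>S. \<exists>a b. (f has_derivative (\<lambda>(h, k). a * h + b * k)) (at p within S))"

definition stolz_angle :: "real \<Rightarrow> real \<Rightarrow> complex set" where
  "stolz_angle \<alpha> \<beta> = {z. Im z < 0 \<and> \<bar>Re z\<bar> < - \<alpha> * Im z \<and> Im z > - \<beta>}"

definition stolz_domain :: "real \<Rightarrow> real \<Rightarrow> complex set" where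
  "stolz_domain \<alpha> \<beta> = stolz_angle \<alpha> \<beta> \<union> cnj ` stolz_angle \<alpha> \<beta>"

definition product_domain :: "real \<Rightarrow> real \<Rightarrow> (complex \<times> complex) set" where
  "product_domain \<alpha> \<beta> = stolz_domain \<alpha> \<beta> \<times> stolz_domain \<alpha> \<beta>"


definition borel_law :: "'a::topological_space measure \<Rightarrow> bool" where
  "borel_law \<mu> \<longleftrightarrow> prob_space \<mu> \<and> sets \<mu> = sets borel"

definition finite_borel :: "'a::topological_space measure \<Rightarrow> bool" where
  "finite_borel \<mu> \<longleftrightarrow> finite_measure \<mu> \<and> sets \<mu> = sets borel"

definition marginal1 :: "(real \<times> real) measure \<Rightarrow> real measure" where
  "marginal1 \<mu> = distr \<mu> borel fst"

definition marginal2 :: "(real \<times> real) measure \<Rightarrow> real measure" where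
  "marginal2 \<mu> = distr \<mu> borel snd"

text \<open>A finite signed measure is a countably additive real-valued set function on
  \<^term>\<open>sets M\<close>.  As for the type of measures, values outside the sigma-algebra are
  normalised to 0, so that equality of signed measures is equality of set functions.\<close>

definition signed_measure_on :: "'a measure \<Rightarrow> ('a set \<Rightarrow> real) \<Rightarrow> bool" where
  "signed_measure_on M \<rho> \<longleftrightarrow>
     \<rho> {} = 0 \<and>
     (\<forall>A :: nat \<Rightarrow> 'a set. range A \<subseteq> sets M \<longrightarrow> disjoint_family A \<longrightarrow>
        (\<lambda>i. \<rho> (A i)) sums \<rho> (\<Union>i. A i)) \<and>
     (\<forall>A. A \<notin> sets M \<longrightarrow> \<rho> A = 0)"

text \<open>The upper variation of the Jordan decomposition.  The supremum is at least 0
  since \<open>B = {}\<close> is allowed, so the truncation of negative values by \<^const>\<open>ennreal\<close>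
  is harmless.\<close>

definition upper_variation :: "'a measure \<Rightarrow> ('a set \<Rightarrow> real) \<Rightarrow> 'a measure" where
  "upper_variation M \<rho> =
     measure_of (space M) (sets M) (\<lambda>A. SUP B\<in>{B\<in>sets M. B \<subseteq> A}. ennreal (\<rho> B))"

definition signed_integral ::
    "'a measure \<Rightarrow> ('a set \<Rightarrow> real) \<Rightarrow> ('a \<Rightarrow> 'b::{banach, second_countable_topology}) \<Rightarrow> 'b" where
  "signed_integral M \<rho> f =
     (\<integral>x. f x \<partial>upper_variation M \<rho>) - (\<integral>x. f x \<partial>upper_variation M (\<lambda>A. - \<rho> A))"


definition cauchy_transform :: "real measure \<Rightarrow> complex \<Rightarrow> complex" where
  "cauchy_transform m z = (\<integral>x. 1 / (z - of_real x) \<partial>m)"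

definition cauchy_transform2 :: "(real \<times> real) measure \<Rightarrow> complex \<Rightarrow> complex \<Rightarrow> complex" where
  "cauchy_transform2 \<mu> z w = (\<integral>(s, t). 1 / ((z - of_real s) * (w - of_real t)) \<partial>\<mu>)"

text \<open>\<open>Rm\<close> is the R-transform of \<open>m\<close> on the domain \<open>\<Delta> \<union> \<Delta>\<^sup>-\<close> with parameters
  \<open>\<alpha>\<close>, \<open>\<beta>\<close>; its values off that domain are irrelevant.\<close>

definition R_transform :: "real measure \<Rightarrow> real \<Rightarrow> real \<Rightarrow> (complex \<Rightarrow> complex) \<Rightarrow> bool" where
  "R_transform m \<alpha> \<beta> Rm \<longleftrightarrow>
     Rm holomorphic_on stolz_domain \<alpha> \<beta> \<and>
     (\<forall>z\<in>stolz_domain \<alpha> \<beta>. 1 / z + Rm z \<notin> \<real> \<and> cauchy_transform m (1 / z + Rm z) = z) \<and>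
     ((\<lambda>z. z * Rm z) \<longlongrightarrow> 0) (at 0 within stolz_domain \<alpha> \<beta>)"

text \<open>The function \<open>Rm\<close> on \<open>D\<close> is the holomorphic extension of the R-transform on some
  sufficiently small domain.\<close>

definition R_transform_on :: "real measure \<Rightarrow> complex set \<Rightarrow> (complex \<Rightarrow> complex) \<Rightarrow> bool" where
  "R_transform_on m D Rm \<longleftrightarrow>
     Rm holomorphic_on D \<and>
     (\<exists>\<alpha>>0. \<exists>\<beta>>0. stolz_domain \<alpha> \<beta> \<subseteq> D \<and> R_transform m \<alpha> \<beta> Rm)"


definition bifree_h ::
    "(real \<times> real) measure \<Rightarrow> (complex \<Rightarrow> complex) \<Rightarrow> (complex \<Rightarrow> complex) \<Rightarrow> complex \<Rightarrow> complex \<Rightarrow> complex" where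
  "bifree_h \<mu> R1 R2 z w = cauchy_transform2 \<mu> (1 / z + R1 z) (1 / w + R2 w) / (z * w)"

text \<open>\<open>R\<close> is the bi-free partial R-transform of \<open>\<mu>\<close> on \<open>D\<close>, that is, the holomorphic
  extension to \<open>D\<close> of the function given by the defining formula on a sufficiently small
  product domain.  It is unique when \<open>D\<close> is a product domain or \<open>(\<complex> - \<real>)\<^sup>2\<close>, as then every
  component of \<open>D\<close> meets every smaller product domain.\<close>

definition bifree_R_transform_on ::
    "(real \<times> real) measure \<Rightarrow> (complex \<times> complex) set \<Rightarrow> (complex \<times> complex \<Rightarrow> complex) \<Rightarrow> bool" where
  "bifree_R_transform_on \<mu> D R \<longleftrightarrow>
     R holomorphic2_on D \<and>
     (\<exists>\<alpha>>0. \<exists>\<beta>>0. \<exists>R1 R2.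
        product_domain \<alpha> \<beta> \<subseteq> D \<and>
        R_transform (marginal1 \<mu>) \<alpha> \<beta> R1 \<and>
        R_transform (marginal2 \<mu>) \<alpha> \<beta> R2 \<and>
        (\<forall>(z, w)\<in>product_domain \<alpha> \<beta>.
           bifree_h \<mu> R1 R2 z w \<noteq> 0 \<and>
           R (z, w) = z * R1 z + w * R2 w + (1 - 1 / bifree_h \<mu> R1 R2 z w)))"

definition bifree_inf_divisible :: "(real \<times> real) measure \<Rightarrow> bool" where
  "bifree_inf_divisible \<nu> \<longleftrightarrow>
     borel_law \<nu> \<and>
     (\<exists>\<alpha>>0. \<exists>\<beta>>0. \<exists>R.
        bifree_R_transform_on \<nu> (product_domain \<alpha> \<beta>) R \<and>
        (\<forall>m\<ge>2. \<exists>\<mu> S.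
           borel_law \<mu> \<and> bifree_R_transform_on \<mu> (product_domain \<alpha> \<beta>) S \<and>
           (\<forall>p\<in>product_domain \<alpha> \<beta>. R p = of_nat m * S p)))"


text \<open>\<open>\<kappa>\<close> is the free additive convolution of \<open>\<mu>\<^sub>1\<close> and \<open>\<mu>\<^sub>2\<close>, defined analytically by
  the additivity of the R-transform (which determines \<open>\<kappa>\<close>).\<close>

definition free_add_conv :: "real measure \<Rightarrow> real measure \<Rightarrow> real measure \<Rightarrow> bool" where
  "free_add_conv \<mu>1 \<mu>2 \<kappa> \<longleftrightarrow>
     borel_law \<mu>1 \<and> borel_law \<mu>2 \<and> borel_law \<kappa> \<and>
     (\<exists>\<alpha>>0. \<exists>\<beta>>0. \<exists>R1 R2.
        R_transform \<mu>1 \<alpha> \<beta> R1 \<and> R_transform \<mu>2 \<alpha> \<beta> R2 \<and>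
        R_transform \<kappa> \<alpha> \<beta> (\<lambda>z. R1 z + R2 z))"

inductive free_conv_power :: "real measure \<Rightarrow> nat \<Rightarrow> real measure \<Rightarrow> bool" for \<mu> where
  one: "free_conv_power \<mu> 1 \<mu>"
| step: "free_conv_power \<mu> n \<kappa> \<Longrightarrow> free_add_conv \<kappa> \<mu> \<kappa>' \<Longrightarrow> free_conv_power \<mu> (Suc n) \<kappa>'"

definition free_inf_divisible :: "real measure \<Rightarrow> bool" where
  "free_inf_divisible \<nu> \<longleftrightarrow>
     borel_law \<nu> \<and> (\<forall>m\<ge>2. \<exists>\<mu>. borel_law \<mu> \<and> free_conv_power \<mu> m \<nu>)"

definition free_inf_div_law :: "real \<Rightarrow> real measure \<Rightarrow> real measure" where
  "free_inf_div_law \<gamma> \<sigma> =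
     (THE \<nu>. free_inf_divisible \<nu> \<and>
        R_transform_on \<nu> (- \<real>)
          (\<lambda>z. of_real \<gamma> + (\<integral>x. (z + of_real x) / (1 - z * of_real x) \<partial>\<sigma>)))"


definition levy_khintchine ::
    "real \<Rightarrow> real \<Rightarrow> (real \<times> real) measure \<Rightarrow> (real \<times> real) measure \<Rightarrow> ((real \<times> real) set \<Rightarrow> real)
      \<Rightarrow> complex \<times> complex \<Rightarrow> complex" where
  "levy_khintchine \<gamma>1 \<gamma>2 \<rho>1 \<rho>2 \<rho> = (\<lambda>(z, w).
     of_real \<gamma>1 * z + of_real \<gamma>2 * w
     + (\<integral>(s, t). (z\<^sup>2 + z * of_real s) / (1 - z * of_real s) \<partial>\<rho>1)
     + (\<integral>(s, t). (w\<^sup>2 + w * of_real t) / (1 - w * of_real t) \<partial>\<rho>2)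
     + signed_integral borel \<rho> (\<lambda>(s, t).
         z * w * of_real (sqrt (1 + s\<^sup>2)) * of_real (sqrt (1 + t\<^sup>2))
           / ((1 - z * of_real s) * (1 - w * of_real t))))"

text \<open>The equalities of measures with densities are equalities of finite signed measures,
  stated on every Borel set; all densities are bounded by 1 in absolute value.\<close>

definition levy_compatible ::
    "(real \<times> real) measure \<Rightarrow> (real \<times> real) measure \<Rightarrow> ((real \<times> real) set \<Rightarrow> real) \<Rightarrow> bool" where
  "levy_compatible \<rho>1 \<rho>2 \<rho> \<longleftrightarrow>
     (\<forall>A\<in>sets borel.
        (\<integral>p. indicator A p * (snd p / sqrt (1 + (snd p)\<^sup>2)) \<partial>\<rho>1)
          = signed_integral borel \<rho> (\<lambda>p. indicator A p * (fst p / sqrt (1 + (fst p)\<^sup>2)))) \<and>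
     (\<forall>A\<in>sets borel.
        (\<integral>p. indicator A p * (fst p / sqrt (1 + (fst p)\<^sup>2)) \<partial>\<rho>2)
          = signed_integral borel \<rho> (\<lambda>p. indicator A p * (snd p / sqrt (1 + (snd p)\<^sup>2)))) \<and>
     \<bar>\<rho> {(0, 0)}\<bar>\<^sup>2 \<le> measure \<rho>1 {(0, 0)} * measure \<rho>2 {(0, 0)}"

definition levy_representation ::
    "(complex \<times> complex) set \<Rightarrow> (complex \<times> complex \<Rightarrow> complex) \<Rightarrow> real \<Rightarrow> real
      \<Rightarrow> (real \<times> real) measure \<Rightarrow> (real \<times> real) measure \<Rightarrow> ((real \<times> real) set \<Rightarrow> real) \<Rightarrow> bool" where
  "levy_representation \<Omega> R \<gamma>1 \<gamma>2 \<rho>1 \<rho>2 \<rho> \<longleftrightarrow>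
     finite_borel \<rho>1 \<and> finite_borel \<rho>2 \<and> signed_measure_on borel \<rho> \<and>
     levy_compatible \<rho>1 \<rho>2 \<rho> \<and>
     levy_khintchine \<gamma>1 \<gamma>2 \<rho>1 \<rho>2 \<rho> holomorphic2_on ((- \<real>) \<times> (- \<real>)) \<and>
     (\<forall>p\<in>\<Omega>. R p = levy_khintchine \<gamma>1 \<gamma>2 \<rho>1 \<rho>2 \<rho> p)"

end

theory Submission
 imports Defs "HOL-Real_Asymp.Real_Asymp"
begin

text \<open>From representation to law: the one-dimensional subordination function \<open>F\<^sub>j\<close> inverts
 \<open>z \<mapsto> z + R\<^sub>j (1/z)\<close>, which forces \<open>G(z, w) = 1 / (F\<^sub>1 z F\<^sub>2 w (1 - q(F\<^sub>1 z, F\<^sub>2 w)))\<close>, \<open>q(z, w)\<close> being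
 the mixed term of \<open>R(1/z, 1/w)\<close>. Positivity of \<open>Re (G (cnj z) w - G z w)\<close> on the upper half planes makes \<open>G\<close> a Cauchy
 transform: the double Poisson formula gives approximating laws, and weak compactness their limit.
 Scaling the data by \<open>1/m\<close> yields the convolution roots.

 From law to representation: with \<open>x' = x / sqrt (1 + x\<^sup>2)\<close> and \<open>\<mu>\<^sub>m\<close> the \<open>m\<close>-th root, the measures
 \<open>m s'\<^sup>2 \<mu>\<^sub>m\<close>, \<open>m t'\<^sup>2 \<mu>\<^sub>m\<close> and \<open>m (s' + t')\<^sup>2 \<mu>\<^sub>m\<close> have bounded mass and are tight. Their subsequential
 limits are \<open>\<rho>\<^sub>1\<close>, \<open>\<rho>\<^sub>2\<close> and \<open>\<rho>\<^sub>1 + \<rho>\<^sub>2 + 2 \<rho>\<close>; compatibility and the inequality at the origin survive the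
 limit.

 Uniqueness: the kernels of \<open>\<rho>\<close> determine it by Poisson inversion, and the compatibility conditions
 determine \<open>\<rho>\<^sub>1\<close> and \<open>\<rho>\<^sub>2\<close> off the axes, where the marginals take over.\<close>

text \<open>Against a common dominating measure the three conditions say that at every point the
  densities \<open>A\<close>, \<open>B\<close>, \<open>C\<close> of the triple form a positive
  semidefinite matrix with rows \<open>(A, C)\<close> and \<open>(C, B)\<close>: off the origin
  compatibility forces \<open>C^2 = A B\<close>, at the origin only the inequality is available.
  Existence of the law rests on this: the real part that has to be nonnegative is a positive
  multiple of two weighted squares plus the integral of that quadratic form. In the converse
  direction the measures \<open>m s' t' mu\<close> are signed and have no compactness of their own;
  the square \<open>(s' + t')^2\<close> recovers their limit by polarisation. Weak convergence does
  not control atoms, so the inequality at the origin is proved for bump functions of fixed width,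
  which shrink to the point only after the limit. A second obstacle is that transforms are germs on
  Stolz domains, and each root may bring a domain of its own. Its equations, written with the
  transforms of the given law and cleared of denominators, are continued to one domain that serves
  all roots before any limit is taken.\<close>

type_synonym plane = "real \<times> real"
abbreviation (input) cor :: "real => complex" where "cor == of_real"
abbreviation (input) "bor == borel_measurable borel"
abbreviation (input) tendsto_seq ("(_/ ----> _)" [60, 60] 60) where "X ----> L == LIMSEQ X L"
abbreviation (input) tendsto_along (infixr "--->" 55) where "f ---> F == tendsto f F"

section \<open>Signed measures\<close>

definition add_measure :: "'a measure => 'a measure => 'a measure" where
 "add_measure M N = measure_of (space M) (sets M) (%A. emeasure M A + emeasure N A)"
abbreviation (input) ratio :: "real => real" where "ratio x == x / sqrt (1 + x^2)"
abbreviation (input) skern :: "complex => real => complex" where "skern z x == of_real (sqrt (1 + x^2)) / (z - of_real x)"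
abbreviation (input) lkern :: "complex => real => complex" where "lkern z x == (z^2 + z * of_real x) / (1 - z * of_real x)"

lemma sets_add_measure [simp, measurable_cong]: "sets (add_measure M N) = sets M"
 and space_add_measure [simp]: "space (add_measure M N) = space M" by (auto simp: add_measure_def)

lemma emeasure_add_measure:
 assumes "sets N = sets M" "A \<in> sets M"
 shows "emeasure (add_measure M N) A = emeasure M A + emeasure N A" unfolding add_measure_def
proof (rule emeasure_measure_of_sigma)
 show "countably_additive (sets M) (%A. emeasure M A + emeasure N A)" unfolding countably_additive_def
  using assms(1) by (auto simp: suminf_add[symmetric] suminf_emeasure)
qed (use assms sets.sigma_algebra_axioms in \<open>auto simp: positive_def\<close>)

lemma nn_integral_add_measure:
 assumes N: "sets N = sets M" and f: "f \<in> borel_measurable M"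
 shows "nn_integral (add_measure M N) (%x. f x) = nn_integral M (%x. f x) + nn_integral N (%x. f x)"
proof -
 have mN: "g \<in> borel_measurable N" and mA: "g \<in> borel_measurable (add_measure M N)"
  if "g \<in> borel_measurable M" for g :: "'a => ennreal" using that measurable_cong_sets[OF N refl] by auto
 from f show ?thesis
proof (induction rule: borel_measurable_induct)
 case (cong f g)
 have "space N = space M" using N by (rule sets_eq_imp_space_eq)
 with cong have "nn_integral (add_measure M N) (%x. f x) = nn_integral (add_measure M N) (%x. g x)"
  "nn_integral M (%x. f x) = nn_integral M (%x. g x)" "nn_integral N (%x. f x) = nn_integral N (%x. g x)"
  by (intro nn_integral_cong; simp)+
 with cong show ?case by simp
next
 case (set A)
 thus ?case by (simp add: N emeasure_add_measure)
next
 case (mult u c)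
 thus ?case using mN[OF mult(2)] by (simp add: nn_integral_cmult distrib_left)
next
 case (add u v)
 thus ?case using nn_integral_add[OF add(1,3)] nn_integral_add[OF mN[OF add(1)] mN[OF add(3)]]
    nn_integral_add[OF mA[OF add(1)] mA[OF add(3)]] by (simp add: ac_simps)
next
 case (seq U)
 have m: "U i \<in> borel_measurable M" "U i \<in> borel_measurable N" "U i \<in> borel_measurable (add_measure M N)" for i
  using seq(1)[of i] mN[OF seq(1)[of i]] by simp_all
 have inc: "incseq (%i. integral\<^sup>N M (U i))" "incseq (%i. integral\<^sup>N N (U i))"
  using seq(3) by (auto simp: incseq_def le_fun_def intro!: nn_integral_mono)
 have SUP: "nn_integral L (%x. (SUP i. U i x)) = (SUP i. integral\<^sup>N L (U i))"
  if "!!i. U i \<in> borel_measurable L" for L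
  using that by (rule nn_integral_monotone_convergence_SUP[OF seq(3)])
 show ?case unfolding SUP_apply using SUP[of M] SUP[of N] SUP[of "add_measure M N"] m
  by (simp add: seq.IH ennreal_SUP_add[OF inc])
qed
qed

lemma finite_measure_add_measure:
 assumes "sets N = sets M" "finite_measure M" "finite_measure N"
 shows "finite_measure (add_measure M N)"
proof
 have "space N = space M" using assms(1) by (rule sets_eq_imp_space_eq)
 thus "emeasure (add_measure M N) (space (add_measure M N)) ~= \<infinity>"
  using emeasure_add_measure[OF assms(1) sets.top] finite_measure.emeasure_finite[OF assms(2), of "space M"]
   finite_measure.emeasure_finite[OF assms(3), of "space M"] by simp
qed

lemma integrable_add_measure:
 fixes f :: "'a => 'b::{banach, second_countable_topology}"
 assumes N: "sets N = sets M" and f: "integrable M f" "integrable N f"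
 shows "integrable (add_measure M N) f" using f unfolding integrable_iff_bounded
 by (auto simp: nn_integral_add_measure[OF N])

lemma integral_add_measure:
 fixes f :: "'a => 'b::{banach, second_countable_topology}"
 assumes N: "sets N = sets M" and f: "integrable M f" "integrable N f"
 shows "(LINT x|(add_measure M N). f x) = (LINT x|M. f x) + (LINT x|N. f x)"
proof -
 let ?S = "add_measure M N"
 have sp: "space N = space M" using N by (rule sets_eq_imp_space_eq)
 have int: "integrable M f & integrable N f" if "integrable ?S f" for f :: "'a => 'b"
  using that unfolding integrable_iff_bounded by (auto simp: nn_integral_add_measure[OF N]
    measurable_cong_sets[OF N refl])
 have "integrable ?S f" by (rule integrable_add_measure[OF N f])
 thus ?thesis
 proof (induction rule: integrable_induct)
  case (base A c)
  hence "emeasure M A < \<infinity>" "emeasure N A < \<infinity>" using emeasure_add_measure[OF N, of A] by auto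
  with base N show ?case by (simp add: emeasure_add_measure measure_def enn2real_plus scaleR_add_left)
 next
  case (add f g)
  thus ?case using int[OF add(1)] int[OF add(2)] by simp
 next
  case (lim f s)
  have "(%i. integral\<^sup>L ?S (s i)) ----> integral\<^sup>L ?S f"
   by (rule integral_dominated_convergence[where w="%x. 2 * norm (f x)"])
    (use lim in \<open>auto\<close>)
  moreover have "(%i. integral\<^sup>L M (s i)) ----> integral\<^sup>L M f"
   by (rule integral_dominated_convergence[where w="%x. 2 * norm (f x)"])
    (use lim int in \<open>auto\<close>)
  moreover have "(%i. integral\<^sup>L N (s i)) ----> integral\<^sup>L N f"
   by (rule integral_dominated_convergence[where w="%x. 2 * norm (f x)"])
    (use lim int sp in \<open>auto intro!: borel_measurable_integrable\<close>)
  ultimately have "(%i. integral\<^sup>L ?S (s i)) ----> integral\<^sup>L M f + integral\<^sup>L N f"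
   by (simp only: lim(5) tendsto_add)
  with `(%i. integral\<^sup>L ?S (s i)) ----> integral\<^sup>L ?S f` show ?case using LIMSEQ_unique by blast
 qed
qed

lemma integrable_bounded:
 fixes f :: "'a => 'b::{banach, second_countable_topology}"
 assumes "finite_measure M" "f \<in> borel_measurable M" "!!x. norm (f x) <= C"
 shows "integrable M f" using assms by (intro finite_measure.integrable_const_bound[where B=C]) auto

text \<open>The hypothesis is \<open>M - N = U - V\<close> with the negative parts moved across.
  Both sides are then one positive measure, and the integrals agree without any integration theory
  for signed measures.\<close>

lemma integral_eq_of_measure_sum_eq:
 fixes f :: "'a => 'b::{banach, second_countable_topology}"
 assumes fin: "finite_measure M" "finite_measure N" "finite_measure U" "finite_measure V"
  and sets: "sets M = S" "sets N = S" "sets U = S" "sets V = S"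
  and eq: "!!A. A \<in> S ==> measure M A + measure V A = measure N A + measure U A"
  and f: "f \<in> borel_measurable M" "!!x. norm (f x) <= C"
 shows "(LINT x|M. f x) + (LINT x|V. f x) = (LINT x|N. f x) + (LINT x|U. f x)"
proof -
 have *: "add_measure M V = add_measure N U"
 proof (rule measure_eqI)
  fix A assume "A \<in> sets (add_measure M V)"
  hence A: "A \<in> S" using sets by simp
  have "emeasure M A = ennreal (measure M A)" "emeasure N A = ennreal (measure N A)"
   "emeasure U A = ennreal (measure U A)" "emeasure V A = ennreal (measure V A)"
   using fin by (auto simp: finite_measure.emeasure_eq_measure)
  thus "emeasure (add_measure M V) A = emeasure (add_measure N U) A"
   using A sets by (simp add: emeasure_add_measure eq ennreal_plus[symmetric] del: ennreal_plus)
 qed (use sets in simp)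
 have "(LINT x|M. f x) + (LINT x|V. f x) = (LINT x|(add_measure M V). f x)"
  using sets fin f by (intro integral_add_measure[symmetric] integrable_bounded[of _ _ C]) auto
 also have "... = (LINT x|N. f x) + (LINT x|U. f x)"
  unfolding * using sets fin f by (intro integral_add_measure integrable_bounded[of _ _ C]) auto
 finally show ?thesis .
qed

section \<open>Hahn and Jordan decompositions\<close>

definition positive_set :: "'a measure => ('a set => real) => 'a set => bool" where
 "positive_set M ro A \<longleftrightarrow> A \<in> sets M & (\<forall>B\<in>sets M. B \<subseteq> A --> 0 <= ro B)"

lemma signed_measure_sums:
 assumes "signed_measure_on M ro" "!!i. A i \<in> sets M" "disjoint_family A"
 shows "(%i. ro (A i)) sums ro (\<Union>i::nat. A i)"
 using assms(1)[unfolded signed_measure_on_def, THEN conjunct2, THEN conjunct1, rule_format, of A]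
  assms(2,3) by auto

lemma signed_measure_empty: "signed_measure_on M ro ==> ro {} = 0" by (simp add: signed_measure_on_def)

lemma signed_measure_Un:
 assumes ro: "signed_measure_on M ro" and AB: "A \<in> sets M" "B \<in> sets M" "A \<inter> B = {}"
 shows "ro (A \<union> B) = ro A + ro B"
proof -
 have "(%i. ro (binaryset A B i)) sums ro (\<Union>i. binaryset A B i)"
  using AB by (intro signed_measure_sums[OF ro]) (auto simp: binaryset_def disjoint_family_on_def)
 moreover have "(%i. ro (binaryset A B i)) sums (\<Sum>i<2. ro (binaryset A B i))"
  by (rule sums_finite) (use signed_measure_empty[OF ro] in \<open>auto simp: binaryset_def\<close>)
 ultimately show ?thesis by (auto dest: sums_unique2 simp: numeral_2_eq_2 binaryset_def)
qed

lemma signed_measure_Diff: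
 assumes "signed_measure_on M ro" "A \<in> sets M" "B \<in> sets M" "B \<subseteq> A"
 shows "ro (A - B) = ro A - ro B"
 using signed_measure_Un[OF assms(1), of B "A - B"] assms by (auto simp: Un_absorb1)

lemma signed_measure_uminus: "signed_measure_on M ro ==> signed_measure_on M (%A. - ro A)"
 by (simp add: signed_measure_on_def sums_minus)

lemma positive_set_UN:
 assumes ro: "signed_measure_on M ro" and A: "!!i::nat. positive_set M ro (A i)"
 shows "positive_set M ro (\<Union>i. A i)" unfolding positive_set_def
proof (intro conjI ballI impI)
 have [measurable]: "A i \<in> sets M" for i using A by (auto simp: positive_set_def)
 show "(\<Union>i. A i) \<in> sets M" by auto
 fix B assume B: "B \<in> sets M" "B \<subseteq> (\<Union>i. A i)"
 have AM: "range A \<subseteq> sets M" by auto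
 have disj: "disjointed A i \<in> sets M" for i using sets.range_disjointed_sets[of A M] AM by blast
 have "(%i. ro (B \<inter> disjointed A i)) sums ro (\<Union>i. B \<inter> disjointed A i)"
  using B(1) disj disjoint_family_disjointed[of A]
  by (intro signed_measure_sums[OF ro]) (blast, auto simp: disjoint_family_on_def)
 moreover have "(\<Union>i. B \<inter> disjointed A i) = B" using B UN_disjointed_eq[of A] by auto
 moreover have "0 <= ro (B \<inter> disjointed A i)" for i
  using A[of i] disjointed_subset[of A i] B(1) disj[of i]
  unfolding positive_set_def by (meson inf.coboundedI2 sets.Int)
 ultimately show "0 <= ro B" using sums_le[OF _ sums_zero, of "%i. ro (B \<inter> disjointed A i)"] by simp
qed

lemma positive_set_mono:
 assumes ro: "signed_measure_on M ro" and "positive_set M ro B" "A \<in> sets M" "A \<subseteq> B"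
 shows "ro A <= ro B"
proof -
 have "0 <= ro (B - A)" using assms(2,3) unfolding positive_set_def by auto
 thus ?thesis using signed_measure_Diff[OF ro, of B A] assms by (auto simp: positive_set_def)
qed

text \<open>Exhaustion: pieces of nonpositive value are removed again and again, each at least half
  as negative as possible. The removed values are summable, so they tend to 0 and the remainder has
  no subset of negative value; removing nonpositive values does not lower the value of the
  remainder.\<close>

lemma exists_positive_subset:
 assumes ro: "signed_measure_on M ro" and E: "E \<in> sets M"
 obtains A where "positive_set M ro A" "A \<subseteq> E" "ro E <= ro A"
proof -
 have ro0: "ro {} = 0" using ro by (rule signed_measure_empty)
 \<comment> \<open>The cap 1 covers sets whose subsets have arbitrarily negative values, which
   cannot be excluded yet; the factor 1/2 is there because the supremum need not be
   attained.\<close>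
 define ok where "ok X C \<longleftrightarrow> C \<in> sets M & C \<subseteq> X & ro C <= 0 \<and>
  (\<forall>B\<in>sets M. B \<subseteq> X --> min 1 (- ro B / 2) <= - ro C)" for X C
 have ex: "\<exists>C. ok X C" if "X \<in> sets M" for X
 proof (cases "\<exists>C\<in>sets M. C \<subseteq> X & 1 <= - ro C")
  case True
  then obtain C where "C \<in> sets M" "C \<subseteq> X" "1 <= - ro C" by blast
  hence "ok X C" by (auto simp: ok_def)
  thus ?thesis ..
 next
  case False
  let ?T = "(%B. - ro B) ` {B \<in> sets M. B \<subseteq> X}"
  have bdd: "bdd_above ?T" using False by (intro bdd_aboveI[of _ 1]) force
  have le: "- ro B <= Sup ?T" if "B \<in> sets M" "B \<subseteq> X" for B
   using that by (intro cSup_upper bdd) auto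
  have S0: "0 <= Sup ?T" using le[of "{}"] ro0 by simp
  show ?thesis
  proof (cases "Sup ?T = 0")
   case True
   hence "ok X {}" using le ro0 by (force simp: ok_def)
   thus ?thesis ..
  next
   case F: False
   have "{} \<in> {B \<in> sets M. B \<subseteq> X}" by simp
   hence "?T ~= {}" by blast
   then obtain C where C: "C \<in> sets M" "C \<subseteq> X" "Sup ?T / 2 < - ro C"
    using less_cSup_iff[OF _ bdd, of "Sup ?T / 2"] F S0 by auto
   have "ok X C" unfolding ok_def
   proof (intro conjI ballI impI)
    show "ro C <= 0" using C S0 by simp
    fix B assume "B \<in> sets M" "B \<subseteq> X"
    from le[OF this] C show "min 1 (- ro B / 2) <= - ro C" by linarith
   qed (use C in auto)
   thus ?thesis ..
  qed
 qed
 define pick where "pick X = (SOME C. ok X C)" for X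
 have pick: "ok X (pick X)" if "X \<in> sets M" for X unfolding pick_def using someI_ex[OF ex[OF that]] .
 define X where "X n = ((%X. X - pick X) ^^ n) E" for n
 have X_Suc: "X (Suc n) = X n - pick (X n)" for n by (simp add: X_def)
 have X0: "X 0 = E" by (simp add: X_def)
 have XM: "X n \<in> sets M" for n by (induction n) (use E pick in \<open>auto simp: X0 X_Suc ok_def\<close>)
 have dec: "X m \<subseteq> X n" if "n <= m" for n m
  using that by (induction rule: dec_induct) (auto simp: X_Suc)
 let ?C = "%n. pick (X n)"
 have okn: "ok (X n) (?C n)" for n using pick XM by blast
 have CM: "?C n \<in> sets M" and CX: "?C n \<subseteq> X n" and C0: "ro (?C n) <= 0" for n
  using okn[of n] by (auto simp: ok_def)
 have disj: "disjoint_family ?C"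
 proof -
  have "?C m \<inter> ?C n = {}" if "n < m" for n m
   using CX[of m] dec[of "Suc n" m] that by (auto simp: X_Suc)
  thus ?thesis unfolding disjoint_family_on_def by (metis Int_commute linorder_neqE_nat)
 qed
 have sums: "(%n. ro (?C n)) sums ro (\<Union>n. ?C n)" by (rule signed_measure_sums[OF ro CM disj])
 define A where "A = E - (\<Union>n. ?C n)"
 have AX: "A \<subseteq> X n" for n by (induction n) (auto simp: A_def X0 X_Suc)
 have CE: "(\<Union>n. ?C n) \<subseteq> E" using CX dec[of 0] X0 by blast
 have CM': "(\<Union>n. ?C n) \<in> sets M" using CM by auto
 have "ro (\<Union>n. ?C n) <= 0" using sums_le[OF _ sums sums_zero] C0 by auto
 hence "ro E <= ro A" unfolding A_def using signed_measure_Diff[OF ro E CM' CE] by simp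
 moreover have "positive_set M ro A" unfolding positive_set_def
 proof (intro conjI ballI impI)
  show "A \<in> sets M" unfolding A_def using E CM' by auto
  fix B assume B: "B \<in> sets M" "B \<subseteq> A"
  have lim: "(%n. - ro (?C n)) ----> 0"
   using summable_LIMSEQ_zero[OF sums_summable[OF sums]] tendsto_minus by force
  \<comment> \<open>Every \<open>B\<close> inside the remainder competed with each removed piece
    \<open>?C n\<close>, whose values tend to 0.\<close>
  have "min 1 (- ro B / 2) <= - ro (?C n)" for n using okn[of n] B AX[of n] unfolding ok_def by blast
  hence "min 1 (- ro B / 2) <= 0" by (intro LIMSEQ_le_const[OF lim]) auto
  thus "0 <= ro B" by linarith
 qed
 moreover have "A \<subseteq> E" by (auto simp: A_def)
 ultimately show ?thesis using that by blast
qed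

text \<open>\<open>P\<close> is a positive set of maximal value. A set of positive value outside
  \<open>P\<close> would contain a positive set of at least that value, and adjoining it to
  \<open>P\<close> would exceed the maximum.\<close>

lemma hahn_decomposition:
 assumes ro: "signed_measure_on M ro"
 obtains P where "positive_set M ro P" "positive_set M (%A. - ro A) (space M - P)"
proof -
 let ?T = "ro ` {A. positive_set M ro A}"
 have pos0: "positive_set M ro {}" using signed_measure_empty[OF ro] by (auto simp: positive_set_def)
 have ne: "?T ~= {}" using pos0 by auto
 \<comment> \<open>Used twice: with \<open>x n = n\<close> to bound the supremum, and with
   \<open>x n\<close> close to the supremum to attain it.\<close>
 have seq: "\<exists>P. positive_set M ro P & (\<forall>n. x n <= ro P)"
  if x: "!!n::nat. \<exists>A. positive_set M ro A & x n <= ro A" for x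
 proof -
  obtain A where A: "!!n. positive_set M ro (A n)" "!!n. x n <= ro (A n)" using x by metis
  have P: "positive_set M ro (\<Union>n. A n)" using positive_set_UN[OF ro A(1)] .
  have "ro (A n) <= ro (\<Union>n. A n)" for n
   using A(1)[of n] by (intro positive_set_mono[OF ro P]) (auto simp: positive_set_def)
  with P A(2) show ?thesis by (meson order_trans)
 qed
 have bdd: "bdd_above ?T"
 proof (rule ccontr)
  assume "\<not> bdd_above ?T"
  hence "\<exists>A. positive_set M ro A & real n <= ro A" for n
   by (auto simp: bdd_above_def not_le intro: less_imp_le)
  from seq[of real, OF this] obtain P where "\<forall>n. real n <= ro P" by blast
  thus False by (meson linorder_not_le reals_Archimedean2)
 qed
 have "\<exists>A. positive_set M ro A & Sup ?T - 1 / Suc n <= ro A" for n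
  using less_cSup_iff[OF ne bdd, of "Sup ?T - 1 / Suc n"] by auto
 from seq[of "%n. Sup ?T - 1 / Suc n", OF this] obtain P where P: "positive_set M ro P" "!!n. Sup ?T - 1 / Suc n <= ro P" by blast
 have lim: "(%n. Sup ?T - 1 / Suc n) ----> Sup ?T - 0"
  by (intro tendsto_diff tendsto_const LIMSEQ_Suc[OF lim_1_over_n])
 have PS: "Sup ?T <= ro P" by (rule LIMSEQ_le_const2[of "%n. Sup ?T - 1 / Suc n"]) (use lim P in auto)
 have "positive_set M (%A. - ro A) (space M - P)" unfolding positive_set_def
 proof (intro conjI ballI impI)
  show "space M - P \<in> sets M" using P by (auto simp: positive_set_def)
  fix B assume B: "B \<in> sets M" "B \<subseteq> space M - P"
  from exists_positive_subset[OF ro B(1)] obtain A where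
   A: "positive_set M ro A" "A \<subseteq> B" "ro B <= ro A" by blast
  have AM: "A \<in> sets M" "P \<in> sets M" using A P by (auto simp: positive_set_def)
  have "positive_set M ro (\<Union>n. if n = (0::nat) then P else A)"
   by (rule positive_set_UN[OF ro]) (use P A in auto)
  moreover have "(\<Union>n. if n = (0::nat) then P else A) = P \<union> A" by auto
  ultimately have "ro (P \<union> A) <= Sup ?T" by (intro cSup_upper bdd) auto
  moreover have "ro (P \<union> A) = ro P + ro A" by (rule signed_measure_Un[OF ro]) (use AM A B in auto)
  ultimately show "0 <= - ro B" using PS A(3) by linarith
 qed
 with P that show ?thesis by blast
qed

lemma sets_upper_variation [simp, measurable_cong]: "sets (upper_variation M ro) = sets M"
 and space_upper_variation [simp]: "space (upper_variation M ro) = space M"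
 by (auto simp: upper_variation_def)

text \<open>On each \<open>A\<close> the supremum is attained at \<open>A \<inter> P\<close>, since
  parts outside \<open>P\<close> only lose value. Countable additivity of the defining set function
  is then inherited from \<open>ro\<close>.\<close>

lemma emeasure_upper_variation:
 assumes ro: "signed_measure_on M ro"
  and P: "positive_set M ro P" "positive_set M (%A. - ro A) (space M - P)"
  and A: "A \<in> sets M"
 shows "emeasure (upper_variation M ro) A = ennreal (ro (A \<inter> P))"
proof -
 have PM [measurable]: "P \<in> sets M" using P by (auto simp: positive_set_def)
 let ?f = "%A. SUP B\<in>{B\<in>sets M. B \<subseteq> A}. ennreal (ro B)"
 have eq: "?f A = ennreal (ro (A \<inter> P))" if A: "A \<in> sets M" for A
 proof (rule antisym)
  show "?f A <= ennreal (ro (A \<inter> P))"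
  proof (rule SUP_least)
   fix B assume B: "B \<in> {B\<in>sets M. B \<subseteq> A}"
   hence BM: "B \<in> sets M" "B \<subseteq> A" by auto
   have "ro B = ro (B \<inter> P) + ro (B - P)"
    using signed_measure_Un[OF ro, of "B \<inter> P" "B - P"] BM by (auto simp: Int_Diff_Un)
   moreover have "ro (B - P) <= 0" using P(2) BM PM sets.sets_into_space[OF BM(1)] unfolding positive_set_def
    by (metis Diff_mono neg_0_le_iff_le order_refl sets.Diff)
   moreover have "ro (B \<inter> P) <= ro (A \<inter> P)"
   proof (rule positive_set_mono[OF ro])
    show "positive_set M ro (A \<inter> P)" using P(1) A by (auto simp: positive_set_def)
   qed (use BM in auto)
   ultimately show "ennreal (ro B) <= ennreal (ro (A \<inter> P))" by (intro ennreal_leI) linarith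
  qed
  show "ennreal (ro (A \<inter> P)) <= ?f A" using A by (intro SUP_upper) auto
 qed
 show ?thesis
 proof (subst emeasure_measure_of[OF upper_variation_def])
  show "positive (sets (upper_variation M ro)) ?f"
   using signed_measure_empty[OF ro] by (simp add: positive_def)
  show "countably_additive (sets (upper_variation M ro)) ?f" unfolding countably_additive_def
  proof (intro allI impI)
   fix B :: "nat => _"
   assume B: "range B \<subseteq> sets (upper_variation M ro)" "disjoint_family B" "(\<Union>i. B i) \<in> sets (upper_variation M ro)"
   hence BM: "B i \<in> sets M" for i by auto
   have "(%i. ro (B i \<inter> P)) sums ro (\<Union>i. B i \<inter> P)"
    using BM B(2) by (intro signed_measure_sums[OF ro]) (auto simp: disjoint_family_on_def)
   moreover have "0 <= ro (B i \<inter> P)" for i using P(1) BM by (auto simp: positive_set_def)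
   ultimately have "(\<Sum>i. ennreal (ro (B i \<inter> P))) = ennreal (ro (\<Union>i. B i \<inter> P))"
    by (intro suminf_ennreal_eq) auto
   moreover have "(\<Union>i. B i \<inter> P) = (\<Union>i. B i) \<inter> P" by auto
   ultimately show "(\<Sum>i. ?f (B i)) = ?f (\<Union>i. B i)"
    using eq[OF BM] eq[of "\<Union>i. B i"] B(3) by simp
  qed
 qed (use A eq sets.sets_into_space in \<open>auto simp: upper_variation_def\<close>)
qed

lemma jordan_decomposition:
 assumes ro: "signed_measure_on M ro"
 shows "finite_measure (upper_variation M ro)" "finite_measure (upper_variation M (%A. - ro A))"
  and "A \<in> sets M ==>
   ro A = measure (upper_variation M ro) A - measure (upper_variation M (%A. - ro A)) A"
proof -
 obtain P where P: "positive_set M ro P" "positive_set M (%A. - ro A) (space M - P)"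
  using hahn_decomposition[OF ro] .
 let ?Q = "space M - P"
 have PM: "P \<in> sets M" using P by (auto simp: positive_set_def)
 hence "space M - ?Q = P" using sets.sets_into_space by blast
 with P have Q: "positive_set M (%A. - (- ro A)) (space M - ?Q)" by simp
 note e = emeasure_upper_variation[OF ro P]
  emeasure_upper_variation[OF signed_measure_uminus[OF ro] P(2) Q]
 show "finite_measure (upper_variation M ro)" "finite_measure (upper_variation M (%A. - ro A))"
  using e[OF sets.top] by (auto intro!: finite_measureI)
 assume A: "A \<in> sets M"
 have "0 <= ro (A \<inter> P)" "0 <= - ro (A \<inter> ?Q)" using P A PM by (auto simp: positive_set_def)
 hence "measure (upper_variation M ro) A = ro (A \<inter> P)"
  "measure (upper_variation M (%A. - ro A)) A = - ro (A \<inter> ?Q)"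
  using e[OF A] by (auto simp: measure_def)
 moreover have "A = (A \<inter> P) \<union> (A \<inter> ?Q)" using sets.sets_into_space[OF A] by auto
 hence "ro A = ro (A \<inter> P) + ro (A \<inter> ?Q)"
  using signed_measure_Un[OF ro, of "A \<inter> P" "A \<inter> ?Q"] A PM by auto
 ultimately show "ro A = measure (upper_variation M ro) A - measure (upper_variation M (%A. - ro A)) A"
  by simp
qed

text \<open>This frees the signed integral from the Jordan parts: the limit measure of the converse
  direction comes as a difference of two densities that need not be recognised as its
  variations.\<close>

lemma signed_integral_eq_diff:
 fixes f :: "'a => 'b::{banach, second_countable_topology}"
 assumes ro: "signed_measure_on M ro"
  and fin: "finite_measure U" "finite_measure V" and sets: "sets U = sets M" "sets V = sets M"
  and eq: "!!A. A \<in> sets M ==> ro A = measure U A - measure V A"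
  and f: "f \<in> borel_measurable M" "!!x. norm (f x) <= C"
 shows "signed_integral M ro f = (LINT x|U. f x) - (LINT x|V. f x)"
proof -
 have "(LINT x|(upper_variation M ro). f x) + (LINT x|V. f x)
   = (LINT x|(upper_variation M (%A. - ro A)). f x) + (LINT x|U. f x)"
  using jordan_decomposition[OF ro] fin sets eq f
  by (intro integral_eq_of_measure_sum_eq[where S="sets M" and C=C]) force+
 thus ?thesis by (simp add: signed_integral_def algebra_simps)
qed

lemma measurable_fst_borel [measurable]:
 "fst \<in> borel_measurable (borel :: ('a::topological_space \<times> 'b::topological_space) measure)"
 and measurable_snd_borel [measurable]:
 "snd \<in> borel_measurable (borel :: ('a \<times> 'b) measure)"
 by (intro borel_measurable_continuous_onI continuous_on_fst continuous_on_snd continuous_on_id)+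

section \<open>Common densities of a compatible triple\<close>

lemma bounded_density_exists:
 assumes L: "finite_measure L" and sets: "sets N = sets L"
  and le: "!!A. A \<in> sets L ==> emeasure N A <= emeasure L A"
 obtains D :: "'a => real" where "D \<in> borel_measurable L" "!!x. 0 <= D x" "!!x. D x <= 1"
  "N = density L (%x. ennreal (D x))"
proof -
 interpret L: finite_measure L by fact
 have sp: "space N = space L" using sets by (rule sets_eq_imp_space_eq)
 have N: "finite_measure N" using le[OF sets.top] by (intro finite_measureI) (auto simp: sp top_unique)
 then interpret N: finite_measure N .
 have ac: "absolutely_continuous L N"
  unfolding absolutely_continuous_def null_sets_def using le sets by fastforce
 from L.real_RN_deriv[OF N ac sets] obtain D where
  D [measurable]: "D \<in> borel_measurable L" and AE: "AE x in L. RN_deriv L N x = ennreal (D x)" and D0: "!!x. 0 <= D x"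
  by metis
 have "density L (RN_deriv L N) = N" by (rule L.density_RN_deriv[OF ac sets])
 hence ND: "N = density L (%x. ennreal (D x))" using density_cong[OF borel_measurable_RN_deriv _ AE] by simp
 have "nn_integral L (%x. ennreal (D x)) = emeasure N (space L)"
  by (simp add: ND emeasure_density cong: nn_integral_cong)
 hence intD: "integrable L D" using D0 by (intro integrableI_nonneg) (auto simp: less_top[symmetric])
 have "AE x in L. 0 <= 1 - D x"
 proof (rule L.density_nonneg)
  fix A assume A: "A \<in> sets L"
  have "emeasure N A = nn_integral L (%x. ennreal (D x * indicator A x))"
   using A by (auto simp: ND emeasure_density intro!: nn_integral_cong split: split_indicator)
  also have "... = ennreal (LINT x|L. D x * indicator A x)"
   using A intD D0 by (intro nn_integral_eq_integral integrable_real_mult_indicator) auto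
  finally have "(LINT x|L. D x * indicator A x) <= measure L A"
   using le[OF A] by (simp add: L.emeasure_eq_measure)
  moreover have "(LINT x|L. indicator A x - D x * indicator A x) = measure L A - (LINT x|L. D x * indicator A x)"
   using A intD using integrable_real_mult_indicator[OF A intD]
   by (subst Bochner_Integration.integral_diff) (auto simp: less_top[symmetric])
  ultimately show "0 <= (LINT x:A|L. 1 - D x)"
   by (simp add: set_lebesgue_integral_def right_diff_distrib mult.commute)
 qed (use intD in auto)
 \<comment> \<open>Replacing \<open>D\<close> by its minimum with 1 changes it on a null set only
   and makes the bound hold at every point.\<close>
 hence "density L (%x. ennreal (D x)) = density L (%x. ennreal (min 1 (D x)))" by (intro density_cong) auto
 with ND D0 show ?thesis by (intro that[of "%x. min 1 (D x)"]) auto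
qed

abbreviation dens :: "'a measure => ('a => real) => 'a measure" where
 "dens L A == density L (%x. ennreal (A x))"

text \<open>The conditions on the triple in pointwise form: together with the signs of
  \<open>A\<close> and \<open>B\<close>, \<open>C^2 <= A B\<close> is positive semidefiniteness of
  the matrix with rows \<open>(A, C)\<close> and \<open>(C, B)\<close>; the last two equations are
  the compatibility conditions with the square roots multiplied out.\<close>

definition levy_density ::
  "plane measure => (plane => real) => (plane => real) => (plane => real) => bool" where
 "levy_density L A B C \<longleftrightarrow> finite_borel L \<and>
   A \<in> bor & B \<in> bor & C \<in> bor \<and>
   (\<forall>p. 0 <= A p & A p <= 1 & 0 <= B p & B p <= 1 & abs (C p) <= 1 & (C p)^2 <= A p * B p) \<and>
   (\<forall>s t. t * sqrt (1 + s^2) * A (s, t) = s * sqrt (1 + t^2) * C (s, t) \<and>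
      s * sqrt (1 + t^2) * B (s, t) = t * sqrt (1 + s^2) * C (s, t))"

lemma sqrt_1_sq_pos [simp]: "0 < sqrt (1 + x^2)" for x :: real
 by (smt (verit) real_sqrt_gt_zero zero_le_power2)

lemma ratio_eq_cross:
 fixes s t a b :: real
 shows "ratio t * a = ratio s * b \<longleftrightarrow> t * sqrt (1 + s^2) * a = s * sqrt (1 + t^2) * b"
 using sqrt_1_sq_pos[of s] sqrt_1_sq_pos[of t] by (simp add: field_simps)

lemma abs_ratio_le_1: "abs (ratio s) <= 1" for s :: real
proof -
 have "abs s = sqrt (s^2)" by simp
 also have "... <= sqrt (1 + s^2)" by (intro real_sqrt_le_mono) simp
 finally show ?thesis using sqrt_1_sq_pos[of s] by simp
qed

text \<open>All measures are dominated by \<open>L\<close>, the sum of \<open>ro1\<close>,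
  \<open>ro2\<close> and the two variations of \<open>ro\<close>. The conditions hold for the
  densities almost everywhere; being homogeneous, they hold everywhere once the densities are set to
  0 on the exceptional set.\<close>

lemma levy_density_exists:
 assumes fb: "finite_borel ro1" "finite_borel ro2" and ro: "signed_measure_on borel ro"
  and comp: "levy_compatible ro1 ro2 ro"
 obtains L A B C where "levy_density L A B C" "ro1 = dens L A" "ro2 = dens L B"
  "!!(f :: plane => complex) K. f \<in> bor ==> (!!p. norm (f p) <= K) ==>
   signed_integral borel ro f = (LINT p|L. C p *\<^sub>R f p)"
proof -
 let ?U = "upper_variation borel ro" and ?V = "upper_variation borel (%A. - ro A)"
 have fin: "finite_measure ro1" "finite_measure ro2" "finite_measure ?U" "finite_measure ?V"
  and sets [measurable_cong]: "sets ro1 = sets borel" "sets ro2 = sets borel"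
   "sets ?U = sets borel" "sets ?V = sets borel"
  using fb jordan_decomposition[OF ro] by (auto simp: finite_borel_def)
 define L where "L = add_measure (add_measure ro1 ro2) (add_measure ?U ?V)"
 have Ls [measurable_cong]: "sets L = sets borel" by (simp add: L_def sets)
 have Lfin: "finite_measure L" unfolding L_def by (intro finite_measure_add_measure) (auto simp: sets fin)
 interpret L: finite_measure L by fact
 have emL: "emeasure L S = emeasure ro1 S + emeasure ro2 S + (emeasure ?U S + emeasure ?V S)"
  if "S \<in> sets L" for S using that by (simp add: L_def emeasure_add_measure sets)
 have ex: "\<exists>D. D \<in> borel_measurable L & (\<forall>x. 0 <= D x) & (\<forall>x. D x <= 1) & N = dens L D"
  if "N \<in> {ro1, ro2, ?U, ?V}" for N
 proof -
  have "emeasure N S <= emeasure L S" if "S \<in> sets L" for S using `N \<in> _` by (auto simp: emL[OF that])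
  thus ?thesis
   using bounded_density_exists[OF Lfin, of N] that sets Ls by (metis (no_types) insert_iff singletonD)
 qed
 obtain a where a: "a \<in> borel_measurable L" "\<forall>x. 0 <= a x" "\<forall>x. a x <= 1" "ro1 = dens L a" using ex[of ro1] by auto
 obtain b where b: "b \<in> borel_measurable L" "\<forall>x. 0 <= b x" "\<forall>x. b x <= 1" "ro2 = dens L b" using ex[of ro2] by auto
 obtain u where u: "u \<in> borel_measurable L" "\<forall>x. 0 <= u x" "\<forall>x. u x <= 1" "?U = dens L u" using ex[of ?U] by auto
 obtain v where v: "v \<in> borel_measurable L" "\<forall>x. 0 <= v x" "\<forall>x. v x <= 1" "?V = dens L v" using ex[of ?V] by auto
 note [measurable] = a(1) b(1) u(1) v(1)
 define c where "c p = u p - v p" for p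
 have c [measurable]: "c \<in> borel_measurable L" unfolding c_def[abs_def] by measurable
 have c1: "abs (c p) <= 1" for p using u(2,3) v(2,3) unfolding c_def by (smt (verit))
 have sgn: "signed_integral borel ro f = (LINT p|L. c p *\<^sub>R f p)"
  if f: "f \<in> bor" "!!p. norm (f p) <= K" for f :: "plane => 'c::{banach,second_countable_topology}" and K
 proof -
  have fL [measurable]: "f \<in> borel_measurable L" using f(1) measurable_cong_sets[OF Ls refl] by blast
  have bd: "norm (d p *\<^sub>R f p) <= K" if "\<forall>p. 0 <= d p" "\<forall>p. d p <= 1" for d :: "_ => real" and p
   using mult_mono[of "d p" 1 "norm (f p)" K] that f(2)[of p]
    abs_of_nonneg[OF that(1)[rule_format, of p]] by simp
  have int: "integrable L (%p. u p *\<^sub>R f p)" "integrable L (%p. v p *\<^sub>R f p)"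
   using bd u v by (intro integrable_bounded[OF Lfin, of _ K]; simp)+
  have "integral\<^sup>L ?U f = (LINT p|L. u p *\<^sub>R f p)" "integral\<^sup>L ?V f = (LINT p|L. v p *\<^sub>R f p)"
   using integral_density[OF fL u(1)] integral_density[OF fL v(1)] u v by simp_all
  with int show ?thesis by (simp add: signed_integral_def c_def scaleR_diff_left)
 qed
 have bd: "norm (indicator S p * ratio s) <= 1" for S :: "plane set" and p and s :: real
  using abs_ratio_le_1[of s] by (auto simp: indicator_def)
 have key: "AE p in L. ratio (y p) * d p = ratio (x p) * c p"
  if d: "d \<in> borel_measurable L" "\<forall>p. 0 <= d p" "\<forall>p. d p <= 1" "N = dens L d"
   and [measurable]: "x \<in> bor" "y \<in> bor"
   and eq: "!!S. S \<in> sets borel ==> (LINT p|N. indicator S p * ratio (y p))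
    = signed_integral borel ro (%p. indicator S p * ratio (x p))"
  for d x y :: "plane => real" and N
 proof (rule density_unique_real)
  note [measurable] = d(1)
  have le1: "abs (ratio z * e) <= 1" if "abs e <= 1" for z e :: real
   using mult_mono[OF abs_ratio_le_1[of z] that] by (simp add: abs_mult)
  show "integrable L (%p. ratio (y p) * d p)"
  proof (rule integrable_bounded[OF Lfin, of _ 1])
   show "norm (ratio (y p) * d p) <= 1" for p
    unfolding real_norm_def using d(2)[rule_format, of p] d(3)[rule_format, of p] by (intro le1) simp
  qed measurable
  show "integrable L (%p. ratio (x p) * c p)"
  proof (rule integrable_bounded[OF Lfin, of _ 1])
   show "norm (ratio (x p) * c p) <= 1" for p unfolding real_norm_def by (rule le1[OF c1])
  qed measurable
  fix S assume "S \<in> sets L"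
  hence S [measurable]: "S \<in> sets borel" by (simp add: Ls)
  have "(LINT p|N. indicator S p * ratio (y p))
    = (LINT p|L. d p *\<^sub>R (indicator S p * ratio (y p)))"
   unfolding d(4) using d(2) by (intro integral_density) auto
  moreover have "signed_integral borel ro (%p. indicator S p * ratio (x p))
    = (LINT p|L. c p *\<^sub>R (indicator S p * ratio (x p)))" by (rule sgn[of _ 1]) (measurable, rule bd)
  ultimately show "(LINT p:S|L. ratio (y p) * d p) = (LINT p:S|L. ratio (x p) * c p)"
   using eq[OF S] by (simp add: set_lebesgue_integral_def mult_ac)
 qed
 have comp1: "!!S. S \<in> sets borel ==> (LINT p|ro1. indicator S p * ratio (snd p))
    = signed_integral borel ro (%p. indicator S p * ratio (fst p))"
  and comp2: "!!S. S \<in> sets borel ==> (LINT p|ro2. indicator S p * ratio (fst p))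
    = signed_integral borel ro (%p. indicator S p * ratio (snd p))"
  and comp3: "abs (ro {(0, 0)})^2 <= measure ro1 {(0, 0)} * measure ro2 {(0, 0)}"
  using comp unfolding levy_compatible_def by blast+
 have AE1: "AE p in L. ratio (snd p) * a p = ratio (fst p) * c p"
  by (rule key[OF a measurable_fst_borel measurable_snd_borel comp1])
 have AE2: "AE p in L. ratio (fst p) * b p = ratio (snd p) * c p"
  by (rule key[OF b measurable_snd_borel measurable_fst_borel comp2])
 \<comment> \<open>Only an atom of \<open>L\<close> at the origin matters; if its mass
   \<open>?m\<close> is positive, the inequality between the measures of the origin can be divided
   by \<open>?m^2\<close>.\<close>
 have AE3: "AE p in L. p = (0, 0) --> (c p)^2 <= a p * b p"
 proof -
  let ?o = "{(0, 0)} :: plane set"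
  let ?m = "measure L ?o"
  have [measurable]: "?o \<in> sets L" by simp
  have at0: "measure (dens L d) ?o = d (0, 0) * ?m"
   if [measurable]: "d \<in> borel_measurable L" and "\<forall>p. 0 <= d p" for d
  proof -
   have "emeasure (dens L d) ?o = nn_integral L (%p. ennreal (d (0, 0)) * indicator ?o p)"
    by (subst emeasure_density) (auto intro!: nn_integral_cong)
   also have "... = ennreal (d (0, 0) * ?m)" using that(2) by (simp add: L.emeasure_eq_measure ennreal_mult)
   finally show ?thesis using that(2) by (simp add: measure_def)
  qed
  have "ro ?o = measure ?U ?o - measure ?V ?o" by (rule jordan_decomposition(3)[OF ro]) simp
  hence "ro ?o = c (0, 0) * ?m"
   using at0[OF u(1,2)] at0[OF v(1,2)] u(4) v(4) by (simp add: c_def algebra_simps)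
  hence "(c (0, 0) * ?m)^2 <= a (0, 0) * ?m * (b (0, 0) * ?m)"
   using comp3 at0[OF a(1,2)] at0[OF b(1,2)] a(4) b(4) by simp
  hence *: "?m = 0 \<or> (c (0, 0))^2 <= a (0, 0) * b (0, 0)"
   by (cases "?m = 0") (auto simp: power2_eq_square zero_less_measure_iff)
  show ?thesis
  proof (cases "?m = 0")
   case True
   hence "?o \<in> null_sets L" by (auto simp: L.emeasure_eq_measure)
   hence "AE p in L. p \<notin> ?o" by (rule AE_not_in)
   thus ?thesis by eventually_elim auto
  next
   case False
   with * show ?thesis by auto
  qed
 qed
 define G where "G = {p. ratio (snd p) * a p = ratio (fst p) * c p \<and>
   ratio (fst p) * b p = ratio (snd p) * c p \<and>
   (p = (0, 0) --> (c p)^2 <= a p * b p)}"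
 have abc [measurable]: "a \<in> bor" "b \<in> bor" "c \<in> bor" by auto
 have [measurable]: "G \<in> sets borel" unfolding G_def by measurable
 have AEG: "AE p in L. p \<in> G" using AE1 AE2 AE3 by eventually_elim (auto simp: G_def)
 let ?i = "%d p. indicator G p * d p :: real"
 have "levy_density L (?i a) (?i b) (?i c)" unfolding levy_density_def
 proof (intro conjI allI)
  show "finite_borel L" using Lfin Ls by (simp add: finite_borel_def)
  fix p
  show "0 <= ?i a p" "?i a p <= 1" "0 <= ?i b p" "?i b p <= 1" "abs (?i c p) <= 1"
   using a(2)[rule_format, of p] a(3)[rule_format, of p] b(2)[rule_format, of p] b(3)[rule_format, of p] c1[of p]
   by (auto simp: indicator_def)
  show "(?i c p)^2 <= ?i a p * ?i b p"
  proof (cases "p \<in> G & p ~= (0, 0)")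
   case True
   obtain s t where p: "p = (s, t)" by fastforce
   define x y where "x = ratio s" and "y = ratio t"
   have r: "y * a p = x * c p" "x * b p = y * c p" using True by (auto simp: G_def x_def y_def p)
   \<comment> \<open>Away from the origin one of the two ratios can be divided by, and elimination
     from the two linear relations gives equality.\<close>
   have "x ~= 0 \<or> y ~= 0" using True sqrt_1_sq_pos[of s] sqrt_1_sq_pos[of t] by (auto simp: x_def y_def p)
   hence "(c p)^2 = a p * b p"
   proof
    assume x: "x ~= 0"
    hence "c p = y * a p / x" "b p = y * c p / x" using r by (simp_all add: field_simps)
    thus ?thesis by (simp add: power2_eq_square)
   next
    assume y: "y ~= 0"
    hence "c p = x * b p / y" "a p = x * c p / y" using r by (simp_all add: field_simps)
    thus ?thesis by (simp add: power2_eq_square)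
   qed
   thus ?thesis using True by simp
  next
   case False
   thus ?thesis by (auto simp: indicator_def G_def)
  qed
  fix s t
  show "t * sqrt (1 + s^2) * ?i a (s, t) = s * sqrt (1 + t^2) * ?i c (s, t)"
   "s * sqrt (1 + t^2) * ?i b (s, t) = t * sqrt (1 + s^2) * ?i c (s, t)"
   using ratio_eq_cross[of t "a (s, t)" s "c (s, t)"] ratio_eq_cross[of s "b (s, t)" t "c (s, t)"]
   by (cases "(s, t) \<in> G"; simp add: G_def)+
 qed measurable
 moreover have "ro1 = dens L (?i a)" "ro2 = dens L (?i b)"
  unfolding a(4) b(4) by (intro density_cong; use AEG in \<open>auto\<close>)+
 moreover have "signed_integral borel ro f = (LINT p|L. ?i c p *\<^sub>R f p)"
  if f: "f \<in> bor" "!!p. norm (f p) <= K" for f :: "plane => complex" and K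
 proof -
  have [measurable]: "f \<in> borel_measurable L" using f(1) measurable_cong_sets[OF Ls refl] by blast
  show ?thesis unfolding sgn[OF f] by (intro integral_cong_AE) (use AEG in \<open>auto\<close>)
 qed
 ultimately show ?thesis using that by blast
qed

section \<open>Weak compactness on the plane\<close>

text \<open>Weak compactness on the plane is reduced to Helly's theorem on the line: Schoenberg's
 space-filling curve is a continuous surjection from the line onto the unit square which has
 a Borel right inverse.\<close>

definition schoenberg :: "real => real" where
 "schoenberg x = max 0 (min 1 (1/2 - cos (pi * x)))"

lemma schoenberg_bounds: "0 <= schoenberg x" "schoenberg x <= 1" by (auto simp: schoenberg_def)

lemma continuous_on_schoenberg [continuous_intros]:
 fixes f :: "real => real"
 shows "continuous_on S f ==> continuous_on S (%x. schoenberg (f x))" unfolding schoenberg_def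
 by (intro continuous_intros)

text \<open>\<open>cos (pi * x)\<close> is at least 1/2 within distance 1/3 of the even integers and
  at most -1/2 within 1/3 of the odd ones; there the clipped function is 0 and 1. The argument lies
  on the plateau that belongs to \<open>e\<close>, so the function reads off the ternary digit
  \<open>2 * e\<close>.\<close>

lemma schoenberg_digit:
 fixes m :: int and e y :: real
 assumes e: "e = 0 \<or> e = 1" and y: "0 <= y" "y <= 1/3"
 shows "schoenberg (2 * of_int m + 2 * e / 3 + y) = e"
proof -
 have "cos (pi * (2 * of_int m + 2 * e / 3 + y)) = cos (pi * (2 * e / 3 + y) + 2 * of_int m * pi)"
  by (simp add: algebra_simps)
 also have "... = cos (pi * (2 * e / 3 + y))"
  using cos_int_2pin[of m] sin_int_2pin[of m] by (simp add: cos_add mult_ac)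
 finally have eq: "schoenberg (2 * of_int m + 2 * e / 3 + y) = max 0 (min 1 (1/2 - cos (pi * (2 * e / 3 + y))))"
  by (simp add: schoenberg_def)
 from e show ?thesis
 proof
  assume "e = 0"
  have "cos (pi / 3) <= cos (pi * y)" using y by (intro cos_monotone_0_pi_le) auto
  thus ?thesis using `e = 0` eq by (simp add: cos_60)
 next
  assume "e = 1"
  have "cos (pi * (2 / 3 + y)) <= cos (2 * pi / 3)" using y by (intro cos_monotone_0_pi_le) auto
  thus ?thesis using `e = 1` eq by (simp add: cos_120)
 qed
qed

text \<open>Coordinate \<open>i\<close> reads the ternary digits at the positions congruent to
  \<open>i\<close> modulo 2 and uses them as binary digits.\<close>

definition schoenberg_curve :: "nat => real => real" where
 "schoenberg_curve i x = (\<Sum>k. schoenberg (3 ^ (2 * k + i) * x) / 2 ^ Suc k)"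

lemma continuous_on_schoenberg_curve: "continuous_on UNIV (schoenberg_curve i)"
proof -
 have "uniform_limit UNIV (%n x. \<Sum>k<n. schoenberg (3 ^ (2 * k + i) * x) / 2 ^ Suc k)
  (%x. \<Sum>k. schoenberg (3 ^ (2 * k + i) * x) / 2 ^ Suc k) sequentially"
 proof (rule Weierstrass_m_test)
  show "summable (%k. (1 / 2) ^ Suc k :: real)" by simp
  show "norm (schoenberg (3 ^ (2 * k + i) * x) / 2 ^ Suc k) <= (1 / 2) ^ Suc k" for k x
   using schoenberg_bounds[of "3 ^ (2 * k + i) * x"] by (simp add: divide_simps)
 qed
 hence "continuous_on UNIV (%x. \<Sum>k. schoenberg (3 ^ (2 * k + i) * x) / 2 ^ Suc k)"
  by (rule uniform_limit_theorem[rotated]) (auto intro!: always_eventually continuous_intros)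
 thus ?thesis by (simp add: schoenberg_curve_def[abs_def])
qed

definition binary_digit :: "nat => real => real" where
 "binary_digit k u = of_int (\<lfloor>2 ^ Suc k * u\<rfloor> mod 2)"

lemma binary_digit_cases: "binary_digit k u = 0 \<or> binary_digit k u = 1" unfolding binary_digit_def by auto

lemma binary_digit_sums:
 assumes u: "0 <= u" "u < 1"
 shows "(%k. binary_digit k u / 2 ^ Suc k) sums u"
proof -
 have part: "(\<Sum>k<n. binary_digit k u / 2 ^ Suc k) = of_int \<lfloor>2 ^ n * u\<rfloor> / 2 ^ n" for n
 proof (induction n)
  case 0
  thus ?case using u by (simp add: floor_eq_iff)
 next
  case (Suc n)
  have "\<lfloor>2 ^ n * u\<rfloor> = \<lfloor>2 ^ Suc n * u\<rfloor> div 2"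
   using floor_divide_real_eq_div[of 2 "2 ^ Suc n * u"] by simp
  hence "\<lfloor>2 ^ Suc n * u\<rfloor> = 2 * \<lfloor>2 ^ n * u\<rfloor> + \<lfloor>2 ^ Suc n * u\<rfloor> mod 2" by simp
  hence "(of_int \<lfloor>2 ^ Suc n * u\<rfloor> :: real) = 2 * of_int \<lfloor>2 ^ n * u\<rfloor> + binary_digit n u"
   unfolding binary_digit_def by simp
  with Suc show ?case by (simp add: field_simps)
 qed
 have "(%n. of_int \<lfloor>2 ^ n * u\<rfloor> / 2 ^ n) ----> u"
 proof (rule real_tendsto_sandwich[of "%n. u - (1/2) ^ n" _ _ "%n. u"])
  show "eventually (%n. u - (1/2) ^ n <= of_int \<lfloor>2 ^ n * u\<rfloor> / 2 ^ n) sequentially"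
  proof (rule always_eventually, rule allI)
   fix n
   have "2 ^ n * u - 1 <= of_int \<lfloor>2 ^ n * u\<rfloor>" by linarith
   hence "(2 ^ n * u - 1) / 2 ^ n <= of_int \<lfloor>2 ^ n * u\<rfloor> / 2 ^ n" by (intro divide_right_mono) auto
   thus "u - (1/2) ^ n <= of_int \<lfloor>2 ^ n * u\<rfloor> / 2 ^ n" by (simp add: diff_divide_distrib power_one_over)
  qed
  show "eventually (%n. of_int \<lfloor>2 ^ n * u\<rfloor> / 2 ^ n <= u) sequentially"
  proof (rule always_eventually, rule allI)
   fix n
   have "of_int \<lfloor>2 ^ n * u\<rfloor> / 2 ^ n <= 2 ^ n * u / 2 ^ n" by (intro divide_right_mono) auto
   thus "of_int \<lfloor>2 ^ n * u\<rfloor> / 2 ^ n <= u" by simp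
  qed
  have "(%n. u - (1/2) ^ n) ----> u - 0" by (intro tendsto_diff tendsto_const LIMSEQ_power_zero) simp
  thus "(%n. u - (1/2) ^ n) ----> u" by simp
 qed auto
 thus ?thesis unfolding sums_def part .
qed

text \<open>A point of the Cantor set: the binary digits of \<open>u\<close> and \<open>v\<close>,
  interleaved and doubled.\<close>

definition ternary_encode :: "real => real => real" where
 "ternary_encode u v = (\<Sum>j. 2 * (if even j then binary_digit (j div 2) u else binary_digit (j div 2) v) / 3 ^ Suc j)"

lemma sums_two_thirds: "(%j. 2 / 3 ^ Suc j :: real) sums 1"
proof -
 have "(%j. 2 / 3 * (1 / 3) ^ j :: real) sums (2 / 3 * (1 / (1 - 1 / 3)))"
  by (intro sums_mult geometric_sums) simp
 thus ?thesis by (simp add: power_one_over)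
qed

text \<open>Multiplication by \<open>3 ^ n\<close> moves the first \<open>n\<close> digits into an
  integer, which is even because all digits are 0 or 2; digit \<open>n\<close> contributes
  \<open>2 * e n / 3\<close>, and the tail is at most 1/3. This is the form that
  \<open>schoenberg_digit\<close> requires.\<close>

lemma ternary_encode:
 fixes u v
 defines "e == %j. if even j then binary_digit (j div 2) u else binary_digit (j div 2) v"
 shows "0 <= ternary_encode u v" "ternary_encode u v <= 1" "schoenberg (3 ^ n * ternary_encode u v) = e n"
proof -
 have e01: "e j = 0 \<or> e j = 1" for j unfolding e_def using binary_digit_cases by auto
 have bnd: "0 <= 2 * e j / 3 ^ Suc j" "2 * e j / 3 ^ Suc j <= 2 / 3 ^ Suc j" for j using e01[of j] by auto
 have sum2: "summable (%j. 2 / 3 ^ Suc j :: real)" using sums_two_thirds by (rule sums_summable)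
 have summ: "summable (%j. 2 * e j / 3 ^ Suc j)"
  by (rule summable_comparison_test'[OF sum2, of 0]) (use bnd in \<open>simp only: real_norm_def abs_of_nonneg\<close>)
 have enc: "ternary_encode u v = (\<Sum>j. 2 * e j / 3 ^ Suc j)" by (simp add: ternary_encode_def e_def)
 show "0 <= ternary_encode u v" unfolding enc by (intro suminf_nonneg summ bnd)
 show "ternary_encode u v <= 1" unfolding enc sums_unique[OF sums_two_thirds]
  by (intro suminf_le bnd summ sum2)
 define y where "y = 3 ^ n * (\<Sum>j. 2 * e (j + Suc n) / 3 ^ Suc (j + Suc n))"
 have summ': "summable (%j. 2 * e (j + Suc n) / 3 ^ Suc (j + Suc n))"
  using summable_ignore_initial_segment[OF summ, of "Suc n"] by simp
 have y0: "0 <= y" unfolding y_def by (intro mult_nonneg_nonneg suminf_nonneg summ' bnd) simp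
 have "y <= 3 ^ n * (\<Sum>j. 2 / 3 ^ Suc (j + Suc n))" unfolding y_def
  by (intro mult_left_mono suminf_le summ' bnd summable_ignore_initial_segment[OF sum2, of "Suc n"]) simp
 also have "(\<Sum>j. 2 / 3 ^ Suc (j + Suc n) :: real) = 1 / 3 ^ Suc n"
  using sums_divide[OF sums_two_thirds, of "3 ^ Suc n"]
  by (intro sums_unique[symmetric]) (simp add: power_add)
 finally have y1: "y <= 1 / 3" by simp
 define m where "m = (\<Sum>j<n. (if e j = 1 then 1 else 0) * 3 ^ (n - Suc j) :: int)"
 have "(\<Sum>j<n. 3 ^ n * (2 * e j / 3 ^ Suc j)) = 2 * of_int m" unfolding m_def of_int_sum sum_distrib_left
 proof (rule sum.cong)
  fix j assume "j \<in> {..<n}"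
  hence "(3::real) ^ n = 3 ^ (n - Suc j) * 3 ^ Suc j"
   by (metis Suc_leI add.commute le_add_diff_inverse lessThan_iff power_add)
  thus "3 ^ n * (2 * e j / 3 ^ Suc j) = 2 * of_int ((if e j = 1 then 1 else 0) * 3 ^ (n - Suc j))"
   using e01[of j] by auto
 qed simp
 moreover have "ternary_encode u v = (\<Sum>j. 2 * e (j + Suc n) / 3 ^ Suc (j + Suc n)) + (\<Sum>j<Suc n. 2 * e j / 3 ^ Suc j)"
  unfolding enc by (rule suminf_split_initial_segment[OF summ])
 ultimately have "3 ^ n * ternary_encode u v = 2 * of_int m + 2 * e n / 3 + y"
  by (simp add: y_def sum_distrib_left algebra_simps)
 thus "schoenberg (3 ^ n * ternary_encode u v) = e n" using schoenberg_digit[OF e01 y0 y1] by simp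
qed

lemma schoenberg_curve_encode:
 assumes "0 <= u" "u < 1" "0 <= v" "v < 1"
 shows "schoenberg_curve 0 (ternary_encode u v) = u" "schoenberg_curve 1 (ternary_encode u v) = v"
 unfolding schoenberg_curve_def ternary_encode(3)
 using binary_digit_sums[OF assms(1,2)] binary_digit_sums[OF assms(3,4)]
 by (auto intro!: sums_unique[symmetric])

lemma measurable_ternary_encode [measurable]:
 assumes [measurable]: "f \<in> borel_measurable M" "g \<in> borel_measurable M"
 shows "(%x. ternary_encode (f x) (g x)) \<in> borel_measurable M"
 unfolding ternary_encode_def binary_digit_def by measurable

text \<open>\<open>arctan\<close> maps the line into the open unit interval, so the encoded numbers
  stay below 1, as their binary expansion requires.\<close>

definition plane_to_line :: "plane => real" where
 "plane_to_line p = ternary_encode (1/2 + arctan (fst p) / pi) (1/2 + arctan (snd p) / pi)"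

text \<open>The curve also reaches the boundary of the square, where \<open>tan\<close> has its
  poles and takes the default value of a division by 0; such points stand for infinity.\<close>

definition line_to_plane :: "real => plane" where
 "line_to_plane x = (tan (pi * (schoenberg_curve 0 x - 1/2)), tan (pi * (schoenberg_curve 1 x - 1/2)))"

lemma line_to_plane_to_line: "line_to_plane (plane_to_line p) = p"
proof -
 have "0 <= 1/2 + arctan s / pi & 1/2 + arctan s / pi < 1" for s
  using arctan_lbound[of s] arctan_ubound[of s] by (auto simp: field_simps)
 thus ?thesis
  by (simp add: line_to_plane_def plane_to_line_def schoenberg_curve_encode[simplified] tan_arctan)
qed

lemma borel_measurable_plane_to_line [measurable]: "plane_to_line \<in> bor"
proof -
 have "fst \<in> borel_measurable (borel :: plane measure)" "snd \<in> borel_measurable (borel :: plane measure)"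
  by auto
 thus ?thesis unfolding plane_to_line_def[abs_def] by measurable
qed

lemma borel_measurable_schoenberg_curve [measurable]: "schoenberg_curve i \<in> bor"
 using continuous_on_schoenberg_curve by (rule borel_measurable_continuous_onI)

lemma borel_measurable_tan [measurable]: "(tan :: real => real) \<in> bor"
 unfolding tan_def[abs_def] by measurable

lemma borel_measurable_line_to_plane [measurable]: "line_to_plane \<in> bor"
proof -
 have "line_to_plane \<in> borel \<rightarrow>\<^sub>M borel \<Otimes>\<^sub>M borel" unfolding line_to_plane_def[abs_def] by measurable
 thus ?thesis by (simp add: borel_prod)
qed

text \<open>On the line all transported laws live in the unit interval, so Helly's theorem applies
  at once. Tightness in the plane is what keeps the limit off the points that the curve sends to
  infinity; elsewhere test functions composed with the curve are continuous. It is stated through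
  \<open>N^2 / (N^2 + x^2)\<close> because Poisson integrals at height \<open>N\<close> produce
  these functions.\<close>

theorem weakly_convergent_subsequence:
 fixes mm :: "nat => plane measure"
 assumes law: "!!n. borel_law (mm n)"
  and tight: "!!e. e > 0 ==> \<exists>N>0. \<forall>n. 1 - e <= (LINT p|(mm n). N^2 / (N^2 + (fst p)^2)) \<and>
   1 - e <= (LINT p|(mm n). N^2 / (N^2 + (snd p)^2))"
 obtains r vv where "strict_mono (r :: nat => nat)" "borel_law vv"
  "!!(h :: plane => complex) K. continuous_on UNIV h ==> (!!p. norm (h p) <= K) ==>
   (%n. \<integral>p. h p \<partial>mm (r n)) ----> (LINT p|vv. h p)"
proof -
 have ps: "prob_space (mm n)" and sets [measurable_cong]: "sets (mm n) = sets borel" for n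
  using law by (auto simp: borel_law_def)
 define l where "l n = distr (mm n) borel plane_to_line" for n
 have rd: "real_distribution (l n)" for n
  unfolding l_def by (intro prob_space.real_distribution_distr ps) measurable
 \<comment> \<open>Tightness on the line is phrased with half-open intervals; the left end -1 makes
   the interval contain 0.\<close>
 have "measure (l n) {-1<..1} = 1" for n
 proof -
  interpret prob_space "mm n" by (rule ps)
  have "measure (l n) {-1<..1} = measure (mm n) (plane_to_line -` {-1<..1} \<inter> space (mm n))"
   unfolding l_def by (intro measure_distr) measurable
  also have "plane_to_line -` {-1<..1} \<inter> space (mm n) = space (mm n)"
   using ternary_encode(1,2) by (auto simp: plane_to_line_def intro!: less_le_trans[OF _ ternary_encode(1), of "-1"])
  finally show ?thesis by (simp add: prob_space)
 qed
 hence "tight l" unfolding tight_def using rd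
  by (intro conjI allI impI exI[of _ "-1 :: real"] exI[of _ "1 :: real"]) simp_all
 from tight_imp_convergent_subsubsequence[OF this strict_mono_id] obtain r M
  where r: "strict_mono r" and M: "real_distribution M" and wc: "weak_conv_m (%n. l (r n)) M"
  by (auto simp: o_def)
 interpret M: real_distribution M by fact
 define vv where "vv = distr M borel line_to_plane"
 let ?c = "%i x. cos (pi * (schoenberg_curve i x - 1/2))" and ?s = "%i x. sin (pi * (schoenberg_curve i x - 1/2))"
 have cont: "isCont (schoenberg_curve i) x" for i x
  using continuous_on_schoenberg_curve[of i] continuous_on_eq_continuous_at[of UNIV] by auto
 have prob1: "measure M {x. ?c i x ~= 0} = 1"
  if x: "x = fst & i = 0 \<or> x = snd & i = (1::nat)" for i and x :: "plane => real"
 proof (rule antisym[OF M.prob_le_1], rule field_le_epsilon)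
  fix e :: real assume "e > 0"
  from tight[OF this] obtain N where N: "N > 0" "!!n. 1 - e <= (LINT p|(mm n). N^2 / (N^2 + (x p)^2))"
   using x by auto
  \<comment> \<open>This is \<open>N^2 / (N^2 + x^2)\<close> at \<open>x = ?s i y / ?c i y\<close>,
    multiplied out so that it stays continuous where the cosine vanishes, with value 0
    there.\<close>
  define pp where "pp y = N^2 * (?c i y)^2 / (N^2 * (?c i y)^2 + (?s i y)^2)" for y
  have den: "0 < N^2 * (?c i y)^2 + (?s i y)^2" for y
  proof (cases "?c i y = 0")
   case True
   thus ?thesis using sin_cos_squared_add[of "pi * (schoenberg_curve i y - 1/2)"] by simp
  next
   case False
   thus ?thesis using N by (intro add_pos_nonneg) auto
  qed
  have pp1: "0 <= pp y" "pp y <= 1" for y using den[of y] by (auto simp: pp_def)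
  have ppc: "isCont pp y" for y unfolding pp_def[abs_def] using den[of y] cont by simp
  have [measurable]: "pp \<in> bor" unfolding pp_def[abs_def] by measurable
  have "x p = tan (pi * (schoenberg_curve i (plane_to_line p) - 1/2))" for p
   using x line_to_plane_to_line[of p] by (auto simp: line_to_plane_def prod_eq_iff)
  moreover have "?c i (plane_to_line p) ~= 0" for p
  proof -
   have "?c i (plane_to_line p) = cos (arctan (x p))"
   proof -
    have "0 <= 1/2 + arctan s / pi & 1/2 + arctan s / pi < 1" for s
     using arctan_lbound[of s] arctan_ubound[of s] by (auto simp: field_simps)
    thus ?thesis using x by (auto simp: plane_to_line_def schoenberg_curve_encode[simplified])
   qed
   thus ?thesis  by simp
  qed
  moreover have "N^2 * c^2 / (N^2 * c^2 + s^2) = N^2 / (N^2 + (s / c)^2)" if "c ~= 0" for c s :: real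
   using that by (simp add: power_divide add_divide_eq_iff)
  ultimately have ppe: "pp (plane_to_line p) = N^2 / (N^2 + (x p)^2)" for p unfolding pp_def tan_def by metis
  have "(%n. \<integral>y. pp y \<partial>l (r n)) ----> (LINT y|M. pp y)"
   by (rule weak_conv_imp_integral_bdd_continuous_conv[OF rd M wc, of _ 1]) (use ppc pp1 in auto)
  moreover have "(LINT y|(l n). pp y) = (LINT p|(mm n). N^2 / (N^2 + (x p)^2))" for n
   unfolding l_def by (subst integral_distr) (auto simp: ppe)
  ultimately have "1 - e <= (LINT y|M. pp y)" using N(2) by (intro LIMSEQ_le_const) auto
  also have "... <= (LINT y|M. indicator {y. ?c i y ~= 0} y)"
   using pp1 by (intro integral_mono M.integrable_const_bound[of _ 1]) (auto simp: indicator_def pp_def)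
  also have "... = measure M {y. ?c i y ~= 0}" by simp
  finally show "1 <= measure M {x. ?c i x ~= 0} + e" by simp
 qed
 have AE: "AE x in M. ?c 0 x ~= 0" "AE x in M. ?c 1 x ~= 0"
  using prob1[of fst 0] prob1[of snd 1] M.AE_prob_1 by force+
 have "borel_law vv" unfolding vv_def borel_law_def by (auto intro!: M.prob_space_distr)
 moreover have "(%n. \<integral>p. h p \<partial>mm (r n)) ----> (LINT p|vv. h p)"
  if h: "continuous_on UNIV h" "!!p. norm (h p) <= K" for h :: "plane => complex" and K
 proof -
  have [measurable]: "h \<in> bor" using h(1) by (rule borel_measurable_continuous_onI)
  have hc: "isCont h p" for p using h(1) continuous_on_eq_continuous_at[of UNIV] by auto
  let ?Z = "{x. ?c 0 x = 0 \<or> ?c 1 x = 0}"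
  have Z: "?Z \<in> sets M" by simp
  have "AE x in M. x \<notin> ?Z" using AE by simp
  hence "emeasure M ?Z = 0" using AE_iff_measurable[OF Z, of "%x. x \<notin> ?Z"] by auto
  moreover have "{x. \<not> isCont (%y. h (line_to_plane y)) x} \<subseteq> ?Z"
  proof safe
   fix x assume x: "\<not> isCont (%y. h (line_to_plane y)) x" "?c 1 x ~= 0"
   show "?c 0 x = 0"
   proof (rule ccontr)
    assume "?c 0 x ~= 0"
    with x have "isCont line_to_plane x" unfolding line_to_plane_def[abs_def] using cont by simp
    with x(1) hc show False using isCont_o2 by blast
   qed
  qed
  ultimately have null: "emeasure M {x. \<not> isCont (%y. h (line_to_plane y)) x} = 0"
   using emeasure_mono[of "{x. \<not> isCont (%y. h (line_to_plane y)) x}" ?Z M, OF _ Z] by simp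
  have "(%n. \<integral>x. h (line_to_plane x) \<partial>l (r n)) ----> (LINT x|M. h (line_to_plane x))"
   by (rule weak_conv_imp_bdd_ae_continuous_conv[OF rd M wc null h(2)]) measurable
  moreover have "(LINT x|(l n). h (line_to_plane x)) = (LINT p|(mm n). h p)" for n
   unfolding l_def by (subst integral_distr) (auto simp: line_to_plane_to_line)
  moreover have "(LINT x|M. h (line_to_plane x)) = (LINT p|vv. h p)"
   unfolding vv_def by (subst integral_distr) auto
  ultimately show ?thesis by simp
 qed
 ultimately show ?thesis using r that by blast
qed

text \<open>A constant for which \<open>sqrt (1 + s^2) <= kernel_bound ze * norm (ze - s)\<close> at
  all real \<open>s\<close>; it bounds the weighted Cauchy kernel uniformly.\<close>

definition kernel_bound :: "complex => real" where
 "kernel_bound ze = 1 + (1 + norm ze) / abs (Im ze)"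

section \<open>Poisson and Cauchy kernels\<close>

lemma nonreal_iff: "ze \<notin> \<real> \<longleftrightarrow> Im ze ~= 0" by (auto simp: complex_is_Real_iff)

lemma nonreal_diff_nonzero [simp]: "Im ze ~= 0 ==> ze - cor s ~= 0" by auto

lemma abs_Im_le_dist: "abs (Im ze) <= norm (ze - cor s)" using abs_Im_le_cmod[of "ze - cor s"] by simp

lemma sqrt_le_kernel_bound:
 assumes "Im ze ~= 0"
 shows "sqrt (1 + s^2) <= kernel_bound ze * norm (ze - cor s)"
proof -
 have "sqrt (1 + s^2) <= 1 + abs s" by (rule real_le_lsqrt) (auto simp: power2_eq_square algebra_simps)
 also have "abs s = norm (ze - (ze - cor s))" by simp
 also have "... <= norm ze + norm (ze - cor s)" by (rule norm_triangle_ineq4)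
 also have "1 + (norm ze + norm (ze - cor s)) = (1 + norm ze) * 1 + norm (ze - cor s)" by simp
 also have "... <= (1 + norm ze) * (norm (ze - cor s) / abs (Im ze)) + norm (ze - cor s)"
  using assms abs_Im_le_dist[of ze s] by (intro add_mono mult_left_mono) auto
 also have "... = kernel_bound ze * norm (ze - cor s)" by (simp add: kernel_bound_def algebra_simps)
 finally show ?thesis by simp
qed

lemma kernel_bound_ge_1: "1 <= kernel_bound ze" by (simp add: kernel_bound_def)

lemma norm_sqrt_kernel_le:
 assumes "Im ze ~= 0"
 shows "norm (skern ze s) <= kernel_bound ze"
 using sqrt_le_kernel_bound[OF assms, of s] nonreal_diff_nonzero[OF assms, of s]
 by (simp add: norm_divide pos_divide_le_eq)

lemma norm_kernel_le:
 assumes "Im ze ~= 0"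
 shows "norm (1 / (ze - cor s)) <= kernel_bound ze"
proof -
 have "norm (1 / (ze - cor s)) <= norm (skern ze s)" by (simp add: norm_divide divide_right_mono)
 with norm_sqrt_kernel_le[OF assms] show ?thesis by (rule order_trans[rotated])
qed

text \<open>The half-plane Poisson kernel without its factor \<open>1 / pi\<close>, so its mass is
  \<open>pi\<close>; at \<open>r = x - s\<close> it is minus the imaginary part of
  \<open>1 / (Complex x et - s)\<close>.\<close>

definition poisson :: "real => real => real" where
 "poisson et r = et / (et^2 + r^2)"

lemma measurable_poisson [measurable]: "f \<in> borel_measurable M ==> (%x. poisson et (f x)) \<in> borel_measurable M"
 unfolding poisson_def by measurable

lemma poisson_nonneg [simp]: "0 <= et ==> 0 <= poisson et r" by (simp add: poisson_def)

lemma norm_Complex_minus_of_real: "(norm (Complex x et - cor s))^2 = et^2 + (x - s)^2"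
 by (simp add: cmod_power2)

lemma poisson_eq_kernel_diff:
 assumes "et ~= 0"
 shows "1 / (Complex x (-et) - cor s) - 1 / (Complex x et - cor s)
  = 2 * \<i> * cor (poisson et (x - s))"
proof -
 define u where "u = Complex x et - cor s"
 have u: "u ~= 0" "cnj u = Complex x (-et) - cor s" "u - cnj u = 2 * \<i> * et"
  using assms by (auto simp: u_def complex_eq_iff)
 have "1 / cnj u - 1 / u = (u - cnj u) / cor ((norm u)^2)"
  using u(1) complex_norm_square[of u] by (simp add: field_simps)
 hence "1 / cnj u - 1 / u = 2 * \<i> * et / cor ((norm u)^2)" by (simp only: u(3))
 thus ?thesis unfolding poisson_def norm_Complex_minus_of_real[symmetric] u(2) by (simp add: u_def)
qed

text \<open>\<open>s^2 <= 2 * x^2 + 2 * (x - s)^2\<close>, and the kernel absorbs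
  \<open>(x - s)^2\<close> because \<open>et <= 1\<close>. Uniformity in \<open>et\<close> is what
  later allows inversion of measures with the unbounded weight \<open>1 + s^2\<close>.\<close>

lemma weighted_poisson_le:
 assumes "0 < et" "et <= 1" "abs x <= X"
 shows "(1 + s^2) * poisson et (x - s) <= (1 + 2 * X^2) * poisson et (x - s) + 2"
proof -
 have "s^2 <= 2 * x^2 + 2 * (x - s)^2" using sum_squares_ge_zero[of "2 * x - s" 0] by (simp add: power2_eq_square algebra_simps)
 moreover have "x^2 <= X^2" using assms by (simp add: abs_le_square_iff[symmetric])
 ultimately have "(1 + s^2) * poisson et (x - s) <= (1 + 2 * X^2 + 2 * (x - s)^2) * poisson et (x - s)"
  using assms by (intro mult_right_mono) auto
 also have "... = (1 + 2 * X^2) * poisson et (x - s) + 2 * ((x - s)^2 * poisson et (x - s))"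
  by (simp add: algebra_simps)
 also have "(x - s)^2 * poisson et (x - s) <= 1"
 proof -
  have "(x - s)^2 * et <= (x - s)^2 * 1" using assms by (intro mult_left_mono) auto
  hence "(x - s)^2 * et <= et^2 + (x - s)^2" using zero_le_power2[of et] by linarith
  thus ?thesis using assms by (simp add: poisson_def add_pos_nonneg)
 qed
 finally show ?thesis by simp
qed

section \<open>Stieltjes inversion of Poisson integrals\<close>

lemma nn_integral_poisson_Icc:
 assumes "0 < et" "a <= b"
 shows "nn_integral lborel (%x. ennreal (poisson et (x - s)) * indicator {a..b} x)
  = ennreal (arctan ((b - s) / et) - arctan ((a - s) / et))"
proof -
 have "((%x. arctan ((x - s) / et)) has_real_derivative poisson et (x - s)) (at x)" for x
 proof -
  have "((%x. arctan ((x - s) / et)) has_real_derivative inverse (1 + ((x - s) / et)^2) * (1 / et)) (at x)"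
   using assms by (auto intro!: derivative_eq_intros)
  moreover have "inverse (1 + ((x - s) / et)^2) * (1 / et) = poisson et (x - s)"
   using assms by (simp add: poisson_def field_simps power2_eq_square)
  ultimately show ?thesis by simp
 qed
 thus ?thesis using assms by (intro nn_integral_FTC_Icc) auto
qed

text \<open>Stieltjes inversion gives endpoints half of their weight; the mean of the open and the
  closed indicator records this.\<close>

lemma arctan_diff_tendsto:
 fixes a b s :: real
 assumes "a < b"
 shows "(%n. arctan ((b - s) * Suc n) - arctan ((a - s) * Suc n)) ---->
  (pi / 2) * (indicator {a<..<b} s + indicator {a..b} s)"
proof -
 have inf: "filterlim (%n. real (Suc n)) at_top sequentially"
  by (rule filterlim_compose[OF filterlim_real_sequentially filterlim_Suc])
 have pos: "(%n. arctan (c * Suc n)) ----> pi / 2" if "c > 0" for c :: real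
  by (rule filterlim_compose[OF tendsto_arctan_at_top]) (rule filterlim_tendsto_pos_mult_at_top[OF tendsto_const that inf])
 have neg: "(%n. arctan (c * Suc n)) ----> - (pi / 2)" if "c < 0" for c :: real
  using tendsto_minus[OF pos[of "-c"]] that by (simp add: arctan_minus)
 have *: "(%n. arctan (c * Suc n)) ----> pi / 2 * sgn c" for c :: real
  using pos[of c] neg[of c] by (cases c "0 :: real" rule: linorder_cases) auto
 have "(%n. arctan ((b - s) * Suc n) - arctan ((a - s) * Suc n)) ----> pi / 2 * sgn (b - s) - pi / 2 * sgn (a - s)"
  by (intro tendsto_diff *)
 also have "pi / 2 * sgn (b - s) - pi / 2 * sgn (a - s) = (pi / 2) * (indicator {a<..<b} s + indicator {a..b} s)"
  using assms by (auto simp: sgn_if)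
 finally show ?thesis .
qed

lemma nn_integral_arctan_eq:
 assumes M: "finite_measure M" and [measurable]: "g \<in> borel_measurable M" "c \<in> borel_measurable M"
  and "0 < et" "a <= b" and c0: "!!p. 0 <= c p"
 shows "nn_integral M (%p. ennreal (c p * (arctan ((b - g p) / et) - arctan ((a - g p) / et))))
  = nn_integral lborel (%x. nn_integral M (%p. ennreal (c p * poisson et (x - g p))) * indicator {a..b} x)"
proof -
 interpret M: finite_measure M by fact
 interpret pair_sigma_finite M lborel ..
 have "nn_integral lborel (%x. nn_integral M (%p. ennreal (c p * poisson et (x - g p))) * indicator {a..b} x)
  = nn_integral lborel (%x. nn_integral M (%p. ennreal (c p * poisson et (x - g p)) * indicator {a..b} x))"
  by (simp add: nn_integral_multc)
 also have "... = nn_integral M (%p. nn_integral lborel (%x. ennreal (c p * poisson et (x - g p)) * indicator {a..b} x))"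
   by (rule Fubini') measurable
 also have "... = nn_integral M (%p. ennreal (c p * (arctan ((b - g p) / et) - arctan ((a - g p) / et))))"
 proof (rule nn_integral_cong)
  fix p
  have "nn_integral lborel (%x. ennreal (c p * poisson et (x - g p)) * indicator {a..b} x)
   = ennreal (c p) * nn_integral lborel (%x. ennreal (poisson et (x - g p)) * indicator {a..b} x)"
   using c0 assms(4) by (subst nn_integral_cmult[symmetric]) (auto simp: ennreal_mult mult_ac)
  thus "nn_integral lborel (%x. ennreal (c p * poisson et (x - g p)) * indicator {a..b} x)
   = ennreal (c p * (arctan ((b - g p) / et) - arctan ((a - g p) / et)))"
   using nn_integral_poisson_Icc[OF assms(4,5), of "g p"] c0 by (simp add: ennreal_mult')
 qed
 finally show ?thesis by simp
qed

lemma ennreal_mult_add: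
 assumes "0 <= A" "0 <= w" "0 <= d"
 shows "ennreal (A * w + 2 * d) = ennreal A * ennreal w + 2 * ennreal d"
proof -
 have "ennreal (2 * d) = 2 * ennreal d" using assms ennreal_mult[of 2 d] by simp
 thus ?thesis using assms by (simp add: ennreal_mult)
qed

text \<open>Integrating \<open>weighted_poisson_le\<close> over \<open>x\<close> in the interval
  gives a dominating constant that depends on neither \<open>et\<close> nor
  \<open>s\<close>.\<close>

lemma weighted_arctan_diff_le:
 assumes "0 < et" "et <= 1" "a <= b" "abs a <= X" "abs b <= X"
 shows "(1 + s^2) * (arctan ((b - s) / et) - arctan ((a - s) / et)) <= (1 + 2 * X^2) * pi + 2 * (b - a)"
proof -
 let ?w = "arctan ((b - s) / et) - arctan ((a - s) / et)"
 have w: "0 <= ?w" "?w <= pi"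
  using assms arctan_le_iff[of "(a - s) / et" "(b - s) / et"] arctan_bounded[of "(a - s) / et"] arctan_bounded[of "(b - s) / et"]
  by (auto simp: divide_right_mono)
 have "ennreal ((1 + s^2) * ?w) = ennreal (1 + s^2) * nn_integral lborel (%x. ennreal (poisson et (x - s)) * indicator {a..b} x)"
  unfolding nn_integral_poisson_Icc[OF assms(1,3)] using w by (simp add: ennreal_mult)
 also have "... = nn_integral lborel (%x. ennreal ((1 + s^2) * poisson et (x - s)) * indicator {a..b} x)"
  using assms(1) by (subst nn_integral_cmult[symmetric]) (auto simp: ennreal_mult mult_ac)
 also have "... <= nn_integral lborel (%x. (ennreal (1 + 2 * X^2) * ennreal (poisson et (x - s)) + 2) * indicator {a..b} x)"
 proof (rule nn_integral_mono)
  fix x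
  have "ennreal ((1 + s^2) * poisson et (x - s)) <= ennreal (1 + 2 * X^2) * ennreal (poisson et (x - s)) + 2" if "x \<in> {a..b}"
  proof -
   have "ennreal ((1 + s^2) * poisson et (x - s)) <= ennreal ((1 + 2 * X^2) * poisson et (x - s) + 2)"
    using that assms by (intro ennreal_leI weighted_poisson_le) auto
   also have "... = ennreal (1 + 2 * X^2) * ennreal (poisson et (x - s)) + 2"
    using assms(1) ennreal_mult_add[of "1 + 2 * X^2" "poisson et (x - s)" 1] by simp
   finally show ?thesis .
  qed
  thus "ennreal ((1 + s^2) * poisson et (x - s)) * indicator {a..b} x
   <= (ennreal (1 + 2 * X^2) * ennreal (poisson et (x - s)) + 2) * indicator {a..b} x"
   by (auto simp: indicator_def)
 qed
 also have "... = nn_integral lborel (%x. ennreal (1 + 2 * X^2) * (ennreal (poisson et (x - s)) * indicator {a..b} x) + 2 * indicator {a..b} x)"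
  by (simp add: distrib_right mult.assoc)
 also have "... = ennreal (1 + 2 * X^2) * ennreal ?w + 2 * ennreal (b - a)"
  using assms(3) by (simp add: nn_integral_add nn_integral_cmult nn_integral_poisson_Icc[OF assms(1,3)])
 also have "... = ennreal ((1 + 2 * X^2) * ?w + 2 * (b - a))"
  using w assms(3) by (intro ennreal_mult_add[symmetric]) auto
 finally have "(1 + s^2) * ?w <= (1 + 2 * X^2) * ?w + 2 * (b - a)"
  using w assms(3) by (subst (asm) ennreal_le_iff) auto
 also have "... <= (1 + 2 * X^2) * pi + 2 * (b - a)" using w by (intro add_mono mult_left_mono) auto
 finally show ?thesis .
qed

lemma poisson_inversion:
 assumes M: "finite_measure M" and [measurable]: "g \<in> borel_measurable M" "c \<in> borel_measurable M"
  and c0: "!!p. 0 <= c p" and cK: "!!p. c p <= K * (1 + (g p)^2)" and "a < b"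
 shows "(%n. \<integral>\<^sup>+x. nn_integral M (%p. ennreal (c p * poisson (1 / Suc n) (x - g p))) * indicator {a..b} x \<partial>lborel)
  ----> (nn_integral M (%p. ennreal (c p * ((pi / 2) * (indicator {a<..<b} (g p) + indicator {a..b} (g p))))))"
proof -
 interpret M: finite_measure M by fact
 define X where "X = abs a + abs b"
 define W where "W = (1 + 2 * X^2) * pi + 2 * (b - a)"
 let ?w = "%n p. arctan ((b - g p) * Suc n) - arctan ((a - g p) * Suc n)"
 have eq: "nn_integral lborel (%x. nn_integral M (%p. ennreal (c p * poisson (1 / Suc n) (x - g p))) * indicator {a..b} x)
  = nn_integral M (%p. ennreal (c p * ?w n p))" for n
  using `a < b` by (subst nn_integral_arctan_eq[symmetric, OF M]) (auto simp: c0)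
 \<comment> \<open>\<open>undefined\<close> is just some point: the two bounds on \<open>c\<close>
   there already force the sign of \<open>K\<close>.\<close>
 have K: "0 <= K"
 proof -
  have "0 <= K * (1 + (g undefined)^2)" using c0[of undefined] cK[of undefined] by linarith
  thus ?thesis using zero_le_power2[of "g undefined"] by (simp add: zero_le_mult_iff)
 qed
 have bnd: "c p * ?w n p <= K * W" for n p
 proof -
  have w0: "0 <= ?w n p" using `a < b` by (simp add: arctan_le_iff)
  hence "c p * ?w n p <= K * ((1 + (g p)^2) * ?w n p)"
   using cK[of p] by (simp add: mult.assoc[symmetric] mult_right_mono)
  also have "(1 + (g p)^2) * ?w n p <= W"
   using weighted_arctan_diff_le[of "1 / Suc n" a b X "g p"] `a < b` by (simp add: W_def X_def)
  finally show ?thesis using K by (simp add: mult_left_mono)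
 qed
 show ?thesis unfolding eq
 proof (rule nn_integral_dominated_convergence[where w="%_. ennreal (K * W)"])
  show "AE p in M. (%n. ennreal (c p * ?w n p)) ---->
    ennreal (c p * ((pi / 2) * (indicator {a<..<b} (g p) + indicator {a..b} (g p))))"
   by (intro always_eventually allI tendsto_ennrealI tendsto_mult tendsto_const arctan_diff_tendsto `a < b`)
  show "nn_integral M (%x. ennreal (K * W)) < \<infinity>"
   by (simp add: ennreal_mult_less_top M.emeasure_eq_measure)
 qed (use bnd in \<open>auto intro!: ennreal_leI\<close>)
qed

text \<open>Shifting the interval to the right by \<open>1 / Suc n\<close> resolves the half
  weights: in the limit the left endpoint is lost and the right one is fully counted.\<close>

lemma poisson_Ioc:
 assumes M: "finite_measure M" and [measurable]: "g \<in> borel_measurable M" "c \<in> borel_measurable M"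
  and c0: "!!p. 0 <= c p" and cK: "!!p. c p <= K * (1 + (g p)^2)" and "a < b"
 shows "(%n. \<integral>\<^sup>+p. ennreal (c p * ((pi / 2) * (indicator {a + 1 / Suc n<..<b + 1 / Suc n} (g p)
     + indicator {a + 1 / Suc n..b + 1 / Suc n} (g p)))) \<partial>M)
  ----> (nn_integral M (%p. ennreal (c p * (pi * indicator {a<..b} (g p)))))" (is "(%n. \<integral>\<^sup>+p. ennreal (c p * ?f n p) \<partial>M) ----> _")
  and "nn_integral M (%p. ennreal (c p * indicator {a<..b} (g p))) < \<infinity>"
proof -
 interpret M: finite_measure M by fact
 define X where "X = abs a + abs b + 1"
 have K: "0 <= K"
 proof -
  have "0 <= K * (1 + (g undefined)^2)" using c0[of undefined] cK[of undefined] by linarith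
  thus ?thesis using zero_le_power2[of "g undefined"] by (simp add: zero_le_mult_iff)
 qed
 have cX: "c p <= K * (1 + X^2)" if "abs (g p) <= X" for p
 proof -
  have "(g p)^2 <= X^2" using that by (simp add: abs_le_square_iff[symmetric])
  hence "K * (1 + (g p)^2) <= K * (1 + X^2)" using K by (intro mult_left_mono) auto
  with cK[of p] show ?thesis by linarith
 qed
 have f_le: "c p * ?f n p <= K * (1 + X^2) * pi" for n p
 proof (cases "g p \<in> {a + 1 / Suc n..b + 1 / Suc n}")
  case True
  have "0 < 1 / real (Suc n)" "1 / real (Suc n) <= 1" by auto
  with True have "abs (g p) <= X" unfolding X_def atLeastAtMost_iff by linarith
  moreover have "?f n p <= pi" "0 <= ?f n p" by (auto simp: indicator_def)
  ultimately show ?thesis using cX[of p] K by (intro mult_mono) auto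
 next
  case False
  hence "?f n p = 0" by auto
  thus ?thesis using K by simp
 qed
 have lim: "(%n. ?f n p) ----> pi * indicator {a<..b} (g p)" for p
 proof -
  let ?F = "%e. (pi / 2) * (indicator {a + e<..<b + e} (g p) + indicator {a + e..b + e} (g p)) :: real"
  let ?l = "pi * indicator {a<..b} (g p) :: real"
  have l0: "(%n. 1 / real (Suc n)) ----> 0" using LIMSEQ_Suc[OF lim_1_over_n] by simp
  have "\<exists>de>0. \<forall>e. 0 < e & e < de --> ?F e = ?l"
  proof -
   consider "g p <= a" | "a < g p" "g p <= b" | "b < g p" by linarith
   thus ?thesis
   proof cases
    case 1
    thus ?thesis by (intro exI[of _ 1]) auto
   next
    case 2
    thus ?thesis by (intro exI[of _ "g p - a"]) auto
   next
    case 3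
    thus ?thesis  by (intro exI[of _ "g p - b"]) auto
   qed
  qed
  then obtain de where de: "de > 0" "!!e. 0 < e ==> e < de ==> ?F e = ?l" by blast
  have "eventually (%n. 1 / real (Suc n) < de) sequentially" using order_tendstoD(2)[OF l0 de(1)] .
  hence "eventually (%n. ?F (1 / real (Suc n)) = ?l) sequentially" by eventually_elim (rule de(2), simp_all)
  thus ?thesis by (rule tendsto_eventually)
 qed
 show "(%n. \<integral>\<^sup>+p. ennreal (c p * ?f n p) \<partial>M) ----> (nn_integral M (%p. ennreal (c p * (pi * indicator {a<..b} (g p)))))"
 proof (rule nn_integral_dominated_convergence[where w="%_. ennreal (K * (1 + X^2) * pi)"])
  show "AE p in M. (%n. ennreal (c p * ?f n p)) ----> ennreal (c p * (pi * indicator {a<..b} (g p)))"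
   by (intro always_eventually allI tendsto_ennrealI tendsto_mult tendsto_const lim)
  show "nn_integral M (%x. ennreal (K * (1 + X^2) * pi)) < \<infinity>"
   by (simp add: ennreal_mult_less_top M.emeasure_eq_measure)
 qed (use f_le in \<open>auto intro!: ennreal_leI\<close>)
 have "c p * indicator {a<..b} (g p) <= K * (1 + X^2)" for p
  using cX[of p] K by (auto simp: indicator_def X_def)
 hence "nn_integral M (%p. ennreal (c p * indicator {a<..b} (g p))) <= nn_integral M (%p. ennreal (K * (1 + X^2)))"
  by (intro nn_integral_mono ennreal_leI)
 also have "... < \<infinity>" by (simp add: ennreal_mult_less_top M.emeasure_eq_measure)
 finally show "nn_integral M (%p. ennreal (c p * indicator {a<..b} (g p))) < \<infinity>" .
qed

text \<open>The image under \<open>g\<close> of the measure with density \<open>c\<close> is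
  recovered on all half-open intervals, which generate the Borel sets and are closed under
  intersection. The growth allowed to \<open>c\<close> admits weights up to \<open>1 + s^2\<close>,
  which the function \<open>h\<close> can divide out again.\<close>

theorem poisson_determines:
 assumes M: "finite_measure M" and N: "finite_measure N"
  and gM [measurable]: "g \<in> borel_measurable M" "c \<in> borel_measurable M"
  and gN [measurable]: "g \<in> borel_measurable N" "c \<in> borel_measurable N"
  and c0: "!!p. 0 <= c p" and cK: "!!p. c p <= K * (1 + (g p)^2)"
  and eq: "!!et x. 0 < et ==> (nn_integral M (%p. ennreal (c p * poisson et (x - g p)))) = nn_integral N (%p. ennreal (c p * poisson et (x - g p)))"
  and h [measurable]: "h \<in> bor"
 shows "nn_integral M (%p. ennreal (c p * h (g p))) = nn_integral N (%p. ennreal (c p * h (g p)))"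
proof -
 have half: "nn_integral M (%p. ennreal (c p * ((pi / 2) * (indicator {a<..<b} (g p) + indicator {a..b} (g p)))))
  = nn_integral N (%p. ennreal (c p * ((pi / 2) * (indicator {a<..<b} (g p) + indicator {a..b} (g p)))))" if "a < b" for a b
  using poisson_inversion[OF M gM c0 cK that] poisson_inversion[OF N gN c0 cK that]
  by (simp add: eq) (rule LIMSEQ_unique)
 have Ioc_pi: "nn_integral M (%p. ennreal (c p * (pi * indicator {a<..b} (g p))))
  = nn_integral N (%p. ennreal (c p * (pi * indicator {a<..b} (g p))))" if "a < b" for a b
  using poisson_Ioc(1)[OF M gM c0 cK that] poisson_Ioc(1)[OF N gN c0 cK that]
  by (subst (asm) half) (auto simp: that intro: LIMSEQ_unique)
 have pull: "nn_integral L (%p. ennreal (c p * (pi * indicator {a<..b} (g p)))) = ennreal pi * nn_integral L (%p. ennreal (c p * indicator {a<..b} (g p)))"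
  if [measurable]: "g \<in> borel_measurable L" "c \<in> borel_measurable L" for L and a b :: real
  using c0 by (subst nn_integral_cmult[symmetric]) (auto simp: ennreal_mult[symmetric] mult_ac)
 define D where "D L = distr (density L (%p. ennreal (c p))) borel g" for L
 have em: "emeasure (D L) B = nn_integral L (%p. ennreal (c p * indicator B (g p)))"
  if [measurable]: "g \<in> borel_measurable L" "c \<in> borel_measurable L" "B \<in> sets borel" for L B
  unfolding D_def by (subst emeasure_distr; measurable; subst emeasure_density; measurable)
    (auto intro!: nn_integral_cong split: split_indicator)
 have Ioc: "emeasure (D M) {a<..b} = emeasure (D N) {a<..b}" for a b
 proof (cases "a < b")
  case True
  have "ennreal pi * emeasure (D M) {a<..b} = ennreal pi * emeasure (D N) {a<..b}"
   using Ioc_pi[OF True] by (simp add: em pull)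
  thus ?thesis by (subst (asm) ennreal_mult_cancel_left) auto
 qed simp
 have "D M = D N"
 proof (rule measure_eqI_generator_eq[where \<Omega>=UNIV and E="range (%(a, b). {a<..b})" and A="%i. {- real i<..real i}"])
  show "Int_stable (range (%(a::real, b). {a<..b}))"
  proof (rule Int_stableI, safe)
   fix a b c d :: real
   have "{a<..b} \<inter> {c<..d} = {max a c<..min b d}" by auto
   thus "{a<..b} \<inter> {c<..d} \<in> range (%(a, b). {a<..b})" by auto
  qed
  show "sets (D M) = sigma_sets UNIV (range (%(a::real, b). {a<..b}))"
   "sets (D N) = sigma_sets UNIV (range (%(a::real, b). {a<..b}))" by (auto simp: D_def borel_sigma_sets_Ioc)
  show "(\<Union>i. {- real i<..real i}) = UNIV"
  proof safe
   fix x :: real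
   obtain n where "abs x < real n" using reals_Archimedean2 by blast
   thus "x \<in> (\<Union>i. {- real i<..real i})" by (auto intro!: exI[of _ n])
  qed simp
  fix i
  show "emeasure (D M) {- real i<..real i} ~= \<infinity>"
  proof (cases "i = 0")
   case False
   hence "- real i < real i" by simp
   from poisson_Ioc(2)[OF M gM c0 cK this] show ?thesis by (simp add: em)
  qed simp
 qed (auto simp: Ioc)
 moreover have "nn_integral L (%p. ennreal (c p * h (g p))) = nn_integral (D L) (%x. ennreal (h x))"
  if [measurable]: "g \<in> borel_measurable L" "c \<in> borel_measurable L" for L unfolding D_def
  by (subst nn_integral_distr; measurable; subst nn_integral_density; measurable) (simp add: ennreal_mult' c0)
 ultimately show ?thesis  by simp
qed

section \<open>Uniqueness for the two-variable Cauchy kernel\<close>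

lemma cauchy_kernel_integrable:
 fixes U :: "plane measure"
 assumes "finite_borel U" "Im ze ~= 0" "Im om ~= 0"
 shows "integrable U (%p. skern ze (fst p) *
  skern om (snd p))"
proof (rule integrable_bounded)
 show "finite_measure U" using assms by (simp add: finite_borel_def)
 have [measurable_cong]: "sets U = sets borel" using assms by (simp add: finite_borel_def)
 show "(%p. skern ze (fst p) *
  skern om (snd p)) \<in> borel_measurable U" by measurable
 show "norm (skern ze (fst p) *
  skern om (snd p)) <= kernel_bound ze * kernel_bound om" for p :: "plane"
  unfolding norm_mult using kernel_bound_ge_1[of ze] by (intro mult_mono norm_sqrt_kernel_le assms) auto
qed

lemma finite_borel_eqI:
 fixes U V :: "plane measure"
 assumes U: "finite_borel U" and V: "finite_borel V"
  and eq: "!!A B. A \<in> sets borel ==> B \<in> sets borel ==> emeasure U (A \<times> B) = emeasure V (A \<times> B)"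
 shows "U = V"
proof (rule measure_eqI_generator_eq[where \<Omega>=UNIV and A="%i::nat. UNIV"
   and E="{a \<times> b |a b. a \<in> sets (borel :: real measure) & b \<in> sets (borel :: real measure)}"])
 show "Int_stable {a \<times> b |a b. a \<in> sets (borel :: real measure) & b \<in> sets (borel :: real measure)}"
  by (rule Int_stable_pair_measure_generator)
 have "sets (borel :: plane measure) = sets (borel \<Otimes>\<^sub>M borel)"
  by (rule arg_cong[OF borel_prod[symmetric]])
 thus "sets U = sigma_sets UNIV {a \<times> b |a b. a \<in> sets (borel :: real measure) & b \<in> sets (borel :: real measure)}"
  "sets V = sigma_sets UNIV {a \<times> b |a b. a \<in> sets (borel :: real measure) & b \<in> sets (borel :: real measure)}"
  using U V by (simp_all add: finite_borel_def sets_pair_measure)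
 show "range (%i::nat. UNIV) \<subseteq> {a \<times> b |a b. a \<in> sets (borel :: real measure) & b \<in> sets (borel :: real measure)}"
  by (auto intro!: exI[of _ UNIV])
 show "emeasure U UNIV ~= \<infinity>" using U finite_measure.emeasure_finite[of U] by (simp add: finite_borel_def)
qed (use eq in auto)

lemma integral_linear_comb4:
 fixes a b c d :: "'a => complex"
 assumes "integrable M a" "integrable M b" "integrable M c" "integrable M d"
 shows "(LINT x|M. k * (a x - b x - c x + d x)) =
  k * ((LINT x|M. a x) - (LINT x|M. b x) - (LINT x|M. c x) + (LINT x|M. d x))" using assms by simp

text \<open>Four kernel values, at both signs of both imaginary parts, combine into a product of two
  Poisson kernels. One-variable uniqueness is applied first in \<open>s\<close>, with the kernel in
  \<open>t\<close> as part of the weight, and then in \<open>t\<close>.\<close>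

theorem cauchy_kernel_determines:
 fixes U V :: "plane measure"
 assumes U: "finite_borel U" and V: "finite_borel V"
  and eq: "!!ze om. Im ze ~= 0 ==> Im om ~= 0 ==>
   (LINT p|U. skern ze (fst p) *
    skern om (snd p))
  = (LINT p|V. skern ze (fst p) *
    skern om (snd p))"
 shows "U = V"
proof -
 note [measurable_cong] = U[unfolded finite_borel_def, THEN conjunct2] V[unfolded finite_borel_def, THEN conjunct2]
 have fin: "finite_measure U" "finite_measure V" using U V by (auto simp: finite_borel_def)
 let ?f = "%p :: plane. sqrt (1 + (fst p)^2)" and ?g = "%p :: plane. sqrt (1 + (snd p)^2)"
 let ?k = "%ze om p. (cor (?f p) / (ze - cor (fst p))) *
    (cor (?g p) / (om - cor (snd p)))"
 let ?P = "%et x ka y p. ?f p * ?g p * poisson ka (y - snd p) * poisson et (x - fst p)"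
 \<comment> \<open>The factor \<open>- (1/4)\<close> is \<open>1 / (2 * \<i>)^2\<close>, one
   \<open>2 * \<i>\<close> for each difference of kernels.\<close>
 have k: "cor (?P et x ka y p) = - (1/4) * (?k (Complex x (-et)) (Complex y (-ka)) p - ?k (Complex x (-et)) (Complex y ka) p
   - ?k (Complex x et) (Complex y (-ka)) p + ?k (Complex x et) (Complex y ka) p)" if "et > 0" "ka > 0" for et x ka y p
 proof -
  have "?k (Complex x (-et)) (Complex y (-ka)) p - ?k (Complex x (-et)) (Complex y ka) p
   - ?k (Complex x et) (Complex y (-ka)) p + ?k (Complex x et) (Complex y ka) p
   = cor (?f p * ?g p) * ((1 / (Complex x (-et) - cor (fst p)) - 1 / (Complex x et - cor (fst p)))
    * (1 / (Complex y (-ka) - cor (snd p)) - 1 / (Complex y ka - cor (snd p))))" by (simp add: algebra_simps)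
  also have "... = - 4 * cor (?P et x ka y p)" using that by (simp add: poisson_eq_kernel_diff)
  finally show ?thesis by simp
 qed
 have int: "integrable L (%p. cor (?P et x ka y p))" if "et > 0" "ka > 0" "finite_borel L" for et x ka y L
  unfolding k[OF that(1,2)] using that
  by (intro integrable_mult_right Bochner_Integration.integrable_add Bochner_Integration.integrable_diff cauchy_kernel_integrable) auto
 have eqc: "(LINT p|U. cor (?P et x ka y p)) = (LINT p|V. cor (?P et x ka y p))" if "et > 0" "ka > 0" for et x ka y
 proof -
  have c: "Im (Complex x (-et)) ~= 0" "Im (Complex x et) ~= 0" "Im (Complex y (-ka)) ~= 0" "Im (Complex y ka) ~= 0"
   using that by auto
  have i: "integrable L (?k ze om)" if "Im ze ~= 0" "Im om ~= 0" "finite_borel L" for L ze om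
   by (rule cauchy_kernel_integrable[OF that(3,1,2)])
  show ?thesis
   unfolding k[OF that] integral_linear_comb4[OF i[OF c(1,3) U] i[OF c(1,4) U] i[OF c(2,3) U] i[OF c(2,4) U]]
    integral_linear_comb4[OF i[OF c(1,3) V] i[OF c(1,4) V] i[OF c(2,3) V] i[OF c(2,4) V]]
   by (simp only: eq[OF c(1,3)] eq[OF c(1,4)] eq[OF c(2,3)] eq[OF c(2,4)])
 qed
 have step0: "nn_integral U (%p. ennreal (?P et x ka y p)) = nn_integral V (%p. ennreal (?P et x ka y p))" if "et > 0" "ka > 0" for et x ka y
 proof -
  have "nn_integral L (%p. ennreal (?P et x ka y p)) = ennreal (Re (LINT p|L. cor (?P et x ka y p)))" if "finite_borel L" for L
  proof -
   have "integrable L (?P et x ka y)"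
    using int[OF `et > 0` `ka > 0` that] by (simp only: complex_of_real_integrable_eq)
   thus ?thesis unfolding integral_complex_of_real Re_complex_of_real
    using `et > 0` `ka > 0` by (intro nn_integral_eq_integral) auto
  qed
  thus ?thesis using eqc[OF that] U V by simp
 qed
 have sq: "sqrt (1 + x^2) <= 1 + x^2" for x :: real
  using self_le_power[of "1 + x^2" 2] by (intro real_le_lsqrt) auto
 have step1: "nn_integral U (%p. ennreal (?g p * indicator A (fst p) * poisson ka (y - snd p)))
   = nn_integral V (%p. ennreal (?g p * indicator A (fst p) * poisson ka (y - snd p)))"
  if "ka > 0" and [measurable]: "A \<in> sets borel" for ka y A
 proof -
  have "nn_integral U (%p. ennreal (?f p * ?g p * poisson ka (y - snd p) * (indicator A (fst p) / ?f p)))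
   = nn_integral V (%p. ennreal (?f p * ?g p * poisson ka (y - snd p) * (indicator A (fst p) / ?f p)))"
  \<comment> \<open>The test function divides out \<open>?f\<close>. The constant \<open>K\<close>
    bounds the factor in \<open>t\<close>, while the factor in \<open>s\<close> obeys
    \<open>sqrt (1 + s^2) <= 1 + s^2\<close>.\<close>
  proof (rule poisson_determines[OF fin, where K="ka * (kernel_bound (Complex y ka))^2" and h="%s. indicator A s / sqrt (1 + s^2)"])
   fix p :: "plane"
   show "0 <= ?f p * ?g p * poisson ka (y - snd p)" using that by simp
   have "?g p * poisson ka (y - snd p) = ka * (norm (cor (?g p) / (Complex y ka - cor (snd p)))
     * norm (1 / (Complex y ka - cor (snd p))))" unfolding poisson_def norm_Complex_minus_of_real[symmetric]
    by (simp add: norm_divide power2_eq_square)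
   also have "... <= ka * (kernel_bound (Complex y ka) * kernel_bound (Complex y ka))"
    using that kernel_bound_ge_1[of "Complex y ka"]
    by (intro mult_left_mono mult_mono norm_sqrt_kernel_le norm_kernel_le) auto
   finally have "?g p * poisson ka (y - snd p) <= ka * (kernel_bound (Complex y ka))^2"
    by (simp only: power2_eq_square)
   hence "?f p * (?g p * poisson ka (y - snd p)) <= (1 + (fst p)^2) * (ka * (kernel_bound (Complex y ka))^2)"
    using sq[of "fst p"] that by (rule_tac mult_mono) auto
   thus "?f p * ?g p * poisson ka (y - snd p) <= ka * (kernel_bound (Complex y ka))^2 * (1 + (fst p)^2)"
    by (simp add: mult_ac)
  qed (use step0 that in \<open>auto simp: mult.assoc\<close>)
  moreover have "?f p * ?g p * poisson ka (y - snd p) * (indicator A (fst p) / ?f p) = ?g p * indicator A (fst p) * poisson ka (y - snd p)" for p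
   using sqrt_1_sq_pos[of "fst p"] by simp
  ultimately show ?thesis by simp
 qed
 have step2: "nn_integral U (%p. ennreal (indicator A (fst p) * indicator B (snd p)))
   = nn_integral V (%p. ennreal (indicator A (fst p) * indicator B (snd p)))"
  if [measurable]: "A \<in> sets borel" "B \<in> sets borel" for A B
 proof -
  have "nn_integral U (%p. ennreal (?g p * indicator A (fst p) * (indicator B (snd p) / ?g p)))
   = nn_integral V (%p. ennreal (?g p * indicator A (fst p) * (indicator B (snd p) / ?g p)))"
  proof (rule poisson_determines[OF fin, where K=1 and h="%s. indicator B s / sqrt (1 + s^2)"])
   fix p :: "plane"
   show "?g p * indicator A (fst p) <= 1 * (1 + (snd p)^2)" using sq[of "snd p"] by (auto simp: indicator_def)
  qed (use step1 in auto)
  moreover have "?g p * indicator A (fst p) * (indicator B (snd p) / ?g p) = indicator A (fst p) * indicator B (snd p)" for p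
   using sqrt_1_sq_pos[of "snd p"] by simp
  ultimately show ?thesis by simp
 qed
 show ?thesis
 proof (rule finite_borel_eqI[OF U V])
  fix A B :: "real set" assume AB: "A \<in> sets borel" "B \<in> sets borel"
  have "emeasure L (A \<times> B) = nn_integral L (%p. ennreal (indicator A (fst p) * indicator B (snd p)))" if "finite_borel L" for L :: "plane measure"
  proof -
   have "A \<times> B \<in> sets (borel \<Otimes>\<^sub>M borel)" using AB by simp
   hence "A \<times> B \<in> sets L" using that unfolding finite_borel_def borel_prod by simp
   hence "emeasure L (A \<times> B) = nn_integral L (%p. indicator (A \<times> B) p)" by simp
   also have "... = nn_integral L (%p. ennreal (indicator A (fst p) * indicator B (snd p)))"
    by (intro nn_integral_cong) (auto simp: indicator_def)
   finally show ?thesis .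
  qed
  thus "emeasure U (A \<times> B) = emeasure V (A \<times> B)" using step2[OF AB] U V by simp
 qed
qed

section \<open>The Poisson formula in a half plane\<close>

lemma poisson_minus_commute: "poisson et (x - s) = poisson et (s - x)"
 by (simp add: poisson_def power2_commute)

lemma nn_integral_poisson:
 assumes "0 < et"
 shows "nn_integral lborel (%s. ennreal (poisson et (x - s))) = ennreal pi"
proof -
 have "(%n. \<integral>\<^sup>+s. ennreal (poisson et (s - x)) * indicator {x - real n..x + real n} s \<partial>lborel)
  ----> (nn_integral lborel (%s. ennreal (poisson et (s - x))))"
 proof (rule nn_integral_LIMSEQ)
  show "incseq (%n s. ennreal (poisson et (s - x)) * indicator {x - real n..x + real n} s)"
   by (auto simp: incseq_def le_fun_def indicator_def)
  show "(%n. ennreal (poisson et (s - x)) * indicator {x - real n..x + real n} s) ----> ennreal (poisson et (s - x))" for s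
  proof (rule tendsto_eventually, rule eventually_mono)
   show "eventually (%n. abs (s - x) <= real n) sequentially"
    using filterlim_real_sequentially by (simp add: filterlim_at_top)
  qed (auto simp: indicator_def)
 qed measurable
 moreover have "nn_integral lborel (%s. ennreal (poisson et (s - x)) * indicator {x - real n..x + real n} s)
  = ennreal (2 * arctan (real n / et))" for n
  using nn_integral_poisson_Icc[OF assms, of "x - real n" "x + real n" x] by (simp add: arctan_minus)
 moreover have "(%n. ennreal (2 * arctan (real n / et))) ----> ennreal (2 * (pi / 2))"
 proof (intro tendsto_ennrealI tendsto_mult tendsto_const filterlim_compose[OF tendsto_arctan_at_top])
  show "filterlim (%n. real n / et) at_top sequentially" using assms filterlim_real_sequentially
   by (simp add: divide_inverse mult.commute filterlim_tendsto_pos_mult_at_top[OF tendsto_const])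
 qed
 ultimately show ?thesis using LIMSEQ_unique by (fastforce simp: poisson_minus_commute[of et x])
qed

lemma integrable_poisson: "0 < et ==> integrable lborel (%s. poisson et (x - s))"
 by (rule integrableI_nonneg) (auto simp: nn_integral_poisson)

lemma integral_poisson: "0 < et ==> (LINT s|lborel. poisson et (x - s)) = pi"
 by (subst integral_eq_nn_integral) (auto simp: nn_integral_poisson)

lemma integrable_bounded_poisson:
 fixes g :: "real => complex"
 assumes "0 < et" and [measurable]: "g \<in> bor" and "!!s. norm (g s) <= C"
 shows "integrable lborel (%s. g s * cor (poisson et (x - s)))"
proof (rule Bochner_Integration.integrable_bound)
 show "integrable lborel (%s. C * poisson et (x - s))"
  by (intro integrable_mult_right integrable_poisson assms)
 have "0 <= C" using norm_ge_zero[of "g 0"] assms(3)[of 0] by linarith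
 thus "AE s in lborel. norm (g s * cor (poisson et (x - s))) <= norm (C * poisson et (x - s))"
  using assms by (auto simp: norm_mult intro!: mult_right_mono)
qed measurable

text \<open>Cauchy's theorem for \<open>(g ze - g z) / ((ze - z) * (ze - cnj z))\<close>, which is
  holomorphic around the closed upper half plane once the singularity at \<open>z\<close> is
  removed. It decays quadratically, so the three outer sides of large rectangles contribute nothing,
  and on the real axis \<open>Im z\<close> times it is \<open>g - g z\<close> times the Poisson
  kernel.\<close>

theorem poisson_formula_half_plane:
 fixes g :: "complex => complex"
 assumes g: "g holomorphic_on {ze. Im ze > - d}" and d: "d > 0"
  and C: "!!ze. Im ze > - d ==> norm (g ze) <= C" and z: "Im z > 0"
 shows "(LINT s|lborel. g (cor s) * cor (poisson (Im z) (Re z - s))) = pi * g z"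
proof -
 \<comment> \<open>\<open>de < d\<close> keeps \<open>S\<close> inside the domain of
   \<open>g\<close>, and \<open>de < Im z\<close> keeps \<open>cnj z\<close> outside
   \<open>S\<close>.\<close>
 define de where "de = min d (Im z) / 2"
 have de: "0 < de" "de < d" "de < Im z" using d z by (auto simp: de_def)
 define S where "S = {ze. Im ze > - de}"
 have S: "open S" "convex S" "z \<in> S"
  using de by (auto simp: S_def open_halfspace_Im_gt convex_halfspace_Im_gt)
 have gS: "g holomorphic_on S" by (rule holomorphic_on_subset[OF g]) (use de in \<open>auto simp: S_def\<close>)
 have CS: "norm (g ze) <= C" if "ze \<in> S" for ze using C[of ze] that de by (auto simp: S_def)
 have C0: "0 <= C" using CS[OF S(3)] norm_ge_zero[of "g z"] by linarith
 define q where "q ze = (if ze = z then deriv g z else (g ze - g z) / (ze - z))" for ze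
 define f where "f ze = q ze / (ze - cnj z)" for ze
 have "q holomorphic_on S" unfolding q_def[abs_def] by (rule pole_lemma_open[OF gS S(1)])
 hence fS: "f holomorphic_on S"
  unfolding f_def[abs_def] using de by (intro holomorphic_intros) (auto simp: S_def)
 \<comment> \<open>A primitive on the convex set \<open>S\<close> replaces contour integrals: the
   integral along the base and the one along the other three sides are the same difference of its
   values.\<close>
 obtain Ph where Ph: "!!ze. ze \<in> S ==> (Ph has_field_derivative f ze) (at ze)"
  using holomorphic_convex_primitive'[OF S(2,1) fS] S(1) by (metis at_within_open)
 \<comment> \<open>Beyond \<open>2 * norm z\<close> both factors of the denominator are at least
   \<open>R / 2\<close>, and \<open>2 * C\<close> over \<open>R^2 / 4\<close> gives the constant
   8.\<close>
 have fle: "norm (f ze) <= 8 * C / R^2" if "ze \<in> S" "R <= norm ze" "2 * norm z < R" for ze R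
 proof -
  have R: "0 < R" using that(3) norm_ge_zero[of z] by linarith
  have "ze ~= z" using that(2,3) norm_ge_zero[of z] by force
  have h: "R / 2 <= norm (ze - u)" if "norm u = norm z" for u
   using norm_triangle_ineq2[of ze u] that `R <= norm ze` `2 * norm z < R` by linarith
  have "norm (f ze) = norm (g ze - g z) / (norm (ze - z) * norm (ze - cnj z))"
   using `ze ~= z` by (simp add: f_def q_def norm_divide norm_mult)
  also have "... <= (2 * C) / ((R / 2) * (R / 2))"
  proof (rule frac_le)
   show "norm (g ze - g z) <= 2 * C"
    using norm_triangle_ineq4[of "g ze" "g z"] CS[OF that(1)] CS[OF S(3)] by linarith
   show "R / 2 * (R / 2) <= norm (ze - z) * norm (ze - cnj z)" using R by (intro mult_mono h) auto
  qed (use C0 R in auto)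
  also have "... = 8 * C / R^2" by (simp add: power2_eq_square)
  finally show ?thesis .
 qed
 have seg: "norm (Ph v - Ph u) <= 8 * C / R^2 * norm (v - u)"
  if "closed_segment u v \<subseteq> S" "2 * norm z < R" "!!ze. ze \<in> closed_segment u v ==> R <= norm ze" for u v R
 proof (rule field_differentiable_bound)
  show "convex (closed_segment u v)" by simp
  show "(Ph has_field_derivative f ze) (at ze within closed_segment u v)" if "ze \<in> closed_segment u v" for ze
   using Ph[of ze] that `closed_segment u v \<subseteq> S` by (blast intro: has_field_derivative_at_within)
  show "norm (f ze) <= 8 * C / R^2" if "ze \<in> closed_segment u v" for ze
   using that fle `closed_segment u v \<subseteq> S` `2 * norm z < R` `!!ze. ze \<in> closed_segment u v ==> R <= norm ze` by blast
 qed auto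
 \<comment> \<open>The three sides have lengths \<open>R\<close>, \<open>2 * R\<close>,
   \<open>R\<close>; with the constant 8 this makes 32.\<close>
 have box: "norm (Ph (cor R) - Ph (cor (-R))) <= 32 * C / R" if R: "2 * norm z < R" for R
 proof -
  have R0: "0 < R" using R norm_ge_zero[of z] by linarith
  have Rle: "R <= norm ze" if "abs (Re ze) = R \<or> abs (Im ze) = R" for ze
   using that abs_Re_le_cmod[of ze] abs_Im_le_cmod[of ze] by linarith
  have conv: "closed_segment u v \<subseteq> S" if "u \<in> S" "v \<in> S" for u v
   using closed_segment_subset[OF that S(2)] .
  have inS: "cor R \<in> S" "cor (-R) \<in> S" "Complex R R \<in> S" "Complex (-R) R \<in> S"
   using R0 de by (auto simp: S_def)
  have seg_Re: "Re ze = c" if "ze \<in> closed_segment u v" "Re u = c" "Re v = c" for ze u v c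
  proof -
   obtain t where "ze = (1 - t) *\<^sub>R u + t *\<^sub>R v" using `ze \<in> closed_segment u v` by (auto simp: in_segment)
   hence "Re ze = (1 - t) * Re u + t * Re v" by simp
   thus ?thesis using that(2,3) by (simp add: algebra_simps)
  qed
  have seg_Im: "Im ze = c" if "ze \<in> closed_segment u v" "Im u = c" "Im v = c" for ze u v c
  proof -
   obtain t where "ze = (1 - t) *\<^sub>R u + t *\<^sub>R v" using `ze \<in> closed_segment u v` by (auto simp: in_segment)
   hence "Im ze = (1 - t) * Im u + t * Im v" by simp
   thus ?thesis using that(2,3) by (simp add: algebra_simps)
  qed
  have "norm (Ph (cor R) - Ph (Complex R R)) <= 8 * C / R^2 * norm (cor R - Complex R R)"
   using seg_Re[of _ "Complex R R" "cor R" R] R0 by (intro seg conv inS R Rle) auto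
  moreover have "norm (cor R - Complex R R) = R" using R0 by (simp add: cmod_def)
  moreover have "norm (Ph (Complex R R) - Ph (Complex (-R) R)) <= 8 * C / R^2 * norm (Complex R R - Complex (-R) R)"
   using seg_Im[of _ "Complex (-R) R" "Complex R R" R] R0 by (intro seg conv inS R Rle) auto
  moreover have "norm (Complex R R - Complex (-R) R) = 2 * R"
  proof -
   have "Complex R R - Complex (-R) R = cor (2 * R)" by (simp add: complex_eq_iff)
   hence "norm (Complex R R - Complex (-R) R) = abs (2 * R)" by simp
   thus ?thesis using R0 by simp
  qed
  moreover have "norm (Ph (Complex (-R) R) - Ph (cor (-R))) <= 8 * C / R^2 * norm (Complex (-R) R - cor (-R))"
   using seg_Re[of _ "cor (-R)" "Complex (-R) R" "-R"] R0 by (intro seg conv inS R Rle) auto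
  moreover have "norm (Complex (-R) R - cor (-R)) = R" using R0 by (simp add: cmod_def)
  moreover have "norm (Ph (cor R) - Ph (cor (-R))) <=
    norm (Ph (cor R) - Ph (Complex R R)) + norm (Ph (Complex R R) - Ph (Complex (-R) R))
    + norm (Ph (Complex (-R) R) - Ph (cor (-R)))"
   using norm_triangle_ineq[of "Ph (cor R) - Ph (Complex R R)" "Ph (Complex R R) - Ph (Complex (-R) R)"]
    norm_triangle_ineq[of "Ph (cor R) - Ph (Complex (-R) R)" "Ph (Complex (-R) R) - Ph (cor (-R))"] by simp
  ultimately have "norm (Ph (cor R) - Ph (cor (-R))) <= 8 * C / R^2 * R + 8 * C / R^2 * (2 * R) + 8 * C / R^2 * R"
   by simp
  also have "... = 32 * C / R"  by (simp add: power2_eq_square)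
  finally show ?thesis .
 qed
 let ?f = "%s. f (cor s)"
 have realS: "cor s \<in> S" for s using de by (simp add: S_def)
 have cont: "continuous_on A (%s. h (cor s))" if "h holomorphic_on S" for A h
  by (rule continuous_on_compose2[OF holomorphic_on_imp_continuous_on[OF that]]) (use realS in \<open>auto\<close>)
 have feq: "Im z * f (cor s) = (g (cor s) - g z) * cor (poisson (Im z) (Re z - s))" for s
 proof -
  have "z = Complex (Re z) (Im z)" by simp
  hence "(cor s - z) * (cor s - cnj z) = cor ((Im z)^2 + (Re z - s)^2)"
   by (simp add: complex_eq_iff power2_eq_square algebra_simps)
  moreover have "cor s ~= z" using z by auto
  ultimately show ?thesis by (simp add: f_def q_def poisson_def)
 qed
 have gm [measurable]: "(%s. g (cor s)) \<in> bor" by (rule borel_measurable_continuous_onI[OF cont[OF gS]])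
 have int: "integrable lborel (%s. (g (cor s) - g z) * cor (poisson (Im z) (Re z - s)))"
 proof (rule integrable_bounded_poisson[OF z, of _ "2 * C"])
  show "norm (g (cor s) - g z) <= 2 * C" for s
   using norm_triangle_ineq4[of "g (cor s)" "g z"] CS[OF realS[of s]] CS[OF S(3)] by linarith
 qed measurable
 have "integrable lborel (%s. Im z * f (cor s))" unfolding feq by (rule int)
 hence "integrable lborel (%s. 1 / cor (Im z) * (cor (Im z) * f (cor s)))" by (rule integrable_mult_right)
 hence intf: "integrable lborel ?f" using z by simp
 have "(%n. \<integral>s. indicator {- real n..real n} s *\<^sub>R ?f s \<partial>lborel) ----> (LINT s|lborel. ?f s)"
 proof (rule integral_dominated_convergence[where w="%s. norm (?f s)"])
  show "AE s in lborel. (%n. indicator {- real n..real n} s *\<^sub>R ?f s) ----> ?f s"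
  proof (rule always_eventually, rule allI, rule tendsto_eventually)
   fix s :: real
   have "eventually (%n. abs s <= real n) sequentially"
    using filterlim_real_sequentially by (simp add: filterlim_at_top)
   thus "eventually (%n. indicator {- real n..real n} s *\<^sub>R ?f s = ?f s) sequentially"
    by eventually_elim (auto simp: indicator_def)
  qed
 qed (use intf in \<open>auto simp: indicator_def\<close>)
 moreover have "(LINT s|lborel. indicator {- real n..real n} s *\<^sub>R ?f s) = Ph (cor (real n)) - Ph (cor (- real n))" for n
 proof (rule integral_FTC_atLeastAtMost)
  show "((%s. Ph (cor s)) has_vector_derivative ?f s) (at s within {- real n..real n})" for s
   using field_vector_diff_chain_within[of cor 1 s "{- real n..real n}" Ph "f (cor s)"]
    Ph[OF realS[of s]] has_vector_derivative_of_real[of "%x. x" 1 "at s within {- real n..real n}"]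
   by (auto simp: o_def intro: has_field_derivative_at_within)
  show "continuous_on {- real n..real n} ?f" by (rule cont[OF fS])
 qed simp
 moreover have "(%n. Ph (cor (real n)) - Ph (cor (- real n))) ----> 0"
 proof (rule Lim_null_comparison)
  have "eventually (%n. 2 * norm z + 1 <= real n) sequentially"
   using filterlim_real_sequentially by (simp add: filterlim_at_top)
  thus "eventually (%n. norm (Ph (cor (real n)) - Ph (cor (- real n))) <= 32 * C / real n) sequentially"
   by eventually_elim (rule box, simp)
  show "(%n. 32 * C / real n) ----> 0" by (rule lim_const_over_n)
 qed
 ultimately have "(LINT s|lborel. ?f s) = 0" using LIMSEQ_unique by simp
 hence "(LINT s|lborel. Im z * ?f s) = 0" by simp
 hence "0 = (LINT s|lborel. g (cor s) * cor (poisson (Im z) (Re z - s))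
   - g z * cor (poisson (Im z) (Re z - s)))" unfolding feq by (simp add: left_diff_distrib)
 also have "... = (LINT s|lborel. g (cor s) * cor (poisson (Im z) (Re z - s)))
   - (LINT s|lborel. g z * cor (poisson (Im z) (Re z - s)))" using z CS realS S(3)
  by (intro Bochner_Integration.integral_diff integrable_bounded_poisson[where C=C]) auto
 also have "(LINT s|lborel. g z * cor (poisson (Im z) (Re z - s))) = pi * g z"
  using z by (simp add: integral_poisson)
 finally show ?thesis by simp
qed

lemma holomorphic2_imp_continuous_on:
 "f holomorphic2_on S ==> continuous_on S f" unfolding holomorphic2_on_def continuous_on_eq_continuous_within
 using has_derivative_continuous by blast

section \<open>Holomorphic functions of two variables\<close>

lemma holomorphic2_imp_holomorphic_fst:
 assumes f: "f holomorphic2_on A \<times> B" and w: "w \<in> B"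
 shows "(%z. f (z, w)) holomorphic_on A" unfolding holomorphic_on_def
proof
 fix z assume z: "z \<in> A"
 then obtain a b where "(f has_derivative (%(h, k). a * h + b * k)) (at (z, w) within A \<times> B)"
  using f w unfolding holomorphic2_on_def by blast
 hence *: "(f has_derivative (%(h, k). a * h + b * k)) (at (z, w) within (%z. (z, w)) ` A)"
  by (rule has_derivative_subset) (use w in auto)
 have "((%z. (z, w)) has_derivative (%h. (h, 0))) (at z within A)" by (auto intro!: derivative_eq_intros)
 from has_derivative_in_compose[OF this *]
 have "((%z. f (z, w)) has_derivative (%h. a * h)) (at z within A)" by simp
 hence "((%z. f (z, w)) has_field_derivative a) (at z within A)" by (simp add: has_field_derivative_def)
 thus "(%z. f (z, w)) field_differentiable at z within A" by (auto simp: field_differentiable_def)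
qed

lemma holomorphic2_imp_holomorphic_snd:
 assumes f: "f holomorphic2_on A \<times> B" and z: "z \<in> A"
 shows "(%w. f (z, w)) holomorphic_on B" unfolding holomorphic_on_def
proof
 fix w assume w: "w \<in> B"
 then obtain a b where "(f has_derivative (%(h, k). a * h + b * k)) (at (z, w) within A \<times> B)"
  using f z unfolding holomorphic2_on_def by blast
 hence *: "(f has_derivative (%(h, k). a * h + b * k)) (at (z, w) within (%w. (z, w)) ` B)"
  by (rule has_derivative_subset) (use z in auto)
 have "((%w. (z, w)) has_derivative (%k. (0, k))) (at w within B)" by (auto intro!: derivative_eq_intros)
 from has_derivative_in_compose[OF this *]
 have "((%w. f (z, w)) has_derivative (%k. b * k)) (at w within B)" by simp
 hence "((%w. f (z, w)) has_field_derivative b) (at w within B)" by (simp add: has_field_derivative_def)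
 thus "(%w. f (z, w)) field_differentiable at w within B" by (auto simp: field_differentiable_def)
qed

lemma holomorphic2_subset: "f holomorphic2_on S ==> T \<subseteq> S ==> f holomorphic2_on T"
 unfolding holomorphic2_on_def by (meson has_derivative_subset subsetD)

lemma holomorphic2_add:
 assumes "f holomorphic2_on S" "g holomorphic2_on S"
 shows "(%p. f p + g p) holomorphic2_on S" unfolding holomorphic2_on_def
proof
 fix p assume p: "p \<in> S"
 obtain a b where "(f has_derivative (%(h, k). a * h + b * k)) (at p within S)"
  using assms(1) p unfolding holomorphic2_on_def by blast
 moreover obtain c d where "(g has_derivative (%(h, k). c * h + d * k)) (at p within S)"
  using assms(2) p unfolding holomorphic2_on_def by blast
 ultimately have "((%p. f p + g p) has_derivative (%x. (%(h, k). a * h + b * k) x + (%(h, k). c * h + d * k) x)) (at p within S)"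
  by simp
 moreover have "(%x. (%(h, k). a * h + b * k) x + (%(h, k). c * h + d * k) x) = (%(h, k). (a + c) * h + (b + d) * k)"
  by (auto simp: algebra_simps)
 ultimately show "\<exists>a b. ((%p. f p + g p) has_derivative (%(h, k). a * h + b * k)) (at p within S)"
  by metis
qed

lemma holomorphic2_fst:
 assumes "f holomorphic_on A" "open A"
 shows "(%p. f (fst p)) holomorphic2_on A \<times> B" unfolding holomorphic2_on_def
proof
 fix p assume p: "p \<in> A \<times> B"
 hence "(f has_derivative (%h. deriv f (fst p) * h)) (at (fst p))"
  using holomorphic_derivI[OF assms, of "fst p"] by (auto simp: has_field_derivative_def)
 hence "(f has_derivative (%h. deriv f (fst p) * h)) (at (fst p) within fst ` (A \<times> B))"
  by (rule has_derivative_at_withinI)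
 from has_derivative_in_compose[OF has_derivative_fst[OF has_derivative_ident] this]
 have "((%p. f (fst p)) has_derivative (%(h, k). deriv f (fst p) * h + 0 * k)) (at p within A \<times> B)"
  by (simp add: case_prod_unfold)
 thus "\<exists>a b. ((%p. f (fst p)) has_derivative (%(h, k). a * h + b * k)) (at p within A \<times> B)" by blast
qed

lemma holomorphic2_snd:
 assumes "f holomorphic_on B" "open B"
 shows "(%p. f (snd p)) holomorphic2_on A \<times> B" unfolding holomorphic2_on_def
proof
 fix p assume p: "p \<in> A \<times> B"
 hence "(f has_derivative (%h. deriv f (snd p) * h)) (at (snd p))"
  using holomorphic_derivI[OF assms, of "snd p"] by (auto simp: has_field_derivative_def)
 hence "(f has_derivative (%h. deriv f (snd p) * h)) (at (snd p) within snd ` (A \<times> B))"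
  by (rule has_derivative_at_withinI)
 from has_derivative_in_compose[OF has_derivative_snd[OF has_derivative_ident] this]
 have "((%p. f (snd p)) has_derivative (%(h, k). 0 * h + deriv f (snd p) * k)) (at p within A \<times> B)"
  by (simp add: case_prod_unfold)
 thus "\<exists>a b. ((%p. f (snd p)) has_derivative (%(h, k). a * h + b * k)) (at p within A \<times> B)" by blast
qed

lemma holomorphic2_compose_fst_snd:
 assumes F: "F holomorphic2_on A' \<times> B'" and o: "open A'" "open B'" and f: "f holomorphic_on A" "open A" "f ` A \<subseteq> A'"
  and g: "g holomorphic_on B" "open B" "g ` B \<subseteq> B'"
 shows "(%p. F (f (fst p), g (snd p))) holomorphic2_on A \<times> B" unfolding holomorphic2_on_def
proof
 fix p assume p: "p \<in> A \<times> B"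
 let ?q = "(f (fst p), g (snd p))"
 have q: "?q \<in> A' \<times> B'" using p f g by auto
 then obtain a b where "(F has_derivative (%(h, k). a * h + b * k)) (at ?q within A' \<times> B')"
  using F unfolding holomorphic2_on_def by blast
 hence F': "(F has_derivative (%(h, k). a * h + b * k)) (at ?q)"
  using at_within_open[OF q open_Times[OF o]] by simp
 have "(f has_derivative (%h. deriv f (fst p) * h)) (at (fst p))" "(g has_derivative (%h. deriv g (snd p) * h)) (at (snd p))"
  using holomorphic_derivI[OF f(1,2), of "fst p"] holomorphic_derivI[OF g(1,2), of "snd p"] p
  by (auto simp: has_field_derivative_def)
 hence "((%p. (f (fst p), g (snd p))) has_derivative (%x. (deriv f (fst p) * fst x, deriv g (snd p) * snd x))) (at p)"
  by (intro has_derivative_Pair has_derivative_compose[OF has_derivative_fst[OF has_derivative_ident]]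
   has_derivative_compose[OF has_derivative_snd[OF has_derivative_ident]])
 from has_derivative_compose[OF this F']
 have "((%p. F (f (fst p), g (snd p))) has_derivative (%(h, k). (a * deriv f (fst p)) * h + (b * deriv g (snd p)) * k)) (at p)"
  by (simp add: case_prod_unfold mult.assoc)
 thus "\<exists>a b. ((%p. F (f (fst p), g (snd p))) has_derivative (%(h, k). a * h + b * k)) (at p within A \<times> B)"
  using has_derivative_at_withinI by blast
qed

lemma open_nonreal [simp]: "open (- \<real> :: complex set)" using closed_complex_Reals by auto

section \<open>Two-variable Cauchy integrals and their holomorphy\<close>

definition cauchy2 :: "'a measure => ('a => complex) => ('a => real) => ('a => real) => complex => complex => complex" where
 "cauchy2 M c x y ze om = (LINT p|M. c p / ((ze - cor (x p)) * (om - cor (y p))))"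

lemma integral_taylor_remainder:
 fixes f g u v :: "'a => complex"
 assumes "integrable M f" "integrable M g" "integrable M u" "integrable M v"
 shows "(LINT p|M. f p - g p - (- u p * h + - v p * k))
  = (LINT p|M. f p) - (LINT p|M. g p) - (- (LINT p|M. u p) * h + - (LINT p|M. v p) * k)" using assms by simp

text \<open>The measure lives on an arbitrary space with real functions \<open>x\<close> and
  \<open>y\<close> on it, so that one result covers measures on the plane and, with \<open>y\<close>
  constant, one-variable integrals. The density \<open>c\<close> may grow like the product of both
  weights, as the mixed term requires.\<close>

locale cauchy2_kernel = finite_measure M for M :: "'a measure" +
 fixes c :: "'a => complex" and x y :: "'a => real" and K :: real
 assumes meas [measurable]: "c \<in> borel_measurable M" "x \<in> borel_measurable M" "y \<in> borel_measurable M"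
  and bound: "!!p. norm (c p) <= K * (sqrt (1 + (x p)^2) * sqrt (1 + (y p)^2))"
begin

lemma K_nonneg: "0 <= K"
proof (rule ccontr)
 assume "\<not> 0 <= K"
 hence "K * (sqrt (1 + (x undefined)^2) * sqrt (1 + (y undefined)^2)) < 0"
  by (intro mult_neg_pos mult_pos_pos sqrt_1_sq_pos) simp
 with bound[of undefined] norm_ge_zero[of "c undefined"] show False by linarith
qed

lemma norm_integrand_le:
 assumes "Im ze ~= 0" "Im om ~= 0"
 shows "norm (c p / ((ze - cor (x p)) * (om - cor (y p)))) <= K * (kernel_bound ze * kernel_bound om)"
proof -
 have n: "0 < norm (ze - cor (x p))" "0 < norm (om - cor (y p))" using assms by auto
 have "norm (c p) <= K * (sqrt (1 + (x p)^2) * sqrt (1 + (y p)^2))" by (rule bound)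
 also have "... <= K * ((kernel_bound ze * norm (ze - cor (x p))) * (kernel_bound om * norm (om - cor (y p))))"
  using kernel_bound_ge_1[of ze] by (intro mult_left_mono mult_mono sqrt_le_kernel_bound assms K_nonneg) auto
 finally show ?thesis using n by (simp add: norm_divide norm_mult pos_divide_le_eq mult_ac)
qed

lemma integrable_kernel:
 assumes "Im ze ~= 0" "Im om ~= 0"
 shows "integrable M (%p. c p / ((ze - cor (x p)) * (om - cor (y p))))"
 by (rule integrable_bounded[OF finite_measure_axioms _ norm_integrand_le[OF assms]]) measurable

lemma integrable_kernel_mult:
 assumes "Im ze ~= 0" "Im om ~= 0" and [measurable]: "d \<in> borel_measurable M" and d: "!!p. norm (d p) <= D"
 shows "integrable M (%p. c p / ((ze - cor (x p)) * (om - cor (y p))) * d p)"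
proof (rule integrable_bounded[OF finite_measure_axioms, where C="K * (kernel_bound ze * kernel_bound om) * D"])
 show "norm (c p / ((ze - cor (x p)) * (om - cor (y p))) * d p) <= K * (kernel_bound ze * kernel_bound om) * D" for p
  unfolding norm_mult using norm_integrand_le[OF assms(1,2), of p] d[of p]
  by (intro mult_mono) (auto intro: order_trans[OF norm_ge_zero])
qed measurable

text \<open>The remainder of the first-order expansion of the kernel is an explicit combination of
  \<open>h^2\<close>, \<open>k^2\<close> and \<open>h * k\<close>, whose coefficients are bounded as
  long as the points stay away from the real axis; it can therefore be integrated.\<close>

lemma cauchy2_has_derivative:
 assumes ze: "Im ze0 ~= 0" and om: "Im om0 ~= 0"
 shows "\<exists>a b. ((%(ze, om). cauchy2 M c x y ze om) has_derivative (%(h, k). a * h + b * k)) (at (ze0, om0) within S)"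
proof -
 let ?k = "%p. c p / ((ze0 - cor (x p)) * (om0 - cor (y p)))"
 let ?u = "%ze p. 1 / (ze - cor (x p))" and ?v = "%om p. 1 / (om - cor (y p))"
 define a where "a = - (LINT p|M. ?k p * ?u ze0 p)"
 define b where "b = - (LINT p|M. ?k p * ?v om0 p)"
 \<comment> \<open>Half the distance to the real axis: points closer than \<open>m\<close> to the
   base point still have distance at least \<open>m\<close> from the axis.\<close>
 define m where "m = min (abs (Im ze0)) (abs (Im om0)) / 2"
 have m: "m > 0" using assms by (auto simp: m_def)
 define C where "C = K * (kernel_bound ze0 * kernel_bound om0) / m^2 * measure M (space M)"
 have inv_le: "norm (1 / (ze - cor s)) <= 1 / m" if "m <= abs (Im ze)" for ze s
  using abs_Im_le_dist[of ze s] that m by (simp add: norm_divide frac_le)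
 have rem: "norm (cauchy2 M c x y ze om - cauchy2 M c x y ze0 om0 - (a * (ze - ze0) + b * (om - om0)))
   <= C * 3 * (norm ((ze, om) - (ze0, om0)))^2"
  if d: "dist (ze, om) (ze0, om0) < m" for ze om
 proof -
  define h where "h = ze - ze0"
  define k where "k = om - om0"
  have hk: "norm h <= norm (h, k)" "norm k <= norm (h, k)" using norm_fst_le[of h k] norm_snd_le[of k h] by auto
  have nd: "norm (h, k) < m" using d by (simp add: dist_norm h_def k_def)
  have "abs (Im ze - Im ze0) < m" "abs (Im om - Im om0) < m"
   using hk nd abs_Im_le_cmod[of h] abs_Im_le_cmod[of k] by (auto simp: h_def k_def)
  moreover have "2 * m <= abs (Im ze0)" "2 * m <= abs (Im om0)" by (auto simp: m_def)
  ultimately have Im: "m <= abs (Im ze)" "m <= abs (Im om)" "m <= abs (Im ze0)" "m <= abs (Im om0)"  by linarith+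
  hence nz: "Im ze ~= 0" "Im om ~= 0" using m by auto
  let ?R = "%p. ?k p * (h^2 * (?u ze p * ?u ze0 p) + k^2 * (?v om p * ?v om0 p) + h * k * (?u ze p * ?v om p))"
  have pt: "c p / ((ze - cor (x p)) * (om - cor (y p))) - ?k p - (- (?k p * ?u ze0 p) * h + - (?k p * ?v om0 p) * k) = ?R p" for p
  proof -
   define A A0 B B0 where "A = ze - cor (x p)" "A0 = ze0 - cor (x p)"
    "B = om - cor (y p)" "B0 = om0 - cor (y p)"
   have nz': "A ~= 0" "A0 ~= 0" "B ~= 0" "B0 ~= 0" using nz assms by (auto simp: A_A0_B_B0_def)
   have hk: "A = A0 + h" "B = B0 + k" by (auto simp: A_A0_B_B0_def h_def k_def)
   have "c p / (A * B) - c p / (A0 * B0) - (- (c p / (A0 * B0) * (1 / A0)) * h + - (c p / (A0 * B0) * (1 / B0)) * k)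
     = c p / (A0 * B0) * (h^2 * (1 / A * (1 / A0)) + k^2 * (1 / B * (1 / B0)) + h * k * (1 / A * (1 / B)))"
    using nz' unfolding hk by (simp add: divide_simps) (simp add: algebra_simps power2_eq_square)
   thus ?thesis by (simp only: A_A0_B_B0_def)
  qed
  have nR: "norm (?R p) <= K * (kernel_bound ze0 * kernel_bound om0) * (3 * (norm (h, k))^2 / m^2)" for p
   unfolding norm_mult[of "?k p"]
  proof (rule mult_mono[OF norm_integrand_le[OF assms]])
   have e: "norm (a1 * a2 * (b1 * b2)) <= (norm (h, k))^2 / m^2"
    if "norm a1 <= norm (h, k)" "norm a2 <= norm (h, k)" "norm b1 <= 1 / m" "norm b2 <= 1 / m" for a1 a2 b1 b2 :: complex
   proof -
    have "norm (a1 * a2 * (b1 * b2)) <= (norm (h, k) * norm (h, k)) * (1 / m * (1 / m))"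
     unfolding norm_mult using that m by (intro mult_mono) auto
    thus ?thesis by (simp add: power2_eq_square)
   qed
   have "norm (h^2 * (?u ze p * ?u ze0 p)) <= (norm (h, k))^2 / m^2"
    unfolding power2_eq_square[of h] by (intro e hk inv_le Im)
   moreover have "norm (k^2 * (?v om p * ?v om0 p)) <= (norm (h, k))^2 / m^2"
    unfolding power2_eq_square[of k] by (intro e hk inv_le Im)
   moreover have "norm (h * k * (?u ze p * ?v om p)) <= (norm (h, k))^2 / m^2" by (intro e hk inv_le Im)
   ultimately show "norm (h^2 * (?u ze p * ?u ze0 p) + k^2 * (?v om p * ?v om0 p) + h * k * (?u ze p * ?v om p)) <= 3 * (norm (h, k))^2 / m^2"
    using norm_triangle_ineq[of "h^2 * (?u ze p * ?u ze0 p)" "k^2 * (?v om p * ?v om0 p)"]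
     norm_triangle_ineq[of "h^2 * (?u ze p * ?u ze0 p) + k^2 * (?v om p * ?v om0 p)" "h * k * (?u ze p * ?v om p)"]
    by linarith
  qed (use K_nonneg kernel_bound_ge_1[of ze0] kernel_bound_ge_1[of om0] in auto)
  have i1: "integrable M (%p. ?k p * ?u ze0 p)" "integrable M (%p. ?k p * ?v om0 p)"
   by (rule integrable_kernel_mult[OF assms _ inv_le[OF Im(3)]], measurable)
    (rule integrable_kernel_mult[OF assms _ inv_le[OF Im(4)]], measurable)
  have i2: "integrable M ?k" by (rule integrable_kernel[OF assms])
  have i3: "integrable M (%p. c p / ((ze - cor (x p)) * (om - cor (y p))))" by (rule integrable_kernel[OF nz])
  have "cauchy2 M c x y ze om - cauchy2 M c x y ze0 om0 - (a * h + b * k) = (LINT p|M. ?R p)"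
   unfolding pt[symmetric] cauchy2_def a_def b_def by (rule integral_taylor_remainder[OF i3 i2 i1, symmetric])
  also have "norm ... <= measure M (space M) * (K * (kernel_bound ze0 * kernel_bound om0) * (3 * (norm (h, k))^2 / m^2))"
  proof -
   define R where "R p = ?R p" for p
   have "integrable M R" unfolding R_def[abs_def] pt[symmetric] using i1 i2 i3
    by (intro Bochner_Integration.integrable_diff Bochner_Integration.integrable_add
      integrable_mult_left Bochner_Integration.integrable_minus)
   hence "(LINT p|M. norm (R p)) <= (LINT p|M. K * (kernel_bound ze0 * kernel_bound om0) * (3 * (norm (h, k))^2 / m^2))"
    using nR unfolding R_def[symmetric] by (intro integral_mono) auto
   hence "norm (LINT p|M. R p) <= measure M (space M) * (K * (kernel_bound ze0 * kernel_bound om0) * (3 * (norm (h, k))^2 / m^2))"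
    by (intro order_trans[OF integral_norm_bound]) simp
   thus ?thesis by (simp only: R_def)
  qed
  also have "... = C * 3 * (norm (h, k))^2" by (simp add: C_def)
  finally show ?thesis by (simp add: h_def k_def)
 qed
 have "((%(ze, om). cauchy2 M c x y ze om) has_derivative (%(h, k). a * h + b * k)) (at (ze0, om0) within S)"
 proof (rule has_derivativeI_sandwich[of m])
  have "bounded_linear (%p. a * fst p + b * snd p)"
   by (intro bounded_linear_add bounded_linear_compose[OF bounded_linear_mult_right] bounded_linear_fst bounded_linear_snd)
  thus "bounded_linear (%(h, k). a * h + b * k)" by (simp add: case_prod_unfold)
  show "norm ((case p of (ze, om) => cauchy2 M c x y ze om) - (case (ze0, om0) of (ze, om) => cauchy2 M c x y ze om)
    - (case p - (ze0, om0) of (h, k) => a * h + b * k)) / norm (p - (ze0, om0)) <= C * 3 * norm (p - (ze0, om0))"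
   if "p ~= (ze0, om0)" "dist p (ze0, om0) < m" for p
  proof -
   obtain ze om where p: "p = (ze, om)" by fastforce
   have "0 < norm (p - (ze0, om0))" using that(1) by simp
   thus ?thesis using rem[of ze om] that(2) unfolding p by (simp add: pos_divide_le_eq power2_eq_square)
  qed
  have "((%p. C * 3 * norm (p - (ze0, om0))) ---> C * 3 * norm ((ze0, om0) - (ze0, om0))) (at (ze0, om0) within S)"
   by (intro tendsto_intros)
  thus "((%p. C * 3 * norm (p - (ze0, om0))) ---> 0) (at (ze0, om0) within S)" by simp
 qed (rule m)
 thus ?thesis by blast
qed

lemma cauchy2_holomorphic2: "(%(ze, om). cauchy2 M c x y ze om) holomorphic2_on (- \<real>) \<times> (- \<real>)"
 unfolding holomorphic2_on_def using cauchy2_has_derivative by (auto simp: nonreal_iff)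

end

text \<open>The two-variable result with \<open>y = 0\<close> and the second variable frozen at
  \<open>\<i>\<close>, whose kernel is then cancelled by a factor \<open>\<i>\<close>.\<close>

lemma cauchy_integral_holomorphic:
 assumes "finite_measure M" and [measurable]: "c \<in> borel_measurable M" "x \<in> borel_measurable M"
  and bound: "!!p. norm (c p) <= K * sqrt (1 + (x p)^2)"
 shows "(%ze. \<integral>p. c p / (ze - cor (x p)) \<partial>M) holomorphic_on - \<real>"
proof -
 interpret cauchy2_kernel M c x "%_. 0" K
  using assms by (intro cauchy2_kernel.intro) (auto simp: cauchy2_kernel_axioms_def)
 have "\<i> \<in> - \<real>" by simp
 hence "(%ze. cauchy2 M c x (%_. 0) ze \<i>) holomorphic_on - \<real>"
  using holomorphic2_imp_holomorphic_fst[OF cauchy2_holomorphic2] by simp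
 hence "(%ze. \<i> * cauchy2 M c x (%_. 0) ze \<i>) holomorphic_on - \<real>" by (intro holomorphic_intros)
 moreover have "\<i> * cauchy2 M c x (%_. 0) ze \<i> = (LINT p|M. c p / (ze - cor (x p)))" for ze
  unfolding cauchy2_def integral_mult_right_zero[symmetric] by simp
 ultimately show ?thesis by simp
qed

text \<open>The reason for the combination \<open>G z (cnj w) - G z w\<close>: for a Cauchy
  transform its real part integrates a product of two positive kernels.\<close>

lemma Re_kernel_cnj_diff:
 assumes "Im z > 0" "Im w > 0"
 shows "Re (1 / ((z - cor s) * (cnj w - cor t)) - 1 / ((z - cor s) * (w - cor t)))
  = 2 * poisson (Im z) (Re z - s) * poisson (Im w) (Re w - t)"
proof -
 have w: "w = Complex (Re w) (Im w)" "cnj w = Complex (Re w) (- Im w)" by (simp_all add: complex_eq_iff)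
 have "1 / ((z - cor s) * (cnj w - cor t)) - 1 / ((z - cor s) * (w - cor t))
  = 1 / (z - cor s) * (1 / (Complex (Re w) (- Im w) - cor t) - 1 / (Complex (Re w) (Im w) - cor t))"
  by (simp add: w(2)[symmetric] right_diff_distrib)
 also have "... = 1 / (z - cor s) * (2 * \<i> * cor (poisson (Im w) (Re w - t)))"
  using assms by (subst poisson_eq_kernel_diff) auto
 finally have "Re (1 / ((z - cor s) * (cnj w - cor t)) - 1 / ((z - cor s) * (w - cor t)))
  = Re (1 / (z - cor s) * (2 * \<i> * cor (poisson (Im w) (Re w - t))))" by simp
 also have "Re (v * (2 * \<i> * cor p)) = - 2 * p * Im v" for v p by simp
 also have "Im (1 / (z - cor s)) = - poisson (Im z) (Re z - s)" by (simp add: poisson_def Im_divide)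
 finally show ?thesis by simp
qed

section \<open>Laws with a prescribed Cauchy transform\<close>

text \<open>A nonconstant holomorphic function is open, and no nonempty open set fits into the
  imaginary axis.\<close>

lemma holomorphic_Re_zero_imp_constant:
 assumes f: "f holomorphic_on S" "open S" "connected S" and Re: "!!z. z \<in> S ==> Re (f z) = 0"
  and "z \<in> S" "w \<in> S"
 shows "f z = f w"
proof (rule ccontr)
 assume "f z ~= f w"
 hence "\<not> f constant_on S" using assms by (metis constant_on_def)
 hence "open (f ` S)" using open_mapping_thm[OF f(1-3) f(2)] by auto
 hence "f z \<in> interior (f ` S)" using `z \<in> S` by (simp add: interior_open)
 then obtain e where e: "e > 0" "ball (f z) e \<subseteq> f ` S" by (auto simp: mem_interior)
 hence "f z + cor (e / 2) \<in> f ` S" by (intro subsetD[OF e(2)]) (simp add: dist_norm)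
 then obtain u where "u \<in> S" "f u = f z + cor (e / 2)" by force
 hence "Re (f u) = Re (f z) + e / 2" by simp
 with Re[OF `u \<in> S`] Re[OF `z \<in> S`] e show False by simp
qed

text \<open>Properties that every Cauchy transform of a law on the plane has. \<open>pos\<close> is
  positivity of the double Poisson integral, and \<open>mass\<close> fixes total mass 1, the limit 2
  being the factor in \<open>Re_kernel_cnj_diff\<close>.\<close>

locale cauchy2_candidate =
 fixes G :: "complex => complex => complex"
 assumes hol1: "!!w. Im w ~= 0 ==> (%z. G z w) holomorphic_on - \<real>"
  and hol2: "!!z. Im z ~= 0 ==> (%w. G z w) holomorphic_on - \<real>"
  and cnj: "!!z w. Im z ~= 0 ==> Im w ~= 0 ==> G (cnj z) (cnj w) = cnj (G z w)"
  and bound: "!!z w. Im z ~= 0 ==> Im w ~= 0 ==> norm (G z w) <= 1 / (abs (Im z) * abs (Im w))"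
  and pos: "!!z w. Im z > 0 ==> Im w > 0 ==> 0 <= Re (G z (cnj w) - G z w)"
  and cont: "continuous_on ((- \<real>) \<times> (- \<real>)) (%(z, w). G z w)"
  and mass: "((%y. y^2 * Re (G (Complex 0 y) (Complex 0 (-y)) - G (Complex 0 y) (Complex 0 y))) ---> 2) at_top"
begin

definition u :: "complex => complex => real" where
 "u z w = Re (G z (cnj w) - G z w)"

lemma u_nonneg: "Im z > 0 ==> Im w > 0 ==> 0 <= u z w" using pos by (simp add: u_def)

text \<open>By definition \<open>u\<close> is the real part of a function holomorphic in
  \<open>z\<close>, but not in \<open>w\<close>; conjugation symmetry writes it as the real part of
  one holomorphic in \<open>w\<close>. So the Poisson formula is available in each variable.\<close>

lemma u_alt: "Im z > 0 ==> Im w > 0 ==> u z w = Re (G (cnj z) w - G z w)"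
 using cnj[of z "cnj w"] by (simp add: u_def)

lemma continuous_on_u:
 assumes "continuous_on S f" "continuous_on S g" "!!x. x \<in> S ==> Im (f x) > 0" "!!x. x \<in> S ==> Im (g x) > 0"
 shows "continuous_on S (%x. u (f x) (g x))"
proof -
 have *: "continuous_on S (%x. G (f x) (h x))" if "continuous_on S h" "!!x. x \<in> S ==> Im (h x) ~= 0" for h
 proof -
  have "continuous_on S (%x. (%(z, w). G z w) (f x, h x))"
  proof (rule continuous_on_compose2[OF cont])
   show "continuous_on S (%x. (f x, h x))" using assms(1) that(1) by (rule continuous_on_Pair)
   show "(%x. (f x, h x)) ` S \<subseteq> (- \<real>) \<times> (- \<real>)"
    using assms(3) that(2) by (fastforce simp: complex_is_Real_iff)
  qed
  thus ?thesis by simp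
 qed
 have "continuous_on S (%x. G (f x) (cnj (g x)))" "continuous_on S (%x. G (f x) (g x))"
  by (intro * continuous_on_cnj; use assms in force)+
 thus ?thesis unfolding u_def by (intro continuous_intros)
qed

text \<open>The line at height \<open>ep\<close> is moved to the real axis; the strip of width
  \<open>ep / 2\<close> below it is the room that \<open>poisson_formula_half_plane\<close>
  requires.\<close>

lemma real_poisson_formula:
 fixes h :: "complex => complex"
 assumes h: "h holomorphic_on - \<real>" and C: "!!ze. Im ze \<ge> ep / 2 ==> norm (h ze) <= C" and "ep > 0" "Im z > 0"
  and nn: "!!ze. Im ze > 0 ==> 0 <= Re (h ze)"
 shows "nn_integral lborel (%s. ennreal (Re (h (Complex s ep)) * poisson (Im z) (Re z - s))) = ennreal (pi * Re (h (z + \<i> * ep)))"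
proof -
 let ?g = "%ze. h (ze + \<i> * cor ep)"
 have g: "?g holomorphic_on {ze. Im ze > - (ep / 2)}"
  by (rule holomorphic_on_compose_gen[OF _ h, unfolded o_def]) (use `ep > 0` in \<open>auto intro!: holomorphic_intros simp: complex_is_Real_iff\<close>)
 have gC: "norm (?g ze) <= C" if "Im ze > - (ep / 2)" for ze using that by (intro C) simp
 have s: "cor s + \<i> * cor ep = Complex s ep" for s by (simp add: complex_eq_iff)
 have "continuous_on UNIV (%s. h (cor s + \<i> * cor ep))"
  by (rule continuous_on_compose2[OF holomorphic_on_imp_continuous_on[OF h]])
   (use `ep > 0` in \<open>auto intro!: continuous_intros simp: complex_is_Real_iff\<close>)
 hence [measurable]: "(%s. h (Complex s ep)) \<in> bor" unfolding s by (rule borel_measurable_continuous_onI)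
 have int: "integrable lborel (%s. h (Complex s ep) * cor (poisson (Im z) (Re z - s)))"
  by (rule integrable_bounded_poisson[OF `Im z > 0`, of _ C]) (measurable, rule C, use `ep > 0` in simp)
 have eq: "Re (h (Complex s ep)) * poisson (Im z) (Re z - s) = Re (h (Complex s ep) * cor (poisson (Im z) (Re z - s)))" for s
  by simp
 have "nn_integral lborel (%s. ennreal (Re (h (Complex s ep)) * poisson (Im z) (Re z - s)))
  = ennreal (LINT s|lborel. Re (h (Complex s ep)) * poisson (Im z) (Re z - s))"
 proof (rule nn_integral_eq_integral)
  show "integrable lborel (%s. Re (h (Complex s ep)) * poisson (Im z) (Re z - s))"
   unfolding eq using int by (rule integrable_Re)
  show "AE s in lborel. 0 <= Re (h (Complex s ep)) * poisson (Im z) (Re z - s)" using assms by simp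
 qed
 also have "(LINT s|lborel. Re (h (Complex s ep)) * poisson (Im z) (Re z - s))
  = Re (LINT s|lborel. h (Complex s ep) * cor (poisson (Im z) (Re z - s)))"
  unfolding eq using int by (rule integral_Re)
 also have "(LINT s|lborel. h (Complex s ep) * cor (poisson (Im z) (Re z - s))) = pi * h (z + \<i> * ep)"
  using poisson_formula_half_plane[OF g _ gC `Im z > 0`] `ep > 0` by (simp add: s)
 finally show ?thesis by simp
qed

lemma double_poisson:
 assumes ep: "ep > 0" and z: "Im z > 0" and w: "Im w > 0"
 shows "nn_integral lborel (%s. nn_integral lborel (%t. ennreal (u (Complex s ep) (Complex t ep) * poisson (Im w) (Re w - t))) * ennreal (poisson (Im z) (Re z - s)))
  = ennreal (pi * pi * u (z + \<i> * ep) (w + \<i> * ep))"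
proof -
 have nb: "norm (G a b) <= 2 / ep^2" if "abs (Im a) \<ge> ep" "abs (Im b) \<ge> ep / 2 \<or> abs (Im b) \<ge> ep" for a b
 proof -
  have b: "abs (Im b) \<ge> ep / 2" using that by auto
  have "norm (G a b) <= 1 / (abs (Im a) * abs (Im b))" using ep that by (intro bound) auto
  also have "... <= 1 / (ep * (ep / 2))" using ep that by (intro divide_left_mono mult_mono mult_pos_pos) auto
  finally show ?thesis by (simp add: power2_eq_square)
 qed
 have nb': "norm (G a b) <= 2 / ep^2" if "abs (Im a) \<ge> ep / 2" "abs (Im b) \<ge> ep" for a b
 proof -
  have "norm (G a b) <= 1 / (abs (Im a) * abs (Im b))" using ep that by (intro bound) auto
  also have "... <= 1 / ((ep / 2) * ep)" using ep that by (intro divide_left_mono mult_mono mult_pos_pos) auto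
  finally show ?thesis by (simp add: power2_eq_square)
 qed
 have diff: "norm (a - b) <= 4 / ep^2" if "norm a <= 2 / ep^2" "norm b <= 2 / ep^2" for a b :: complex
  using norm_triangle_ineq4[of a b] that by simp
 have wep: "Im (w + \<i> * ep) > 0" "ep <= abs (Im (w + \<i> * ep))" using w ep by auto
 have inner: "nn_integral lborel (%t. ennreal (u (Complex s ep) (Complex t ep) * poisson (Im w) (Re w - t)))
   = ennreal (pi * u (Complex s ep) (w + \<i> * ep))" for s
 proof -
  let ?h = "%ze. G (cnj (Complex s ep)) ze - G (Complex s ep) ze"
  have re: "Re (?h ze) = u (Complex s ep) ze" if "Im ze > 0" for ze
   using u_alt[of "Complex s ep" ze] that ep by simp
  have "nn_integral lborel (%t. ennreal (Re (?h (Complex t ep)) * poisson (Im w) (Re w - t))) = ennreal (pi * Re (?h (w + \<i> * ep)))"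
  proof (rule real_poisson_formula[OF _ _ ep w])
   show "?h holomorphic_on - \<real>" using ep by (intro holomorphic_intros hol2) auto
   show "norm (?h ze) <= 4 / ep^2" if "ep / 2 <= Im ze" for ze using that by (intro diff nb) auto
   show "0 <= Re (?h ze)" if "Im ze > 0" for ze unfolding re[OF that] using that ep by (intro u_nonneg) auto
  qed
  thus ?thesis using re[of "Complex _ ep"] re[OF wep(1)] ep by simp
 qed
 let ?k = "%ze. G ze (cnj (w + \<i> * ep)) - G ze (w + \<i> * ep)"
 have "nn_integral lborel (%s. ennreal (Re (?k (Complex s ep)) * poisson (Im z) (Re z - s))) = ennreal (pi * Re (?k (z + \<i> * ep)))"
 proof (rule real_poisson_formula[OF _ _ ep z])
  show "?k holomorphic_on - \<real>" using wep by (intro holomorphic_intros hol1) auto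
  show "norm (?k ze) <= 4 / ep^2" if "ep / 2 <= Im ze" for ze using that wep by (intro diff nb') auto
  show "0 <= Re (?k ze)" if "Im ze > 0" for ze by (rule pos[OF that wep(1)])
 qed
 hence k: "nn_integral lborel (%s. ennreal (u (Complex s ep) (w + \<i> * ep) * poisson (Im z) (Re z - s))) = ennreal (pi * u (z + \<i> * ep) (w + \<i> * ep))"
  by (simp only: u_def)
 have [measurable]: "(%s. u (Complex s ep) (w + \<i> * ep)) \<in> bor"
 proof (rule borel_measurable_continuous_onI, rule continuous_on_u)
  have "Complex s ep = cor s + \<i> * ep" for s by (simp add: complex_eq_iff)
  thus "continuous_on UNIV (%s. Complex s ep)" by (simp add: continuous_intros)
 qed (use ep w in auto)
 have "nn_integral lborel (%s. ennreal (pi * u (Complex s ep) (w + \<i> * ep)) * ennreal (poisson (Im z) (Re z - s)))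
  = nn_integral lborel (%s. ennreal pi * ennreal (u (Complex s ep) (w + \<i> * ep) * poisson (Im z) (Re z - s)))"
  using ep z wep u_nonneg[of "Complex _ ep" "w + \<i> * ep"] by (simp add: ennreal_mult[symmetric] mult.assoc)
 also have "... = ennreal pi * ennreal (pi * u (z + \<i> * ep) (w + \<i> * ep))"
  by (subst nn_integral_cmult) (measurable, simp only: k)
 also have "... = ennreal (pi * pi * u (z + \<i> * ep) (w + \<i> * ep))"
  by (simp add: ennreal_mult'[symmetric] mult.assoc)
 finally show ?thesis unfolding inner .
qed

text \<open>What the law sought becomes after convolution with a Poisson kernel of width
  \<open>ep\<close> in each variable. The constant collects one \<open>pi\<close> from each kernel
  and the factor 2 in \<open>u\<close>.\<close>

definition approx :: "real => plane measure" where
 "approx ep = density lborel (%p. ennreal (u (Complex (fst p) ep) (Complex (snd p) ep) / (2 * pi * pi)))"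

lemma sets_approx [simp, measurable_cong]: "sets (approx ep) = sets borel"
 and space_approx [simp]: "space (approx ep) = UNIV" by (auto simp: approx_def)

lemma measurable_u_Complex [measurable]:
 assumes "ep > 0"
 shows "(%p. u (Complex (fst p) ep) (Complex (snd p) ep)) \<in> bor"
proof (rule borel_measurable_continuous_onI, rule continuous_on_u)
 have "Complex s ep = cor s + \<i> * ep" for s by (simp add: complex_eq_iff)
 thus "continuous_on UNIV (%p::plane. Complex (fst p) ep)" "continuous_on UNIV (%p::plane. Complex (snd p) ep)"
  by (auto intro!: continuous_intros)
qed (use assms in auto)

text \<open>The semigroup law of Poisson kernels: successive smoothings add their heights.\<close>

lemma nn_integral_approx:
 assumes ep: "ep > 0" and z: "Im z > 0" and w: "Im w > 0"
 shows "nn_integral (approx ep) (%p. ennreal (poisson (Im z) (Re z - fst p) * poisson (Im w) (Re w - snd p)))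
  = ennreal (u (z + \<i> * ep) (w + \<i> * ep) / 2)"
proof -
 let ?P = "%p :: plane. poisson (Im z) (Re z - fst p) * poisson (Im w) (Re w - snd p)"
 let ?u = "%p. u (Complex (fst p) ep) (Complex (snd p) ep)"
 have mb: "f \<in> borel_measurable (lborel \<Otimes>\<^sub>M lborel)" if "f \<in> bor" for f :: "plane => ennreal"
  using that by (simp add: lborel_prod)
 note [measurable] = measurable_u_Complex[OF ep]
 have pu: "0 <= ?u p" for p using ep by (intro u_nonneg) auto
 have "nn_integral (approx ep) (%p. ennreal (?P p)) = nn_integral lborel (%p. ennreal (?u p / (2 * pi * pi)) * ennreal (?P p))"
  unfolding approx_def by (subst nn_integral_density) measurable
 also have "... = nn_integral lborel (%p. ennreal (1 / (2 * pi * pi)) * ennreal (?u p * ?P p))"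
  using pu z w by (intro nn_integral_cong) (simp add: ennreal_mult[symmetric])
 also have "... = ennreal (1 / (2 * pi * pi)) * nn_integral lborel (%p. ennreal (?u p * ?P p))"
  by (subst nn_integral_cmult) measurable
 also have "nn_integral lborel (%p. ennreal (?u p * ?P p)) = nn_integral (lborel \<Otimes>\<^sub>M lborel) (%p. ennreal (?u p * ?P p))"
  by (simp only: lborel_prod)
 also have "... = nn_integral lborel (%s. \<integral>\<^sup>+t. ennreal (?u (s, t) * ?P (s, t)) \<partial>lborel)"
  by (rule lborel.nn_integral_fst[symmetric]) (rule mb, measurable)
 also have "... = nn_integral lborel (%s. nn_integral lborel (%t. ennreal (u (Complex s ep) (Complex t ep) * poisson (Im w) (Re w - t))) * ennreal (poisson (Im z) (Re z - s)))"
 proof (rule nn_integral_cong)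
  fix s
  have "(%t. ?u (s, t)) \<in> bor"
   by (rule measurable_compose[OF _ measurable_u_Complex[OF ep], of "%t. (s, t)"])
    auto
  hence [measurable]: "(%t. u (Complex s ep) (Complex t ep)) \<in> bor" by simp
  show "nn_integral lborel (%t. ennreal (?u (s, t) * ?P (s, t)))
   = nn_integral lborel (%t. ennreal (u (Complex s ep) (Complex t ep) * poisson (Im w) (Re w - t))) * ennreal (poisson (Im z) (Re z - s))"
   using pu[of "(s, _)"] z w
   by (subst nn_integral_multc[symmetric]) (measurable, auto simp: ennreal_mult[symmetric] mult_ac)
 qed
 also have "... = ennreal (pi * pi * u (z + \<i> * ep) (w + \<i> * ep))" by (rule double_poisson[OF assms])
 finally show ?thesis using u_nonneg[of "z + \<i> * ep" "w + \<i> * ep"] assms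
  by (simp add: ennreal_mult[symmetric])
qed

lemma square_poisson: "n * poisson n (0 - s) = n^2 / (n^2 + s^2)" by (simp add: poisson_def power2_eq_square)

lemma nn_integral_approx_square:
 assumes "ep > 0" "n > 0"
 shows "nn_integral (approx ep) (%p. ennreal (n^2 / (n^2 + (fst p)^2) * (n^2 / (n^2 + (snd p)^2))))
  = ennreal (n^2 * u (Complex 0 (n + ep)) (Complex 0 (n + ep)) / 2)"
proof -
 have "n^2 / (n^2 + s^2) * (n^2 / (n^2 + t^2)) = n^2 * (poisson n (0 - s) * poisson n (0 - t))" for s t
  unfolding square_poisson[symmetric] by (simp add: power2_eq_square)
 hence "nn_integral (approx ep) (%p. ennreal (n^2 / (n^2 + (fst p)^2) * (n^2 / (n^2 + (snd p)^2))))
  = nn_integral (approx ep) (%p. ennreal (n^2) * ennreal (poisson n (0 - fst p) * poisson n (0 - snd p)))"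
  using assms by (simp add: ennreal_mult)
 also have "... = ennreal (n^2) * nn_integral (approx ep) (%p. ennreal (poisson n (0 - fst p) * poisson n (0 - snd p)))"
  by (rule nn_integral_cmult) measurable
 also have "nn_integral (approx ep) (%p. ennreal (poisson n (0 - fst p) * poisson n (0 - snd p))) = ennreal (u (Complex 0 (n + ep)) (Complex 0 (n + ep)) / 2)"
 proof -
  have "Complex 0 n + \<i> * ep = Complex 0 (n + ep)" by (simp add: complex_eq_iff)
  thus ?thesis using nn_integral_approx[of ep "Complex 0 n" "Complex 0 n"] assms by simp
 qed
 finally show ?thesis using assms u_nonneg[of "Complex 0 (n + ep)" "Complex 0 (n + ep)"]
  by (simp add: ennreal_mult[symmetric])
qed

text \<open>The mass that the law sought shows through the windows \<open>y^2 / (y^2 + s^2)\<close>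
  and \<open>y^2 / (y^2 + t^2)\<close>.\<close>

definition ka :: "real => real" where
 "ka y = y^2 * u (Complex 0 y) (Complex 0 y) / 2"

lemma ka_lim: "(ka ---> 1) at_top"
proof -
 have "cnj (Complex 0 y) = Complex 0 (-y)" for y by (simp add: complex_eq_iff)
 thus ?thesis using tendsto_divide[OF mass tendsto_const, of 2] by (simp add: ka_def[abs_def] u_def)
qed

lemma ka_nonneg: "y > 0 ==> 0 <= ka y" by (simp add: ka_def u_nonneg)

lemma approx_eq_ka:
 assumes "ep > 0" "n > 0"
 shows "nn_integral (approx ep) (%p. ennreal (n^2 / (n^2 + (fst p)^2) * (n^2 / (n^2 + (snd p)^2))))
  = ennreal ((n / (n + ep))^2 * ka (n + ep))"
 unfolding nn_integral_approx_square[OF assms] ka_def using assms by (simp add: power_divide)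

text \<open>The windows increase to 1, so by monotone convergence the total mass is a limit of
  values of \<open>ka\<close>.\<close>

lemma approx_law:
 assumes ep: "ep > 0"
 shows "borel_law (approx ep)"
proof -
 have "(%n. \<integral>\<^sup>+p. ennreal ((real (Suc n))^2 / ((real (Suc n))^2 + (fst p)^2) * ((real (Suc n))^2 / ((real (Suc n))^2 + (snd p)^2))) \<partial>approx ep)
  ----> (nn_integral (approx ep) (%p. 1))"
 proof (rule nn_integral_LIMSEQ)
  have mono: "m^2 / (m^2 + s^2) <= n^2 / (n^2 + s^2)" if "0 < m" "m <= n" for m n s :: real
  proof -
   have "m^2 <= n^2" using that by simp
   hence "m^2 * s^2 <= n^2 * s^2" by (intro mult_right_mono) auto
   hence "m^2 * (n^2 + s^2) <= n^2 * (m^2 + s^2)" by (simp add: algebra_simps)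
   moreover have "0 < m^2 + s^2" "0 < n^2 + s^2" using that by (auto intro!: add_pos_nonneg)
   ultimately show ?thesis by (simp add: divide_le_eq le_divide_eq)
  qed
  show "incseq (%n p. ennreal ((real (Suc n))^2 / ((real (Suc n))^2 + (fst p)^2) * ((real (Suc n))^2 / ((real (Suc n))^2 + (snd p)^2))))"
   unfolding incseq_def le_fun_def by (intro allI impI ennreal_leI mult_mono mono) auto
  have lim1: "(%n. (real (Suc n))^2 / ((real (Suc n))^2 + s^2)) ----> 1" for s :: real by real_asymp
  show "(%n. ennreal ((real (Suc n))^2 / ((real (Suc n))^2 + (fst p)^2) * ((real (Suc n))^2 / ((real (Suc n))^2 + (snd p)^2)))) ----> 1" for p :: "plane"
   using tendsto_ennrealI[OF tendsto_mult[OF lim1[of "fst p"] lim1[of "snd p"]]] by simp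
 qed measurable
 moreover have "(%n. ennreal ((real (Suc n) / (real (Suc n) + ep))^2 * ka (real (Suc n) + ep))) ----> ennreal (1^2 * 1)"
 proof (intro tendsto_ennrealI tendsto_mult tendsto_power)
  show "(%n. real (Suc n) / (real (Suc n) + ep)) ----> 1" by real_asymp
  show "(%n. ka (real (Suc n) + ep)) ----> 1" by (rule filterlim_compose[OF ka_lim]) real_asymp
 qed
 moreover have "nn_integral (approx ep) (%p. ennreal ((real (Suc n))^2 / ((real (Suc n))^2 + (fst p)^2) * ((real (Suc n))^2 / ((real (Suc n))^2 + (snd p)^2))))
   = ennreal ((real (Suc n) / (real (Suc n) + ep))^2 * ka (real (Suc n) + ep))" for n
  by (rule approx_eq_ka[OF ep]) simp
 ultimately have "nn_integral (approx ep) (%p. 1) = ennreal (1^2 * 1)" by (simp only: LIMSEQ_unique)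
 hence "emeasure (approx ep) UNIV = 1" by simp
 thus ?thesis unfolding borel_law_def by (intro conjI prob_spaceI) simp_all
qed

text \<open>The mass in a window is \<open>(N / (N + ep))^2 * ka (N + ep)\<close>, and for
  \<open>ep <= 1\<close> both factors are bounded below uniformly. The product of the two windows is
  at most each of them.\<close>

lemma approx_tight:
 assumes "e > 0"
 shows "\<exists>N>0. \<forall>ep. 0 < ep & ep <= 1 --> 1 - e <= (LINT p|(approx ep). N^2 / (N^2 + (fst p)^2)) \<and>
   1 - e <= (LINT p|(approx ep). N^2 / (N^2 + (snd p)^2))"
proof -
 have "eventually (%y. 1 - e / 2 <= ka y) at_top"
  using order_tendstoD(1)[OF ka_lim, of "1 - e / 2"] assms by (auto elim: eventually_mono)
 then obtain Y where Y: "!!y. y \<ge> Y ==> 1 - e / 2 <= ka y" by (auto simp: eventually_at_top_linorder)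
 have "((%N. (N / (N + 1))^2 * (1 - e / 2)) ---> 1 * (1 - e / 2)) at_top"
  by (intro tendsto_mult tendsto_const) real_asymp
 hence "eventually (%N. 1 - e < (N / (N + 1))^2 * (1 - e / 2)) at_top"
  using order_tendstoD(1)[of _ "1 * (1 - e / 2)" at_top "1 - e"] assms by auto
 hence "eventually (%N. 1 - e < (N / (N + 1))^2 * (1 - e / 2) & Y <= N & 0 < N) at_top"
  by (intro eventually_conj eventually_ge_at_top eventually_gt_at_top)
 then obtain N where N: "1 - e < (N / (N + 1))^2 * (1 - e / 2)" "Y <= N" "0 < N"
  by (metis (no_types, lifting) eventually_happens' trivial_limit_at_top_linorder)
 show ?thesis
 proof (intro exI[of _ N] conjI allI impI)
  fix ep :: real assume ep: "0 < ep & ep <= 1"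
  interpret prob_space "approx ep" using approx_law[of ep] ep by (simp add: borel_law_def)
  have b: "0 <= N^2 / (N^2 + s^2)" "N^2 / (N^2 + s^2) <= 1" for s
   using N by (auto simp: divide_le_eq_1 intro: add_pos_nonneg)
  have int: "integrable (approx ep) f" if "f \<in> bor" "!!p. 0 <= f p" "!!p. f p <= 1" for f :: "plane => real"
   using that by (intro integrable_const_bound[of _ 1]) auto
  let ?F = "%p :: plane. N^2 / (N^2 + (fst p)^2) * (N^2 / (N^2 + (snd p)^2))"
  have intF: "integrable (approx ep) ?F"
  proof (rule int)
   show "?F \<in> bor" by measurable
   show "0 <= ?F p" for p by simp
   show "?F p <= 1" for p by (rule mult_le_one[OF b(2) b(1) b(2)])
  qed
  have intx: "integrable (approx ep) (%p. N^2 / (N^2 + (x p)^2))" if "x \<in> bor" for x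
   using that by (intro int b) measurable
  have "(N / (N + 1))^2 * (1 - e / 2) <= (N / (N + 1))^2 * ka (N + ep)" using Y[of "N + ep"] N ep by simp
  also have "... <= (N / (N + ep))^2 * ka (N + ep)"
   using N ep by (intro mult_right_mono power_mono divide_left_mono ka_nonneg) auto
  also have "... = (LINT p|(approx ep). ?F p)"
  proof -
   have "ennreal (LINT p|(approx ep). ?F p) = ennreal ((N / (N + ep))^2 * ka (N + ep))"
    using approx_eq_ka[of ep N] ep N intF by (subst (asm) nn_integral_eq_integral) auto
   thus ?thesis using N ep ka_nonneg[of "N + ep"] by simp
  qed
  finally have F: "1 - e <= (LINT p|(approx ep). ?F p)" using N(1) by linarith
  have "(LINT p|(approx ep). ?F p) <= (LINT p|(approx ep). N^2 / (N^2 + (fst p)^2))"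
  proof (rule integral_mono[OF intF])
   show "integrable (approx ep) (%p. N^2 / (N^2 + (fst p)^2))" by (rule intx) measurable
   show "?F p <= N^2 / (N^2 + (fst p)^2)" for p
    using mult_left_mono[OF b(2)[of "snd p"] b(1)[of "fst p"]] by simp
  qed
  with F show "1 - e <= (LINT p|(approx ep). N^2 / (N^2 + (fst p)^2))" by linarith
  have "(LINT p|(approx ep). ?F p) <= (LINT p|(approx ep). N^2 / (N^2 + (snd p)^2))"
  proof (rule integral_mono[OF intF])
   show "integrable (approx ep) (%p. N^2 / (N^2 + (snd p)^2))" by (rule intx) measurable
   show "?F p <= N^2 / (N^2 + (snd p)^2)" for p
    using mult_right_mono[OF b(2)[of "fst p"] b(1)[of "snd p"]] by simp
  qed
  with F show "1 - e <= (LINT p|(approx ep). N^2 / (N^2 + (snd p)^2))" by linarith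
 qed (use N in simp)
qed

text \<open>The width of the smoothing tends to 0 along a weakly convergent subsequence. Kernels are
  bounded and continuous and \<open>u\<close> is continuous, so the smoothed identity passes to the
  limit.\<close>

lemma law_with_poisson_integrals:
 obtains vv where "borel_law vv"
  "!!z w. Im z > 0 ==> Im w > 0 ==>
   (LINT p|vv. poisson (Im z) (Re z - fst p) * poisson (Im w) (Re w - snd p)) = u z w / 2"
proof -
 define mm where "mm n = approx (1 / real (Suc n))" for n
 have law: "borel_law (mm n)" for n unfolding mm_def by (rule approx_law) simp
 have tight: "\<exists>N>0. \<forall>n. 1 - e <= (LINT p|(mm n). N^2 / (N^2 + (fst p)^2)) \<and>
   1 - e <= (LINT p|(mm n). N^2 / (N^2 + (snd p)^2))" if "e > 0" for e
 proof -
  have "0 < 1 / real (Suc n) & 1 / real (Suc n) <= 1" for n by simp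
  thus ?thesis using approx_tight[OF that] unfolding mm_def by blast
 qed
 obtain r vv
  where r: "strict_mono (r :: nat => nat)" and vv: "borel_law vv"
  and lim: "!!(h :: plane => complex) K. continuous_on UNIV h ==> (!!p. norm (h p) <= K) ==>
   (%n. \<integral>p. h p \<partial>mm (r n)) ----> (LINT p|vv. h p)"
 proof (rule weakly_convergent_subsequence[of mm, OF law tight], assumption)
  fix r vv
  assume "strict_mono (r :: nat => nat)" "borel_law vv"
   and "!!(h :: plane => complex) K. continuous_on UNIV h ==> (!!p. norm (h p) <= K) ==>
    (%n. \<integral>p. h p \<partial>mm (r n)) ----> (LINT p|vv. h p)"
  thus thesis by (rule that)
 qed
 have "(LINT p|vv. poisson (Im z) (Re z - fst p) * poisson (Im w) (Re w - snd p)) = u z w / 2"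
  if zw: "Im z > 0" "Im w > 0" for z w
 proof -
  let ?P = "%p :: plane. poisson (Im z) (Re z - fst p) * poisson (Im w) (Re w - snd p)"
  have nz: "0 < a^2 + b^2" if "a > 0" for a b :: real using that by (intro add_pos_nonneg) auto
  have ple: "0 <= poisson a b" "poisson a b <= 1 / a" if "a > 0" for a b
   using that nz[OF that, of b] by (auto simp: poisson_def frac_le_eq power2_eq_square)
  have P: "0 <= ?P p" "?P p <= 1 / Im z * (1 / Im w)" for p
   by (intro mult_nonneg_nonneg ple zw) (use zw in \<open>intro mult_mono ple; simp\<close>)
  have cont: "continuous_on UNIV ?P" unfolding poisson_def
   by (intro continuous_intros) (use nz[OF zw(1)] nz[OF zw(2)] in \<open>simp_all only: less_numeral_extra less_imp_neq[THEN not_sym] not_False_eq_True ball_UNIV simp_thms\<close>)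
  have "(%n. \<integral>p. cor (?P p) \<partial>mm (r n)) ----> (LINT p|vv. cor (?P p))"
   by (rule lim[where K="1 / Im z * (1 / Im w)"], intro continuous_on_of_real cont) (use P in \<open>simp only: norm_of_real abs_of_nonneg\<close>)
  hence l1: "(%n. \<integral>p. ?P p \<partial>mm (r n)) ----> (LINT p|vv. ?P p)"
   unfolding integral_complex_of_real by (simp only: tendsto_of_real_iff)
  have eq: "(LINT p|(mm n). ?P p) = u (z + \<i> * (1 / real (Suc n))) (w + \<i> * (1 / real (Suc n))) / 2" for n
  proof -
   let ?ep = "1 / real (Suc n)"
   interpret prob_space "approx ?ep" using approx_law[of ?ep] by (simp add: borel_law_def)
   have "?P \<in> borel_measurable (approx ?ep)" by measurable
   hence "integrable (approx ?ep) ?P" using P by (intro integrable_const_bound[of _ "1 / Im z * (1 / Im w)"]) auto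
   hence "ennreal (LINT p|(approx ?ep). ?P p) = ennreal (u (z + \<i> * ?ep) (w + \<i> * ?ep) / 2)"
    using nn_integral_approx[of ?ep z w] zw P by (subst (asm) nn_integral_eq_integral) auto
   moreover have "0 <= u (z + \<i> * ?ep) (w + \<i> * ?ep)" using zw by (intro u_nonneg) (auto simp: add_pos_pos)
   ultimately show ?thesis unfolding mm_def using P by simp
  qed
  have l0: "(%n. 1 / real (Suc n)) ----> 0" by real_asymp
  have "(%e. u (z + \<i> * cor e) (w + \<i> * cor e)) \<midarrow>0\<rightarrow> u (z + \<i> * 0) (w + \<i> * 0)"
  proof -
   have "continuous_on {e. - min (Im z) (Im w) < e} (%e. u (z + \<i> * cor e) (w + \<i> * cor e))"
    by (intro continuous_on_u continuous_intros) auto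
   hence "isCont (%e. u (z + \<i> * cor e) (w + \<i> * cor e)) 0"
    by (rule continuous_on_interior) (use zw in \<open>auto simp: interior_open open_greaterThan[unfolded greaterThan_def]\<close>)
   thus ?thesis by (simp add: isCont_def)
  qed
  hence "isCont (%e. u (z + \<i> * cor e) (w + \<i> * cor e)) 0" by (simp add: isCont_def)
  from isCont_tendsto_compose[OF this l0]
  have "(%n. u (z + \<i> * cor (1 / real (Suc n))) (w + \<i> * cor (1 / real (Suc n)))) ----> u z w" by simp
  from tendsto_divide[OF this tendsto_const, of 2] have "(%n. \<integral>p. ?P p \<partial>mm n) ----> u z w / 2"
   unfolding eq by simp
  from LIMSEQ_subseq_LIMSEQ[OF this r] have "(%n. \<integral>p. ?P p \<partial>mm (r n)) ----> u z w / 2" by (simp add: o_def)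
  with l1 show ?thesis using LIMSEQ_unique by blast
 qed
 with vv that show ?thesis by blast
qed

end

context cauchy2_candidate begin

text \<open>Poisson integrals control only one real part of the difference \<open>D\<close> between
  \<open>G\<close> and the Cauchy transform of the limit law. Holomorphic functions with vanishing
  real part are constant, and the constants vanish because \<open>D\<close> decays away from the
  real axis.\<close>

theorem law_exists:
 obtains vv where "borel_law vv" "!!z w. Im z ~= 0 ==> Im w ~= 0 ==> cauchy_transform2 vv z w = G z w"
proof -
 obtain vv where vv: "borel_law vv" and
  P: "!!z w. Im z > 0 ==> Im w > 0 ==>
   (LINT p|vv. poisson (Im z) (Re z - fst p) * poisson (Im w) (Re w - snd p)) = u z w / 2"
 proof (rule law_with_poisson_integrals)
  fix vv
  assume "borel_law vv" "!!z w. Im z > 0 ==> Im w > 0 ==>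
   (LINT p|vv. poisson (Im z) (Re z - fst p) * poisson (Im w) (Re w - snd p)) = u z w / 2"
  thus thesis by (rule that)
 qed
 have [measurable_cong]: "sets vv = sets borel" and ps: "prob_space vv" using vv by (auto simp: borel_law_def)
 interpret N: prob_space vv by (rule ps)
 have one_le: "1 <= sqrt (1 + x^2) * sqrt (1 + y^2)" for x y :: real
  using mult_mono[of 1 "sqrt (1 + x^2)" 1 "sqrt (1 + y^2)"] by simp
 have ck: "cauchy2_kernel vv (%_. 1) fst snd 1" using one_le
  by (intro cauchy2_kernel.intro) (auto simp: cauchy2_kernel_axioms_def)
 let ?G = "cauchy_transform2 vv"
 have G_eq: "?G z w = cauchy2 vv (%_. 1) fst snd z w" for z w
  by (simp add: cauchy_transform2_def cauchy2_def case_prod_unfold)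
 define D where "D z w = G z w - ?G z w" for z w
 have hol2D: "(%w. D z w) holomorphic_on - \<real>" if "Im z ~= 0" for z
  unfolding D_def G_eq using holomorphic2_imp_holomorphic_snd[OF cauchy2_kernel.cauchy2_holomorphic2[OF ck], of z] that
  by (intro holomorphic_intros hol2) (auto simp: nonreal_iff)
 have hol1D: "(%z. D z w) holomorphic_on - \<real>" if "Im w ~= 0" for w
  unfolding D_def G_eq using holomorphic2_imp_holomorphic_fst[OF cauchy2_kernel.cauchy2_holomorphic2[OF ck], of w] that
  by (intro holomorphic_intros hol1) (auto simp: nonreal_iff)
 have cnjG: "?G (cnj z) (cnj w) = cnj (?G z w)" for z w
  using Bochner_Integration.integral_cnj[of vv "%p. 1 / ((z - cor (fst p)) * (w - cor (snd p)))"]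
  by (simp add: cauchy_transform2_def case_prod_unfold)
 have cnjD: "D (cnj z) (cnj w) = cnj (D z w)" if "Im z ~= 0" "Im w ~= 0" for z w
  using cnj[OF that] cnjG by (simp add: D_def)
 have boundG: "norm (?G z w) <= 1 / (abs (Im z) * abs (Im w))" if "Im z ~= 0" "Im w ~= 0" for z w
 proof -
  have "norm (?G z w) <= (LINT p|vv. norm (1 / ((z - cor (fst p)) * (w - cor (snd p)))))"
   unfolding cauchy_transform2_def by (simp only: case_prod_unfold integral_norm_bound)
  also have "... <= (LINT p|vv. 1 / (abs (Im z) * abs (Im w)))"
  proof (rule integral_mono)
   show "norm (1 / ((z - cor (fst p)) * (w - cor (snd p)))) <= 1 / (abs (Im z) * abs (Im w))" for p :: "plane"
    using that abs_Im_le_dist[of z "fst p"] abs_Im_le_dist[of w "snd p"]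
    by (simp add: norm_divide norm_mult) (intro divide_left_mono mult_mono mult_pos_pos, auto)
  qed (use cauchy2_kernel.integrable_kernel[OF ck that] in auto)
  finally show ?thesis by (simp add: N.prob_space)
 qed
 have boundD: "norm (D z w) <= 2 / (abs (Im z) * abs (Im w))" if "Im z ~= 0" "Im w ~= 0" for z w
  using norm_triangle_ineq4[of "G z w" "?G z w"] boundG[OF that] bound[OF that] by (simp add: D_def)
 have Re0: "Re (D z (cnj w) - D z w) = 0" if zw: "Im z > 0" "Im w > 0" for z w
 proof -
  have i: "integrable vv (%p. 1 / ((z - cor (fst p)) * (w' - cor (snd p))))" if "Im w' ~= 0" for w'
   using cauchy2_kernel.integrable_kernel[OF ck, of z w'] zw that by simp
  have "?G z (cnj w) - ?G z w = (LINT p|vv. 1 / ((z - cor (fst p)) * (cnj w - cor (snd p)))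
    - 1 / ((z - cor (fst p)) * (w - cor (snd p))))"
   using i[of w] i[of "cnj w"] zw unfolding cauchy_transform2_def case_prod_unfold by simp
  hence "Re (?G z (cnj w) - ?G z w) = (LINT p|vv. Re (1 / ((z - cor (fst p)) * (cnj w - cor (snd p)))
    - 1 / ((z - cor (fst p)) * (w - cor (snd p)))))" using i[of w] i[of "cnj w"] zw by simp
  also have "... = 2 * (LINT p|vv. poisson (Im z) (Re z - fst p) * poisson (Im w) (Re w - snd p))"
   by (simp only: Re_kernel_cnj_diff[OF zw] mult.assoc integral_mult_right_zero)
  also have "... = u z w" by (simp add: P[OF zw])
  finally show ?thesis by (simp add: D_def u_def)
 qed
 let ?H = "{z. Im z > 0}"
 have H: "open ?H" "connected ?H" "?H \<subseteq> - \<real>"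
  by (auto simp: open_halfspace_Im_gt complex_is_Real_iff)
 have small: "c = 0" if c: "!!y. y > 0 ==> norm c <= C / y" for c :: complex and C :: real
 proof -
  have "(%n. C / real (Suc n)) ----> 0" using LIMSEQ_Suc[OF lim_const_over_n[of C]] by simp
  hence "norm c <= 0" by (rule LIMSEQ_le_const) (use c in auto)
  thus ?thesis by simp
 qed
 \<comment> \<open>The first variable: \<open>D z (cnj w) - D z w\<close> is holomorphic in
   \<open>z\<close> with real part 0, hence a constant, and its decay makes the constant 0.\<close>
 have step1: "D z (cnj w) = D z w" if zw: "Im z > 0" "Im w > 0" for z w
 proof -
  have const: "D z (cnj w) - D z w = D z' (cnj w) - D z' w" if "Im z' > 0" for z'
  proof (rule holomorphic_Re_zero_imp_constant[where S="?H" and f="%z. D z (cnj w) - D z w"])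
   show "(%z. D z (cnj w) - D z w) holomorphic_on ?H"
    using zw by (intro holomorphic_intros holomorphic_on_subset[OF hol1D H(3)]) auto
  qed (use H Re0 zw that in auto)
  have "D z (cnj w) - D z w = 0"
  proof (rule small)
   fix y :: real assume y: "y > 0"
   have "norm (D z (cnj w) - D z w) <= norm (D (Complex 0 y) (cnj w)) + norm (D (Complex 0 y) w)"
    using const[of "Complex 0 y"] y norm_triangle_ineq4 by simp
   also have "... <= 2 / (y * Im w) + 2 / (y * Im w)"
    using boundD[of "Complex 0 y" "cnj w"] boundD[of "Complex 0 y" w] y zw by (intro add_mono) auto
   also have "... = (4 / Im w) / y" by simp
   finally show "norm (D z (cnj w) - D z w) <= (4 / Im w) / y" .
  qed
  thus ?thesis by simp
 qed
 \<comment> \<open>By the previous step \<open>D z w\<close> is the conjugate of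
   \<open>D (cnj z) w\<close>. Their sum is real and their difference imaginary, while both are
   holomorphic in \<open>w\<close>; so both are constant in \<open>w\<close>, and decay applies
   again.\<close>
 have step2: "D z w = 0" if zw: "Im z > 0" "Im w > 0" for z w
 proof -
  have eq: "D z w' = cnj (D (cnj z) w')" if "Im w' > 0" for w'
   using step1[OF zw(1) that] cnjD[of "cnj z" w'] zw that by simp
  have hz: "(%w. D z w) holomorphic_on ?H" "(%w. D (cnj z) w) holomorphic_on ?H"
   using zw by (auto intro!: holomorphic_on_subset[OF hol2D H(3)])
  have sum: "D z w + D (cnj z) w = D z w' + D (cnj z) w'" if w': "Im w' > 0" for w'
  proof -
   have "\<i> * (D z w + D (cnj z) w) = \<i> * (D z w' + D (cnj z) w')"
   proof (rule holomorphic_Re_zero_imp_constant[where S="?H" and f="%w. \<i> * (D z w + D (cnj z) w)"])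
    show "(%w. \<i> * (D z w + D (cnj z) w)) holomorphic_on ?H" by (intro holomorphic_intros hz)
    show "Re (\<i> * (D z v + D (cnj z) v)) = 0" if "v \<in> ?H" for v using eq[of v] that by simp
   qed (use H zw w' in auto)
   thus ?thesis by simp
  qed
  have diff: "D z w - D (cnj z) w = D z w' - D (cnj z) w'" if w': "Im w' > 0" for w'
  proof (rule holomorphic_Re_zero_imp_constant[where S="?H" and f="%w. D z w - D (cnj z) w"])
   show "(%w. D z w - D (cnj z) w) holomorphic_on ?H" by (intro holomorphic_intros hz)
   show "Re (D z v - D (cnj z) v) = 0" if "v \<in> ?H" for v using eq[of v] that by simp
  qed (use H zw w' in auto)
  show ?thesis
  proof (rule small)
   fix y :: real assume y: "y > 0"
   have "D z w = D z (Complex 0 y)"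
    using sum[of "Complex 0 y"] diff[of "Complex 0 y"] y by (simp add: complex_eq_iff)
   thus "norm (D z w) <= (2 / Im z) / y" using boundD[of z "Complex 0 y"] y zw by simp
  qed
 qed
 have "D z w = 0" if zw: "Im z ~= 0" "Im w ~= 0" for z w
 proof -
  consider "Im z > 0" "Im w > 0" | "Im z > 0" "Im w < 0" | "Im z < 0" "Im w > 0" | "Im z < 0" "Im w < 0" using zw by linarith
  thus ?thesis
  proof cases
   case 2
   thus ?thesis using step1[of z "cnj w"] step2[of z "cnj w"] by simp
  next
   case 3
   thus ?thesis using step1[of "cnj z" w] step2[of "cnj z" w] cnjD[of "cnj z" "cnj w"] by simp
  next
   case 4
   thus ?thesis using step2[of "cnj z" "cnj w"] cnjD[OF zw] by simp
  qed (rule step2)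
 qed
 with vv show ?thesis by (intro that) (auto simp: D_def)
qed

end

section \<open>The free subordination function\<close>

locale nevanlinna_pair =
 fixes ga :: real and si :: "real measure"
 assumes fb: "finite_borel si"
begin

lemma finite_si: "finite_measure si" and sets_si [simp, measurable_cong]: "sets si = sets borel"
 using fb by (auto simp: finite_borel_def)

sublocale finite_measure si by (rule finite_si)

text \<open>The Voiculescu transform of the law sought, that is, its R-transform at
  \<open>1 / ze\<close>.\<close>

definition phi :: "complex => complex" where
 "phi ze = of_real ga + (LINT s|si. (1 + ze * of_real s) / (ze - of_real s))"

text \<open>The quotient \<open>- Im (phi ze) / Im ze\<close>; hence \<open>H\<close> keeps
  \<open>ze\<close> in its half plane exactly where \<open>X ze < 1\<close>.\<close>

definition X :: "complex => real" where
 "X ze = (LINT s|si. (1 + s^2) / (norm (ze - of_real s))^2)"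

definition H :: "complex => complex" where
 "H ze = ze + phi ze"

text \<open>Minus the divided difference of \<open>phi\<close>.\<close>

definition I :: "complex => complex => complex" where
 "I ze ze' = (LINT s|si. of_real (1 + s^2) / ((ze - of_real s) * (ze' - of_real s)))"

lemma integrable_resolvent:
 assumes "Im ze ~= 0"
 shows "integrable si (%s. 1 / (ze - cor s))"
 by (rule integrable_bounded[OF finite_si _ norm_kernel_le[OF assms]]) measurable

lemma phi_integrand_eq:
 assumes "Im ze ~= 0"
 shows "(1 + ze * cor s) / (ze - cor s) = (1 + ze^2) * (1 / (ze - cor s)) - ze"
proof -
 define d where "d = ze - cor s"
 have d: "d ~= 0" and s: "cor s = ze - d" using nonreal_diff_nonzero[OF assms] by (auto simp: d_def)
 have "(1 + ze * (ze - d)) / (ze - (ze - d)) = (1 + ze^2) * (1 / (ze - (ze - d))) - ze"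
  using d by (simp add: field_simps power2_eq_square)
 thus ?thesis unfolding s .
qed

lemma integrable_phi:
 assumes "Im ze ~= 0"
 shows "integrable si (%s. (1 + ze * cor s) / (ze - cor s))" unfolding phi_integrand_eq[OF assms]
 by (intro Bochner_Integration.integrable_diff integrable_mult_right integrable_resolvent assms integrable_const)

lemma phi_alt:
 assumes "Im ze ~= 0"
 shows "phi ze = of_real ga + ((1 + ze^2) * (LINT s|si. 1 / (ze - of_real s)) - ze * of_real (measure si (space si)))"
proof -
 have "(LINT s|si. (1 + ze^2) * (1 / (ze - cor s)) - ze)
   = (LINT s|si. (1 + ze^2) * (1 / (ze - cor s))) - (LINT s|si. ze)"
  by (rule Bochner_Integration.integral_diff[OF integrable_mult_right[OF integrable_resolvent[OF assms]] integrable_const])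
 thus ?thesis unfolding phi_def phi_integrand_eq[OF assms] integral_mult_right_zero
  by (simp add: scaleR_conv_of_real)
qed

lemma phi_holomorphic: "phi holomorphic_on - \<real>"
proof -
 have "(%ze. \<integral>s. 1 / (ze - cor s) \<partial>si) holomorphic_on - \<real>"
  by (rule cauchy_integral_holomorphic[OF finite_si, where K=1]) auto
 hence "(%ze. of_real ga + ((1 + ze^2) * (LINT s|si. 1 / (ze - of_real s)) - ze * of_real (measure si (space si)))) holomorphic_on - \<real>"
  by (intro holomorphic_intros)
 thus ?thesis by (rule holomorphic_transform) (auto simp: phi_alt complex_is_Real_iff)
qed

lemma H_holomorphic: "H holomorphic_on - \<real>"
 unfolding H_def[abs_def] by (intro holomorphic_intros phi_holomorphic)

lemma cnj_phi: "phi (cnj ze) = cnj (phi ze)"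
 using Bochner_Integration.integral_cnj[of si "%s. (1 + ze * of_real s) / (ze - of_real s)"]
 by (simp add: phi_def)

lemma cnj_H: "H (cnj ze) = cnj (H ze)" by (simp add: H_def cnj_phi)

lemma X_bounds:
 assumes "Im ze ~= 0"
 shows "0 <= (1 + s^2) / (norm (ze - of_real s))^2" "(1 + s^2) / (norm (ze - of_real s))^2 <= (kernel_bound ze)^2"
proof -
 show "0 <= (1 + s^2) / (norm (ze - of_real s))^2" by simp
 have "(sqrt (1 + s^2))^2 <= (kernel_bound ze * norm (ze - cor s))^2"
  by (intro power_mono sqrt_le_kernel_bound assms) simp
 thus "(1 + s^2) / (norm (ze - of_real s))^2 <= (kernel_bound ze)^2"
  using nonreal_diff_nonzero[OF assms, of s] by (simp add: power_mult_distrib pos_divide_le_eq)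
qed

lemma integrable_X:
 assumes "Im ze ~= 0"
 shows "integrable si (%s. (1 + s^2) / (norm (ze - of_real s))^2)"
proof (rule integrable_bounded[OF finite_si])
 show "norm ((1 + s^2) / (norm (ze - of_real s))^2) <= (kernel_bound ze)^2" for s
  using X_bounds[OF assms, of s] by simp
qed measurable

lemma X_nonneg: "0 <= X ze" unfolding X_def by simp

lemma X_cnj: "X (cnj ze) = X ze"
proof -
 have "norm (cnj ze - of_real s) = norm (ze - of_real s)" for s
  using complex_mod_cnj[of "ze - of_real s"] by simp
 thus ?thesis by (simp add: X_def)
qed

lemma norm_I_integrand:
 assumes "Im ze ~= 0" "Im ze' ~= 0"
 shows "norm (cor (1 + s^2) / ((ze - of_real s) * (ze' - of_real s)))
  <= ((1 + s^2) / (norm (ze - of_real s))^2 + (1 + s^2) / (norm (ze' - of_real s))^2) / 2"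
proof -
 define a b where "a = 1 / norm (ze - cor s)" and "b = 1 / norm (ze' - cor s)"
 have "0 <= (a - b)^2" by simp
 hence "(1 + s^2) * (a * b) <= (1 + s^2) * ((a^2 + b^2) / 2)"
  by (intro mult_left_mono) (auto simp: power2_eq_square algebra_simps)
 moreover have "norm (cor (1 + s^2)) = 1 + s^2" by (simp only: norm_of_real) simp
 ultimately show ?thesis by (simp add: norm_divide norm_mult a_def b_def power_one_over distrib_left)
qed

lemma integrable_I:
 assumes "Im ze ~= 0" "Im ze' ~= 0"
 shows "integrable si (%s. of_real (1 + s^2) / ((ze - of_real s) * (ze' - of_real s)) :: complex)"
proof (rule Bochner_Integration.integrable_bound)
 show "integrable si (%s. ((1 + s^2) / (norm (ze - of_real s))^2 + (1 + s^2) / (norm (ze' - of_real s))^2) / 2)"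
  by (intro integrable_divide Bochner_Integration.integrable_add integrable_X assms)
 show "AE s in si. norm (cor (1 + s^2) / ((ze - of_real s) * (ze' - of_real s)))
  <= norm (((1 + s^2) / (norm (ze - of_real s))^2 + (1 + s^2) / (norm (ze' - of_real s))^2) / 2)"
  by (intro always_eventually allI order_trans[OF norm_I_integrand[OF assms]]) simp
qed measurable

lemma norm_I_le:
 assumes "Im ze ~= 0" "Im ze' ~= 0"
 shows "norm (I ze ze') <= (X ze + X ze') / 2"
proof -
 have "norm (I ze ze') <= (LINT s|si. norm (cor (1 + s^2) / ((ze - of_real s) * (ze' - of_real s))))"
  unfolding I_def by simp
 also have "... <= (LINT s|si. ((1 + s^2) / (norm (ze - of_real s))^2 + (1 + s^2) / (norm (ze' - of_real s))^2) / 2)"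
  by (intro integral_mono integrable_norm integrable_I assms norm_I_integrand
    integrable_divide Bochner_Integration.integrable_add integrable_X)
 also have "... = (X ze + X ze') / 2"
  unfolding X_def using integrable_X[OF assms(1)] integrable_X[OF assms(2)] by simp
 finally show ?thesis .
qed

lemma phi_diff:
 assumes "Im ze ~= 0" "Im ze' ~= 0"
 shows "phi ze - phi ze' = - (ze - ze') * I ze ze'"
proof -
 have pt: "(1 + ze * cor s) / (ze - of_real s) - (1 + ze' * cor s) / (ze' - of_real s)
   = - (ze - ze') * (of_real (1 + s^2) / ((ze - of_real s) * (ze' - of_real s)))" for s
  using nonreal_diff_nonzero[OF assms(1), of s] nonreal_diff_nonzero[OF assms(2), of s]
  by (simp add: divide_simps) (simp add: algebra_simps power2_eq_square)
 have "phi ze - phi ze' = (LINT s|si. (1 + ze * cor s) / (ze - of_real s) - (1 + ze' * cor s) / (ze' - of_real s))"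
  unfolding phi_def using integrable_phi[OF assms(1)] integrable_phi[OF assms(2)] by simp
 also have "... = - (ze - ze') * I ze ze'" unfolding pt I_def by (rule integral_mult_right_zero)
 finally show ?thesis .
qed

lemma H_diff:
 assumes "Im ze ~= 0" "Im ze' ~= 0"
 shows "H ze - H ze' = (ze - ze') * (1 - I ze ze')"
 using phi_diff[OF assms] by (simp add: H_def algebra_simps)

lemma I_cnj:
 assumes "Im ze ~= 0"
 shows "I ze (cnj ze) = of_real (X ze)"
proof -
 have "of_real (1 + s^2) / ((ze - cor s) * (cnj ze - of_real s)) = cor ((1 + s^2) / (norm (ze - of_real s))^2)" for s
  using complex_norm_square[of "ze - cor s"] by simp
 thus ?thesis unfolding I_def X_def by (simp only: integral_complex_of_real)
qed

lemma Im_H: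
 assumes "Im ze ~= 0"
 shows "Im (H ze) = Im ze * (1 - X ze)"
proof -
 have "H ze - cnj (H ze) = (ze - cnj ze) * (1 - of_real (X ze))"
  using H_diff[of ze "cnj ze"] assms by (simp add: cnj_H I_cnj)
 hence "2 * Im (H ze) = 2 * Im ze * (1 - X ze)" by (simp add: complex_eq_iff)
 thus ?thesis by simp
qed

definition D :: "complex set" where
 "D = {ze. 0 < Im ze * Im (H ze)}"

lemma D_iff: "ze \<in> D \<longleftrightarrow> Im ze ~= 0 & X ze < 1"
proof (cases "Im ze = 0")
 case False
 hence "0 < Im ze * Im ze" by (metis not_real_square_gt_zero)
 hence "0 < Im ze * Im ze * (1 - X ze) \<longleftrightarrow> X ze < 1"
  using zero_less_mult_iff[of "Im ze * Im ze" "1 - X ze"] by linarith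
 with False show ?thesis by (simp add: D_def Im_H mult.assoc)
qed (simp add: D_def)

lemma cnj_D: "cnj ze \<in> D \<longleftrightarrow> ze \<in> D" by (simp add: D_iff X_cnj)

lemma D_nonreal: "ze \<in> D ==> Im ze ~= 0" "ze \<in> D ==> Im (H ze) ~= 0" by (auto simp: D_def)

lemma open_D: "open D"
proof -
 have "continuous_on (- \<real>) (%ze. Im ze * Im (H ze))"
  using holomorphic_on_imp_continuous_on[OF H_holomorphic] by (intro continuous_intros)
 hence "open ({ze. 0 < Im ze * Im (H ze)} \<inter> - \<real>)"
  using continuous_on_open_vimage[OF open_nonreal, THEN iffD1, rule_format, of _ "{0<..}"]
  by (fastforce simp: Int_def)
 moreover have "{ze. 0 < Im ze * Im (H ze)} \<inter> - \<real> = D" by (auto simp: D_def complex_is_Real_iff)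
 ultimately show ?thesis by simp
qed

text \<open>\<open>norm (1 - I ze ze')\<close> is at least the arithmetic mean of
  \<open>1 - X ze\<close> and \<open>1 - X ze'\<close>, hence at least their geometric mean. The
  product form matters because \<open>Im_H\<close> turns each factor into a quotient of imaginary
  parts.\<close>

lemma H_contracts:
 assumes "ze \<in> D" "ze' \<in> D"
 shows "(norm (ze - ze'))^2 * ((1 - X ze) * (1 - X ze')) <= (norm (H ze - H ze'))^2"
proof -
 have nz: "Im ze ~= 0" "Im ze' ~= 0" and a: "0 < 1 - X ze" and b: "0 < 1 - X ze'" using assms by (auto simp: D_iff)
 have "1 - norm (I ze ze') <= norm (1 - I ze ze')" using norm_triangle_ineq2[of 1 "I ze ze'"] by simp
 hence "((1 - X ze) + (1 - X ze')) / 2 <= norm (1 - I ze ze')" using norm_I_le[OF nz] by argo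
 hence "(((1 - X ze) + (1 - X ze')) / 2)^2 <= (norm (1 - I ze ze'))^2" using a b by simp
 moreover have "(1 - X ze) * (1 - X ze') <= (((1 - X ze) + (1 - X ze')) / 2)^2"
  using zero_le_power2[of "X ze - X ze'"] by (simp add: power2_eq_square field_simps)
 ultimately have "(1 - X ze) * (1 - X ze') <= (norm (1 - I ze ze'))^2" by linarith
 hence "(norm (ze - ze'))^2 * ((1 - X ze) * (1 - X ze')) <= (norm (ze - ze'))^2 * (norm (1 - I ze ze'))^2"
  by (intro mult_left_mono) auto
 thus ?thesis by (simp add: H_diff[OF nz] norm_mult power_mult_distrib)
qed

lemma inj_H: "inj_on H D"
proof (rule inj_onI)
 fix ze ze' assume ze: "ze \<in> D" "ze' \<in> D" and eq: "H ze = H ze'"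
 define k where "k = (1 - X ze) * (1 - X ze')"
 have "0 < k" using ze by (auto simp: D_iff k_def)
 moreover have "(norm (ze - ze'))^2 * k <= 0" using H_contracts[OF ze] eq by (simp add: k_def)
 ultimately have "(norm (ze - ze'))^2 <= 0" by (auto simp: mult_le_0_iff)
 thus "ze = ze'" by simp
qed

text \<open>After division by \<open>h\<close> the integrand is at most
  \<open>1 / h^2 + abs s / sqrt (h^2 + s^2)\<close>, which tends to 0 at each \<open>s\<close> and
  is at most 2 for \<open>h >= 1\<close>.\<close>

lemma phi_axis: "((%h. phi (Complex 0 h) / of_real h) ---> 0) at_top"
proof -
 have inv: "((%h. of_real ga / cor h) ---> 0) at_top"
 proof -
  have "((%h. cor (ga / h)) ---> of_real 0) at_top" by (intro tendsto_of_real) real_asymp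
  thus ?thesis by simp
 qed
 have "((%h. \<integral>s. (1 + Complex 0 h * of_real s) / (Complex 0 h - of_real s) / of_real h \<partial>si) ---> (LINT s|si. 0)) at_top"
 proof (rule integral_dominated_convergence_at_top[where w="%_. 2"])
  have le: "norm ((1 + Complex 0 h * of_real s) / (Complex 0 h - of_real s) / of_real h) <= 1 / h^2 + abs s / sqrt (h^2 + s^2)"
   if "h \<ge> 1" for h s :: real
  proof -
   have n: "norm (Complex 0 h - of_real s) = sqrt (h^2 + s^2)" by (simp add: cmod_def add.commute)
   have hn: "h <= sqrt (h^2 + s^2)" by simp
   have nh: "norm (Complex 0 h) = h" using that by (simp add: cmod_def)
   have "norm (1 + Complex 0 h * of_real s) <= 1 + h * abs s"
    using norm_triangle_ineq[of 1 "Complex 0 h * of_real s"] unfolding norm_mult nh by simp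
   hence "norm ((1 + Complex 0 h * of_real s) / (Complex 0 h - of_real s) / of_real h) <= (1 + h * abs s) / (sqrt (h^2 + s^2) * h)"
    unfolding norm_divide n using that by (simp add: divide_right_mono)
   also have "... = 1 / (sqrt (h^2 + s^2) * h) + abs s / sqrt (h^2 + s^2)"
    using that by (simp add: add_divide_distrib)
   also have "1 / (sqrt (h^2 + s^2) * h) <= 1 / h^2"
   proof (rule frac_le)
    show "h^2 <= sqrt (h^2 + s^2) * h" using that hn unfolding power2_eq_square[of h] by simp
   qed (use that in auto)
   finally show ?thesis by simp
  qed
  show "AE s in si. ((%h. (1 + Complex 0 h * of_real s) / (Complex 0 h - of_real s) / of_real h) ---> 0) at_top"
  proof (rule always_eventually, rule allI, rule Lim_null_comparison)
   fix s
   show "eventually (%h. norm ((1 + Complex 0 h * of_real s) / (Complex 0 h - of_real s) / of_real h) <= 1 / h^2 + abs s / sqrt (h^2 + s^2)) at_top"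
    using eventually_ge_at_top[of "1::real"] by eventually_elim (rule le)
   show "((%h. 1 / h^2 + abs s / sqrt (h^2 + s^2)) ---> 0) at_top" by real_asymp
  qed
  show "eventually (%h. AE s in si. norm ((1 + Complex 0 h * of_real s) / (Complex 0 h - of_real s) / of_real h) <= 2) at_top"
   using eventually_ge_at_top[of "1::real"]
  proof eventually_elim
   case (elim h)
   have "1 / h^2 <= 1" using elim by simp
   moreover have "abs s / sqrt (h^2 + s^2) <= 1" for s
   proof -
    have "abs s <= sqrt (h^2 + s^2)" by simp
    moreover have "0 < h^2 + s^2" using elim by (intro add_pos_nonneg) auto
    hence "0 < sqrt (h^2 + s^2)" by simp
    ultimately show ?thesis by simp
   qed
   ultimately have "1 / h^2 + abs s / sqrt (h^2 + s^2) <= 2" for s by (metis add_mono one_add_one)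
   thus ?case by (intro always_eventually allI order_trans[OF le[OF elim]])
  qed
  show "(%s. (1 + Complex 0 t * of_real s) / (Complex 0 t - of_real s) / cor t) \<in> borel_measurable si" for t by measurable
 qed auto
 hence "((%h. of_real ga / cor h + (LINT s|si. (1 + Complex 0 h * of_real s) / (Complex 0 h - of_real s) / of_real h)) ---> 0 + 0) at_top"
  using inv by (intro tendsto_add) auto
 thus ?thesis unfolding phi_def integral_divide_zero by (simp only: add_divide_distrib[symmetric] add_0)
qed

lemma eventually_axis_in_D: "eventually (%h. Complex 0 h \<in> D) at_top"
proof -
 have "eventually (%h. norm (phi (Complex 0 h) / of_real h) < 1) at_top"
  using phi_axis by (simp add: tendsto_iff)
 thus ?thesis using eventually_gt_at_top[of "0::real"]
 proof eventually_elim
  case (elim h)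
  hence "norm (phi (Complex 0 h)) < h" by (simp add: norm_divide)
  hence "0 < Im (H (Complex 0 h))" using abs_Im_le_cmod[of "phi (Complex 0 h)"] by (simp add: H_def)
  thus ?case using elim by (simp add: D_def)
 qed
qed

text \<open>In the upper half plane the image is open by the open mapping theorem, nonempty because
  of the imaginary axis, and relatively closed because preimages of a convergent sequence stay in a
  compact set. Connectedness makes it everything; conjugation handles the lower half plane.\<close>

lemma H_image: "H ` D = - \<real>"
proof -
 let ?U = "{z. 0 < Im z}"
 let ?D = "D \<inter> ?U"
 have oU: "open ?U" "connected ?U" by (auto simp: open_halfspace_Im_gt)
 have sub: "H ` ?D \<subseteq> ?U" by (auto simp: D_def zero_less_mult_iff)
 have oD: "open ?D" using open_D oU by blast
 have hD: "H holomorphic_on ?D"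
  by (rule holomorphic_on_subset[OF H_holomorphic]) (auto simp: complex_is_Real_iff)
 have iD: "inj_on H ?D" by (rule inj_on_subset[OF inj_H]) auto
 have opn: "open (H ` ?D)" by (rule open_mapping_thm3[OF hD oD iD])
 have ne: "H ` ?D ~= {}"
 proof -
  obtain h where "h > 0" "Complex 0 h \<in> D"
   using eventually_happens'[OF trivial_limit_at_top_linorder eventually_conj[OF eventually_axis_in_D eventually_gt_at_top[of 0]]] by blast
  hence "Complex 0 h \<in> ?D" by simp
  thus ?thesis by blast
 qed
 have closed: "z \<in> H ` ?D" if z: "z \<in> ?U" and lim: "\<forall>n. w n \<in> H ` ?D" "w ----> z" for z w
 proof -
  define v where "v n = (SOME u. u \<in> ?D & H u = w n)" for n
  have "v n \<in> ?D & H (v n) = w n" for n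
  proof -
   obtain u where "u \<in> ?D" "w n = H u" using lim(1)[rule_format, of n] by auto
   hence "\<exists>u. u \<in> ?D & H u = w n" by auto
   thus ?thesis unfolding v_def by (rule someI_ex)
  qed
  hence v: "v n \<in> ?D" "H (v n) = w n" for n by simp_all
  define y where "y = Im z / 2"
  have y: "0 < y" using z by (simp add: y_def)
  have "(%n. Im (w n)) ----> Im z" using lim(2) by (rule tendsto_Im)
  hence "eventually (%n. y < Im (w n)) sequentially"
   using z by (intro order_tendstoD(1)[of _ "Im z"]) (auto simp: y_def)
  then obtain m where m: "!!n. n \<ge> m ==> y < Im (w n)" by (auto simp: eventually_sequentially)
  have Xv: "0 < 1 - X (v n)" "Im (w n) = Im (v n) * (1 - X (v n))" "0 < Im (v n)" for n
   using v[of n] Im_H[of "v n"] by (auto simp: D_iff)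
  \<comment> \<open>On the domain \<open>H\<close> only lowers heights, so the preimages stay at
    least as high as the images.\<close>
  have Imv: "y < Im (v n)" if "n \<ge> m" for n
  proof -
   have "Im (v n) * (1 - X (v n)) <= Im (v n) * 1" using Xv[of n] X_nonneg[of "v n"] by simp
   thus ?thesis using m[OF that] Xv(2)[of n] by linarith
  qed
  obtain B where B: "!!n. norm (w n) <= B"
   using lim(2) convergent_imp_Bseq[of w] by (auto simp: convergent_def Bseq_def)
  \<comment> \<open>Since \<open>1 - X (v n) = Im (w n) / Im (v n)\<close>,
    \<open>H_contracts\<close> bounds the squared distance from \<open>v n\<close> to
    \<open>v m\<close> by a multiple of \<open>Im (v n)\<close>; a quadratic quantity below a linear
    one bounds \<open>v n\<close>.\<close>
  define c where "c = (2 * B)^2 * Im (v m) / (y * Im (w m))"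
  have bnd: "(norm (v n - v m))^2 <= c * Im (v n)" if "n \<ge> m" for n
  proof -
   have "(norm (v n - v m))^2 * ((1 - X (v n)) * (1 - X (v m))) <= (norm (w n - w m))^2"
    using H_contracts[of "v n" "v m"] v by auto
   also have "... <= (2 * B)^2"
    using norm_triangle_ineq4[of "w n" "w m"] B[of n] B[of m] by (intro power_mono) auto
   finally have 1: "(norm (v n - v m))^2 * ((1 - X (v n)) * (1 - X (v m))) <= (2 * B)^2" .
   have "(norm (v n - v m))^2 * (y * Im (w m)) <= (norm (v n - v m))^2 * (Im (w n) * Im (w m))"
    using m[OF that] m[of m] y by (intro mult_left_mono mult_right_mono) auto
   also have "... = (norm (v n - v m))^2 * ((1 - X (v n)) * (1 - X (v m))) * (Im (v n) * Im (v m))"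
    by (simp add: Xv(2))
   also have "... <= (2 * B)^2 * (Im (v n) * Im (v m))" using 1 Xv(3) by simp
   finally show ?thesis using y m[of m] by (simp add: c_def pos_le_divide_eq mult_ac)
  qed
  have c0: "0 <= c" using y m[of m] Xv(3)[of m] by (auto simp: c_def)
  have nv: "norm (v n) <= norm (v m) + (c + 1 + norm (v m))" if "n \<ge> m" for n
  proof -
   define r where "r = norm (v n - v m)"
   have "Im (v n) <= norm (v m) + r"
    using abs_Im_le_cmod[of "v n"] norm_triangle_sub[of "v n" "v m"] by (simp add: r_def)
   hence "r^2 <= c * (norm (v m) + r)" using bnd[OF that] c0 by (smt (verit) mult_left_mono r_def)
   hence "r <= c + 1 + norm (v m)"
   proof -
    have False if "r > c + 1 + norm (v m)"
    proof -
     have r0: "0 < r" using that c0 norm_ge_zero[of "v m"] by linarith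
     have "(c + 1 + norm (v m)) * r < r * r" using that r0 by simp
     moreover have "c <= r" using that norm_ge_zero[of "v m"] by linarith
     hence "c * norm (v m) <= norm (v m) * r" using mult_right_mono[of c r "norm (v m)"] by (simp add: mult.commute)
     ultimately show False using `r^2 <= c * (norm (v m) + r)` r0
      by (simp add: power2_eq_square algebra_simps)
    qed
    thus ?thesis by force
   qed
   thus ?thesis using norm_triangle_sub[of "v n" "v m"] by (simp add: r_def)
  qed
  define K where "K = cball 0 (norm (v m) + (c + 1 + norm (v m))) \<inter> {ze. y <= Im ze}"
  have "compact K" unfolding K_def by (intro compact_Int_closed compact_cball closed_halfspace_Im_ge)
  moreover have "\<forall>n. v (n + m) \<in> K" using nv Imv by (auto simp: K_def less_imp_le)
  ultimately obtain l r where l: "l \<in> K" "strict_mono (r :: nat => nat)" "((%n. v (n + m)) \<circ> r) ----> l"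
   unfolding compact_def by metis
  have Iml: "0 < Im l" using l(1) y by (simp add: K_def)
  hence "isCont H l" using holomorphic_on_imp_continuous_on[OF H_holomorphic]
   by (auto simp: continuous_on_eq_continuous_at complex_is_Real_iff)
  from isCont_tendsto_compose[OF this l(3)] have "(%n. w (r n + m)) ----> H l" by (simp add: v(2))
  moreover have "(%n. w (r n + m)) ----> z"
   using LIMSEQ_subseq_LIMSEQ[OF LIMSEQ_ignore_initial_segment[OF lim(2), of m] l(2)] by (simp add: o_def)
  ultimately have "H l = z" using LIMSEQ_unique by blast
  hence "l \<in> ?D" using Iml z by (auto simp: D_def)
  with `H l = z` show ?thesis by blast
 qed
 have "closedin (top_of_set ?U) (H ` ?D)" unfolding closedin_limpt
 proof (intro conjI allI impI sub)
  fix z assume z: "z islimpt H ` ?D & z \<in> ?U"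
  hence "z \<in> closure (H ` ?D)" by (simp add: closure_def)
  then obtain w where "\<forall>n. w n \<in> H ` ?D" "w ----> z" unfolding closure_sequential by blast
  with z show "z \<in> H ` ?D" by (intro closed) simp_all
 qed
 moreover have "openin (top_of_set ?U) (H ` ?D)" using opn sub by (simp add: openin_open_eq[OF oU(1)])
 ultimately have up: "H ` ?D = ?U" using oU(2) ne unfolding connected_clopen by blast
 show ?thesis
 proof
  show "H ` D \<subseteq> - \<real>" by (auto dest: D_nonreal simp: complex_is_Real_iff)
  show "- \<real> \<subseteq> H ` D"
  proof
   fix z :: complex assume "z \<in> - \<real>"
   hence "Im z > 0 \<or> Im (cnj z) > 0" by (auto simp: complex_is_Real_iff)
   thus "z \<in> H ` D"
   proof
    assume "Im z > 0"
    hence "z \<in> H ` ?D" using up by blast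
    thus ?thesis by blast
   next
    assume "Im (cnj z) > 0"
    hence "cnj z \<in> H ` ?D" using up by blast
    then obtain ze where "ze \<in> D" "cnj z = H ze" by blast
    hence "cnj ze \<in> D" "z = H (cnj ze)" by (simp_all add: cnj_D cnj_H) (metis complex_cnj_cnj)
    thus ?thesis by blast
   qed
  qed
 qed
qed

text \<open>The reciprocal Cauchy transform of the marginal law to be constructed.\<close>

definition F :: "complex => complex" where
 "F = inv_into D H"

lemma F_in_D: "Im z ~= 0 ==> F z \<in> D" and H_F: "Im z ~= 0 ==> H (F z) = z"
 using inv_into_into[of z H D] f_inv_into_f[of z H D] H_image by (auto simp: F_def complex_is_Real_iff)

lemma F_H: "ze \<in> D ==> F (H ze) = ze" unfolding F_def by (rule inv_into_f_f[OF inj_H])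

lemma F_cnj: "Im z ~= 0 ==> F (cnj z) = cnj (F z)"
 using F_H[of "cnj (F z)"] F_in_D[of z] H_F[of z] by (simp add: cnj_D cnj_H)

lemma Im_F: "Im z ~= 0 ==> Im z = Im (F z) * (1 - X (F z))" "Im z ~= 0 ==> Im (F z) ~= 0"
 "Im z ~= 0 ==> X (F z) < 1" using F_in_D[of z] H_F[of z] Im_H[of "F z"] by (auto simp: D_iff)

lemma Im_F_pos: "Im z > 0 ==> Im (F z) > 0" using Im_F[of z] by (auto simp: zero_less_mult_iff)

lemma F_holomorphic: "F holomorphic_on - \<real>"
proof -
 have hD: "H holomorphic_on D"
  by (rule holomorphic_on_subset[OF H_holomorphic]) (auto dest: D_nonreal simp: complex_is_Real_iff)
 obtain g where g: "g holomorphic_on H ` D" "!!ze. ze \<in> D ==> g (H ze) = ze"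
  using holomorphic_has_inverse[OF hD open_D inj_H] by metis
 show ?thesis
  by (rule holomorphic_transform[OF g(1)[unfolded H_image]]) (metis H_F F_in_D g(2) nonreal_iff ComplD)
qed

text \<open>\<open>H_contracts\<close> compares \<open>F (\<i> h)\<close> with
  \<open>\<i> h\<close>, whose images under \<open>H\<close> differ by \<open>phi (\<i> h)\<close>.
  With \<open>r\<close> the relative error and \<open>p\<close> the norm of
  \<open>phi (\<i> h) / h\<close> it becomes \<open>r^2 * (1 - p) <= p^2 * (1 + r)\<close>, so
  \<open>r\<close> tends to 0 together with \<open>p\<close>.\<close>

lemma F_axis: "((%h. F (Complex 0 h) / of_real h) ---> \<i>) at_top"
proof -
 define p where "p h = norm (phi (Complex 0 h) / of_real h)" for h :: real
 have p: "(p ---> 0) at_top" unfolding p_def using tendsto_norm[OF phi_axis] by simp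
 have "eventually (%h. p h < 1/2) at_top" by (rule order_tendstoD(2)[OF p]) simp
 hence "eventually (%h. (norm (F (Complex 0 h) / of_real h - \<i>))^2 <= 4 * (p h)^2 + 4 * (p h) ^ 4) at_top"
  using eventually_gt_at_top[of "0::real"] eventually_axis_in_D
 proof eventually_elim
  case (elim h)
  let ?ze = "Complex 0 h"
  define f where "f = F ?ze"
  define r where "r = norm (f / of_real h - \<i>)"
  have f: "f \<in> D" "H f = ?ze" "Im f > 0" "h = Im f * (1 - X f)" "X f < 1"
   using F_in_D[of ?ze] H_F[of ?ze] Im_F_pos[of ?ze] Im_F[of ?ze] elim by (auto simp: f_def)
  have ph: "norm (phi ?ze) = p h * h" using elim by (simp add: p_def norm_divide)
  have X1: "h * (1 - p h) <= h * (1 - X ?ze)"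
  proof -
   have "h * (1 - X ?ze) = h + Im (phi ?ze)" using Im_H[of ?ze] elim by (simp add: H_def)
   moreover have "- (p h * h) <= Im (phi ?ze)" using abs_Im_le_cmod[of "phi ?ze"] ph by linarith
   ultimately show ?thesis by (simp add: algebra_simps)
  qed
  have rh: "norm (f - ?ze) = r * h"
  proof -
   have "f - ?ze = (f / of_real h - \<i>) * of_real h" using elim by (simp add: field_simps complex_eq_iff)
   thus ?thesis using elim by (simp add: r_def norm_mult)
  qed
  have Imf: "Im f <= h * (1 + r)" using abs_Im_le_cmod[of "f - ?ze"] rh by (simp add: algebra_simps)
  have "(norm (f - ?ze))^2 * ((1 - X f) * (1 - X ?ze)) <= (norm (H f - H ?ze))^2"
   by (rule H_contracts[OF f(1) elim(3)])
  also have "norm (H f - H ?ze) = p h * h" unfolding f(2) using ph by (simp add: H_def)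
  finally have "(r * h)^2 * ((1 - X f) * (1 - X ?ze)) <= (p h * h)^2" unfolding rh .
  hence "(r * h)^2 * ((1 - X f) * (1 - X ?ze)) * (Im f * h) <= (p h * h)^2 * (Im f * h)"
   using f(3) elim by simp
  hence "(r * h)^2 * (h * (h * (1 - X ?ze))) <= (p h * h)^2 * (Im f * h)" by (subst f(4)) (simp add: mult_ac)
  moreover have "(r * h)^2 * (h * (h * (1 - p h))) <= (r * h)^2 * (h * (h * (1 - X ?ze)))"
   using X1 elim by (intro mult_left_mono) auto
  moreover have "(p h * h)^2 * (Im f * h) <= (p h * h)^2 * (h * (1 + r) * h)"
   using Imf elim by (intro mult_left_mono mult_right_mono) auto
  ultimately have "(r^2 * (1 - p h)) * (h^2 * h^2) <= ((p h)^2 * (1 + r)) * (h^2 * h^2)"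
   by (simp add: power2_eq_square mult_ac)
  hence "r^2 * (1 - p h) <= (p h)^2 * (1 + r)" using elim by simp
  moreover have "r^2 * (1/2) <= r^2 * (1 - p h)" using elim by (intro mult_left_mono) auto
  ultimately have "r^2 <= 2 * (p h)^2 + 2 * (p h)^2 * r" by (simp add: algebra_simps)
  moreover have "2 * (p h)^2 * r <= r^2 / 2 + 2 * (p h) ^ 4"
   using zero_le_power2[of "r - 2 * (p h)^2"] by (simp add: power2_eq_square power4_eq_xxxx algebra_simps)
  ultimately have "r^2 <= 4 * (p h)^2 + 4 * (p h) ^ 4" by linarith
  thus ?case by (simp add: r_def f_def)
 qed
 note E = this
 have L: "((%h. 4 * (p h)^2 + 4 * (p h) ^ 4) ---> 0) at_top"
 proof -
  have "((%h. 4 * (p h)^2 + 4 * (p h) ^ 4) ---> 4 * 0^2 + 4 * 0 ^ 4) at_top" by (intro tendsto_intros p)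
  thus ?thesis by simp
 qed
 have "((%h. (norm (F (Complex 0 h) / of_real h - \<i>))^2) ---> 0) at_top"
  by (rule tendsto_sandwich[OF _ E tendsto_const L]) simp
 hence "((%h. sqrt ((norm (F (Complex 0 h) / of_real h - \<i>))^2)) ---> sqrt 0) at_top" by simp
 hence "((%h. norm (F (Complex 0 h) / of_real h - \<i>)) ---> 0) at_top" by simp
 hence "((%h. F (Complex 0 h) / of_real h - \<i>) ---> 0) at_top" by (rule tendsto_norm_zero_cancel)
 thus ?thesis by (rule LIM_zero_cancel)
qed

end

section \<open>Algebraic identities behind the positivity of the resolvent\<close>

lemma resolvent_identity:
 fixes z z' w w' d d' e e' k k' :: complex
 assumes "e ~= 0" "e' ~= 0" "w ~= w'" "z ~= z'"
  and k: "k = (w' * e - w * d) / ((w' - w) * e)" "k' = (w * e' - w' * d') / ((w - w') * e')"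
 shows "(1 - k) * (1 - k') + k * k' + k * (1 - k') * (1 - e) + k' * (1 - k) * (1 - e')
   + (z * w * (1 - d) - z * w' * (1 - e) - z' * w * (1 - e') + z' * w' * (1 - d')) / ((z' - z) * (w' - w))
   + k * ((z * (1 - e) - z' * (1 - d')) / (z' - z)) + k' * ((z' * (1 - e') - z * (1 - d)) / (z - z'))
   + (1 - k) * ((w * (1 - e') - w' * (1 - d')) / (w' - w)) + (1 - k') * ((w' * (1 - e) - w * (1 - d)) / (w - w'))
  = (z' * w' * d' + z * w * d - (z' * w / e + z * w' / e') * (d * d')) / ((z' - z) * (w' - w))"
proof -
 have D: "z' - z ~= 0" "w' - w ~= 0" using assms by auto
 \<comment> \<open>\<open>A\<close> and \<open>B\<close> are the numerators of \<open>k\<close> and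
   \<open>k'\<close>; with them the identity becomes polynomial after clearing denominators.\<close>
 define A where "A = k * e * (w' - w)"
 define B where "B = k' * e' * (w' - w)"
 have A: "A = w' * e - w * d" and B: "B = w' * d' - w * e'"
  using assms unfolding A_def B_def k by (simp_all add: field_simps)
 have keq: "k = A / (e * (w' - w))" "k' = B / (e' * (w' - w))" using assms by (simp_all add: A_def B_def)
 have m: "z - z' = - (z' - z)" "w - w' = - (w' - w)" by auto
 show ?thesis unfolding keq m using D assms(1,2) by (simp add: divide_simps A B) (simp add: algebra_simps)
qed

lemma partial_fraction:
 fixes z z' s :: complex
 assumes "z ~= z'" "z - s ~= 0" "z' - s ~= 0"
 shows "s / ((z - s) * (z' - s)) = (z / (z - s) - z' / (z' - s)) / (z' - z)"
 using assms by (simp add: divide_simps) (simp add: algebra_simps)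

text \<open>The quadratic form of the densities in the entries \<open>k * f / (z - s)\<close> and
  \<open>g * ((1 - k) + s / (z - s)) / (w - t)\<close>, expanded into six kernels whose integrals
  are known. Partial fractions remove stray factors \<open>s\<close> and \<open>t\<close>;
  \<open>comp\<close> trades \<open>s\<close> times \<open>B\<close> for \<open>t\<close> times
  \<open>C\<close>, so every mixed term becomes one kernel in \<open>s\<close> times one in
  \<open>t\<close>. The weight \<open>k\<close> is free here; \<open>resolvent_identity\<close>
  fixes it.\<close>

lemma gram_expansion:
 fixes z z' w w' k k' s t f g A B C :: complex
 assumes "z ~= z'" "w ~= w'" "z - s ~= 0" "z' - s ~= 0" "w - t ~= 0" "w' - t ~= 0"
  and comp: "s * g * B = t * f * C"
 defines "Q == C * (f * g) / ((z - s) * (w - t))" and "Q' == C * (f * g) / ((z' - s) * (w' - t))"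
  and "T == C * (f * g) / ((z - s) * (w' - t))" and "T' == C * (f * g) / ((z' - s) * (w - t))"
 shows "A * (k * f / (z - s)) * (k' * f / (z' - s))
   + C * (k * f / (z - s)) * (g * ((1 - k') + s / (z' - s)) / (w' - t))
   + C * (k' * f / (z' - s)) * (g * ((1 - k) + s / (z - s)) / (w - t))
   + B * (g * ((1 - k) + s / (z - s)) / (w - t)) * (g * ((1 - k') + s / (z' - s)) / (w' - t))
  = k * k' * (A * f^2 / ((z - s) * (z' - s))) + (1 - k) * (1 - k') * (B * g^2 / ((w - t) * (w' - t)))
   + (k * (1 - k') + k * z / (z' - z) - (1 - k') * w' / (w' - w) - z * w' / ((z' - z) * (w' - w))) * T
   + (k' * (1 - k) - k' * z' / (z' - z) + (1 - k) * w / (w' - w) - z' * w / ((z' - z) * (w' - w))) * T'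
   + (k' * z / (z' - z) + (1 - k') * w / (w' - w) + z * w / ((z' - z) * (w' - w))) * Q
   + (- k * z' / (z' - z) - (1 - k) * w' / (w' - w) + z' * w' / ((z' - z) * (w' - w))) * Q'"
proof -
 define u u' v v' where uv: "u = 1 / (z - s)" "u' = 1 / (z' - s)" "v = 1 / (w - t)" "v' = 1 / (w' - t)"
 define x y where xy: "x = 1 / (z' - z)" "y = 1 / (w' - w)"
 have su: "s * (u * u') = (z * u - z' * u') * x" using partial_fraction[OF assms(1,3,4)] by (simp add: uv xy)
 have tv: "t * (v * v') = (w * v - w' * v') * y" using partial_fraction[OF assms(2,5,6)] by (simp add: uv xy)
 have "A * (k * f * u) * (k' * f * u')
   + C * (k * f * u) * (g * ((1 - k') + s * u') * v')
   + C * (k' * f * u') * (g * ((1 - k) + s * u) * v)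
   + B * (g * ((1 - k) + s * u) * v) * (g * ((1 - k') + s * u') * v')
  = k * k' * (A * f^2 * (u * u')) + (1 - k) * (1 - k') * (B * g^2 * (v * v'))
   + k * (1 - k') * (C * (f * g) * (u * v')) + k' * (1 - k) * (C * (f * g) * (u' * v))
   + k * (C * (f * g)) * (s * (u * u')) * v' + k' * (C * (f * g)) * (s * (u * u')) * v
   + ((1 - k) * u' + (1 - k') * u) * ((s * g * B) * g) * (v * v')
   + (s * g * B) * g * (s * (u * u')) * (v * v')" by (simp add: algebra_simps power2_eq_square)
 also have "... = k * k' * (A * f^2 * (u * u')) + (1 - k) * (1 - k') * (B * g^2 * (v * v'))
   + k * (1 - k') * (C * (f * g) * (u * v')) + k' * (1 - k) * (C * (f * g) * (u' * v))
   + k * (C * (f * g)) * (s * (u * u')) * v' + k' * (C * (f * g)) * (s * (u * u')) * v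
   + ((1 - k) * u' + (1 - k') * u) * (C * (f * g)) * (t * (v * v'))
   + (C * (f * g)) * (s * (u * u')) * (t * (v * v'))" unfolding comp by simp
 also have "... = k * k' * (A * f^2 * (u * u')) + (1 - k) * (1 - k') * (B * g^2 * (v * v'))
   + (k * (1 - k') + k * z * x - (1 - k') * w' * y - z * w' * (x * y)) * (C * (f * g) * (u * v'))
   + (k' * (1 - k) - k' * z' * x + (1 - k) * w * y - z' * w * (x * y)) * (C * (f * g) * (u' * v))
   + (k' * z * x + (1 - k') * w * y + z * w * (x * y)) * (C * (f * g) * (u * v))
   + (- k * z' * x - (1 - k) * w' * y + z' * w' * (x * y)) * (C * (f * g) * (u' * v'))"
  unfolding su tv by (simp add: algebra_simps)
 finally show ?thesis unfolding Q_def Q'_def T_def T'_def uv xy by simp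
qed

section \<open>The bi-free transform of a Levy triple\<close>

locale levy_data =
 fixes ga1 ga2 :: real and L :: "plane measure" and A B C :: "plane => real"
 assumes ld: "levy_density L A B C"
begin

lemma finite_L: "finite_measure L" and sets_L [simp, measurable_cong]: "sets L = sets borel"
 using ld by (auto simp: levy_density_def finite_borel_def)

sublocale finite_measure L by (rule finite_L)

lemma ABC_measurable [measurable]:
 "A \<in> bor" "B \<in> bor" "C \<in> bor" using ld by (auto simp: levy_density_def)

lemma ABC_bounds: "0 <= A p" "A p <= 1" "0 <= B p" "B p <= 1" "abs (C p) <= 1" "(C p)^2 <= A p * B p"
 using ld unfolding levy_density_def by blast+

lemma compatible: "t * sqrt (1 + s^2) * A (s, t) = s * sqrt (1 + t^2) * C (s, t)"
  "s * sqrt (1 + t^2) * B (s, t) = t * sqrt (1 + s^2) * C (s, t)"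
 using ld unfolding levy_density_def by blast+

lemma finite_borel_dens:
 assumes [measurable]: "d \<in> bor" and d: "!!p. 0 <= d p" "!!p. d p <= 1"
 shows "finite_borel (dens L d)"
proof -
 have "emeasure (dens L d) (space L) = nn_integral L (%p. ennreal (d p) * indicator (space L) p)"
  by (rule emeasure_density[OF _ sets.top]) measurable
 also have "... <= nn_integral L (%p. 1)" using d by (intro nn_integral_mono) auto
 also have "... < \<infinity>"  by (simp add: less_top[symmetric])
 finally show ?thesis by (auto simp: finite_borel_def intro!: finite_measureI)
qed

lemma finite_borel_marginal:
 "finite_borel ro ==> finite_borel (marginal1 ro)" "finite_borel ro ==> finite_borel (marginal2 ro)"
 for ro :: "plane measure" by (auto simp: finite_borel_def marginal1_def marginal2_def
   intro!: finite_measure.finite_measure_distr)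

sublocale N1: nevanlinna_pair ga1 "marginal1 (dens L A)"
 by unfold_locales (intro finite_borel_marginal finite_borel_dens ABC_bounds, measurable)

sublocale N2: nevanlinna_pair ga2 "marginal2 (dens L B)"
 by unfold_locales (intro finite_borel_marginal finite_borel_dens ABC_bounds, measurable)

lemma integral_marginal:
 fixes h :: "real => 'b::{banach, second_countable_topology}"
 assumes [measurable]: "h \<in> bor"
 shows "(LINT s|(marginal1 (dens L A)). h s) = (LINT p|L. A p *\<^sub>R h (fst p))"
  "(LINT s|(marginal2 (dens L B)). h s) = (LINT p|L. B p *\<^sub>R h (snd p))"
 unfolding marginal1_def marginal2_def using ABC_bounds by (subst integral_distr; simp add: integral_density)+

abbreviation X1 :: "complex => real" where "X1 == N1.X"
abbreviation X2 :: "complex => real" where "X2 == N2.X"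

lemma X1_eq: "X1 ze = (LINT p|L. A p * ((1 + (fst p)^2) / (norm (ze - of_real (fst p)))^2))"
 and X2_eq: "X2 om = (LINT p|L. B p * ((1 + (snd p)^2) / (norm (om - of_real (snd p)))^2))"
 unfolding N1.X_def N2.X_def by (subst integral_marginal; simp)+

lemma integrable_X1:
 assumes "Im ze ~= 0"
 shows "integrable L (%p. A p * ((1 + (fst p)^2) / (norm (ze - of_real (fst p)))^2))"
proof (rule integrable_bounded[OF finite_L])
 show "norm (A p * ((1 + (fst p)^2) / (norm (ze - of_real (fst p)))^2)) <= 1 * (kernel_bound ze)^2" for p
  unfolding norm_mult using ABC_bounds(1,2)[of p] N1.X_bounds[OF assms, of "fst p"]
  by (intro mult_mono) (simp_all only: real_norm_def abs_of_nonneg)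
qed measurable

lemma integrable_X2:
 assumes "Im om ~= 0"
 shows "integrable L (%p. B p * ((1 + (snd p)^2) / (norm (om - of_real (snd p)))^2))"
proof (rule integrable_bounded[OF finite_L])
 show "norm (B p * ((1 + (snd p)^2) / (norm (om - of_real (snd p)))^2)) <= 1 * (kernel_bound om)^2" for p
  unfolding norm_mult using ABC_bounds(3,4)[of p] N1.X_bounds[OF assms, of "snd p"]
  by (intro mult_mono) (simp_all only: real_norm_def abs_of_nonneg)
qed measurable

definition c :: "plane => complex" where
 "c p = of_real (C p) * (of_real (sqrt (1 + (fst p)^2)) * of_real (sqrt (1 + (snd p)^2)))"

sublocale K: cauchy2_kernel L c fst snd 1
proof (intro cauchy2_kernel.intro cauchy2_kernel_axioms.intro finite_L)
 show "c \<in> borel_measurable L" unfolding c_def[abs_def] by measurable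
 show "norm (c p) <= 1 * (sqrt (1 + (fst p)^2) * sqrt (1 + (snd p)^2))" for p
 proof -
  have "norm (c p) = abs (C p) * (sqrt (1 + (fst p)^2) * sqrt (1 + (snd p)^2))" by (simp add: c_def norm_mult)
  also have "... <= 1 * (sqrt (1 + (fst p)^2) * sqrt (1 + (snd p)^2))"
   using ABC_bounds(5)[of p] by (intro mult_right_mono) auto
  finally show ?thesis .
 qed
qed measurable

definition q :: "complex => complex => complex" where
 "q ze om = cauchy2 L c fst snd ze om"

lemma q_holomorphic2: "(%(ze, om). q ze om) holomorphic2_on (- \<real>) \<times> (- \<real>)"
 unfolding q_def by (rule K.cauchy2_holomorphic2)

lemma q_cnj: "q (cnj ze) (cnj om) = cnj (q ze om)"
 using Bochner_Integration.integral_cnj[of L "%p. c p / ((ze - of_real (fst p)) * (om - of_real (snd p)))"]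
 by (simp add: q_def cauchy2_def c_def)

text \<open>The arithmetic-geometric mean inequality for \<open>A p * x^2\<close> and
  \<open>B p * y^2\<close>, by way of \<open>C^2 <= A B\<close>.\<close>

lemma abs_C_le: "2 * abs (C p) * (x * y) <= A p * x^2 + B p * y^2" if "0 <= x" "0 <= y"
proof (rule power2_le_imp_le)
 have "(2 * abs (C p) * (x * y))^2 = 4 * (C p)^2 * (x * y)^2" by (simp add: power_mult_distrib)
 also have "... <= 4 * (A p * B p) * (x * y)^2" using ABC_bounds(6)[of p] by (intro mult_right_mono mult_left_mono) auto
 also have "... <= (A p * x^2 + B p * y^2)^2"
  using zero_le_power2[of "A p * x^2 - B p * y^2"] by (simp add: power2_eq_square algebra_simps)
 finally show "(2 * abs (C p) * (x * y))^2 <= (A p * x^2 + B p * y^2)^2" .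
 show "0 <= A p * x^2 + B p * y^2" using ABC_bounds(1,3)[of p] by auto
qed

text \<open>The parameter \<open>r\<close> moves weight between the variables: \<open>r = 1\<close>
  gives norm below 1 where both \<open>X1\<close> and \<open>X2\<close> are below 1, while a small
  or a large \<open>r\<close> makes \<open>q\<close> vanish when only one of them tends to
  0.\<close>

lemma norm_q_le:
 assumes nz: "Im ze ~= 0" "Im om ~= 0" and r: "r > 0"
 shows "norm (q ze om) <= (r * X1 ze + X2 om / r) / 2"
proof -
 let ?a = "%p. A p * ((1 + (fst p)^2) / (norm (ze - of_real (fst p)))^2)"
 let ?b = "%p. B p * ((1 + (snd p)^2) / (norm (om - of_real (snd p)))^2)"
 have pt: "norm (c p / ((ze - of_real (fst p)) * (om - of_real (snd p)))) <= (r * ?a p + ?b p / r) / 2" for p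
 proof -
  define x where "x = sqrt r * (sqrt (1 + (fst p)^2) / norm (ze - of_real (fst p)))"
  define y where "y = (sqrt (1 + (snd p)^2) / norm (om - of_real (snd p))) / sqrt r"
  have x2: "x^2 = r * ((1 + (fst p)^2) / (norm (ze - of_real (fst p)))^2)"
   and y2: "y^2 = (1 + (snd p)^2) / (norm (om - of_real (snd p)))^2 / r"
   using r by (simp_all add: x_def y_def power_mult_distrib power_divide)
  have "2 * norm (c p / ((ze - of_real (fst p)) * (om - of_real (snd p)))) = 2 * abs (C p) * (x * y)"
   using r by (simp add: c_def x_def y_def norm_mult norm_divide)
  also have "... <= A p * x^2 + B p * y^2" using r by (intro abs_C_le) (auto simp: x_def y_def)
  finally show ?thesis by (simp add: x2 y2 mult_ac)
 qed
 have ia: "integrable L (%p. r * ?a p)" by (rule integrable_mult_right) (rule integrable_X1[OF nz(1)])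
 have ib: "integrable L (%p. ?b p / r)" by (rule integrable_divide) (rule integrable_X2[OF nz(2)])
 have i: "integrable L (%p. (r * ?a p + ?b p / r) / 2)"
  by (rule integrable_divide) (rule Bochner_Integration.integrable_add[OF ia ib])
 have "norm (q ze om) <= (LINT p|L. norm (c p / ((ze - of_real (fst p)) * (om - of_real (snd p)))))"
  unfolding q_def cauchy2_def by simp
 also have "... <= (LINT p|L. (r * ?a p + ?b p / r) / 2)"
  using K.integrable_kernel[OF nz] i pt by (intro integral_mono integrable_norm)
 also have "... = ((LINT p|L. r * ?a p) + (LINT p|L. ?b p / r)) / 2"
  using Bochner_Integration.integral_add[OF ia ib] by simp
 also have "... = (r * X1 ze + X2 om / r) / 2"
  by (simp only: X1_eq X2_eq integral_divide_zero integral_mult_right_zero)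
 finally show ?thesis .
qed

lemma norm_q_less_1:
 assumes "Im ze ~= 0" "Im om ~= 0" "X1 ze < 1" "X2 om < 1"
 shows "norm (q ze om) < 1" "1 - q ze om ~= 0"
proof -
 show *: "norm (q ze om) < 1" using norm_q_le[OF assms(1,2), of 1] assms(3,4) by simp
 thus "1 - q ze om ~= 0" by auto
qed

lemma gram_nonneg:
 fixes a b :: complex
 shows "0 <= Re (of_real (A p) * a * cnj a + of_real (C p) * a * cnj b + of_real (C p) * cnj a * b + of_real (B p) * b * cnj b)"
proof -
 have aa: "a * cnj a = of_real ((norm a)^2)" "b * cnj b = of_real ((norm b)^2)"
  by (simp_all only: complex_norm_square)
 have "of_real (A p) * a * cnj a + of_real (C p) * a * cnj b + of_real (C p) * cnj a * b + of_real (B p) * b * cnj b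
  = of_real (A p) * (a * cnj a) + of_real (C p) * (a * cnj b + cnj (a * cnj b)) + of_real (B p) * (b * cnj b)"
  by (simp add: algebra_simps)
 also have "Re ... = A p * (norm a)^2 + 2 * C p * Re (a * cnj b) + B p * (norm b)^2" unfolding aa by simp
 finally have eq: "Re (of_real (A p) * a * cnj a + of_real (C p) * a * cnj b + of_real (C p) * cnj a * b + of_real (B p) * b * cnj b)
  = A p * (norm a)^2 + 2 * C p * Re (a * cnj b) + B p * (norm b)^2" .
 have "abs (2 * C p * Re (a * cnj b)) = 2 * abs (C p) * abs (Re (a * cnj b))" by (simp add: abs_mult)
 also have "... <= 2 * abs (C p) * (norm a * norm b)"
  using abs_Re_le_cmod[of "a * cnj b"] by (intro mult_left_mono) (auto simp: norm_mult)
 also have "... <= A p * (norm a)^2 + B p * (norm b)^2" by (rule abs_C_le) auto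
 finally show ?thesis unfolding eq by linarith
qed

lemma integral_comb6:
 fixes T1 T2 R1 R2 R3 R4 :: "plane => complex"
 assumes "integrable L T1" "integrable L T2" "integrable L R1" "integrable L R2" "integrable L R3" "integrable L R4"
 shows "(LINT p|L. c1 * T1 p + c2 * T2 p + c3 * R1 p + c4 * R2 p + c5 * R3 p + c6 * R4 p)
  = c1 * (LINT p|L. T1 p) + c2 * (LINT p|L. T2 p) + c3 * (LINT p|L. R1 p) + c4 * (LINT p|L. R2 p)
   + c5 * (LINT p|L. R3 p) + c6 * (LINT p|L. R4 p)"
  "integrable L (%p. c1 * T1 p + c2 * T2 p + c3 * R1 p + c4 * R2 p + c5 * R3 p + c6 * R4 p)"
 using assms by simp_all

text \<open>In the Fock space model behind this identity the two faces act as commuting operators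
 with resolvents \<open>r\<^sub>1 = (z - a)\<^sup>-\<^sup>1\<close> and \<open>r\<^sub>2 = (w - b)\<^sup>-\<^sup>1\<close>, and the real part below is a positive
 multiple of the squared norm of \<open>r\<^sub>1 r\<^sub>2\<close> applied to the vacuum vector.\<close>

lemma resolvent_positivity:
 assumes ze: "0 < Im ze" "X1 ze < 1" and om: "0 < Im om" "X2 om < 1"
 shows "0 <= Re (1 / (ze * cnj om * (1 - q ze (cnj om))) - 1 / (ze * om * (1 - q ze om)))"
proof -
 have nz: "Im ze ~= 0" "Im om ~= 0" "Im (cnj ze) ~= 0" "Im (cnj om) ~= 0" using assms by auto
 define d e where "d = 1 - q ze om" and "e = 1 - q ze (cnj om)"
 have d: "d ~= 0" and e: "e ~= 0"
  using norm_q_less_1[of ze om] norm_q_less_1[of ze "cnj om"] assms by (auto simp: d_def e_def N2.X_cnj)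
 have qs: "q ze om = 1 - d" "q ze (cnj om) = 1 - e" "q (cnj ze) (cnj om) = 1 - cnj d" "q (cnj ze) om = 1 - cnj e"
  using q_cnj[of ze om] q_cnj[of ze "cnj om"] by (simp_all add: d_def e_def)
 \<comment> \<open>The value of the free weight for which the expansion collapses in
   \<open>resolvent_identity\<close>.\<close>
 define k where "k = (cnj om * e - om * d) / ((cnj om - om) * e)"
 have k': "cnj k = (om * cnj e - cnj om * cnj d) / ((om - cnj om) * cnj e)" by (simp add: k_def)
 have neq: "om ~= cnj om" "ze ~= cnj ze" using assms by (auto simp: complex_eq_iff)
 let ?f = "%p :: plane. cor (sqrt (1 + (fst p)^2))"
 let ?g = "%p :: plane. cor (sqrt (1 + (snd p)^2))"
 let ?s = "%p :: plane. cor (fst p)" and ?t = "%p :: plane. cor (snd p)"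
 let ?T1 = "%p. cor (A p) * (?f p)^2 / ((ze - ?s p) * (cnj ze - ?s p))"
 let ?T2 = "%p. cor (B p) * (?g p)^2 / ((om - ?t p) * (cnj om - ?t p))"
 let ?R = "%ze om p. cor (C p) * (?f p * ?g p) / ((ze - ?s p) * (om - ?t p))"
 have sqf: "(?f p)^2 = cor (1 + (fst p)^2)" "(?g p)^2 = cor (1 + (snd p)^2)" for p
  by (simp_all only: of_real_power[symmetric] real_sqrt_pow2 add_nonneg_nonneg zero_le_one zero_le_power2)
 have den: "(xx - cor x) * (cnj xx - cor x) = cor ((norm (xx - of_real x))^2)" for xx x
  using complex_norm_square[of "xx - cor x"] by simp
 have T1: "?T1 = (%p. cor (A p * ((1 + (fst p)^2) / (norm (ze - of_real (fst p)))^2)))"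
  and T2: "?T2 = (%p. cor (B p * ((1 + (snd p)^2) / (norm (om - of_real (snd p)))^2)))"
  unfolding sqf den by auto
 have iT1: "integrable L ?T1" unfolding T1 complex_of_real_integrable_eq by (rule integrable_X1[OF nz(1)])
 have iT2: "integrable L ?T2" unfolding T2 complex_of_real_integrable_eq by (rule integrable_X2[OF nz(2)])
 have IT1: "(LINT p|L. ?T1 p) = of_real (X1 ze)" unfolding T1 integral_complex_of_real X1_eq ..
 have IT2: "(LINT p|L. ?T2 p) = of_real (X2 om)" unfolding T2 integral_complex_of_real X2_eq ..
 have iR: "integrable L (?R a b)" if "Im a ~= 0" "Im b ~= 0" for a b
  using K.integrable_kernel[OF that] by (simp add: c_def)
 have IR: "(LINT p|L. ?R a b p) = q a b" for a b by (simp add: q_def cauchy2_def c_def)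
 let ?a = "%p. k * ?f p / (ze - ?s p)" and ?b = "%p. ?g p * ((1 - k) + ?s p / (ze - ?s p)) / (om - ?t p)"
 let ?x = "1 / (cnj ze - ze)" and ?y = "1 / (cnj om - om)"
 define c3 where "c3 = k * (1 - cnj k) + k * ze / (cnj ze - ze) - (1 - cnj k) * cnj om / (cnj om - om) - ze * cnj om / ((cnj ze - ze) * (cnj om - om))"
 define c4 where "c4 = cnj k * (1 - k) - cnj k * cnj ze / (cnj ze - ze) + (1 - k) * om / (cnj om - om) - cnj ze * om / ((cnj ze - ze) * (cnj om - om))"
 define c5 where "c5 = cnj k * ze / (cnj ze - ze) + (1 - cnj k) * om / (cnj om - om) + ze * om / ((cnj ze - ze) * (cnj om - om))"
 define c6 where "c6 = - k * cnj ze / (cnj ze - ze) - (1 - k) * cnj om / (cnj om - om) + cnj ze * cnj om / ((cnj ze - ze) * (cnj om - om))"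
 define V where "V p = k * cnj k * ?T1 p + (1 - k) * (1 - cnj k) * ?T2 p + c3 * ?R ze (cnj om) p + c4 * ?R (cnj ze) om p
   + c5 * ?R ze om p + c6 * ?R (cnj ze) (cnj om) p" for p
 have V_eq: "V p = of_real (A p) * ?a p * cnj (?a p) + of_real (C p) * ?a p * cnj (?b p) + of_real (C p) * cnj (?a p) * ?b p
   + of_real (B p) * ?b p * cnj (?b p)" for p
 proof -
  have "cor (fst p * sqrt (1 + (snd p)^2) * B p) = of_real (snd p * sqrt (1 + (fst p)^2) * C p)"
   using compatible(2)[of "fst p" "snd p"] by simp
  hence "?s p * ?g p * of_real (B p) = ?t p * ?f p * of_real (C p)" by simp
  note comp = this
  have c: "cnj (?a p) = cnj k * ?f p / (cnj ze - ?s p)" "cnj (?b p) = ?g p * ((1 - cnj k) + ?s p / (cnj ze - ?s p)) / (cnj om - ?t p)"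
   by simp_all
  show ?thesis unfolding V_def c3_def c4_def c5_def c6_def c
   by (rule gram_expansion[where z=ze and z'="cnj ze" and w=om and w'="cnj om" and k=k and k'="cnj k" and A="of_real (A p)", OF neq(2,1) _ _ _ _ comp, symmetric])
    (intro nonreal_diff_nonzero nz)+
 qed
 have "0 <= Re (V p)" for p unfolding V_eq by (rule gram_nonneg)
 moreover have "integrable L V" unfolding V_def[abs_def] by (intro integral_comb6(2) iT1 iT2 iR nz)
 ultimately have V0: "0 <= Re (LINT p|L. V p)"
  using Bochner_Integration.integral_nonneg[of L "%p. Re (V p)"] by simp
 have IV: "(LINT p|L. V p) = k * cnj k * of_real (X1 ze) + (1 - k) * (1 - cnj k) * of_real (X2 om)
   + c3 * (1 - e) + c4 * (1 - cnj e) + c5 * (1 - d) + c6 * (1 - cnj d)"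
  unfolding V_def integral_comb6(1)[OF iT1 iT2 iR[OF nz(1,4)] iR[OF nz(3,2)] iR[OF nz(1,2)] iR[OF nz(3,4)]] IT1 IT2 IR qs ..
 \<comment> \<open>Three terms with nonnegative real part. The two squares are weighted so that
   \<open>X1 ze\<close> and \<open>X2 om\<close>, which the integral of \<open>V\<close>
   contributes, cancel.\<close>
 define S where "S = (1 - of_real (X2 om)) * ((1 - k) * (1 - cnj k)) + (LINT p|L. V p) + (1 - of_real (X1 ze)) * (k * cnj k)"
 have nonneg: "0 <= Re ((1 - of_real x) * (u * cnj u))" if "x < 1" for x u
 proof -
  have "(1 - cor x) * (u * cnj u) = of_real ((1 - x) * (norm u)^2)"
   by (simp only: complex_norm_square[symmetric]) simp
  thus ?thesis using that by simp
 qed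
 have S0: "0 <= Re S" using V0 nonneg[OF om(2), of "1 - k"] nonneg[OF ze(2), of k] by (simp add: S_def)
 have "S = (cnj ze * cnj om * cnj d + ze * om * d - (cnj ze * om / e + ze * cnj om / cnj e) * (d * cnj d)) / ((cnj ze - ze) * (cnj om - om))"
 proof -
  have m: "ze - cnj ze = - (cnj ze - ze)" "om - cnj om = - (cnj om - om)" by auto
  have e': "cnj e ~= 0" using e by simp
  have "S = (1 - k) * (1 - cnj k) + k * cnj k + c3 * (1 - e) + c4 * (1 - cnj e) + c5 * (1 - d) + c6 * (1 - cnj d)"
   unfolding S_def IV by (simp add: algebra_simps)
  also have "... = (1 - k) * (1 - cnj k) + k * cnj k + k * (1 - cnj k) * (1 - e) + cnj k * (1 - k) * (1 - cnj e)
   + (ze * om * (1 - d) - ze * cnj om * (1 - e) - cnj ze * om * (1 - cnj e) + cnj ze * cnj om * (1 - cnj d)) / ((cnj ze - ze) * (cnj om - om))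
   + k * ((ze * (1 - e) - cnj ze * (1 - cnj d)) / (cnj ze - ze)) + cnj k * ((cnj ze * (1 - cnj e) - ze * (1 - d)) / (ze - cnj ze))
   + (1 - k) * ((om * (1 - cnj e) - cnj om * (1 - cnj d)) / (cnj om - om)) + (1 - cnj k) * ((cnj om * (1 - e) - om * (1 - d)) / (om - cnj om))"
  proof -
   define x y where "x = 1 / (cnj ze - ze)" and "y = 1 / (cnj om - om)"
   have dv: "a / (cnj ze - ze) = a * x" "a / (cnj om - om) = a * y" "a / ((cnj ze - ze) * (cnj om - om)) = a * (x * y)"
    "a / (ze - cnj ze) = - (a * x)" "a / (om - cnj om) = - (a * y)" for a
    unfolding m divide_minus_right by (simp_all only: x_def y_def times_divide_eq_right mult_1_right) simp_all
   show ?thesis unfolding c3_def c4_def c5_def c6_def dv by (simp add: algebra_simps)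
  qed
  also have "... = (cnj ze * cnj om * cnj d + ze * om * d - (cnj ze * om / e + ze * cnj om / cnj e) * (d * cnj d)) / ((cnj ze - ze) * (cnj om - om))"
   by (rule resolvent_identity[OF e e' neq k_def k'])
  finally show ?thesis .
 qed
 \<comment> \<open>\<open>S\<close> is real: after the positive factor is split off, what remains is
   the quantity under consideration plus its conjugate.\<close>
 also have "... = of_real ((norm (ze * om * d))^2 / (4 * Im ze * Im om)) * ((1 / (ze * cnj om * e) - 1 / (ze * om * d)) + cnj (1 / (ze * cnj om * e) - 1 / (ze * om * d)))"
 proof -
  have den4: "(cnj ze - ze) * (cnj om - om) = - of_real (4 * Im ze * Im om)" by (simp add: complex_eq_iff)
  have z0: "ze ~= 0" "om ~= 0" "cnj ze ~= 0" "cnj om ~= 0" "cnj d ~= 0" "cnj e ~= 0" using assms d e by auto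
  have I0: "cor (4 * Im ze * Im om) ~= 0" using assms by simp
  have nn: "cor ((norm (ze * om * d))^2) = (ze * om * d) * (cnj ze * cnj om * cnj d)"
   by (simp only: complex_norm_square complex_cnj_mult)
  show ?thesis unfolding den4 of_real_divide nn complex_cnj_mult complex_cnj_one complex_cnj_cnj
   using z0 d e I0 by (simp add: divide_simps) (simp add: algebra_simps)
 qed
 also have "... = of_real ((norm (ze * om * d))^2 / (4 * Im ze * Im om)) * of_real (2 * Re (1 / (ze * cnj om * e) - 1 / (ze * om * d)))"
  by (simp only: complex_add_cnj)
 finally have "Re S = (norm (ze * om * d))^2 / (4 * Im ze * Im om) * (2 * Re (1 / (ze * cnj om * e) - 1 / (ze * om * d)))"
  by simp
 moreover have "0 < (norm (ze * om * d))^2 / (4 * Im ze * Im om)"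
  using assms d by (intro divide_pos_pos mult_pos_pos zero_less_power) auto
 ultimately have "0 <= 2 * Re (1 / (ze * cnj om * e) - 1 / (ze * om * d))"
  using S0 by (simp only: zero_le_mult_iff) linarith
 thus ?thesis by (simp only: d_def e_def zero_le_mult_iff) simp
qed

end

section \<open>Stolz domains and the one-dimensional R-transform\<close>

lemma stolz_domain_iff: "z \<in> stolz_domain al be \<longleftrightarrow> Im z ~= 0 & abs (Re z) < al * abs (Im z) & abs (Im z) < be"
proof -
 have "z \<in> cnj ` stolz_angle al be \<longleftrightarrow> cnj z \<in> stolz_angle al be" by (metis complex_cnj_cnj imageE imageI)
 thus ?thesis by (auto simp: stolz_domain_def stolz_angle_def abs_if)
qed

lemma stolz_domain_mono: "be <= be' ==> stolz_domain al be \<subseteq> stolz_domain al be'"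
 by (auto simp: stolz_domain_iff)

lemma stolz_domain_nonreal: "z \<in> stolz_domain al be ==> Im z ~= 0" "stolz_domain al be \<subseteq> - \<real>"
 by (auto simp: stolz_domain_iff complex_is_Real_iff)

lemma norm_stolz_domain_le:
 assumes "z \<in> stolz_domain al be"
 shows "norm z <= sqrt (1 + al^2) * abs (Im z)"
proof -
 have "(Re z)^2 <= (al * abs (Im z))^2" using assms by (intro power2_le_iff_abs_le[THEN iffD2]) (auto simp: stolz_domain_iff)
 hence "(norm z)^2 <= (1 + al^2) * (Im z)^2" by (simp add: cmod_power2 algebra_simps)
 hence "sqrt ((norm z)^2) <= sqrt ((1 + al^2) * (Im z)^2)" by (rule real_sqrt_le_mono)
 thus ?thesis by (simp add: real_sqrt_mult)
qed

text \<open>\<open>cnj z * (1 - z * s)\<close> has imaginary part \<open>- Im z\<close>, because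
  \<open>cnj z * z * s\<close> is real, and in the Stolz domain \<open>norm z\<close> is comparable
  to \<open>abs (Im z)\<close>. This uniform bound dominates integrals as \<open>z\<close> tends to
  0 nontangentially.\<close>

lemma stolz_denominator:
 assumes "z \<in> stolz_domain al be"
 shows "1 <= sqrt (1 + al^2) * norm (1 - z * cor s)"
proof -
 have "abs (Im z) <= norm (cnj z * (1 - z * cor s))"
  using abs_Im_le_cmod[of "cnj z * (1 - z * cor s)"] by (simp add: algebra_simps)
 also have "... <= sqrt (1 + al^2) * abs (Im z) * norm (1 - z * cor s)"
  unfolding norm_mult using norm_stolz_domain_le[OF assms] by (intro mult_right_mono) auto
 finally have "abs (Im z) * 1 <= abs (Im z) * (sqrt (1 + al^2) * norm (1 - z * cor s))" by (simp add: mult_ac)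
 thus ?thesis using stolz_domain_nonreal(1)[OF assms] by simp
qed

lemma nonreal_1_minus_mult [simp]: "Im z ~= 0 ==> 1 - z * cor s ~= 0" by (auto simp: complex_eq_iff)

lemma Im_one_divide_iff [simp]: "Im (1 / z) = 0 \<longleftrightarrow> Im z = 0"
proof -
 have "Im (1 / z) = - Im z / (norm z)^2" by (simp add: Im_divide cmod_power2)
 thus ?thesis by auto
qed

lemma inverse_holomorphic_nonreal:
 assumes "f holomorphic_on - \<real>"
 shows "(%z. f (1 / z)) holomorphic_on - \<real>"
proof -
 have "(%z. 1 / z) holomorphic_on - \<real>" by (intro holomorphic_intros) auto
 moreover have "(%z. 1 / z) ` (- \<real>) \<subseteq> - (\<real> :: complex set)" by (auto simp: complex_is_Real_iff)
 ultimately show ?thesis using holomorphic_on_compose_gen[of "%z. 1 / z" _ f, OF _ assms] by (simp add: comp_def)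
qed

context nevanlinna_pair
begin

definition R :: "complex => complex" where
 "R z = phi (1 / z)"

lemma R_holomorphic: "R holomorphic_on - \<real>"
 unfolding R_def[abs_def] by (rule inverse_holomorphic_nonreal[OF phi_holomorphic])

lemma R_eq:
 assumes "Im z ~= 0"
 shows "R z = of_real ga + (LINT x|si. (z + of_real x) / (1 - z * of_real x))"
proof -
 have z: "z ~= 0" using assms by auto
 have "(1 + 1 / z * of_real s) / (1 / z - of_real s) = (z + of_real s) / (1 - z * of_real s)" for s
  using z nonreal_1_minus_mult[OF assms, of s] by (simp add: field_simps)
 thus ?thesis by (simp only: R_def phi_def)
qed

lemma mult_R:
 assumes "Im z ~= 0"
 shows "z * R z = of_real ga * z + (LINT s|si. lkern z s)"
proof -
 have "z * ((z + of_real s) / (1 - z * of_real s)) = lkern z s" for s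
  by (simp add: power2_eq_square algebra_simps)
 thus ?thesis
  unfolding R_eq[OF assms] distrib_left integral_mult_right_zero[symmetric] by (simp only: mult.commute[of z "of_real ga"])
qed

text \<open>Dominated convergence along sequences; the kernel is affine in
  \<open>1 / (1 - z * s)\<close>, which \<open>stolz_denominator\<close> bounds.\<close>

lemma mult_R_tendsto_0: "((%z. z * R z) ---> 0) (at 0 within stolz_domain al be)"
 unfolding tendsto_at_iff_sequentially comp_def
proof safe
 fix X assume X: "\<forall>i. X i \<in> stolz_domain al be - {0}" and lim: "X ----> (0::complex)"
 have nz: "Im (X i) ~= 0" for i using X stolz_domain_nonreal by blast
 define k where "k = sqrt (1 + al^2)"
 obtain M where M: "norm (X i) <= M" for i
  using convergent_imp_Bseq[OF convergentI[OF lim]] by (auto simp: Bseq_def)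
 have "(%i. \<integral>s. ((X i)^2 + X i * of_real s) / (1 - X i * of_real s) \<partial>si) ----> (LINT s|si. 0)"
 proof (rule integral_dominated_convergence[where w="%_. (M^2 + 1) * k + 1"])
  have "(%i. ((X i)^2 + X i * of_real s) / (1 - X i * of_real s)) ----> lkern 0 s" for s
   by (intro tendsto_intros lim) auto
  thus "AE s in si. (%i. ((X i)^2 + X i * of_real s) / (1 - X i * of_real s)) ----> 0" by simp
  show "AE s in si. norm (((X i)^2 + X i * of_real s) / (1 - X i * of_real s)) <= (M^2 + 1) * k + 1" for i
  proof (intro AE_I2)
   fix s
   let ?d = "1 - X i * cor s"
   have d: "?d ~= 0" by (rule nonreal_1_minus_mult[OF nz])
   have 1: "1 <= k * norm ?d" unfolding k_def using X by (intro stolz_denominator) blast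
   have "((X i)^2 + X i * of_real s) / ?d = ((X i)^2 + 1) * (1 / ?d) - 1" using d by (simp add: field_simps)
   also have "norm ... <= norm ((X i)^2 + 1) * norm (1 / ?d) + 1"
    unfolding norm_mult[symmetric] by (rule order_trans[OF norm_triangle_ineq4]) simp
   also have "... <= (M^2 + 1) * k + 1"
   proof (intro add_right_mono mult_mono)
    show "norm ((X i)^2 + 1) <= M^2 + 1"
     using M[of i] by (intro order_trans[OF norm_triangle_ineq]) (simp add: norm_power power_mono)
    show "norm (1 / ?d) <= k" using 1 d by (simp add: norm_divide divide_le_eq)
   qed auto
   finally show "norm (((X i)^2 + X i * of_real s) / ?d) <= (M^2 + 1) * k + 1" .
  qed
 qed (use finite_measure.integrable_const[OF finite_si] in simp_all)
 hence "(%i. of_real ga * X i + (LINT s|si. ((X i)^2 + X i * of_real s) / (1 - X i * of_real s))) ----> of_real ga * 0 + 0"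
  by (intro tendsto_intros lim) simp
 thus "(%i. X i * R (X i)) ----> 0" by (simp add: mult_R[OF nz])
qed

text \<open>Nontangentially \<open>abs (Im (1 / z))\<close> is comparable to
  \<open>1 / norm z\<close>, so a small \<open>z * R z\<close> makes \<open>phi (1 / z)\<close>
  smaller than \<open>abs (Im (1 / z))\<close>, and then \<open>X (1 / z) < 1\<close>.\<close>

lemma small_R_imp_D:
 assumes z: "z \<in> stolz_domain al be" and small: "norm (z * R z) * sqrt (1 + al^2) < 1"
 shows "1 / z \<in> D"
proof -
 have nz: "Im z ~= 0" "Im (1 / z) ~= 0" using stolz_domain_nonreal(1)[OF z] by simp_all
 hence z0: "z ~= 0" by auto
 have Im: "abs (Im (1 / z)) = abs (Im z) / (norm z)^2" by (simp add: Im_divide cmod_power2)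
 have "norm (phi (1 / z)) * norm z * sqrt (1 + al^2) < 1" using small by (simp add: R_def norm_mult mult_ac)
 hence "norm (phi (1 / z)) * norm z * sqrt (1 + al^2) * (abs (Im z) / (norm z)^2) < 1 * (abs (Im z) / (norm z)^2)"
  using nz z0 by (intro mult_strict_right_mono) auto
 moreover have "norm (phi (1 / z)) <= norm (phi (1 / z)) * norm z * sqrt (1 + al^2) * (abs (Im z) / (norm z)^2)"
 proof -
  have "1 <= sqrt (1 + al^2) * abs (Im z) / norm z" using norm_stolz_domain_le[OF z] z0 by simp
  hence "norm (phi (1 / z)) * 1 <= norm (phi (1 / z)) * (sqrt (1 + al^2) * abs (Im z) / norm z)"
   by (intro mult_left_mono) auto
  also have "... = norm (phi (1 / z)) * norm z * sqrt (1 + al^2) * (abs (Im z) / (norm z)^2)"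
    by (simp add: power2_eq_square)
  finally show ?thesis by simp
 qed
 ultimately have lt: "norm (phi (1 / z)) < abs (Im (1 / z))" by (simp add: Im)
 have "Im (1 / z) * X (1 / z) = - Im (phi (1 / z))" using Im_H[OF nz(2)] by (simp add: H_def algebra_simps)
 hence "abs (Im (1 / z)) * X (1 / z) = abs (Im (phi (1 / z)))" using X_nonneg[of "1 / z"] by (metis abs_minus_cancel abs_mult abs_of_nonneg)
 also have "... < abs (Im (1 / z)) * 1" using abs_Im_le_cmod[of "phi (1 / z)"] lt by linarith
 finally have "X (1 / z) < 1" using nz(2) by simp
 thus ?thesis using nz by (simp only: D_iff) blast
qed

lemma stolz_domain_in_D:
 "\<exists>be0>0. \<forall>be z. be <= be0 --> z \<in> stolz_domain al be --> 1 / z \<in> D"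
proof -
 define k where "k = sqrt (1 + al^2)"
 have k: "k > 0" unfolding k_def by (rule sqrt_1_sq_pos)
 have "eventually (%z. dist (z * R z) 0 < 1 / k) (at 0 within stolz_domain al 1)"
  by (rule tendstoD[OF mult_R_tendsto_0]) (use k in simp)
 then obtain d where d: "d > 0" "!!z. z \<in> stolz_domain al 1 ==> z ~= 0 ==> dist z 0 < d ==> dist (z * R z) 0 < 1 / k"
  unfolding eventually_at by blast
 show ?thesis
 \<comment> \<open>\<open>k\<close> compares \<open>norm z\<close> with \<open>abs (Im z)\<close>,
   so height below \<open>d / k\<close> forces \<open>norm z < d\<close>.\<close>
 proof (intro exI[of _ "min 1 (d / k)"] conjI allI impI)
  show "0 < min 1 (d / k)" using d k by simp
  fix be z assume be: "be <= min 1 (d / k)" and z: "z \<in> stolz_domain al be"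
  have z1: "z \<in> stolz_domain al 1" using z be stolz_domain_mono[of be 1] by auto
  have "norm z <= k * abs (Im z)" using norm_stolz_domain_le[OF z] by (simp add: k_def)
  also have "... < k * (d / k)" using z be k by (intro mult_strict_left_mono) (auto simp: stolz_domain_iff)
  finally have "norm z < d" using k by simp
  hence "norm (z * R z) < 1 / k" using d(2)[OF z1] stolz_domain_nonreal(1)[OF z] by (cases "z = 0") auto
  thus "1 / z \<in> D" using k by (intro small_R_imp_D[OF z]) (simp add: less_divide_eq k_def)
 qed
qed

text \<open>\<open>1 / z + R z\<close> is \<open>H (1 / z)\<close>, and \<open>F\<close> undoes
  \<open>H\<close> on \<open>D\<close>.\<close>

lemma R_transform_R:
 assumes G: "!!z. Im z ~= 0 ==> cauchy_transform m z = 1 / F z"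
  and D: "!!z. z \<in> stolz_domain al be ==> 1 / z \<in> D"
 shows "R_transform m al be R" unfolding R_transform_def
proof (intro conjI ballI)
 show "R holomorphic_on stolz_domain al be"
  by (rule holomorphic_on_subset[OF R_holomorphic stolz_domain_nonreal(2)])
 show "((%z. z * R z) ---> 0) (at 0 within stolz_domain al be)" by (rule mult_R_tendsto_0)
 fix z assume z: "z \<in> stolz_domain al be"
 have H: "1 / z + R z = H (1 / z)" by (simp add: H_def R_def)
 have nr: "Im (H (1 / z)) ~= 0" by (rule D_nonreal(2)[OF D[OF z]])
 thus "1 / z + R z \<notin> \<real>" by (simp only: H complex_is_Real_iff not_False_eq_True)
 show "cauchy_transform m (1 / z + R z) = z" unfolding H G[OF nr] F_H[OF D[OF z]] by simp
qed

end

section \<open>Marginals as limits along the imaginary axis\<close>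

lemma cauchy_transform2_eq:
 "cauchy_transform2 mm z w = (LINT p|mm. 1 / ((z - of_real (fst p)) * (w - of_real (snd p))))"
 by (simp add: cauchy_transform2_def case_prod_beta')

lemma cauchy_transform_marginal:
 assumes [measurable_cong]: "sets mm = sets borel"
 shows "cauchy_transform (marginal1 mm) z = (LINT p|mm. 1 / (z - of_real (fst p)))"
  "cauchy_transform (marginal2 mm) z = (LINT p|mm. 1 / (z - of_real (snd p)))"
 unfolding cauchy_transform_def marginal1_def marginal2_def by (subst integral_distr; simp)+

lemma norm_axis_kernel_le: "norm (Complex 0 v / (Complex 0 v - cor t)) <= 1"
proof -
 have "norm (Complex 0 v) = abs v" by (simp add: cmod_def)
 thus ?thesis using abs_Im_le_dist[of "Complex 0 v" t] by (simp add: norm_divide divide_le_eq_1)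
qed

lemma axis_kernel_tendsto: "((%v. Complex 0 v / (Complex 0 v - cor t)) ---> 1) at_top"
proof -
 have "eventually (%v. norm (Complex 0 v / (Complex 0 v - cor t) - 1) <= abs t / v) at_top"
  using eventually_gt_at_top[of 0]
 proof eventually_elim
  case (elim v)
  have "Complex 0 v - cor t ~= 0" using elim by (intro nonreal_diff_nonzero) simp
  hence "Complex 0 v / (Complex 0 v - cor t) - 1 = of_real t / (Complex 0 v - cor t)"
   by (simp add: divide_simps)
  thus ?case using elim abs_Im_le_dist[of "Complex 0 v" t] by (simp add: norm_divide frac_le)
 qed
 moreover have "((%v. abs t / v) ---> 0) at_top"
  by (intro tendsto_divide_0[OF tendsto_const filterlim_at_top_imp_at_infinity] filterlim_ident)
 ultimately show ?thesis by (rule LIM_zero_cancel[OF Lim_null_comparison])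
qed

text \<open>The factor \<open>\<i> v\<close> turns the kernel in the variable that runs to infinity
  into one that is bounded by 1 and tends to 1.\<close>

lemma cauchy_transform2_tendsto:
 assumes mm: "borel_law mm" and z: "Im z ~= 0"
 shows "((%v. Complex 0 v * cauchy_transform2 mm z (Complex 0 v)) ---> cauchy_transform (marginal1 mm) z) at_top"
  "((%v. Complex 0 v * cauchy_transform2 mm (Complex 0 v) z) ---> cauchy_transform (marginal2 mm) z) at_top"
proof -
 interpret prob_space mm using mm by (simp add: borel_law_def)
 have s [measurable_cong]: "sets mm = sets borel" using mm by (simp add: borel_law_def)
 have *: "((%v. \<integral>p. Complex 0 v / (Complex 0 v - of_real (g p)) * (1 / (z - of_real (f p))) \<partial>mm) ---> (LINT p|mm. 1 / (z - of_real (f p)))) at_top"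
  if [measurable]: "f \<in> borel_measurable mm" "g \<in> borel_measurable mm" for f g
 proof (rule integral_dominated_convergence_at_top[where w="%_. kernel_bound z"])
  show "\<forall>\<^sub>F v in at_top. AE p in mm. norm (Complex 0 v / (Complex 0 v - of_real (g p)) * (1 / (z - of_real (f p)))) <= kernel_bound z"
   unfolding norm_mult using mult_mono[OF norm_axis_kernel_le norm_kernel_le[OF z]] by simp
  show "AE p in mm. ((%v. Complex 0 v / (Complex 0 v - of_real (g p)) * (1 / (z - of_real (f p)))) ---> 1 / (z - of_real (f p))) at_top"
   by (intro AE_I2 tendsto_eq_rhs[OF tendsto_mult[OF axis_kernel_tendsto tendsto_const]] mult_1)
 qed simp_all
 show "((%v. Complex 0 v * cauchy_transform2 mm z (Complex 0 v)) ---> cauchy_transform (marginal1 mm) z) at_top"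
  using *[of fst snd] unfolding cauchy_transform2_eq cauchy_transform_marginal[OF s] integral_mult_right_zero[symmetric]
  by (simp add: mult.commute)
 show "((%v. Complex 0 v * cauchy_transform2 mm (Complex 0 v) z) ---> cauchy_transform (marginal2 mm) z) at_top"
  using *[of snd fst] unfolding cauchy_transform2_eq cauchy_transform_marginal[OF s] integral_mult_right_zero[symmetric]
  by simp
qed

lemma Complex_0_minus: "Complex 0 (- y) = cnj (Complex 0 y)" by (simp add: complex_eq_iff)

context nevanlinna_pair
begin

text \<open>From \<open>y = Im F * (1 - X F)\<close> at \<open>\<i> y\<close>, where
  \<open>F (\<i> y) / y\<close> tends to \<open>\<i>\<close>.\<close>

lemma X_F_axis: "((%y. X (F (Complex 0 y))) ---> 0) at_top"
proof -
 have "((%y. 1 - 1 / Im (F (Complex 0 y) / of_real y)) ---> 1 - 1 / Im \<i>) at_top"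
  by (intro tendsto_intros F_axis) simp
 moreover have "eventually (%y. 1 - 1 / Im (F (Complex 0 y) / of_real y) = X (F (Complex 0 y))) at_top"
  using eventually_gt_at_top[of 0]
 proof eventually_elim
  case (elim y)
  have "y = Im (F (Complex 0 y)) * (1 - X (F (Complex 0 y)))" "Im (F (Complex 0 y)) ~= 0"
   using Im_F[of "Complex 0 y"] elim by simp_all
  moreover hence "y / Im (F (Complex 0 y)) = 1 - X (F (Complex 0 y))" by (metis nonzero_mult_div_cancel_left)
  ultimately show ?case by simp
 qed
 ultimately show ?thesis by (rule tendsto_eq_rhs[OF Lim_transform_eventually]) simp_all
qed

lemma axis_div_F: "((%y. Complex 0 y / F (Complex 0 y)) ---> 1) at_top"
proof -
 have "((%y. \<i> / (F (Complex 0 y) / of_real y)) ---> \<i> / \<i>) at_top"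
  by (intro tendsto_intros F_axis) simp
 moreover have "eventually (%y. \<i> / (F (Complex 0 y) / of_real y) = Complex 0 y / F (Complex 0 y)) at_top"
   by eventually_elim (simp add: Complex_eq)
 ultimately show ?thesis by (rule tendsto_eq_rhs[OF Lim_transform_eventually]) simp_all
qed

end

section \<open>The Cauchy transform built from a Levy triple\<close>

context levy_data
begin

definition G :: "complex => complex => complex" where
 "G z w = 1 / (N1.F z * N2.F w * (1 - q (N1.F z) (N2.F w)))"

lemma F_nonreal:
 assumes "Im z ~= 0" "Im w ~= 0"
 shows "Im (N1.F z) ~= 0" "Im (N2.F w) ~= 0" "N1.F z ~= 0" "N2.F w ~= 0" "1 - q (N1.F z) (N2.F w) ~= 0"
proof -
 show "Im (N1.F z) ~= 0" "Im (N2.F w) ~= 0" using N1.Im_F(2) N2.Im_F(2) assms by blast+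
 thus "N1.F z ~= 0" "N2.F w ~= 0" "1 - q (N1.F z) (N2.F w) ~= 0"
  using norm_q_less_1(2) N1.Im_F(3) N2.Im_F(3) assms by auto
qed

lemma q_F_holomorphic2: "(%p. q (N1.F (fst p)) (N2.F (snd p))) holomorphic2_on (- \<real>) \<times> (- \<real>)"
 using holomorphic2_compose_fst_snd[OF q_holomorphic2 open_nonreal open_nonreal N1.F_holomorphic open_nonreal _ N2.F_holomorphic open_nonreal]
  F_nonreal by (auto simp: image_subset_iff nonreal_iff)

text \<open>With \<open>x\<close> and \<open>y\<close> the two values of \<open>X\<close>,
  \<open>(1 - x) * (1 - y) <= 1 - (x + y) / 2\<close>, which is at most the norm of
  \<open>1 - q\<close>. The factors on the left are exactly those by which the heights of
  \<open>F\<close> exceed the heights of \<open>z\<close> and \<open>w\<close>.\<close>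

lemma norm_G_le:
 assumes "Im z ~= 0" "Im w ~= 0"
 shows "norm (G z w) <= 1 / (abs (Im z) * abs (Im w))"
proof -
 let ?f = "N1.F z" and ?g = "N2.F w"
 have X: "0 <= X1 ?f" "X1 ?f < 1" "0 <= X2 ?g" "X2 ?g < 1"
  using N1.X_nonneg N2.X_nonneg N1.Im_F(3) N2.Im_F(3) assms by blast+
 have z: "abs (Im z) = abs (Im ?f) * (1 - X1 ?f)" and w: "abs (Im w) = abs (Im ?g) * (1 - X2 ?g)"
  using arg_cong[OF N1.Im_F(1)[OF assms(1)], of abs] arg_cong[OF N2.Im_F(1)[OF assms(2)], of abs] X
  by (simp_all only: abs_mult abs_of_nonneg diff_ge_0_iff_ge less_imp_le)
 have "X1 ?f * X2 ?g <= X1 ?f * 1" "X1 ?f * X2 ?g <= 1 * X2 ?g" using X by (intro mult_mono; simp)+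
 moreover have "(1 - X1 ?f) * (1 - X2 ?g) = 1 - X1 ?f - X2 ?g + X1 ?f * X2 ?g" by (simp add: algebra_simps)
 moreover have "m <= x ==> m <= y ==> 1 - x - y + m <= 1 - (x + y) / 2" for m x y :: real by (simp add: field_simps)
 ultimately have "(1 - X1 ?f) * (1 - X2 ?g) <= 1 - (X1 ?f + X2 ?g) / 2" by simp
 also have "... <= 1 - norm (q ?f ?g)" using norm_q_le[of ?f ?g 1] F_nonreal[OF assms] by simp
 also have "... <= norm (1 - q ?f ?g)" using norm_triangle_ineq2[of 1 "q ?f ?g"] by simp
 finally have "(1 - X1 ?f) * (1 - X2 ?g) <= norm (1 - q ?f ?g)" .
 hence "(abs (Im ?f) * abs (Im ?g)) * ((1 - X1 ?f) * (1 - X2 ?g)) <= (norm ?f * norm ?g) * norm (1 - q ?f ?g)"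
  using X abs_Im_le_cmod by (intro mult_mono) auto
 hence "abs (Im z) * abs (Im w) <= norm ?f * norm ?g * norm (1 - q ?f ?g)" unfolding z w by (simp only: mult_ac)
 thus ?thesis using assms unfolding G_def norm_divide norm_mult by (intro frac_le) auto
qed

sublocale cauchy2_candidate G
proof
 show "(%z. G z w) holomorphic_on - \<real>" if w: "Im w ~= 0" for w
  unfolding G_def using holomorphic2_imp_holomorphic_fst[OF q_F_holomorphic2, of w] F_nonreal[OF _ w] w
  by (intro holomorphic_intros N1.F_holomorphic) (auto simp: nonreal_iff)
 show "(%w. G z w) holomorphic_on - \<real>" if z: "Im z ~= 0" for z
  unfolding G_def using holomorphic2_imp_holomorphic_snd[OF q_F_holomorphic2, of z] F_nonreal[OF z] z
  by (intro holomorphic_intros N2.F_holomorphic) (auto simp: nonreal_iff)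
 show "G (cnj z) (cnj w) = cnj (G z w)" if "Im z ~= 0" "Im w ~= 0" for z w
  using that by (simp add: G_def N1.F_cnj N2.F_cnj q_cnj)
 show "norm (G z w) <= 1 / (abs (Im z) * abs (Im w))" if "Im z ~= 0" "Im w ~= 0" for z w
  by (rule norm_G_le[OF that])
 show "0 <= Re (G z (cnj w) - G z w)" if "Im z > 0" "Im w > 0" for z w
  using resolvent_positivity[of "N1.F z" "N2.F w"] that N1.Im_F_pos N2.Im_F_pos N1.Im_F(3) N2.Im_F(3)
  by (simp add: G_def N2.F_cnj)
 show "continuous_on ((- \<real>) \<times> (- \<real>)) (%(z, w). G z w)" unfolding G_def case_prod_beta'
  using F_nonreal by (intro continuous_intros holomorphic2_imp_continuous_on[OF q_F_holomorphic2]
    holomorphic2_imp_continuous_on[OF holomorphic2_fst[OF N1.F_holomorphic open_nonreal]]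
    holomorphic2_imp_continuous_on[OF holomorphic2_snd[OF N2.F_holomorphic open_nonreal]])
   (auto simp: nonreal_iff)
 let ?y = "%y. Complex 0 y"
 have q0: "((%y. q (N1.F (?y y)) (N2.F (?y y))) ---> 0) at_top" "((%y. q (N1.F (?y y)) (cnj (N2.F (?y y)))) ---> 0) at_top"
 proof -
  have "((%y. (X1 (N1.F (?y y)) + X2 (N2.F (?y y))) / 2) ---> (0 + 0) / 2) at_top"
   by (intro tendsto_intros N1.X_F_axis N2.X_F_axis) simp
  hence l: "((%y. (X1 (N1.F (?y y)) + X2 (N2.F (?y y))) / 2) ---> 0) at_top" by simp
  have "norm (q (N1.F (?y y)) (N2.F (?y y))) <= (X1 (N1.F (?y y)) + X2 (N2.F (?y y))) / 2"
   "norm (q (N1.F (?y y)) (cnj (N2.F (?y y)))) <= (X1 (N1.F (?y y)) + X2 (N2.F (?y y))) / 2" if "y > 0" for y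
   using norm_q_le[of "N1.F (?y y)" "N2.F (?y y)" 1] norm_q_le[of "N1.F (?y y)" "cnj (N2.F (?y y))" 1]
    F_nonreal[of "?y y" "?y y"] that by (simp_all add: N2.X_cnj)
  note le = this
  show "((%y. q (N1.F (?y y)) (N2.F (?y y))) ---> 0) at_top"
   by (rule Lim_null_comparison[OF eventually_mono[OF eventually_gt_at_top[of 0] le(1)] l])
  show "((%y. q (N1.F (?y y)) (cnj (N2.F (?y y)))) ---> 0) at_top"
   by (rule Lim_null_comparison[OF eventually_mono[OF eventually_gt_at_top[of 0] le(2)] l])
 qed
 let ?a = "%y. ?y y / N1.F (?y y)" and ?b = "%y. ?y y / N2.F (?y y)"
 \<comment> \<open>The terms with and without conjugation tend to 1 each; the minus sign of the
   second is cancelled by the square of \<open>\<i> y\<close>.\<close>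
 have "((%y. Re (?a y * cnj (?b y) / (1 - q (N1.F (?y y)) (cnj (N2.F (?y y)))) + ?a y * ?b y / (1 - q (N1.F (?y y)) (N2.F (?y y)))))
  ---> Re (1 * cnj 1 / (1 - 0) + 1 * 1 / (1 - 0))) at_top"
  by (intro tendsto_intros N1.axis_div_F N2.axis_div_F q0) simp_all
 moreover have "eventually (%y. Re (?a y * cnj (?b y) / (1 - q (N1.F (?y y)) (cnj (N2.F (?y y)))) + ?a y * ?b y / (1 - q (N1.F (?y y)) (N2.F (?y y))))
   = y^2 * Re (G (Complex 0 y) (Complex 0 (-y)) - G (Complex 0 y) (Complex 0 y))) at_top"
  using eventually_gt_at_top[of 0]
 proof eventually_elim
  case (elim y)
  have e: "?y y * cnj (?y y) = of_real (y^2)" "?y y * ?y y = - of_real (y^2)" by (simp_all add: complex_eq_iff power2_eq_square)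
  have dv: "a / f * (b / g) / d = a * b * (1 / (f * g * d))" for a b f g d :: complex by simp
  have "?a y * cnj (?b y) / (1 - q (N1.F (?y y)) (cnj (N2.F (?y y)))) = of_real (y^2) * G (?y y) (cnj (?y y))"
   using elim by (simp only: G_def N2.F_cnj complex_cnj_divide dv e complex.sel)
  moreover have "?a y * ?b y / (1 - q (N1.F (?y y)) (N2.F (?y y))) = - of_real (y^2) * G (?y y) (?y y)"
   by (simp only: G_def dv e)
  ultimately show ?case by (simp only: Complex_0_minus) (simp add: right_diff_distrib)
 qed
 ultimately show "((%y. y^2 * Re (G (Complex 0 y) (Complex 0 (-y)) - G (Complex 0 y) (Complex 0 y))) ---> 2) at_top"
  by (rule tendsto_eq_rhs[OF Lim_transform_eventually]) simp_all
qed

text \<open>Only one value \<open>x\<close> of \<open>X\<close> tends to 0. The choice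
  \<open>r = sqrt (x + 1 / v)\<close>, or its inverse, makes both summands of
  \<open>norm_q_le\<close> small; \<open>1 / v\<close> keeps the square root positive.\<close>

lemma q_tendsto_0:
 assumes "Im ze ~= 0"
 shows "((%v. q ze (N2.F (Complex 0 v))) ---> 0) at_top" "((%v. q (N1.F (Complex 0 v)) ze) ---> 0) at_top"
proof -
 have lim: "((%v. sqrt (x v + 1 / v) * (K + 1) / 2) ---> 0) at_top" if "(x ---> 0) at_top" for x :: "real => real" and K
 proof -
  have "((%v. sqrt (x v + 1 / v) * (K + 1) / 2) ---> sqrt (0 + 0) * (K + 1) / 2) at_top"
   by (intro tendsto_intros that tendsto_divide_0[OF tendsto_const filterlim_at_top_imp_at_infinity] filterlim_ident) simp
  thus ?thesis by simp
 qed
 have small: "(sqrt (x + 1 / v) * K + x / sqrt (x + 1 / v)) / 2 <= sqrt (x + 1 / v) * (K + 1) / 2" "0 < sqrt (x + 1 / v)"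
  if "0 <= x" "v > 0" for x v K :: real
 proof -
  show p: "0 < sqrt (x + 1 / v)" using that by (simp add: add_nonneg_pos)
  have "x <= sqrt (x + 1 / v) * sqrt (x + 1 / v)" using that by simp
  hence "x / sqrt (x + 1 / v) <= sqrt (x + 1 / v)" using p by (simp only: pos_divide_le_eq)
  thus "(sqrt (x + 1 / v) * K + x / sqrt (x + 1 / v)) / 2 <= sqrt (x + 1 / v) * (K + 1) / 2"
   by (simp only: distrib_left mult_1_right divide_right_mono add_left_mono zero_le_numeral)
 qed
 show "((%v. q ze (N2.F (Complex 0 v))) ---> 0) at_top"
 proof (rule Lim_null_comparison[OF eventually_mono[OF eventually_gt_at_top[of 0]] lim[OF N2.X_F_axis]])
  fix v :: real assume v: "0 < v"
  let ?x = "X2 (N2.F (Complex 0 v))"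
  have "norm (q ze (N2.F (Complex 0 v))) <= (sqrt (?x + 1 / v) * X1 ze + ?x / sqrt (?x + 1 / v)) / 2"
   using small(2)[OF N2.X_nonneg v] assms v by (intro norm_q_le N2.Im_F(2)) auto
  also have "... <= sqrt (?x + 1 / v) * (X1 ze + 1) / 2" by (rule small(1)[OF N2.X_nonneg v])
  finally show "norm (q ze (N2.F (Complex 0 v))) <= sqrt (?x + 1 / v) * (X1 ze + 1) / 2" .
 qed
 show "((%v. q (N1.F (Complex 0 v)) ze) ---> 0) at_top"
 proof (rule Lim_null_comparison[OF eventually_mono[OF eventually_gt_at_top[of 0]] lim[OF N1.X_F_axis]])
  fix v :: real assume v: "0 < v"
  let ?x = "X1 (N1.F (Complex 0 v))"
  have "norm (q (N1.F (Complex 0 v)) ze) <= (1 / sqrt (?x + 1 / v) * ?x + X2 ze / (1 / sqrt (?x + 1 / v))) / 2"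
   using small(2)[OF N1.X_nonneg v] assms v by (intro norm_q_le N1.Im_F(2)) auto
  also have "... = (sqrt (?x + 1 / v) * X2 ze + ?x / sqrt (?x + 1 / v)) / 2" by simp
  also have "... <= sqrt (?x + 1 / v) * (X2 ze + 1) / 2" by (rule small(1)[OF N1.X_nonneg v])
  finally show "norm (q (N1.F (Complex 0 v)) ze) <= sqrt (?x + 1 / v) * (X2 ze + 1) / 2" .
 qed
qed

text \<open>The marginal transforms are limits of \<open>G\<close> with one variable running up the
  imaginary axis: there \<open>q\<close> tends to 0 and \<open>F\<close> behaves like the
  identity.\<close>

theorem law_with_transforms:
 obtains vv where "borel_law vv" "!!z w. Im z ~= 0 ==> Im w ~= 0 ==> cauchy_transform2 vv z w = G z w"
  "!!z. Im z ~= 0 ==> cauchy_transform (marginal1 vv) z = 1 / N1.F z"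
  "!!z. Im z ~= 0 ==> cauchy_transform (marginal2 vv) z = 1 / N2.F z"
proof (rule law_exists)
 fix vv assume vv: "borel_law vv" and eq: "!!z w. Im z ~= 0 ==> Im w ~= 0 ==> cauchy_transform2 vv z w = G z w"
 show thesis
 proof (rule that[OF vv eq])
  fix z assume z: "Im z ~= 0"
  show "cauchy_transform (marginal1 vv) z = 1 / N1.F z"
  proof (rule tendsto_unique[OF trivial_limit_at_top_linorder cauchy_transform2_tendsto(1)[OF vv z]])
   have "((%v. Complex 0 v / N2.F (Complex 0 v) / (N1.F z * (1 - q (N1.F z) (N2.F (Complex 0 v))))) ---> 1 / (N1.F z * (1 - 0))) at_top"
    using F_nonreal[OF z z] by (intro tendsto_intros N2.axis_div_F q_tendsto_0) auto
   moreover have "eventually (%v. Complex 0 v / N2.F (Complex 0 v) / (N1.F z * (1 - q (N1.F z) (N2.F (Complex 0 v))))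
     = Complex 0 v * cauchy_transform2 vv z (Complex 0 v)) at_top"
    using eventually_gt_at_top[of 0] by eventually_elim (simp add: eq[OF z] G_def)
   ultimately show "((%v. Complex 0 v * cauchy_transform2 vv z (Complex 0 v)) ---> 1 / N1.F z) at_top"
    by (rule tendsto_eq_rhs[OF Lim_transform_eventually]) simp_all
  qed
  show "cauchy_transform (marginal2 vv) z = 1 / N2.F z"
  proof (rule tendsto_unique[OF trivial_limit_at_top_linorder cauchy_transform2_tendsto(2)[OF vv z]])
   have "((%v. Complex 0 v / N1.F (Complex 0 v) / (N2.F z * (1 - q (N1.F (Complex 0 v)) (N2.F z)))) ---> 1 / (N2.F z * (1 - 0))) at_top"
    using F_nonreal[OF z z] by (intro tendsto_intros N1.axis_div_F q_tendsto_0) auto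
   moreover have "eventually (%v. Complex 0 v / N1.F (Complex 0 v) / (N2.F z * (1 - q (N1.F (Complex 0 v)) (N2.F z)))
     = Complex 0 v * cauchy_transform2 vv (Complex 0 v) z) at_top"
    using eventually_gt_at_top[of 0] by eventually_elim (simp add: eq[OF _ z] G_def)
   ultimately show "((%v. Complex 0 v * cauchy_transform2 vv (Complex 0 v) z) ---> 1 / N2.F z) at_top"
    by (rule tendsto_eq_rhs[OF Lim_transform_eventually]) simp_all
  qed
 qed
qed

end

section \<open>The bi-free R-transform of the constructed law\<close>

context levy_data
begin

text \<open>The Levy-Khintchine function off the real axis, in the form in which its holomorphy and
  its law are accessible.\<close>

definition lk :: "complex \<times> complex => complex" where
 "lk p = fst p * N1.R (fst p) + snd p * N2.R (snd p) + q (1 / fst p) (1 / snd p)"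

lemma lk_holomorphic2: "lk holomorphic2_on (- \<real>) \<times> (- \<real>)"
proof -
 have inv: "(%z. 1 / z) holomorphic_on - \<real>" by (intro holomorphic_intros) auto
 have "(%p. fst p * N1.R (fst p)) holomorphic2_on (- \<real>) \<times> (- \<real>)"
  by (rule holomorphic2_fst) (intro holomorphic_intros N1.R_holomorphic open_nonreal)+
 moreover have "(%p. snd p * N2.R (snd p)) holomorphic2_on (- \<real>) \<times> (- \<real>)"
  by (rule holomorphic2_snd) (intro holomorphic_intros N2.R_holomorphic open_nonreal)+
 moreover have "(%p. q (1 / fst p) (1 / snd p)) holomorphic2_on (- \<real>) \<times> (- \<real>)"
  using holomorphic2_compose_fst_snd[OF q_holomorphic2 open_nonreal open_nonreal inv open_nonreal _ inv open_nonreal]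
  by (auto simp: image_subset_iff nonreal_iff)
 ultimately show ?thesis unfolding lk_def[abs_def] by (intro holomorphic2_add)
qed

lemma integrable_levy_term:
 assumes "Im z ~= 0"
 shows "(LINT (s, t)|(dens L A). lkern z s) = z * N1.R z - of_real ga1 * z"
  "(LINT (s, t)|(dens L B). lkern z t) = z * N2.R z - of_real ga2 * z"
proof -
 have "(LINT (s, t)|(dens L A). lkern z s) = (LINT s|(marginal1 (dens L A)). lkern z s)"
  "(LINT (s, t)|(dens L B). lkern z t) = (LINT s|(marginal2 (dens L B)). lkern z s)"
  unfolding marginal1_def marginal2_def by (subst integral_distr; simp add: case_prod_beta')+
 thus "(LINT (s, t)|(dens L A). lkern z s) = z * N1.R z - of_real ga1 * z"
  "(LINT (s, t)|(dens L B). lkern z t) = z * N2.R z - of_real ga2 * z"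
  using N1.mult_R[OF assms] N2.mult_R[OF assms] by simp_all
qed

lemma levy_khintchine_eq_lk:
 assumes signed: "!!(f :: plane => complex) K. f \<in> bor ==> (!!p. norm (f p) <= K) ==>
   signed_integral borel ro f = (LINT p|L. C p *\<^sub>R f p)"
  and z: "Im z ~= 0" and w: "Im w ~= 0"
 shows "levy_khintchine ga1 ga2 (dens L A) (dens L B) ro (z, w) = lk (z, w)"
proof -
 let ?f = "%(s, t). z * w * of_real (sqrt (1 + s^2)) * of_real (sqrt (1 + t^2)) / ((1 - z * of_real s) * (1 - w * of_real t))"
 have z0: "z ~= 0" "w ~= 0" using z w by auto
 have d: "1 - z * of_real s = z * (1 / z - of_real s)" "1 - w * of_real s = w * (1 / w - of_real s)" for s
  using z0 by (simp_all add: right_diff_distrib)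
 have f: "?f p = skern (1 / z) (fst p) * skern (1 / w) (snd p)" for p
  using z0 by (simp add: case_prod_beta' d)
 have "signed_integral borel ro ?f = (LINT p|L. C p *\<^sub>R ?f p)"
 proof (rule signed)
  show "?f \<in> bor"  by measurable
  show "norm (?f p) <= kernel_bound (1 / z) * kernel_bound (1 / w)" for p
   unfolding f norm_mult using z w kernel_bound_ge_1[of "1 / z"] by (intro mult_mono norm_sqrt_kernel_le) auto
 qed
 also have "... = q (1 / z) (1 / w)"
  unfolding f q_def cauchy2_def c_def by (intro Bochner_Integration.integral_cong) (auto simp: scaleR_conv_of_real)
 finally show ?thesis unfolding levy_khintchine_def lk_def by (simp add: integrable_levy_term z w)
qed

text \<open>At \<open>1 / z + R z = H (1 / z)\<close> the functions \<open>F\<close> are undone and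
  \<open>bifree_h\<close> becomes \<open>1 / (1 - q)\<close>, so the term \<open>1 - 1 / h\<close>
  of the transform is \<open>q\<close>. The admissible height depends on the slope
  \<open>al\<close>, because \<open>1 / z\<close> has to lie in the domain where \<open>H\<close> is
  inverted.\<close>

theorem law_with_R_transform:
 obtains vv where "borel_law vv"
  "!!al. \<exists>be0>0. \<forall>be\<le>be0. R_transform (marginal1 vv) al be N1.R & R_transform (marginal2 vv) al be N2.R \<and>
   (\<forall>(z, w)\<in>product_domain al be. bifree_h vv N1.R N2.R z w ~= 0 \<and>
    lk (z, w) = z * N1.R z + w * N2.R w + (1 - 1 / bifree_h vv N1.R N2.R z w))"
proof (rule law_with_transforms)
 fix vv assume vv: "borel_law vv" and G: "!!z w. Im z ~= 0 ==> Im w ~= 0 ==> cauchy_transform2 vv z w = G z w"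
  and G1: "!!z. Im z ~= 0 ==> cauchy_transform (marginal1 vv) z = 1 / N1.F z"
  and G2: "!!z. Im z ~= 0 ==> cauchy_transform (marginal2 vv) z = 1 / N2.F z"
 show thesis
 proof (rule that[OF vv])
  fix al
  obtain b1 where b1: "b1 > 0" "!!be z. be <= b1 ==> z \<in> stolz_domain al be ==> 1 / z \<in> N1.D" using N1.stolz_domain_in_D[of al] by blast
  obtain b2 where b2: "b2 > 0" "!!be z. be <= b2 ==> z \<in> stolz_domain al be ==> 1 / z \<in> N2.D" using N2.stolz_domain_in_D[of al] by blast
  have main: "bifree_h vv N1.R N2.R z w ~= 0 \<and>
    lk (z, w) = z * N1.R z + w * N2.R w + (1 - 1 / bifree_h vv N1.R N2.R z w)"
   if D: "1 / z \<in> N1.D" "1 / w \<in> N2.D" for z w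
  proof -
   have H: "1 / z + N1.R z = N1.H (1 / z)" "1 / w + N2.R w = N2.H (1 / w)"
    by (simp_all add: N1.H_def N1.R_def N2.H_def N2.R_def)
   have D': "Im (1 / z) ~= 0" "X1 (1 / z) < 1" "Im (1 / w) ~= 0" "X2 (1 / w) < 1"
    using D by (simp_all only: N1.D_iff N2.D_iff simp_thms)
   hence z0: "z ~= 0" "w ~= 0" by auto
   have n: "1 - q (1 / z) (1 / w) ~= 0" by (intro norm_q_less_1(2) D')
   have "bifree_h vv N1.R N2.R z w = G (N1.H (1 / z)) (N2.H (1 / w)) / (z * w)"
    unfolding bifree_h_def H by (simp only: G[OF N1.D_nonreal(2)[OF D(1)] N2.D_nonreal(2)[OF D(2)]])
   also have "... = 1 / (1 - q (1 / z) (1 / w))"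
    unfolding G_def N1.F_H[OF D(1)] N2.F_H[OF D(2)] using z0 by simp
   finally show ?thesis using n by (simp add: lk_def)
  qed
  show "\<exists>be0>0. \<forall>be\<le>be0. R_transform (marginal1 vv) al be N1.R & R_transform (marginal2 vv) al be N2.R \<and>
   (\<forall>(z, w)\<in>product_domain al be. bifree_h vv N1.R N2.R z w ~= 0 \<and>
    lk (z, w) = z * N1.R z + w * N2.R w + (1 - 1 / bifree_h vv N1.R N2.R z w))"
  proof (intro exI[of _ "min b1 b2"] conjI allI impI ballI)
   show "0 < min b1 b2" using b1 b2 by simp
   fix be assume be: "be <= min b1 b2"
   show "R_transform (marginal1 vv) al be N1.R" using be by (intro N1.R_transform_R G1 b1(2)) auto
   show "R_transform (marginal2 vv) al be N2.R" using be by (intro N2.R_transform_R G2 b2(2)) auto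
   fix p assume "p \<in> product_domain al be"
   thus "case p of (z, w) => bifree_h vv N1.R N2.R z w ~= 0 \<and>
     lk (z, w) = z * N1.R z + w * N2.R w + (1 - 1 / bifree_h vv N1.R N2.R z w)"
    using be b1(2)[of be "fst p"] b2(2)[of be "snd p"] main[of "fst p" "snd p"] by (auto simp: product_domain_def)
  qed
 qed
qed

end

lemma product_domain_subset: "be <= be' ==> product_domain al be \<subseteq> product_domain al be'"
 "product_domain al be \<subseteq> (- \<real>) \<times> (- \<real>)"
 using stolz_domain_mono[of be be' al] stolz_domain_nonreal(2)[of al be] by (auto simp: product_domain_def)

lemma (in levy_data) law_bifree_R_transform:
 obtains vv where "borel_law vv" "!!al be. al > 0 ==> be > 0 ==> bifree_R_transform_on vv (product_domain al be) lk"
  "!!al. \<exists>be0>0. \<forall>be\<le>be0. R_transform (marginal1 vv) al be N1.R & R_transform (marginal2 vv) al be N2.R"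
proof (rule law_with_R_transform)
 fix vv assume vv: "borel_law vv"
  and ex: "!!al. \<exists>be0>0. \<forall>be\<le>be0. R_transform (marginal1 vv) al be N1.R & R_transform (marginal2 vv) al be N2.R \<and>
   (\<forall>(z, w)\<in>product_domain al be. bifree_h vv N1.R N2.R z w ~= 0 \<and>
    lk (z, w) = z * N1.R z + w * N2.R w + (1 - 1 / bifree_h vv N1.R N2.R z w))"
 show thesis
 proof (rule that[OF vv])
  show "\<exists>be0>0. \<forall>be\<le>be0. R_transform (marginal1 vv) al be N1.R & R_transform (marginal2 vv) al be N2.R" for al
   using ex[of al] by blast
  fix al be :: real assume ab: "al > 0" "be > 0"
  obtain be0 where b0: "be0 > 0" "!!be. be <= be0 ==> R_transform (marginal1 vv) al be N1.R & R_transform (marginal2 vv) al be N2.R \<and>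
   (\<forall>(z, w)\<in>product_domain al be. bifree_h vv N1.R N2.R z w ~= 0 \<and>
    lk (z, w) = z * N1.R z + w * N2.R w + (1 - 1 / bifree_h vv N1.R N2.R z w))" using ex[of al] by blast
  show "bifree_R_transform_on vv (product_domain al be) lk" unfolding bifree_R_transform_on_def
  proof (intro conjI)
   show "lk holomorphic2_on product_domain al be"
    by (rule holomorphic2_subset[OF lk_holomorphic2 product_domain_subset(2)])
   show "\<exists>al'>0. \<exists>be'>0. \<exists>R1 R2. product_domain al' be' \<subseteq> product_domain al be \<and>
     R_transform (marginal1 vv) al' be' R1 & R_transform (marginal2 vv) al' be' R2 \<and>
     (\<forall>(z, w)\<in>product_domain al' be'. bifree_h vv R1 R2 z w ~= 0 \<and>
      lk (z, w) = z * R1 z + w * R2 w + (1 - 1 / bifree_h vv R1 R2 z w))"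
    using b0(2)[of "min be be0"] product_domain_subset(1)[of "min be be0" be al] ab b0(1)
    by (intro exI[of _ al] exI[of _ "min be be0"] exI[of _ N1.R] exI[of _ N2.R] conjI) auto
  qed
 qed
qed

lemma levy_density_scale:
 assumes ld: "levy_density L A B C" and r: "0 <= r" "r <= 1"
 shows "levy_density L (%p. r * A p) (%p. r * B p) (%p. r * C p)"
proof -
 have b: "0 <= A p" "A p <= 1" "0 <= B p" "B p <= 1" "abs (C p) <= 1" "(C p)^2 <= A p * B p"
  "t * sqrt (1 + s^2) * A (s, t) = s * sqrt (1 + t^2) * C (s, t)"
  "s * sqrt (1 + t^2) * B (s, t) = t * sqrt (1 + s^2) * C (s, t)" for p s t
  using ld unfolding levy_density_def by blast+
 have [measurable]: "A \<in> bor" "B \<in> bor" "C \<in> bor" using ld by (auto simp: levy_density_def)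
 have le: "r * x <= 1" if "0 <= x" "x <= 1" for x using mult_mono[of r 1 x 1] that r by simp
 have sq: "(r * C p)^2 <= r * A p * (r * B p)" for p
  using mult_left_mono[OF b(6)[of p], of "r^2"] by (simp add: power2_eq_square mult_ac)
 have c: "t * sqrt (1 + s^2) * (r * A (s, t)) = s * sqrt (1 + t^2) * (r * C (s, t))"
  "s * sqrt (1 + t^2) * (r * B (s, t)) = t * sqrt (1 + s^2) * (r * C (s, t))" for s t
  using b(7)[of t s] b(8)[of s t] by simp_all
 show ?thesis unfolding levy_density_def
 proof (intro conjI allI)
  show "abs (r * C p) <= 1" for p using le[of "abs (C p)"] b(5)[of p] r by (simp add: abs_mult)
  show "t * sqrt (1 + s^2) * (r * A (s, t)) = s * sqrt (1 + t^2) * (r * C (s, t))"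
   "s * sqrt (1 + t^2) * (r * B (s, t)) = t * sqrt (1 + s^2) * (r * C (s, t))" for s t by (rule c)+
  show "(r * C p)^2 <= r * A p * (r * B p)" for p by (rule sq)
 qed (use ld r b in \<open>auto intro!: le simp: levy_density_def\<close>)
qed

lemma phi_integrand_measurable: "(%s. (1 + ze * cor s) / (ze - of_real s)) \<in> bor" by measurable

lemma levy_data_scale:
 \<comment> \<open>The transform is linear in the constants and the triple, so the factor
   \<open>1 / m\<close> gives roots of every order; \<open>r <= 1\<close> preserves the bounds on
   the densities.\<close>
 assumes "levy_data L A B C" and r: "0 <= r" "r <= 1"
 defines "A' == %p. r * A p" and "B' == %p. r * B p" and "C' == %p. r * C p"
 shows "levy_data L A' B' C'" "levy_data.lk (r * ga1) (r * ga2) L A' B' C' p = of_real r * levy_data.lk ga1 ga2 L A B C p"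
proof -
 interpret levy_data ga1 ga2 L A B C by fact
 show S: "levy_data L A' B' C'"
  unfolding A'_def B'_def C'_def by (rule levy_data.intro levy_density_scale ld r)+
 interpret S: levy_data "r * ga1" "r * ga2" L A' B' C' by (rule S)
 have "S.N1.R z = of_real r * N1.R z" for z unfolding S.N1.R_def S.N1.phi_def N1.R_def N1.phi_def
  by (simp only: S.integral_marginal(1) integral_marginal(1) phi_integrand_measurable)
   (simp only: A'_def scaleR_conv_of_real of_real_mult mult.assoc integral_mult_right_zero distrib_left)
 moreover have "S.N2.R z = of_real r * N2.R z" for z unfolding S.N2.R_def S.N2.phi_def N2.R_def N2.phi_def
  by (simp only: S.integral_marginal(2) integral_marginal(2) phi_integrand_measurable)
   (simp only: B'_def scaleR_conv_of_real of_real_mult mult.assoc integral_mult_right_zero distrib_left)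
 moreover have "S.q ze om = of_real r * q ze om" for ze om
  unfolding S.q_def q_def cauchy2_def S.c_def c_def integral_mult_right_zero[symmetric] by (simp add: C'_def mult.assoc)
 ultimately show "S.lk p = of_real r * lk p" by (simp only: S.lk_def lk_def distrib_left mult.left_commute)
qed

section \<open>Uniqueness of laws and of R-transforms\<close>

lemma cauchy_transform_holomorphic:
 assumes "borel_law m"
 shows "cauchy_transform m holomorphic_on - \<real>"
proof -
 have [measurable_cong]: "sets m = sets borel" and "prob_space m" using assms by (auto simp: borel_law_def)
 hence "(%ze. \<integral>p. 1 / (ze - cor p) \<partial>m) holomorphic_on - \<real>"
  by (intro cauchy_integral_holomorphic[where K=1] prob_space.finite_measure) auto
 thus ?thesis by (simp add: cauchy_transform_def[abs_def])
qed

lemma cauchy_transform_cnj: "cauchy_transform m (cnj z) = cnj (cauchy_transform m z)"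
 using Bochner_Integration.integral_cnj[of m "%x. 1 / (z - of_real x)"] by (simp add: cauchy_transform_def)

lemma integrable_cauchy_kernel:
 assumes "borel_law m" "Im z ~= 0"
 shows "integrable m (%x. 1 / (z - cor x))"
proof -
 have [measurable_cong]: "sets m = sets borel" and "prob_space m" using assms by (auto simp: borel_law_def)
 thus ?thesis by (intro integrable_bounded[OF _ _ norm_kernel_le[OF assms(2)]] prob_space.finite_measure) auto
qed

lemma cauchy_transform_determines:
 assumes m: "borel_law m" and m': "borel_law m'"
  and eq: "!!z. Im z > 0 ==> cauchy_transform m z = cauchy_transform m' z"
 shows "m = m'"
proof (rule measure_eqI)
 have s [measurable_cong, simp]: "sets m = sets borel" "sets m' = sets borel" and f: "finite_measure m" "finite_measure m'"
  using m m' by (auto simp: borel_law_def prob_space.finite_measure)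
 show "sets m = sets m'" by simp
 have Im: "Im (1 / (Complex x et - cor s)) = - poisson et (x - s)" for x et s
  by (simp add: Im_divide poisson_def add.commute)
 have I: "nn_integral M (%s. ennreal (1 * poisson et (x - s))) = ennreal (- Im (cauchy_transform M (Complex x et)))"
  if M: "borel_law M" and et: "et > 0" for M x et
 proof -
  have i: "integrable M (%s. 1 / (Complex x et - cor s))" using et by (intro integrable_cauchy_kernel[OF M]) simp
  have "integrable M (%s. poisson et (x - s))" using integrable_Im[OF i] by (simp add: Im)
  moreover have "(LINT s|M. poisson et (x - s)) = - Im (cauchy_transform M (Complex x et))"
   unfolding cauchy_transform_def integral_Im[OF i, symmetric] Im by simp
  ultimately show ?thesis using et by (simp add: nn_integral_eq_integral)
 qed
 fix A assume "A \<in> sets m"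
 hence A [measurable]: "A \<in> sets borel" by simp
 have "nn_integral m (%s. ennreal (1 * indicator A s)) = nn_integral m' (%s. ennreal (1 * indicator A s))"
 proof (rule poisson_determines[where g="%s. s" and c="%_. 1" and K=1, OF f])
  show "nn_integral m (%s. ennreal (1 * poisson et (x - s))) = nn_integral m' (%s. ennreal (1 * poisson et (x - s)))" if "et > 0" for et x
   using that by (simp only: I[OF m] I[OF m'] eq complex.sel)
 qed auto
 thus "emeasure m A = emeasure m' A" by (simp add: ennreal_indicator)
qed

lemma stolz_domain_mono2: "al <= al' ==> be <= be' ==> stolz_domain al be \<subseteq> stolz_domain al' be'"
 unfolding stolz_domain_iff subset_iff  by (auto intro: less_le_trans)

lemma product_domain_mono2: "al <= al' ==> be <= be' ==> product_domain al be \<subseteq> product_domain al' be'"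
 using stolz_domain_mono2[of al al' be be'] by (auto simp: product_domain_def)

lemma R_transform_subset:
 assumes "R_transform m al be f" "al' <= al" "be' <= be"
 shows "R_transform m al' be' f" using assms stolz_domain_mono2[OF assms(2,3)] unfolding R_transform_def
 by (meson holomorphic_on_subset subsetD tendsto_within_subset)

lemma R_transform_cong:
 assumes "R_transform m al be f" and eq: "!!z. z \<in> stolz_domain al be ==> f z = g z"
 shows "R_transform m al be g"
proof -
 have "((%z. z * f z) ---> 0) (at 0 within stolz_domain al be) \<longleftrightarrow> ((%z. z * g z) ---> 0) (at 0 within stolz_domain al be)"
  by (intro Lim_cong_within) (auto simp: eq)
 thus ?thesis using assms holomorphic_cong[of "stolz_domain al be" _ f g] by (auto simp: R_transform_def)
qed

lemma axis_in_stolz_domain: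
 assumes "al > 0" "et ~= 0" "abs et < be"
 shows "Complex 0 et \<in> stolz_domain al be" using assms by (simp add: stolz_domain_iff)

lemma open_stolz_angle: "open (stolz_angle al be)"
 unfolding stolz_angle_def by (intro open_Collect_conj open_Collect_less continuous_intros)

lemma open_stolz_domain: "open (stolz_domain al be)"
proof -
 have "cnj ` stolz_angle al be = cnj -` stolz_angle al be" by (auto simp: image_iff) (metis complex_cnj_cnj)
 thus ?thesis unfolding stolz_domain_def by (auto intro!: open_stolz_angle open_vimage)
qed

text \<open>\<open>H z = 1 / z + f z\<close> has the Cauchy transform as a left inverse, so it is
  injective and its image accumulates at \<open>H z0\<close>. Both Cauchy transforms agree on the
  image, hence on the half plane of \<open>H z0\<close>, and by conjugation on the other
  one.\<close>

lemma R_transform_determines_law: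
 assumes m: "borel_law m" and m': "borel_law m'" and ab: "al > 0" "be > 0"
  and f: "R_transform m al be f" and f': "R_transform m' al be f"
 shows "m = m'"
proof -
 let ?S = "stolz_domain al be"
 define H where "H z = 1 / z + f z" for z
 have H: "Im (H z) ~= 0" "cauchy_transform m (H z) = z" "cauchy_transform m' (H z) = z" if "z \<in> ?S" for z
  using f f' that unfolding R_transform_def H_def complex_is_Real_iff by blast+
 define z0 where "z0 = Complex 0 (be / 2)"
 have z0: "z0 \<in> ?S" unfolding z0_def using ab by (intro axis_in_stolz_domain) auto
 \<comment> \<open>The notion of R-transform leaves open which half plane contains
   \<open>H z0\<close>.\<close>
 define U where "U = {z. 0 < Im z * Im (H z0)}"
 have U: "open U" "connected U" "U \<subseteq> - \<real>"
 proof -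
  have "U = (if 0 < Im (H z0) then {z. 0 < Im z} else {z. Im z < 0})"
   using H(1)[OF z0] by (auto simp: U_def zero_less_mult_iff)
  moreover have "open {z. 0 < Im z}" "open {z. Im z < 0}" "connected {z. 0 < Im z}" "connected {z. Im z < 0}"
   by (simp_all add: open_halfspace_Im_gt open_halfspace_Im_lt convex_connected convex_halfspace_Im_gt convex_halfspace_Im_lt)
  ultimately show "open U" "connected U" by simp_all
  show "U \<subseteq> - \<real>" by (auto simp: U_def complex_is_Real_iff)
 qed
 have cont: "isCont H z0"
 proof -
  have "f holomorphic_on ?S" using f by (simp add: R_transform_def)
  hence "isCont f z0"
   using z0 open_stolz_domain holomorphic_on_imp_continuous_on continuous_on_eq_continuous_at by blast
  thus ?thesis using stolz_domain_nonreal(1)[OF z0] unfolding H_def by (intro continuous_intros) auto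
 qed
 have hol: "(%z. cauchy_transform m z - cauchy_transform m' z) holomorphic_on U"
  using cauchy_transform_holomorphic[OF m] cauchy_transform_holomorphic[OF m'] U(3)
  by (intro holomorphic_intros) auto
 have H0: "H z0 \<in> U" using H(1)[OF z0] by (auto simp: U_def zero_less_mult_iff)
 have lp: "H z0 islimpt (H ` ?S \<inter> U)" unfolding islimpt_approachable
 proof (intro allI impI)
  fix e :: real assume "e > 0"
  have "\<forall>\<^sub>F z in at z0. z \<in> ?S & dist (H z) (H z0) < e & H z \<in> U & z ~= z0"
   by (intro eventually_conj eventually_at_in_open'[OF open_stolz_domain z0] tendstoD[OF cont[unfolded isCont_def] `e > 0`]
     topological_tendstoD[OF cont[unfolded isCont_def] U(1) H0] eventually_neq_at_within)
  then obtain z where zS: "z \<in> ?S" and dH: "dist (H z) (H z0) < e" and "H z \<in> U" "z ~= z0"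
   using eventually_happens'[OF at_neq_bot, of _ z0] by blast
  moreover have "H z ~= H z0" using H(2)[OF zS] H(2)[OF z0] `z ~= z0` by auto
  ultimately show "\<exists>x'\<in>H ` ?S \<inter> U. x' ~= H z0 & dist x' (H z0) < e"  by blast
 qed
 have eq: "cauchy_transform m z = cauchy_transform m' z" if "z \<in> U" for z
 proof -
  have "cauchy_transform m z - cauchy_transform m' z = 0"
   by (rule analytic_continuation[OF hol U(1,2) _ H0 lp _ that]) (auto simp: H)
  thus ?thesis by simp
 qed
 show ?thesis
 proof (rule cauchy_transform_determines[OF m m'])
  fix z assume "Im z > 0"
  hence "z \<in> U \<or> cnj z \<in> U" using H(1)[OF z0] by (auto simp: U_def zero_less_mult_iff)
  thus "cauchy_transform m z = cauchy_transform m' z"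
   using eq[of z] eq[of "cnj z"] by (auto simp: cauchy_transform_cnj)
 qed
qed

text \<open>A perturbation this small uses up at most half of the margin in
  \<open>stolz_denominator\<close>, hence the factor 2.\<close>

lemma stolz_kernel:
 assumes z: "z \<in> stolz_domain al be" and a: "norm a * sqrt (1 + al^2) <= 1 / 2"
 shows "1 + a - z * cor s ~= 0" "norm (1 / (1 + a - z * cor s)) <= 2 * sqrt (1 + al^2)"
proof -
 define d where "d = 1 + a - z * cor s"
 have "1 <= sqrt (1 + al^2) * norm (d - a)" using stolz_denominator[OF z, of s] by (simp add: d_def)
 also have "... <= sqrt (1 + al^2) * (norm d + norm a)" by (intro mult_left_mono norm_triangle_ineq4) simp
 finally have *: "1 / 2 <= sqrt (1 + al^2) * norm d" using a by (simp add: distrib_left mult.commute[of "sqrt _"])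
 thus nz: "d ~= 0" by auto
 show "norm (1 / d) <= 2 * sqrt (1 + al^2)" using * by (simp add: norm_divide divide_le_eq)
qed

text \<open>If \<open>u\<close> and \<open>u'\<close> are both mapped to \<open>z\<close>,
  subtracting the Cauchy transforms leaves \<open>(u' - u) * z^2\<close> times an integral that
  tends to 1 as \<open>z\<close> tends to 0 in the Stolz domain; so \<open>u = u'\<close> close to
  0. In this way injectivity of the Cauchy transform is not presupposed.\<close>

lemma R_transform_unique:
 assumes m: "borel_law m" and f: "R_transform m al be f" and f': "R_transform m al be f'" and "be > 0"
 obtains be0 where "0 < be0" "be0 <= be" "!!z. z \<in> stolz_domain al be0 ==> f z = f' z"
proof -
 interpret prob_space m using m by (simp add: borel_law_def)
 have [measurable_cong]: "sets m = sets borel" using m by (simp add: borel_law_def)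
 let ?F = "at 0 within stolz_domain al be"
 let ?I = "%z. \<integral>x. 1 / ((1 + z * f z - z * of_real x) * (1 + z * f' z - z * of_real x)) \<partial>m"
 have lims: "((%z. z * f z) ---> 0) ?F" "((%z. z * f' z) ---> 0) ?F" using f f' by (simp_all add: R_transform_def)
 define K where "K = sqrt (1 + al^2)"
 have K: "K > 0" unfolding K_def by (rule sqrt_1_sq_pos)
 have "(?I ---> (LINT x|m. 1 / ((1 + 0 - 0 * of_real x) * (1 + 0 - 0 * of_real x)))) ?F"
  unfolding tendsto_at_iff_sequentially comp_def
 proof safe
  fix X assume X: "\<forall>i. X i \<in> stolz_domain al be - {0}" and X0: "X ----> (0 :: complex)"
  have lim: "(%i. X i * f (X i)) ----> 0" "(%i. X i * f' (X i)) ----> 0"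
   using lims X X0 unfolding tendsto_at_iff_sequentially comp_def by blast+
  have "\<forall>\<^sub>F i in sequentially. norm (X i * f (X i)) < 1 / (2 * K) & norm (X i * f' (X i)) < 1 / (2 * K)"
   using tendstoD[OF lim(1), of "1 / (2 * K)"] tendstoD[OF lim(2), of "1 / (2 * K)"] K by (simp add: eventually_conj)
  then obtain N where N: "!!i. i \<ge> N ==> norm (X i * f (X i)) < 1 / (2 * K) & norm (X i * f' (X i)) < 1 / (2 * K)"
   unfolding eventually_sequentially by blast
  have "(%i. ?I (X (i + N))) ----> (LINT x|m. 1 / ((1 + 0 - 0 * of_real x) * (1 + 0 - 0 * of_real x)))"
  proof (rule integral_dominated_convergence[where w="%_. (2 * K) * (2 * K)"])
   show "AE x in m. (%i. 1 / ((1 + X (i + N) * f (X (i + N)) - X (i + N) * of_real x) * (1 + X (i + N) * f' (X (i + N)) - X (i + N) * of_real x)))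
     ----> 1 / ((1 + 0 - 0 * of_real x) * (1 + 0 - 0 * of_real x))"
    by (intro AE_I2 tendsto_intros LIMSEQ_ignore_initial_segment[OF lim(1)] LIMSEQ_ignore_initial_segment[OF lim(2)] LIMSEQ_ignore_initial_segment[OF X0]) simp
   show "AE x in m. norm (1 / ((1 + X (i + N) * f (X (i + N)) - X (i + N) * of_real x) * (1 + X (i + N) * f' (X (i + N)) - X (i + N) * of_real x)))
     <= (2 * K) * (2 * K)" for i
   proof (rule AE_I2)
    fix x
    have b: "norm (X (i + N) * f (X (i + N))) * K <= 1 / 2" "norm (X (i + N) * f' (X (i + N))) * K <= 1 / 2"
     using N[of "i + N"] K by (simp_all add: field_simps)
    have S: "X (i + N) \<in> stolz_domain al be" using X by blast
    show "norm (1 / ((1 + X (i + N) * f (X (i + N)) - X (i + N) * of_real x) * (1 + X (i + N) * f' (X (i + N)) - X (i + N) * of_real x))) <= (2 * K) * (2 * K)"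
     using mult_mono[OF stolz_kernel(2)[OF S b(1)[unfolded K_def], of x] stolz_kernel(2)[OF S b(2)[unfolded K_def], of x]]
     by (simp add: norm_divide norm_mult K_def)
   qed
  qed simp_all
  thus "(%i. ?I (X i)) ----> (LINT x|m. 1 / ((1 + 0 - 0 * of_real x) * (1 + 0 - 0 * of_real x)))"
   by (rule LIMSEQ_offset)
 qed
 hence I1: "(?I ---> 1) ?F" using prob_space by simp
 have "\<forall>\<^sub>F z in ?F. ?I z ~= 0" using tendsto_imp_eventually_ne[OF I1] by simp
 then obtain d where d: "d > 0" "!!z. z \<in> stolz_domain al be ==> z ~= 0 ==> dist z 0 < d ==> ?I z ~= 0"
  unfolding eventually_at by blast
 show thesis
 proof (rule that)
  show "0 < min be (d / K)" "min be (d / K) <= be" using d K `be > 0` by auto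
  fix z assume z: "z \<in> stolz_domain al (min be (d / K))"
  have zS: "z \<in> stolz_domain al be" using z stolz_domain_mono[of "min be (d / K)" be] by auto
  have z0: "z ~= 0" using stolz_domain_nonreal(1)[OF z] by auto
  have "norm z <= K * abs (Im z)" using norm_stolz_domain_le[OF z] by (simp add: K_def)
  also have "... < K * (d / K)" using z K by (intro mult_strict_left_mono) (auto simp: stolz_domain_iff)
  finally have I: "?I z ~= 0" using K d(2)[OF zS z0] by simp
  define u u' where "u = 1 / z + f z" and "u' = 1 / z + f' z"
  have u: "Im u ~= 0" "Im u' ~= 0" and G: "cauchy_transform m u = z" "cauchy_transform m u' = z"
   using f f' zS unfolding R_transform_def u_def u'_def complex_is_Real_iff by blast+
  have zu: "1 + z * f z = z * u" "1 + z * f' z = z * u'" using z0 by (simp_all add: u_def u'_def distrib_left)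
  have "0 = (LINT x|m. 1 / (u - of_real x) - 1 / (u' - of_real x))"
   using Bochner_Integration.integral_diff[OF integrable_cauchy_kernel[OF m u(1)] integrable_cauchy_kernel[OF m u(2)]] G
   by (simp add: cauchy_transform_def)
  also have "... = (LINT x|m. (u' - u) * z^2 * (1 / ((1 + z * f z - z * of_real x) * (1 + z * f' z - z * of_real x))))"
  proof (intro Bochner_Integration.integral_cong refl)
   fix x
   have dz: "z * u - z * of_real x = z * (u - of_real x)" "z * u' - z * of_real x = z * (u' - of_real x)" by (simp_all add: right_diff_distrib)
   have "(u - cor x) ~= 0" "(u' - cor x) ~= 0" by (rule nonreal_diff_nonzero[OF u(1)], rule nonreal_diff_nonzero[OF u(2)])
   thus "1 / (u - of_real x) - 1 / (u' - of_real x) = (u' - u) * z^2 * (1 / ((1 + z * f z - z * of_real x) * (1 + z * f' z - z * of_real x)))"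
    unfolding zu dz using z0 by (simp add: divide_simps power2_eq_square)
  qed
  also have "... = (u' - u) * z^2 * ?I z" by (rule integral_mult_right_zero)
  finally have "u' = u" using z0 I by simp
  thus "f z = f' z" by (simp add: u_def u'_def)
 qed
qed

section \<open>Marginal transforms as limits of the bi-free transform\<close>

definition bifree_local ::
 "plane measure => real => real => (complex => complex) => (complex => complex) => (complex \<times> complex => complex) => bool" where
 "bifree_local mm al be R1 R2 R \<longleftrightarrow> borel_law mm \<and>
   R_transform (marginal1 mm) al be R1 & R_transform (marginal2 mm) al be R2 \<and>
   (\<forall>(z, w)\<in>product_domain al be. bifree_h mm R1 R2 z w ~= 0 \<and>
    R (z, w) = z * R1 z + w * R2 w + (1 - 1 / bifree_h mm R1 R2 z w))"

lemma bifree_local_subset: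
 assumes "bifree_local mm al be R1 R2 R" "al' <= al" "be' <= be"
 shows "bifree_local mm al' be' R1 R2 R" unfolding bifree_local_def
proof (intro conjI)
 show "R_transform (marginal1 mm) al' be' R1" "R_transform (marginal2 mm) al' be' R2" "borel_law mm"
  using assms R_transform_subset by (auto simp: bifree_local_def)
 show "\<forall>(z, w)\<in>product_domain al' be'. bifree_h mm R1 R2 z w ~= 0 \<and>
   R (z, w) = z * R1 z + w * R2 w + (1 - 1 / bifree_h mm R1 R2 z w)"
  using assms(1) unfolding bifree_local_def by (intro ballI) (meson product_domain_mono2[OF assms(2,3)] subsetD)
qed

lemma stolz_kernel_average:
 fixes a :: "nat => complex"
 assumes "finite_measure M" and [measurable]: "f \<in> borel_measurable M" "g \<in> borel_measurable M"
  and u: "Im u ~= 0" and X: "!!i. X i \<in> stolz_domain al be" "X ----> 0" and a: "a ----> 0"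
 shows "(%i. \<integral>p. 1 / (u - of_real (f p)) * (1 / (1 + a i - X i * of_real (g p))) \<partial>M) ----> (LINT p|M. 1 / (u - of_real (f p)))"
proof -
 interpret finite_measure M by fact
 define K where "K = sqrt (1 + al^2)"
 have K: "K > 0" unfolding K_def by (rule sqrt_1_sq_pos)
 have "\<forall>\<^sub>F i in sequentially. norm (a i) < 1 / (2 * K)" using tendstoD[OF a, of "1 / (2 * K)"] K by simp
 then obtain N where N: "!!i. i \<ge> N ==> norm (a i) < 1 / (2 * K)" unfolding eventually_sequentially by blast
 have "(%i. \<integral>p. 1 / (u - of_real (f p)) * (1 / (1 + a (i + N) - X (i + N) * of_real (g p))) \<partial>M)
  ----> (LINT p|M. 1 / (u - of_real (f p)) * (1 / (1 + 0 - 0 * of_real (g p))))"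
 proof (rule integral_dominated_convergence[where w="%_. kernel_bound u * (2 * K)"])
  show "AE p in M. (%i. 1 / (u - of_real (f p)) * (1 / (1 + a (i + N) - X (i + N) * of_real (g p))))
    ----> 1 / (u - of_real (f p)) * (1 / (1 + 0 - 0 * of_real (g p)))"
   by (intro AE_I2 tendsto_intros LIMSEQ_ignore_initial_segment[OF a] LIMSEQ_ignore_initial_segment[OF X(2)]) simp
  show "AE p in M. norm (1 / (u - of_real (f p)) * (1 / (1 + a (i + N) - X (i + N) * of_real (g p)))) <= kernel_bound u * (2 * K)" for i
  proof (rule AE_I2)
   fix p
   have "norm (a (i + N)) * K <= 1 / 2" using N[of "i + N"] K by (simp add: field_simps)
   thus "norm (1 / (u - of_real (f p)) * (1 / (1 + a (i + N) - X (i + N) * of_real (g p)))) <= kernel_bound u * (2 * K)"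
    unfolding norm_mult K_def
    using kernel_bound_ge_1[of u] by (intro mult_mono norm_kernel_le u stolz_kernel(2)[OF X(1)]) auto
  qed
 qed simp_all
 thus ?thesis by (rule LIMSEQ_offset[where k=N, OF tendsto_eq_rhs]) simp
qed

text \<open>When one variable tends to 0 in the Stolz domain, \<open>bifree_h\<close> tends to the
  marginal Cauchy transform at \<open>1 / z + R1 z\<close>, divided by \<open>z\<close>, that is, to
  1. Hence the bi-free transform alone determines both marginal transforms.\<close>

lemma bifree_local_tendsto:
 assumes loc: "bifree_local mm al be R1 R2 R" and z: "z \<in> stolz_domain al be"
  and X: "!!i. X i \<in> stolz_domain al be" "X ----> 0"
 shows "(%i. R (z, X i)) ----> z * R1 z" "(%i. R (X i, z)) ----> z * R2 z"
proof -
 have mm: "borel_law mm" and R1: "R_transform (marginal1 mm) al be R1" and R2: "R_transform (marginal2 mm) al be R2"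
  and eq: "!!z w. z \<in> stolz_domain al be ==> w \<in> stolz_domain al be ==>
    R (z, w) = z * R1 z + w * R2 w + (1 - 1 / bifree_h mm R1 R2 z w)"
  using loc unfolding bifree_local_def product_domain_def by auto
 have s [measurable_cong]: "sets mm = sets borel" and fin: "finite_measure mm"
  using mm by (auto simp: borel_law_def prob_space.finite_measure)
 have X0: "X i ~= 0" for i using stolz_domain_nonreal(1)[OF X(1)[of i]] by auto
 have z0: "z ~= 0" using stolz_domain_nonreal(1)[OF z] by auto
 have XR: "(%i. X i * R1 (X i)) ----> 0" "(%i. X i * R2 (X i)) ----> 0"
  using R1 R2 X X0 unfolding R_transform_def tendsto_at_iff_sequentially comp_def by blast+
 have u: "Im (1 / z + R1 z) ~= 0" "Im (1 / z + R2 z) ~= 0" "cauchy_transform (marginal1 mm) (1 / z + R1 z) = z" "cauchy_transform (marginal2 mm) (1 / z + R2 z) = z"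
  using R1 R2 z unfolding R_transform_def complex_is_Real_iff by blast+
 have k: "1 / (u * (1 / x + r - y)) / (z * x) = 1 / u * (1 / (1 + x * r - x * y)) / z" if "x ~= 0" for u x r y :: complex
 proof -
  have "x * (1 / x + r - y) = 1 + x * r - x * y" using that by (simp add: algebra_simps)
  thus ?thesis by (simp flip: `x * (1 / x + r - y) = 1 + x * r - x * y`)
 qed
 have h1: "bifree_h mm R1 R2 z (X i) = (LINT p|mm. 1 / (1 / z + R1 z - of_real (fst p)) * (1 / (1 + X i * R2 (X i) - X i * of_real (snd p)))) / z" for i
  unfolding bifree_h_def cauchy_transform2_eq integral_divide_zero[symmetric] k[OF X0] ..
 have h2: "bifree_h mm R1 R2 (X i) z = (LINT p|mm. 1 / (1 / z + R2 z - of_real (snd p)) * (1 / (1 + X i * R1 (X i) - X i * of_real (fst p)))) / z" for i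
  unfolding bifree_h_def cauchy_transform2_eq integral_divide_zero[symmetric] k[OF X0, symmetric] by (simp only: mult.commute)
 have l1: "(%i. bifree_h mm R1 R2 z (X i)) ----> z / z"
  unfolding h1 using stolz_kernel_average[OF fin _ _ u(1) X XR(2), of fst snd] u(3) z0
  by (intro tendsto_divide tendsto_const) (simp_all add: cauchy_transform_marginal[OF s])
 have l2: "(%i. bifree_h mm R1 R2 (X i) z) ----> z / z"
  unfolding h2 using stolz_kernel_average[OF fin _ _ u(2) X XR(1), of snd fst] u(4) z0
  by (intro tendsto_divide tendsto_const) (simp_all add: cauchy_transform_marginal[OF s])
 have "(%i. z * R1 z + X i * R2 (X i) + (1 - 1 / bifree_h mm R1 R2 z (X i))) ----> z * R1 z + 0 + (1 - 1 / (z / z))"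
  using z0 by (intro tendsto_intros XR l1) simp
 thus "(%i. R (z, X i)) ----> z * R1 z" using z0 by (simp add: eq[OF z X(1)])
 have "(%i. X i * R1 (X i) + z * R2 z + (1 - 1 / bifree_h mm R1 R2 (X i) z)) ----> 0 + z * R2 z + (1 - 1 / (z / z))"
  using z0 by (intro tendsto_intros XR l2) simp
 thus "(%i. R (X i, z)) ----> z * R2 z" using z0 by (simp add: eq[OF X(1) z])
qed

section \<open>One-dimensional laws with a prescribed R-transform\<close>

context nevanlinna_pair
begin

text \<open>The line is embedded in the plane as the axis \<open>t = 0\<close>, where compatibility
  holds with \<open>B = C = 0\<close>; the first marginal of the planar law is the one
  wanted.\<close>

lemma law_with_R_transform_1d: "\<exists>m. borel_law m & (\<forall>al. \<exists>be0>0. \<forall>be\<le>be0. R_transform m al be R)"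
proof -
 define L where "L = distr si borel (%s. (s, 0 :: real))"
 define A where "A p = (if snd p = 0 then 1 else 0 :: real)" for p :: "plane"
 have [measurable]: "A \<in> bor" unfolding A_def[abs_def] by measurable
 have "finite_borel L" unfolding finite_borel_def L_def by (auto intro!: finite_measure.finite_measure_distr finite_si)
 then interpret L: levy_data ga 0 L A "%_. 0" "%_. 0" by unfold_locales (auto simp: levy_density_def A_def)
 have eq: "marginal1 (dens L A) = si"
 proof (rule measure_eqI)
  show "sets (marginal1 (dens L A)) = sets si" by simp
  fix S assume "S \<in> sets (marginal1 (dens L A))"
  hence S [measurable]: "S \<in> sets borel" by simp
  have pre: "fst -` S \<in> sets (borel :: plane measure)" using measurable_sets[OF measurable_fst_borel S] by simp
  have "emeasure (marginal1 (dens L A)) S = emeasure (dens L A) (fst -` S)"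
   unfolding marginal1_def by (subst emeasure_distr) (auto simp: L_def)
  also have "... = nn_integral L (%p. ennreal (A p) * indicator S (fst p))"
   using pre by (subst emeasure_density) (auto simp: indicator_def)
  also have "... = nn_integral si (%s. indicator S s)"
   unfolding L_def by (subst nn_integral_distr) (auto simp: A_def)
  finally show "emeasure (marginal1 (dens L A)) S = emeasure si S" by simp
 qed
 obtain vv where vv: "borel_law vv" "!!al. \<exists>be0>0. \<forall>be\<le>be0. R_transform (marginal1 vv) al be L.N1.R & R_transform (marginal2 vv) al be L.N2.R"
  by (rule L.law_bifree_R_transform) (rule that)
 have "borel_law (marginal1 vv)"
  using vv(1) unfolding borel_law_def marginal1_def by (auto intro!: prob_space.prob_space_distr)
 moreover have "\<exists>be0>0. \<forall>be\<le>be0. R_transform (marginal1 vv) al be R" for al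
  using vv(2)[of al] unfolding eq by blast
 ultimately show ?thesis by blast
qed

lemma nevanlinna_pair_scale:
 assumes r: "0 <= r"
 shows "nevanlinna_pair (density si (%_. ennreal r))" "nevanlinna_pair.R (r * ga) (density si (%_. ennreal r)) z = of_real r * R z"
proof -
 have "emeasure (density si (%_. ennreal r)) (space si) < \<infinity>"
  by (subst emeasure_density[OF _ sets.top]) (simp_all add: ennreal_mult_eq_top_iff less_top[symmetric])
 thus *: "nevanlinna_pair (density si (%_. ennreal r))"
  by unfold_locales (auto simp: finite_borel_def intro!: finite_measureI)
 interpret S: nevanlinna_pair "r * ga" "density si (%_. ennreal r)" by fact
 have "(LINT s|(density si (%_. ennreal r)). f s) = of_real r * (LINT s|si. f s)" if [measurable]: "f \<in> bor" for f :: "real => complex"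
  using r by (subst integral_density) (auto simp: scaleR_conv_of_real)
 hence "S.phi ze = of_real r * phi ze" for ze
  unfolding S.phi_def phi_def by (simp only: phi_integrand_measurable distrib_left of_real_mult)
 thus "S.R z = of_real r * R z" by (simp add: S.R_def R_def)
qed

text \<open>Before the definite description applies, the law has to be free infinitely divisible.
  For each \<open>n\<close>, laws \<open>ka j\<close> with transform \<open>(j / n) * R\<close> are
  available; each is the free convolution of its predecessor with \<open>ka 1\<close>, and
  \<open>ka n\<close> is the given law by uniqueness.\<close>

lemma free_inf_div_law_eqI:
 assumes m: "borel_law m" and ab: "al > 0" "be > 0" and f: "R_transform m al be f" and eq: "!!z. z \<in> stolz_domain al be ==> f z = R z"
 shows "free_inf_div_law ga si = m"
proof -
 let ?Ph = "%z. of_real ga + (LINT x|si. (z + of_real x) / (1 - z * of_real x))"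
 have RPh: "R z = ?Ph z" if "z \<in> - \<real>" for z using that by (intro R_eq) (simp add: complex_is_Real_iff)
 have mR: "R_transform m al be R" by (rule R_transform_cong[OF f eq])
 \<comment> \<open>Transforms given on unrelated Stolz domains are compared on a common smaller
   one.\<close>
 have unique: "m' = m''" if "borel_law m'" "borel_law m''" "R_transform m' al1 be1 f1" "R_transform m'' al2 be2 f2"
   "al1 > 0" "be1 > 0" "al2 > 0" "be2 > 0" "!!z. z \<in> - \<real> ==> f1 z = f2 z" for m' m'' al1 be1 al2 be2 f1 f2
 proof (rule R_transform_determines_law[OF that(1,2)])
  show "0 < min al1 al2" "0 < min be1 be2" using that by auto
  show "R_transform m' (min al1 al2) (min be1 be2) f1" by (rule R_transform_subset[OF that(3)]) auto
  show "R_transform m'' (min al1 al2) (min be1 be2) f1"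
   by (rule R_transform_cong[OF R_transform_subset[OF that(4)]]) (use that(9) stolz_domain_nonreal(2) in fastforce)+
 qed
 have on: "R_transform_on m (- \<real>) ?Ph" unfolding R_transform_on_def
 proof (intro conjI exI)
  show "?Ph holomorphic_on - \<real>" by (rule holomorphic_transform[OF R_holomorphic RPh])
  show "R_transform m al be ?Ph" using RPh stolz_domain_nonreal(2) by (intro R_transform_cong[OF mR]) blast
 qed (use ab stolz_domain_nonreal(2) in auto)
 have "\<exists>mm. borel_law mm & free_conv_power mm n m" if n: "n \<ge> 2" for n
 proof -
  let ?r = "%j. real j / real n"
  have "\<exists>m. borel_law m & (\<forall>al. \<exists>be0>0. \<forall>be\<le>be0. R_transform m al be (%z. of_real (?r j) * R z))" for j
  proof -
   interpret S: nevanlinna_pair "?r j * ga" "density si (%_. ennreal (?r j))" by (rule nevanlinna_pair_scale) simp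
   have "S.R = (%z. of_real (?r j) * R z)" by (rule ext, rule nevanlinna_pair_scale) simp
   thus ?thesis using S.law_with_R_transform_1d by simp
  qed
  then obtain ka where ka: "!!j. borel_law (ka j)" "!!j. \<forall>al. \<exists>be0>0. \<forall>be\<le>be0. R_transform (ka j) al be (%z. of_real (?r j) * R z)"
   by metis
  have k1: "\<exists>b>0. \<forall>be\<le>b. R_transform (ka j) 1 be (%z. of_real (?r j) * R z)" for j using ka(2) by blast
  \<comment> \<open>Convolution powers start at exponent 1, hence \<open>Suc j\<close>.\<close>
  have "free_conv_power (ka 1) (Suc j) (ka (Suc j))" for j
  proof (induction j)
   case 0
   show ?case using free_conv_power.one[of "ka 1"] by simp
  next
   case (Suc j)
   obtain b where b: "b > 0" "\<forall>be\<le>b. R_transform (ka (Suc j)) 1 be (%z. of_real (?r (Suc j)) * R z)" using k1 by blast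
   obtain b' where b': "b' > 0" "\<forall>be\<le>b'. R_transform (ka 1) 1 be (%z. of_real (?r 1) * R z)" using k1 by blast
   obtain b'' where b'': "b'' > 0" "\<forall>be\<le>b''. R_transform (ka (Suc (Suc j))) 1 be (%z. of_real (?r (Suc (Suc j))) * R z)" using k1 by blast
   let ?b = "min b (min b' b'')"
   have "R_transform (ka (Suc (Suc j))) 1 ?b (%z. of_real (?r (Suc j)) * R z + of_real (?r 1) * R z)"
   proof (rule R_transform_cong)
    show "R_transform (ka (Suc (Suc j))) 1 ?b (%z. of_real (?r (Suc (Suc j))) * R z)" using b''(2) by simp
    have "?r (Suc (Suc j)) = ?r (Suc j) + ?r 1" by (simp add: add_divide_distrib)
    thus "of_real (?r (Suc (Suc j))) * R z = of_real (?r (Suc j)) * R z + of_real (?r 1) * R z" for z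
     by (simp only: of_real_add distrib_right)
   qed
   hence "free_add_conv (ka (Suc j)) (ka 1) (ka (Suc (Suc j)))"
    unfolding free_add_conv_def using ka(1) b b' b''(1)
    by (intro conjI exI[of _ 1] exI[of _ ?b] exI[of _ "%z. of_real (?r (Suc j)) * R z"] exI[of _ "%z. of_real (?r 1) * R z"]) simp_all
   thus ?case by (rule free_conv_power.step[OF Suc])
  qed
  from this[of "n - 1"] have p: "free_conv_power (ka 1) n (ka n)" using n by simp
  obtain b where b: "b > 0" "\<forall>be\<le>b. R_transform (ka n) 1 be (%z. of_real (?r n) * R z)" using k1 by blast
  have "ka n = m" by (rule unique[OF ka(1) m b(2)[rule_format, OF order_refl] mR _ b(1) ab]) (use n in auto)
  thus ?thesis using p ka(1) by auto
 qed
 hence "free_inf_divisible m" unfolding free_inf_divisible_def using m by blast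
 moreover have "m' = m" if m': "free_inf_divisible m'" "R_transform_on m' (- \<real>) ?Ph" for m'
 proof -
  obtain al' be' where 1: "al' > 0" "be' > 0" "R_transform m' al' be' ?Ph"
   using m'(2) unfolding R_transform_on_def by blast
  show ?thesis
   by (rule unique[OF _ m 1(3) mR 1(1,2) ab]) (use m'(1) RPh in \<open>auto simp: free_inf_divisible_def\<close>)
 qed
 ultimately show ?thesis
  unfolding free_inf_div_law_def using on by (intro the_equality conjI) (assumption, assumption, elim conjE)
qed

end

section \<open>Weak limits of finite measures\<close>

lemma finite_borel_density_bounded:
 fixes L :: "plane measure"
 assumes L: "finite_borel L" and [measurable]: "d \<in> bor" and d: "!!p. d p <= K"
 shows "finite_borel (dens L d)"
proof -
 have s [measurable_cong]: "sets L = sets borel" and f: "finite_measure L" using L by (auto simp: finite_borel_def)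
 have "emeasure (dens L d) (space L) = nn_integral L (%p. ennreal (d p) * indicator (space L) p)"
  by (rule emeasure_density[OF _ sets.top]) measurable
 also have "... <= nn_integral L (%p. ennreal (max 0 K))"
  by (intro nn_integral_mono) (auto intro!: ennreal_leI d)
 also have "... < \<infinity>" using finite_measure.emeasure_finite[OF f, of "space L"] by (simp add: ennreal_mult_eq_top_iff less_top[symmetric])
 finally show ?thesis using s by (auto simp: finite_borel_def intro!: finite_measureI)
qed

lemma integral_density_const:
 fixes f :: "'a => 'b::{banach, second_countable_topology}"
 assumes "0 <= c" and [measurable]: "f \<in> borel_measurable M"
 shows "(LINT x|(density M (%_. ennreal c)). f x) = c *\<^sub>R (LINT x|M. f x)"
 using assms by (subst integral_density) auto

definition weakly_converges :: "(nat => plane measure) => plane measure => bool" where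
 "weakly_converges P P' \<longleftrightarrow> (\<forall>(h :: plane => complex) K. continuous_on UNIV h --> (\<forall>p. norm (h p) <= K) -->
   (%n. \<integral>p. h p \<partial>P n) ----> (LINT p|P'. h p))"

lemma weakly_convergesD:
 assumes "weakly_converges P P'" "continuous_on UNIV h" "!!p. norm (h p) <= K"
 shows "(%n. \<integral>p. h p \<partial>P n) ----> (LINT p|P'. (h p :: complex))"
 using assms unfolding weakly_converges_def by blast

lemma weakly_converges_subseq:
 assumes "weakly_converges P P'" "strict_mono r"
 shows "weakly_converges (%n. P (r n)) P'" unfolding weakly_converges_def
proof (intro allI impI)
 fix h :: "plane => complex" and K assume h: "continuous_on UNIV h" "\<forall>p. norm (h p) <= K"
 show "(%n. \<integral>p. h p \<partial>P (r n)) ----> (LINT p|P'. h p)"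
  using LIMSEQ_subseq_LIMSEQ[OF weakly_convergesD[OF assms(1) h(1)] assms(2)] h(2) by (auto simp: comp_def)
qed

text \<open>Along a subsequence the masses converge. With a positive limit, normalisation reduces
  the claim to laws; if the masses tend to 0, normalisation fails, but the zero measure is a
  limit.\<close>

lemma finite_weak_limit:
 fixes tt :: "nat => plane measure"
 assumes fb: "!!n. finite_borel (tt n)" and mass: "!!n. measure (tt n) UNIV <= M"
  and tight: "!!e. e > 0 ==> \<exists>N>0. \<forall>n. (LINT p|(tt n). (fst p)^2 / (N^2 + (fst p)^2)) <= e \<and>
   (LINT p|(tt n). (snd p)^2 / (N^2 + (snd p)^2)) <= e"
 obtains r tt' where "strict_mono (r :: nat => nat)" "finite_borel tt'" "weakly_converges (%n. tt (r n)) tt'"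
proof -
 have s [measurable_cong]: "sets (tt n) = sets borel" and fin: "finite_measure (tt n)" for n
  using fb by (auto simp: finite_borel_def)
 have sp: "space (tt n) = UNIV" for n using sets_eq_imp_space_eq[OF s] by simp
 define m where "m n = measure (tt n) UNIV" for n
 have "seq_compact {0..M}" by (rule compact_imp_seq_compact) simp
 moreover have "\<forall>n. m n \<in> {0..M}" using mass by (simp add: m_def)
 ultimately obtain l r0 where l: "l \<in> {0..M}" "strict_mono (r0 :: nat => nat)" "(m \<circ> r0) ----> l"
  unfolding seq_compact_def by blast
 show ?thesis
 proof (cases "l = 0")
  case True
  have "weakly_converges (%n. tt (r0 n)) (null_measure borel)" unfolding weakly_converges_def
  proof (intro allI impI)
   fix h :: "plane => complex" and K assume h: "continuous_on UNIV h" "\<forall>p. norm (h p) <= K"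
   have hb [measurable]: "h \<in> bor" using h(1) by (rule borel_measurable_continuous_onI)
   have lim0: "(%n. K * m (r0 n)) ----> 0" using tendsto_mult[OF tendsto_const l(3), of K] True by simp
   have le: "norm (LINT p|(tt (r0 n)). h p) <= K * m (r0 n)" for n
   proof -
    interpret finite_measure "tt (r0 n)" by (rule fin)
    have "norm (LINT p|(tt (r0 n)). h p) <= (LINT p|(tt (r0 n)). norm (h p))" by simp
    also have "... <= (LINT p|(tt (r0 n)). K)"
     using h(2) by (intro integral_mono integrable_const integrable_bounded[OF fin, of _ _ K]) auto
    finally show ?thesis by (simp add: m_def sp mult.commute)
   qed
   have "(%n. \<integral>p. h p \<partial>tt (r0 n)) ----> 0" by (rule Lim_null_comparison[OF always_eventually[OF allI[OF le]] lim0])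
   thus "(%n. \<integral>p. h p \<partial>tt (r0 n)) ----> (LINT p|(null_measure borel). h p)" by simp
  qed
  moreover have "finite_borel (null_measure borel :: plane measure)"
   by (auto simp: finite_borel_def intro!: finite_measureI)
  ultimately show ?thesis using l(2) by (intro that)
 next
  case False
  hence l0: "l > 0" using l(1) by simp
  have "\<forall>\<^sub>F n in sequentially. l / 2 < (m \<circ> r0) n" by (rule order_tendstoD(1)[OF l(3)]) (use l0 in simp)
  then obtain N0 where N0: "!!n. n \<ge> N0 ==> l / 2 < m (r0 n)" unfolding eventually_sequentially by auto
  define r1 where "r1 n = r0 (n + N0)" for n
  have r1: "strict_mono r1" using l(2) by (auto simp: r1_def strict_mono_def)
  have m1: "l / 2 < m (r1 n)" "0 < m (r1 n)" for n using N0[of "n + N0"] l0 by (auto simp: r1_def)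
  define mm where "mm n = density (tt (r1 n)) (%_. ennreal (1 / m (r1 n)))" for n
  have sm [measurable_cong]: "sets (mm n) = sets borel" for n by (simp add: mm_def s)
  have intmm: "(LINT p|(mm n). f p) = (1 / m (r1 n)) *\<^sub>R (LINT p|(tt (r1 n)). f p)" if [measurable]: "f \<in> bor"
   for f :: "plane => 'c::{banach, second_countable_topology}" and n
   unfolding mm_def using m1(2)[of n] by (intro integral_density_const) auto
  have law: "borel_law (mm n)" for n unfolding borel_law_def
  proof
   have "emeasure (mm n) (space (mm n)) = ennreal (1 / m (r1 n)) * emeasure (tt (r1 n)) UNIV"
    unfolding mm_def by (simp add: emeasure_density sp)
   also have "... = 1"
    using m1(2)[of n] by (simp add: finite_measure.emeasure_eq_measure[OF fin] m_def ennreal_mult[symmetric])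
   finally show "prob_space (mm n)" by (rule prob_spaceI)
  qed (rule sm)
  have "\<exists>N>0. \<forall>n. 1 - e <= (LINT p|(mm n). N^2 / (N^2 + (fst p)^2)) & 1 - e <= (LINT p|(mm n). N^2 / (N^2 + (snd p)^2))" if e: "e > 0" for e
  proof -
   \<comment> \<open>Division by a mass above \<open>l / 2\<close> turns the bound
     \<open>e * l / 2\<close> into \<open>e\<close>.\<close>
   obtain N where N: "N > 0" "!!n. (LINT p|(tt n). (fst p)^2 / (N^2 + (fst p)^2)) <= e * l / 2" "!!n. (LINT p|(tt n). (snd p)^2 / (N^2 + (snd p)^2)) <= e * l / 2"
    using tight[of "e * l / 2"] e l0 by auto
   have "1 - e <= (LINT p|(mm n). N^2 / (N^2 + (f p)^2))"
    if [measurable]: "f \<in> bor" and le: "(LINT p|(tt (r1 n)). (f p)^2 / (N^2 + (f p)^2)) <= e * l / 2" for f n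
   proof -
    interpret mm: prob_space "mm n" using law by (simp add: borel_law_def)
    have N2: "N^2 + (f p)^2 > 0" for p using N(1) by (simp add: add_pos_nonneg)
    have i: "integrable (mm n) (%p. (f p)^2 / (N^2 + (f p)^2))"
     using N2 by (intro integrable_bounded[OF mm.finite_measure_axioms, of _ 1]) auto
    have "(LINT p|(mm n). N^2 / (N^2 + (f p)^2)) = (LINT p|(mm n). 1 - (f p)^2 / (N^2 + (f p)^2))"
    proof (intro Bochner_Integration.integral_cong refl)
     show "N^2 / (N^2 + (f p)^2) = 1 - (f p)^2 / (N^2 + (f p)^2)" for p
       using N(1) by (simp add: eq_diff_eq add_divide_distrib[symmetric])
    qed
    also have "... = 1 - (LINT p|(mm n). (f p)^2 / (N^2 + (f p)^2))"
     using i by (subst Bochner_Integration.integral_diff) (auto simp: mm.prob_space)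
    also have "(LINT p|(mm n). (f p)^2 / (N^2 + (f p)^2)) = (LINT p|(tt (r1 n)). (f p)^2 / (N^2 + (f p)^2)) / m (r1 n)"
     by (subst intmm) auto
    moreover have "(LINT p|(tt (r1 n)). (f p)^2 / (N^2 + (f p)^2)) / m (r1 n) <= (e * l / 2) / (l / 2)"
     using le m1[of n] e l0 by (intro frac_le) auto
    ultimately show ?thesis using l0 by simp
   qed
   thus ?thesis using N by auto
  qed
  from weakly_convergent_subsequence[OF law this] obtain r2 vv where r2: "strict_mono (r2 :: nat => nat)" and vv: "borel_law vv"
   and lim: "!!(h :: plane => complex) K. continuous_on UNIV h ==> (!!p. norm (h p) <= K) ==>
    (%n. \<integral>p. h p \<partial>mm (r2 n)) ----> (LINT p|vv. h p)" by metis
  have svv [measurable_cong]: "sets vv = sets borel" using vv by (simp add: borel_law_def)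
  have ml: "(%n. m (r1 (r2 n))) ----> l"
   using LIMSEQ_subseq_LIMSEQ[OF l(3), of "%n. r2 n + N0"] r2 by (auto simp: r1_def comp_def strict_mono_def)
  show ?thesis
  proof (rule that)
   show "strict_mono (r1 \<circ> r2)" using r1 r2 by (rule strict_mono_o)
   show "finite_borel (density vv (%_. ennreal l))"
    using vv by (intro finite_borel_density_bounded) (auto simp: borel_law_def finite_borel_def prob_space.finite_measure)
   show "weakly_converges (%n. tt ((r1 \<circ> r2) n)) (density vv (%_. ennreal l))"
    unfolding weakly_converges_def
   proof (intro allI impI)
    fix h :: "plane => complex" and K assume h: "continuous_on UNIV h" "\<forall>p. norm (h p) <= K"
    have hb [measurable]: "h \<in> bor" using h(1) by (rule borel_measurable_continuous_onI)
    have "(%n. m (r1 (r2 n)) *\<^sub>R (LINT p|(mm (r2 n)). h p)) ----> l *\<^sub>R (LINT p|vv. h p)"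
     using h by (intro tendsto_intros ml lim) auto
    moreover have "m (r1 (r2 n)) *\<^sub>R (LINT p|(mm (r2 n)). h p) = (LINT p|(tt ((r1 \<circ> r2) n)). h p)" for n
     using m1(2)[of "r2 n"] by (subst intmm) auto
    ultimately show "(%n. \<integral>p. h p \<partial>tt ((r1 \<circ> r2) n)) ----> (LINT p|(density vv (%_. ennreal l)). h p)"
     using l0 by (subst integral_density_const) auto
   qed
  qed
 qed
qed

lemma common_density3:
 fixes P Q S :: "plane measure"
 assumes "finite_borel P" "finite_borel Q" "finite_borel S"
 obtains L p q s where "finite_borel L" "P = dens L p" "Q = dens L q" "S = dens L s"
  "p \<in> bor" "q \<in> bor" "s \<in> bor"
  "!!x. 0 <= p x & p x <= 1 & 0 <= q x & q x <= 1 & 0 <= s x & s x <= 1"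
proof -
 define L where "L = add_measure P (add_measure Q S)"
 have s: "sets P = sets borel" "sets Q = sets borel" "sets S = sets borel" and f: "finite_measure P" "finite_measure Q" "finite_measure S"
  using assms by (auto simp: finite_borel_def)
 have Ls: "sets L = sets borel" and Lf: "finite_measure L"
  unfolding L_def using s f by (auto intro!: finite_measure_add_measure)
 have em: "emeasure L A = emeasure P A + (emeasure Q A + emeasure S A)" if "A \<in> sets L" for A
  using that unfolding L_def by (simp add: emeasure_add_measure s)
 have ex: "\<exists>d. d \<in> bor & (\<forall>x. 0 <= d x & d x <= 1) & N = dens L d" if "N \<in> {P, Q, S}" for N
 proof (rule bounded_density_exists[OF Lf])
  show "sets N = sets L" using that s Ls by auto
  show "emeasure N A <= emeasure L A" if "A \<in> sets L" for A using `N \<in> _` by (auto simp: em[OF that])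
  fix D :: "plane => real" assume D: "D \<in> borel_measurable L" "!!x. 0 <= D x" "!!x. D x <= 1" "N = dens L D"
  have "D \<in> bor" using D(1) measurable_cong_sets[OF Ls refl] by auto
  thus ?thesis using D by blast
 qed
 obtain p where p: "p \<in> bor" "\<forall>x. 0 <= p x & p x <= 1" "P = dens L p" using ex[of P] by auto
 obtain q where q: "q \<in> bor" "\<forall>x. 0 <= q x & q x <= 1" "Q = dens L q" using ex[of Q] by auto
 obtain t where t: "t \<in> bor" "\<forall>x. 0 <= t x & t x <= 1" "S = dens L t" using ex[of S] by auto
 show ?thesis using p q t Ls Lf by (intro that[of L p q t]) (auto simp: finite_borel_def)
qed

lemma integral_density_pos_neg:
 fixes L :: "plane measure" and h :: "plane => 'c::{banach, second_countable_topology}"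
 assumes L: "finite_borel L" and [measurable]: "D \<in> bor" and K: "!!p. abs (D p) <= K"
  and [measurable]: "h \<in> bor" and hB: "!!p. norm (h p) <= B"
 shows "(LINT p|(dens L (%p. max 0 (D p))). h p) - (LINT p|(dens L (%p. max 0 (- D p))). h p) = (LINT p|L. D p *\<^sub>R h p)"
proof -
 have s [measurable_cong]: "sets L = sets borel" and f: "finite_measure L" using L by (auto simp: finite_borel_def)
 have b: "max 0 (D p) <= K" "max 0 (- D p) <= K" for p using K[of p] by auto
 have i: "integrable L (%p. max 0 (D p) *\<^sub>R h p)" "integrable L (%p. max 0 (- D p) *\<^sub>R h p)"
  using b hB by (intro integrable_bounded[OF f, of _ "K * B"]; auto intro!: mult_mono)+
 have "(LINT p|(dens L (%p. max 0 (D p))). h p) - (LINT p|(dens L (%p. max 0 (- D p))). h p)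
   = (LINT p|L. max 0 (D p) *\<^sub>R h p) - (LINT p|L. max 0 (- D p) *\<^sub>R h p)"
  by (subst (1 2) integral_density) auto
 also have "... = (LINT p|L. max 0 (D p) *\<^sub>R h p - max 0 (- D p) *\<^sub>R h p)"
  by (rule Bochner_Integration.integral_diff[OF i, symmetric])
 also have "... = (LINT p|L. D p *\<^sub>R h p)"
  by (intro Bochner_Integration.integral_cong) (auto simp: max_def)
 finally show ?thesis .
qed

text \<open>The positive and the negative part of \<open>D\<close> are densities of measures with
  the same Cauchy integrals; these measures coincide, so \<open>D\<close> integrates every bounded
  function to 0.\<close>

lemma kernel_functional_zero:
 fixes L :: "plane measure"
 assumes L: "finite_borel L" and D [measurable]: "D \<in> bor" and K: "!!p. abs (D p) <= K"
  and zero: "!!ze om. Im ze ~= 0 ==> Im om ~= 0 ==>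
   (LINT p|L. D p *\<^sub>R (skern ze (fst p) *
    skern om (snd p))) = 0"
  and g [measurable]: "g \<in> bor" and gB: "!!p. abs (g p) <= B"
 shows "(LINT p|L. g p * D p) = (0 :: real)"
proof -
 have s [measurable_cong]: "sets L = sets borel" and f: "finite_measure L" using L by (auto simp: finite_borel_def)
 let ?U = "dens L (%p. max 0 (D p))" and ?V = "dens L (%p. max 0 (- D p))"
 have b: "max 0 (D p) <= K" "max 0 (- D p) <= K" for p using K[of p] by auto
 have fb: "finite_borel ?U" "finite_borel ?V" by (rule finite_borel_density_bounded[OF L _ b(1)] finite_borel_density_bounded[OF L _ b(2)]; measurable)+
 note diff = integral_density_pos_neg[OF L D K]
 have "?U = ?V"
 proof (rule cauchy_kernel_determines[OF fb])
  fix ze om :: complex assume nz: "Im ze ~= 0" "Im om ~= 0"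
  let ?h = "%p :: plane. skern ze (fst p) *
    skern om (snd p)"
  have "norm (?h p) <= kernel_bound ze * kernel_bound om" for p
   unfolding norm_mult using nz kernel_bound_ge_1[of ze] by (intro mult_mono norm_sqrt_kernel_le) auto
  hence "(LINT p|?U. ?h p) - (LINT p|?V. ?h p) = 0" using zero[OF nz] by (subst diff) auto
  thus "(LINT p|?U. ?h p) = (LINT p|?V. ?h p)" by simp
 qed
 thus ?thesis using diff[OF g, of B] gB by (simp add: mult.commute)
qed

text \<open>In the array, \<open>mm n\<close> is the \<open>(n + 2)\<close>-nd convolution root, and the transform equation is
 cleared of its denominators: it reads \<open>G (1/z + R z / m) = z\<close> divided by \<open>z\<close>.\<close>

section \<open>Arrays of convolution roots\<close>

locale root_array =
 fixes al be :: real and R :: "complex => complex" and mm :: "nat => plane measure" and f :: "plane => real"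
 assumes ab: "0 < al" "0 < be" and law: "!!n. borel_law (mm n)" and f [measurable]: "f \<in> bor"
  and small: "!!z. z \<in> stolz_domain al be ==> norm (z * R z) * sqrt (1 + al^2) <= 1 / 2"
  and lim0: "((%z. z * R z) ---> 0) (at 0 within stolz_domain al be)"
  and eq: "!!n z. z \<in> stolz_domain al be ==>
   (LINT p|(mm n). 1 / (1 + z * R z / of_nat (n + 2) - z * of_real (f p))) = 1"
begin

lemma sets_mm [simp, measurable_cong]: "sets (mm n) = sets borel" and prob_mm: "prob_space (mm n)" and fin_mm: "finite_measure (mm n)"
 using law by (auto simp: borel_law_def prob_space.finite_measure)

abbreviation K :: real where "K == sqrt (1 + al^2)"
abbreviation m :: "nat => real" where "m n == real (n + 2)"
abbreviation shift :: "nat => complex => complex" where "shift n z == z * R z / of_nat (n + 2)"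

lemma K_pos: "0 < K" by (rule sqrt_1_sq_pos)

lemma norm_shift: "norm (shift n z) = norm (z * R z) / m n" unfolding norm_divide norm_of_nat ..

lemma shift_small: "z \<in> stolz_domain al be ==> norm (shift n z) * K <= 1 / 2"
proof -
 assume z: "z \<in> stolz_domain al be"
 have "norm (shift n z) <= norm (z * R z)" unfolding norm_shift by (simp add: divide_le_eq mult_le_cancel_left1)
 hence "norm (shift n z) * K <= norm (z * R z) * K" by (rule mult_right_mono) simp
 thus ?thesis using small[OF z] by linarith
qed

text \<open>\<open>X z\<close> is the integrand whose averages converge, and \<open>Y n z\<close> is
  its version with the shifted denominator: the transform equation says that \<open>Y n z\<close>
  has mean exactly 0, and the two differ by a multiple of \<open>1 / m n\<close>.\<close>

definition X :: "complex => plane => complex" where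
 "X z p = z * of_real (f p) / (1 - z * of_real (f p))"

definition Y :: "nat => complex => plane => complex" where
 "Y n z p = 1 / (1 + shift n z - z * of_real (f p)) - 1"

lemma measurable_XY [measurable]: "X z \<in> bor" "Y n z \<in> bor"
 unfolding X_def[abs_def] Y_def[abs_def] by measurable

lemma X_alt: "z \<in> stolz_domain al be ==> X z p = 1 / (1 - z * of_real (f p)) - 1"
 using nonreal_1_minus_mult[OF stolz_domain_nonreal(1), of z al be "f p"] by (simp add: X_def divide_simps)

lemma norm_X_le_const: "z \<in> stolz_domain al be ==> norm (X z p) <= K + 1"
proof -
 assume z: "z \<in> stolz_domain al be"
 have "norm (1 / (1 - z * of_real (f p))) <= K" using stolz_denominator[OF z, of "f p"]
  by (simp add: norm_divide divide_le_eq)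
 thus ?thesis unfolding X_alt[OF z] by (intro order_trans[OF norm_triangle_ineq4]) simp
qed

text \<open>\<open>X\<close> vanishes to first order at \<open>f p = 0\<close>, so its mean inherits
  the decay of the mean of \<open>abs (ratio (f p))\<close>.\<close>

lemma norm_X_le: "z \<in> stolz_domain al be ==> norm (X z p) <= kernel_bound (1 / z) * abs (ratio (f p))"
proof -
 assume z: "z \<in> stolz_domain al be"
 have nz: "Im z ~= 0" "Im (1 / z) ~= 0" using stolz_domain_nonreal(1)[OF z] by simp_all
 hence z0: "z ~= 0" by auto
 have d: "1 - z * of_real (f p) = z * (1 / z - of_real (f p))" using z0 by (simp add: right_diff_distrib)
 have sq: "cor (sqrt (1 + (f p)^2)) ~= 0" using sqrt_1_sq_pos[of "f p"] by simp
 have "X z p = skern (1 / z) (f p) * of_real (ratio (f p))" unfolding X_def d using z0 sq by simp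
 thus "norm (X z p) <= kernel_bound (1 / z) * abs (ratio (f p))"
  by (simp only: norm_mult norm_of_real) (intro mult_right_mono norm_sqrt_kernel_le nz abs_ge_zero)
qed

lemma norm_Y_minus_X: "z \<in> stolz_domain al be ==> norm (Y n z p - X z p) <= norm (shift n z) * (2 * K) * norm (1 / (1 - z * of_real (f p)))"
 and norm_Y_minus_X_le: "z \<in> stolz_domain al be ==> norm (Y n z p - X z p) <= 2 * K * K * norm (z * R z) / m n"
proof -
 assume z: "z \<in> stolz_domain al be"
 have d: "1 - z * of_real (f p) ~= 0" by (rule nonreal_1_minus_mult[OF stolz_domain_nonreal(1)[OF z]])
 have d': "1 + shift n z - z * of_real (f p) ~= 0" by (rule stolz_kernel(1)[OF z shift_small[OF z]])
 define a where "a = shift n z"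
 have "1 / (1 + a - z * of_real (f p)) - 1 / (1 - z * of_real (f p)) = - (a * (1 / (1 + a - z * of_real (f p))) * (1 / (1 - z * of_real (f p))))"
  using d d' unfolding a_def[symmetric] by (simp add: divide_simps)
 hence "norm (Y n z p - X z p) = norm (shift n z) * norm (1 / (1 + shift n z - z * of_real (f p))) * norm (1 / (1 - z * of_real (f p)))"
  unfolding X_alt[OF z] Y_def a_def[symmetric] by (simp only: norm_mult norm_minus_cancel diff_diff_eq2 diff_add_eq[symmetric] diff_add_cancel)
 also have "... <= norm (shift n z) * (2 * K) * norm (1 / (1 - z * of_real (f p)))"
  by (intro mult_right_mono mult_left_mono stolz_kernel(2)[OF z shift_small[OF z]]) auto
 finally show 1: "norm (Y n z p - X z p) <= norm (shift n z) * (2 * K) * norm (1 / (1 - z * of_real (f p)))" .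
 have "norm (1 / (1 - z * of_real (f p))) <= K"
  using stolz_denominator[OF z, of "f p"] by (simp add: norm_divide divide_le_eq)
 hence "norm (shift n z) * (2 * K) * norm (1 / (1 - z * of_real (f p))) <= norm (shift n z) * (2 * K) * K"
   by (intro mult_left_mono) auto
 also have "... = 2 * K * K * norm (z * R z) / m n" unfolding norm_shift by simp
 finally show "norm (Y n z p - X z p) <= 2 * K * K * norm (z * R z) / m n" using 1 by linarith
qed

lemma norm_Y_le_const: "z \<in> stolz_domain al be ==> norm (Y n z p) <= 2 * K + 1"
proof -
 assume z: "z \<in> stolz_domain al be"
 have "norm (1 / (1 + shift n z - z * of_real (f p))) <= 2 * K" by (rule stolz_kernel(2)[OF z shift_small[OF z]])
 thus ?thesis unfolding Y_def by (intro order_trans[OF norm_triangle_ineq4]) simp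
qed

lemma integrable_X: "z \<in> stolz_domain al be ==> integrable (mm n) (X z)"
 using norm_X_le_const by (intro integrable_bounded[OF fin_mm, of _ _ "K + 1"]) auto

lemma integrable_Y: "z \<in> stolz_domain al be ==> integrable (mm n) (Y n z)"
 using norm_Y_le_const by (intro integrable_bounded[OF fin_mm, of _ _ "2 * K + 1"]) auto

lemma integral_Y: "z \<in> stolz_domain al be ==> (LINT p|(mm n). Y n z p) = 0"
proof -
 assume z: "z \<in> stolz_domain al be"
 interpret prob_space "mm n" by (rule prob_mm)
 have "integrable (mm n) (%p. Y n z p + 1)" by (intro Bochner_Integration.integrable_add integrable_Y z) simp
 hence i: "integrable (mm n) (%p. 1 / (1 + shift n z - z * of_real (f p)))" by (simp add: Y_def)
 have "(LINT p|(mm n). Y n z p) = (LINT p|(mm n). 1 / (1 + shift n z - z * of_real (f p))) - 1"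
  unfolding Y_def by (subst Bochner_Integration.integral_diff[OF i]) (simp_all add: prob_space)
 thus ?thesis by (simp only: eq[OF z] diff_self)
qed

text \<open>The error is left proportional to the mean of \<open>norm (X z p)\<close> because it is
  estimated in two ways: by 1 on the imaginary axis, for the mass bounds, and by a null sequence,
  for the limit.\<close>

lemma norm_average_X: "z \<in> stolz_domain al be ==>
 norm (of_real (m n) * (LINT p|(mm n). X z p) - z * R z) <= norm (z * R z) * (2 * K) * (LINT p|(mm n). norm (X z p))"
proof -
 assume z: "z \<in> stolz_domain al be"
 interpret prob_space "mm n" by (rule prob_mm)
 define a where "a = shift n z"
 \<comment> \<open>Read as \<open>X - a = a * X * (Y + 1) + (1 + a) * Y\<close>, where the last term
   has mean 0.\<close>
 have e: "X z p - a * X z p * (Y n z p + 1) - a = (1 + a) * Y n z p" for p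
 proof -
  have d: "1 - z * of_real (f p) ~= 0" by (rule nonreal_1_minus_mult[OF stolz_domain_nonreal(1)[OF z]])
  have d': "1 + a - z * of_real (f p) ~= 0" unfolding a_def by (rule stolz_kernel(1)[OF z shift_small[OF z]])
  define u where "u = z * cor (f p)"
  show ?thesis using d d' unfolding X_def Y_def a_def[symmetric]
   by (simp add: divide_simps) (simp add: algebra_simps)
 qed
 have iXY: "integrable (mm n) (%p. a * X z p * (Y n z p + 1))"
 proof (rule integrable_bounded[OF fin_mm])
  show "norm (a * X z p * (Y n z p + 1)) <= norm a * (K + 1) * (2 * K + 1 + 1)" for p
   unfolding norm_mult using norm_X_le_const[OF z, of p] norm_Y_le_const[OF z, of n p]
   by (intro mult_mono order_trans[OF norm_triangle_ineq]) auto
 qed measurable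
 have "(LINT p|(mm n). X z p - a * X z p * (Y n z p + 1) - a) = (LINT p|(mm n). X z p) - (LINT p|(mm n). a * X z p * (Y n z p + 1)) - a"
  using integrable_X[OF z, of n] iXY by (simp add: prob_space)
 hence "(LINT p|(mm n). X z p) - (LINT p|(mm n). a * X z p * (Y n z p + 1)) - a = 0"
  unfolding e by (simp add: integral_Y[OF z])
 hence "(LINT p|(mm n). X z p) - a = (LINT p|(mm n). a * X z p * (Y n z p + 1))" by (simp add: algebra_simps)
 also have "norm ... <= (LINT p|(mm n). norm a * (2 * K) * norm (X z p))"
 proof (intro order_trans[OF integral_norm_bound] integral_mono integrable_norm iXY integrable_mult_right integrable_X z)
  fix p
  have "norm (Y n z p + 1) <= 2 * K" unfolding Y_def using stolz_kernel(2)[OF z shift_small[OF z]] by simp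
  hence "norm (X z p) * norm (Y n z p + 1) <= norm (X z p) * (2 * K)" by (rule mult_left_mono) simp
  hence "norm a * (norm (X z p) * norm (Y n z p + 1)) <= norm a * (norm (X z p) * (2 * K))" by (rule mult_left_mono) simp
  thus "norm (a * X z p * (Y n z p + 1)) <= norm a * (2 * K) * norm (X z p)" by (simp add: norm_mult mult_ac)
 qed
 finally have le: "norm ((LINT p|(mm n). X z p) - a) <= norm a * (2 * K) * (LINT p|(mm n). norm (X z p))" by simp
 have ma: "of_real (m n) * a = z * R z" "m n * norm a = norm (z * R z)"
 proof -
  have "complex_of_nat (n + 2) ~= 0" by (simp only: of_nat_eq_0_iff)
  thus "of_real (m n) * a = z * R z" unfolding a_def of_real_of_nat_eq times_divide_eq_right by simp
  show "m n * norm a = norm (z * R z)" unfolding a_def norm_shift by simp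
 qed
 have "norm (of_real (m n) * (LINT p|(mm n). X z p) - z * R z) = m n * norm ((LINT p|(mm n). X z p) - a)"
  unfolding ma(1)[symmetric] right_diff_distrib[symmetric] norm_mult norm_of_real by simp
 also have "... <= m n * (norm a * (2 * K) * (LINT p|(mm n). norm (X z p)))" by (rule mult_left_mono[OF le]) simp
 also have "... = norm (z * R z) * (2 * K) * (LINT p|(mm n). norm (X z p))" unfolding ma(2)[symmetric] by simp
 finally show ?thesis .
qed

text \<open>At \<open>- \<i> y\<close> the real part of \<open>X\<close> is minus
  \<open>(y * f p)^2 / (1 + (y * f p)^2)\<close>. So the average of \<open>X\<close>, which is
  already compared with \<open>z * R z\<close>, controls the mass at scale
  \<open>1 / y\<close>.\<close>

lemma axis_mass_le:
 assumes y: "0 < y" "y < be"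
 shows "m n * (LINT p|(mm n). (y * f p)^2 / (1 + (y * f p)^2)) <= norm (Complex 0 (- y) * R (Complex 0 (- y))) * (1 + 2 * K)"
proof -
 interpret prob_space "mm n" by (rule prob_mm)
 define z where "z = Complex 0 (- y)"
 have z: "z \<in> stolz_domain al be" unfolding z_def using y ab by (intro axis_in_stolz_domain) auto
 have Xp: "Re (X z p) = - ((y * f p)^2 / (1 + (y * f p)^2))" "norm (X z p) <= 1" for p
 proof -
  have X: "X z p = Complex 0 (- (y * f p)) / Complex 1 (y * f p)" by (simp add: X_def z_def complex_eq_iff Re_divide Im_divide)
  show "Re (X z p) = - ((y * f p)^2 / (1 + (y * f p)^2))" unfolding X by (simp add: Re_divide power2_eq_square)
  have "norm (X z p) = abs (y * f p / sqrt (1 + (y * f p)^2))"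
   unfolding X norm_divide by (simp only: cmod_def complex.sel) simp
  thus "norm (X z p) <= 1" using abs_ratio_le_1[of "y * f p"] by simp
 qed
 have "m n * (LINT p|(mm n). (y * f p)^2 / (1 + (y * f p)^2)) = - Re (of_real (m n) * (LINT p|(mm n). X z p))"
 proof -
  have "Re (LINT p|(mm n). X z p) = - (LINT p|(mm n). (y * f p)^2 / (1 + (y * f p)^2))"
   using integral_Re[OF integrable_X[OF z, of n]] by (simp only: Xp(1) Bochner_Integration.integral_minus)
  thus ?thesis by simp
 qed
 also have "... <= norm (of_real (m n) * (LINT p|(mm n). X z p))" using abs_Re_le_cmod by (rule order_trans[OF abs_ge_minus_self])
 also have "... <= norm (z * R z) + norm (of_real (m n) * (LINT p|(mm n). X z p) - z * R z)"
  by (rule norm_triangle_sub)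
 also have "... <= norm (z * R z) + norm (z * R z) * (2 * K) * (LINT p|(mm n). norm (X z p))" by (rule add_left_mono[OF norm_average_X[OF z]])
 also have "... <= norm (z * R z) + norm (z * R z) * (2 * K) * 1"
 proof (intro add_left_mono mult_left_mono)
  have "(LINT p|(mm n). norm (X z p)) <= (LINT p|(mm n). 1)" using integrable_X[OF z] Xp(2) by (intro integral_mono) auto
  thus "(LINT p|(mm n). norm (X z p)) <= 1" by (simp add: prob_space)
 qed (use K_pos in auto)
 finally show ?thesis unfolding z_def by (simp add: distrib_left)
qed

lemma integrable_square_ratio: "integrable (mm n) (%p. (y * f p)^2 / (1 + (y * f p)^2))"
 by (intro integrable_bounded[OF fin_mm, of _ _ 1]) (auto simp: add_pos_nonneg)

lemma integrable_ratio_square: "integrable (mm n) (%p. ratio (f p)^2)"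
proof (rule integrable_bounded[OF fin_mm])
 show "norm (ratio (f p)^2) <= 1" for p using abs_ratio_le_1[of "f p"] by (simp add: abs_square_le_1)
qed measurable

lemma mass_bounded: "\<exists>C. \<forall>n. m n * (LINT p|(mm n). ratio (f p)^2) <= C"
proof -
 define y where "y = min (be / 2) 1"
 have y: "0 < y" "y < be" "y <= 1" using ab by (auto simp: y_def)
 have pt: "ratio (f p)^2 <= (1 / y^2) * ((y * f p)^2 / (1 + (y * f p)^2))" for p
 proof -
  have "ratio (f p)^2 = (f p)^2 / (1 + (f p)^2)" by (simp add: power_divide)
  also have "... <= (f p)^2 / (1 + (y * f p)^2)"
   using y mult_right_mono[of "y^2" 1 "(f p)^2"] by (intro divide_left_mono) (auto simp: power_mult_distrib power_le_one add_pos_nonneg)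
  also have "... = (1 / y^2) * ((y * f p)^2 / (1 + (y * f p)^2))" using y by (simp add: power_mult_distrib)
  finally show ?thesis .
 qed
 have "m n * (LINT p|(mm n). ratio (f p)^2) <= (1 / y^2) * (norm (Complex 0 (- y) * R (Complex 0 (- y))) * (1 + 2 * K))" for n
 proof -
  have "(LINT p|(mm n). ratio (f p)^2) <= (LINT p|(mm n). (1 / y^2) * ((y * f p)^2 / (1 + (y * f p)^2)))"
   by (intro integral_mono integrable_mult_right integrable_square_ratio integrable_ratio_square pt)
  hence "(LINT p|(mm n). ratio (f p)^2) <= (1 / y^2) * (LINT p|(mm n). (y * f p)^2 / (1 + (y * f p)^2))"
   by (simp only: integral_mult_right_zero)
  hence "m n * (LINT p|(mm n). ratio (f p)^2) <= m n * ((1 / y^2) * (LINT p|(mm n). (y * f p)^2 / (1 + (y * f p)^2)))"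
   by (rule mult_left_mono) simp
  also have "... = (1 / y^2) * (m n * (LINT p|(mm n). (y * f p)^2 / (1 + (y * f p)^2)))" by simp
  also have "... <= (1 / y^2) * (norm (Complex 0 (- y) * R (Complex 0 (- y))) * (1 + 2 * K))"
   by (intro mult_left_mono axis_mass_le y) simp
  finally show ?thesis .
 qed
 thus ?thesis by blast
qed

text \<open>\<open>axis_mass_le\<close> with \<open>y = 1 / N\<close>: its bound tends to 0 with
  \<open>y\<close>, since \<open>z * R z\<close> does, and does not depend on
  \<open>n\<close>.\<close>

lemma tail_small:
 assumes e: "0 < e"
 shows "\<exists>N0>0. \<forall>N\<ge>N0. \<forall>n. m n * (LINT p|(mm n). (f p)^2 / (N^2 + (f p)^2)) <= e"
proof -
 define d0 where "d0 = e / (1 + 2 * K)"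
 have d0: "d0 > 0" using e K_pos by (simp add: d0_def add_pos_pos)
 obtain d where d: "d > 0" "!!z. z \<in> stolz_domain al be ==> z ~= 0 ==> dist z 0 < d ==> dist (z * R z) 0 < d0"
  using tendstoD[OF lim0 d0] unfolding eventually_at by blast
 define y0 where "y0 = min (be / 2) (d / 2)"
 have y0: "y0 > 0" "y0 < be" "y0 < d" using ab d(1) by (auto simp: y0_def)
 have "m n * (LINT p|(mm n). (f p)^2 / (N^2 + (f p)^2)) <= e" if N: "N \<ge> 1 / y0" for N n
 proof -
  have N0: "N > 0" using N y0(1) by (meson divide_pos_pos less_le_trans zero_less_one)
  define y where "y = 1 / N"
  have y: "0 < y" "y <= y0" using N N0 y0(1) by (auto simp: y_def divide_le_eq mult.commute)
  have eqy: "(f p)^2 / (N^2 + (f p)^2) = (y * f p)^2 / (1 + (y * f p)^2)" for p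
  proof -
   have "1 + (y * f p)^2 = (N^2 + (f p)^2) / N^2" "(y * f p)^2 = (f p)^2 / N^2"
    using N0 by (simp_all add: y_def power_divide add_divide_distrib)
   thus ?thesis using N0 by simp
  qed
  have S: "Complex 0 (- y) \<in> stolz_domain al be" using y y0 ab by (intro axis_in_stolz_domain) auto
  have "dist (Complex 0 (- y) * R (Complex 0 (- y))) 0 < d0"
  proof (rule d(2)[OF S])
   show "Complex 0 (- y) ~= 0" using y by (simp add: complex_eq_iff)
   show "dist (Complex 0 (- y)) 0 < d" using y y0 by (simp add: cmod_def)
  qed
  hence "norm (Complex 0 (- y) * R (Complex 0 (- y))) * (1 + 2 * K) <= d0 * (1 + 2 * K)"
    by (intro mult_right_mono) auto
  also have "1 + 2 * K ~= 0" using K_pos by linarith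
  hence "d0 * (1 + 2 * K) = e" unfolding d0_def by simp
  finally have "norm (Complex 0 (- y) * R (Complex 0 (- y))) * (1 + 2 * K) <= e" .
  moreover have "y < be" using y y0 by linarith
  ultimately show ?thesis unfolding eqy using axis_mass_le[OF y(1), of n] by linarith
 qed
 thus ?thesis using y0(1) by (intro exI[of _ "1 / y0"]) auto
qed

text \<open>\<open>abs g <= 1 / r + r * g^2\<close> with \<open>r = sqrt (m n)\<close> balances both
  terms: second moments of order \<open>1 / m n\<close> give first moments of order
  \<open>1 / sqrt (m n)\<close>.\<close>

lemma mean_ratio_tendsto_0: "(%n. \<integral>p. abs (ratio (f p)) \<partial>mm n) ----> 0"
proof -
 obtain C where C: "!!n. m n * (LINT p|(mm n). ratio (f p)^2) <= C" using mass_bounded by blast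
 have le: "norm (LINT p|(mm n). abs (ratio (f p))) <= (1 + C) / sqrt (m n)" for n
 proof -
  interpret prob_space "mm n" by (rule prob_mm)
  let ?g = "%p. ratio (f p)"
  define r where "r = sqrt (m n)"
  have r: "r > 0" "r * r = m n" by (simp_all add: r_def)
  have pt: "abs (?g p) <= 1 / r + r * (?g p)^2" for p
  proof -
   have "2 * r * t <= 1 + r^2 * t^2" for t
    using zero_le_power2[of "1 - r * t"] by (simp add: power2_diff power_mult_distrib)
   from this[of "abs (?g p)"] have "2 * (r * abs (?g p)) <= 1 + r^2 * (?g p)^2" by (simp only: power2_abs mult.assoc)
   moreover have "0 <= r * abs (?g p)" using r by simp
   moreover have "2 * u <= v ==> 0 <= u ==> u <= v" for u v :: real by linarith
   ultimately have "r * abs (?g p) <= 1 + r^2 * (?g p)^2" by blast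
   also have "... = r * (1 / r + r * (?g p)^2)" using r by (simp add: distrib_left power2_eq_square)
   finally show ?thesis using r(1) by (simp only: mult_le_cancel_left_pos)
  qed
  have "(LINT p|(mm n). abs (?g p)) <= (LINT p|(mm n). 1 / r + r * (?g p)^2)"
   using abs_ratio_le_1 pt by (intro integral_mono Bochner_Integration.integrable_add integrable_const integrable_mult_right integrable_ratio_square integrable_bounded[OF fin_mm, of _ _ 1]) auto
  also have "... = 1 / r + r * (LINT p|(mm n). (?g p)^2)"
   using integrable_ratio_square[of n] by (subst Bochner_Integration.integral_add) (auto simp: prob_space)
  also have "r * (LINT p|(mm n). (?g p)^2) = m n * (LINT p|(mm n). (?g p)^2) / r"  unfolding r(2)[symmetric] by simp
  also have "1 / r + ... <= 1 / r + C / r" using C[of n] r by (intro add_left_mono divide_right_mono) auto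
  finally show ?thesis by (simp add: r_def add_divide_distrib)
 qed
 have "(%n. (1 + C) / sqrt (m n)) ----> 0" by real_asymp
 thus ?thesis by (rule Lim_null_comparison[OF always_eventually[OF allI[OF le]]])
qed

lemma mean_X_tendsto_0:
 assumes z: "z \<in> stolz_domain al be"
 shows "(%n. \<integral>p. norm (X z p) \<partial>mm n) ----> 0"
proof -
 have le: "norm (LINT p|(mm n). norm (X z p)) <= kernel_bound (1 / z) * (LINT p|(mm n). abs (ratio (f p)))" for n
 proof -
  have "(LINT p|(mm n). norm (X z p)) <= (LINT p|(mm n). kernel_bound (1 / z) * abs (ratio (f p)))"
   using abs_ratio_le_1 by (intro integral_mono integrable_norm integrable_X z norm_X_le integrable_mult_right integrable_bounded[OF fin_mm, of _ _ 1]) auto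
  thus ?thesis by (simp del: abs_divide)
 qed
 have "(%n. kernel_bound (1 / z) * (LINT p|(mm n). abs (ratio (f p)))) ----> 0"
  using tendsto_mult[OF tendsto_const mean_ratio_tendsto_0, of "kernel_bound (1 / z)"] by simp
 thus ?thesis by (rule Lim_null_comparison[OF always_eventually[OF allI[OF le]]])
qed

lemma mean_Y_tendsto_0:
 assumes z: "z \<in> stolz_domain al be"
 shows "(%n. \<integral>p. norm (Y n z p) \<partial>mm n) ----> 0"
proof -
 let ?c = "2 * K * K * norm (z * R z)"
 have le: "norm (LINT p|(mm n). norm (Y n z p)) <= (LINT p|(mm n). norm (X z p)) + ?c / m n" for n
 proof -
  interpret prob_space "mm n" by (rule prob_mm)
  have "(LINT p|(mm n). norm (Y n z p)) <= (LINT p|(mm n). norm (X z p) + ?c / m n)"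
  proof (intro integral_mono integrable_norm integrable_Y integrable_X z Bochner_Integration.integrable_add integrable_const)
   show "norm (Y n z p) <= norm (X z p) + ?c / m n" for p
    using norm_Y_minus_X_le[OF z, of n p] norm_triangle_sub[of "Y n z p" "X z p"] by linarith
  qed
  also have "... = (LINT p|(mm n). norm (X z p)) + ?c / m n"
   using integrable_X[OF z, of n] by (subst Bochner_Integration.integral_add) (auto simp: prob_space)
  finally show ?thesis by simp
 qed
 have "(%n. ?c / m n) ----> 0" by real_asymp
 hence "(%n. (LINT p|(mm n). norm (X z p)) + ?c / m n) ----> 0 + 0" by (intro tendsto_add mean_X_tendsto_0 z)
 thus ?thesis by (intro Lim_null_comparison[OF always_eventually[OF allI[OF le]]]) simp
qed

lemma average_X_tendsto:
 assumes z: "z \<in> stolz_domain al be"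
 shows "(%n. of_real (m n) * (LINT p|(mm n). X z p)) ----> z * R z"
proof (rule LIM_zero_cancel, rule Lim_null_comparison[OF always_eventually[OF allI[OF norm_average_X[OF z]]]])
 show "(%n. norm (z * R z) * (2 * K) * (LINT p|(mm n). norm (X z p))) ----> 0"
  using tendsto_mult[OF tendsto_const mean_X_tendsto_0[OF z], of "norm (z * R z) * (2 * K)"] by simp
qed

end

section \<open>Joint limits of both coordinates\<close>

lemma signed_measure_diff:
 assumes U: "finite_measure U" "sets U = sets M" and V: "finite_measure V" "sets V = sets M"
 shows "signed_measure_on M (%A. measure U A - measure V A)" unfolding signed_measure_on_def
proof (intro conjI allI impI)
 fix A :: "nat => 'a set" assume A: "range A \<subseteq> sets M" "disjoint_family A"
 have "(%i. measure U (A i)) sums measure U (\<Union>i. A i)" "(%i. measure V (A i)) sums measure V (\<Union>i. A i)"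
  using finite_measure.finite_measure_UNION[OF U(1), of A] finite_measure.finite_measure_UNION[OF V(1), of A] A U V by simp_all
 thus "(%i. measure U (A i) - measure V (A i)) sums (measure U (\<Union>i. A i) - measure V (\<Union>i. A i))"
  by (rule sums_diff)
qed (auto simp: U V measure_notin_sets)


lemma abs_ratio_power2_le: "ratio x^2 <= 1" using abs_ratio_le_1[of x] by (simp only: abs_square_le_1)

lemma continuous_ratio [continuous_intros]: "continuous_on S f ==> continuous_on S (%p. ratio (f p))"
 by (intro continuous_intros) (auto simp: add_pos_nonneg less_imp_neq[symmetric])

text \<open>The vectors \<open>(b, - c)\<close> and \<open>(- c, a)\<close> give the determinant
  times \<open>b\<close> and times \<open>a\<close>; if both coefficients vanish,
  \<open>(1, - c)\<close> forces \<open>c = 0\<close>.\<close>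

lemma quadratic_form_nonneg_imp:
 fixes a b c :: real
 assumes "!!x y. 0 <= x^2 * a + 2 * x * y * c + y^2 * b"
 shows "c^2 <= a * b"
proof -
 have a: "0 <= a" and b: "0 <= b" using assms[of 1 0] assms[of 0 1] by auto
 have 1: "0 <= b * (a * b - c^2)" using assms[of b "- c"] by (simp add: power2_eq_square algebra_simps)
 have 2: "0 <= a * (a * b - c^2)" using assms[of "- c" a] by (simp add: power2_eq_square algebra_simps)
 show ?thesis
 proof (cases "a = 0 & b = 0")
  case True
  thus ?thesis using assms[of 1 "- c"] by (simp add: power2_eq_square)
 next
  case False
  thus ?thesis using 1 2 a b by (auto simp: zero_le_mult_iff)
 qed
qed

locale bifree_array = A1: root_array al be R1 mm fst + A2: root_array al be R2 mm snd
 for al be :: real and R1 R2 :: "complex => complex" and mm :: "nat => plane measure" +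
 fixes Q :: "complex => complex => complex"
 assumes eq12: "!!n z w. z \<in> stolz_domain al be ==> w \<in> stolz_domain al be ==>
  (LINT p|(mm n). 1 / ((1 + z * R1 z / of_nat (n + 2) - z * of_real (fst p)) * (1 + w * R2 w / of_nat (n + 2) - w * of_real (snd p))))
   * (1 - Q z w / of_nat (n + 2)) = 1"
begin

text \<open>The joint equation gives \<open>m * J = (1 + J) * Q\<close> exactly for the mean
  \<open>J\<close> of the product of the two \<open>Y\<close>, and \<open>J\<close> tends to 0.
  Passing from \<open>Y\<close> to \<open>X\<close> costs \<open>1 / m\<close> times means that tend
  to 0, so the factor \<open>m\<close> in front does no harm.\<close>

lemma product_limit:
 assumes z: "z \<in> stolz_domain al be" and w: "w \<in> stolz_domain al be"
 shows "(%n. of_real (A1.m n) * (LINT p|(mm n). A1.X z p * A2.X w p)) ----> Q z w"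
proof -
 define J where "J n = (LINT p|(mm n). A1.Y n z p * A2.Y n w p)" for n
 have iYY: "integrable (mm n) (%p. A1.Y n z p * A2.Y n w p)" for n
 proof (rule integrable_bounded[OF A1.fin_mm])
  show "norm (A1.Y n z p * A2.Y n w p) <= (2 * A1.K + 1) * (2 * A1.K + 1)" for p
   unfolding norm_mult  by (intro mult_mono A1.norm_Y_le_const A2.norm_Y_le_const z w) auto
 qed measurable
 have iXX: "integrable (mm n) (%p. A1.X z p * A2.X w p)" for n
 proof (rule integrable_bounded[OF A1.fin_mm])
  show "norm (A1.X z p * A2.X w p) <= (A1.K + 1) * (A1.K + 1)" for p
   unfolding norm_mult  by (intro mult_mono A1.norm_X_le_const A2.norm_X_le_const z w) auto
 qed measurable
 have mJ: "of_real (A1.m n) * J n = (1 + J n) * Q z w" for n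
 proof -
  interpret prob_space "mm n" by (rule A1.prob_mm)
  have "(LINT p|(mm n). 1 / ((1 + A1.shift n z - z * of_real (fst p)) * (1 + A2.shift n w - w * of_real (snd p))))
   = (LINT p|(mm n). A1.Y n z p * A2.Y n w p + A1.Y n z p + A2.Y n w p + 1)"
   by (intro Bochner_Integration.integral_cong) (auto simp: A1.Y_def A2.Y_def algebra_simps)
  also have "... = J n + 1"
   using iYY[of n] A1.integrable_Y[OF z, of n] A2.integrable_Y[OF w, of n] A1.integral_Y[OF z, of n] A2.integral_Y[OF w, of n]
   by (simp add: J_def prob_space)
  finally have "(J n + 1) * (1 - Q z w / of_nat (n + 2)) = 1" using eq12[OF z w, of n] by simp
  moreover have "N * x = (1 + x) * y" if "N ~= 0" "(x + 1) * (1 - y / N) = 1" for N x y :: complex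
  proof -
   have "(1 - y / N) * N = N - y" using that(1) by (simp add: left_diff_distrib)
   hence "(x + 1) * (N - y) = (x + 1) * (1 - y / N) * N" by simp
   also have "... = N" unfolding that(2) by simp
   finally show ?thesis by (simp add: algebra_simps)
  qed
  moreover have "(of_nat (n + 2) :: complex) ~= 0" by (simp only: of_nat_eq_0_iff)
  ultimately show ?thesis by simp
 qed
 have J0: "J ----> 0"
 proof -
  have le: "norm (J n) <= (2 * A1.K + 1) * (LINT p|(mm n). norm (A2.Y n w p))" for n
  proof -
   have "norm (J n) <= (LINT p|(mm n). norm (A1.Y n z p * A2.Y n w p))" unfolding J_def by simp
   also have "... <= (LINT p|(mm n). (2 * A1.K + 1) * norm (A2.Y n w p))"
    using A1.norm_Y_le_const[OF z] by (intro integral_mono integrable_norm iYY integrable_mult_right A2.integrable_Y w)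
     (auto simp: norm_mult intro!: mult_right_mono)
   finally show ?thesis by simp
  qed
  have "(%n. (2 * A1.K + 1) * (LINT p|(mm n). norm (A2.Y n w p))) ----> 0"
   using tendsto_mult[OF tendsto_const A2.mean_Y_tendsto_0[OF w], of "2 * A1.K + 1"] by simp
  thus ?thesis by (rule Lim_null_comparison[OF always_eventually[OF allI[OF le]]])
 qed
 have "(%n. (1 + J n) * Q z w) ----> (1 + 0) * Q z w" by (intro tendsto_intros J0)
 hence lim: "(%n. of_real (A1.m n) * J n) ----> Q z w" unfolding mJ by simp
 let ?c = "2 * A1.K * A1.K * norm (z * R1 z)" and ?d = "2 * A1.K * A1.K * norm (w * R2 w)"
 have le: "norm (of_real (A1.m n) * (LINT p|(mm n). A1.X z p * A2.X w p) - of_real (A1.m n) * J n)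
   <= ?c * (LINT p|(mm n). norm (A2.Y n w p)) + ?d * (LINT p|(mm n). norm (A1.X z p))" for n
 proof -
  have i1: "integrable (mm n) (%p. norm (A2.Y n w p))" by (rule integrable_norm[OF A2.integrable_Y[OF w]])
  have i2: "integrable (mm n) (%p. norm (A1.X z p))" by (rule integrable_norm[OF A1.integrable_X[OF z]])
  have comb: "(LINT p|(mm n). a * norm (A2.Y n w p) + b * norm (A1.X z p)) = a * (LINT p|(mm n). norm (A2.Y n w p)) + b * (LINT p|(mm n). norm (A1.X z p))"
   for a b :: real using i1 i2 by simp
  have dJ: "(LINT p|(mm n). A1.X z p * A2.X w p) - J n = (LINT p|(mm n). A1.X z p * A2.X w p - A1.Y n z p * A2.Y n w p)"
   unfolding J_def by (rule Bochner_Integration.integral_diff[OF iXX iYY, symmetric])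
  have "norm (LINT p|(mm n). A1.X z p * A2.X w p - A1.Y n z p * A2.Y n w p) <= (LINT p|(mm n). (?c / A1.m n) * norm (A2.Y n w p) + (?d / A1.m n) * norm (A1.X z p))"
  proof (intro order_trans[OF integral_norm_bound] integral_mono integrable_norm Bochner_Integration.integrable_diff iXX iYY
    Bochner_Integration.integrable_add integrable_mult_right A2.integrable_Y A1.integrable_X z w)
   fix p
   have "A1.X z p * A2.X w p - A1.Y n z p * A2.Y n w p = - ((A1.Y n z p - A1.X z p) * A2.Y n w p) - (A2.Y n w p - A2.X w p) * A1.X z p"
    by (simp add: algebra_simps)
   also have "norm ... <= norm (A1.Y n z p - A1.X z p) * norm (A2.Y n w p) + norm (A2.Y n w p - A2.X w p) * norm (A1.X z p)"
    by (rule order_trans[OF norm_triangle_ineq4]) (simp add: norm_mult)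
   also have "... <= (?c / A1.m n) * norm (A2.Y n w p) + (?d / A1.m n) * norm (A1.X z p)"
    by (intro add_mono mult_right_mono A1.norm_Y_minus_X_le A2.norm_Y_minus_X_le z w norm_ge_zero)
   finally show "norm (A1.X z p * A2.X w p - A1.Y n z p * A2.Y n w p) <= (?c / A1.m n) * norm (A2.Y n w p) + (?d / A1.m n) * norm (A1.X z p)" .
  qed
  hence *: "norm ((LINT p|(mm n). A1.X z p * A2.X w p) - J n)
   <= (?c / A1.m n) * (LINT p|(mm n). norm (A2.Y n w p)) + (?d / A1.m n) * (LINT p|(mm n). norm (A1.X z p))"
   unfolding dJ comb .
  have cancel: "A1.m n * ((c / A1.m n) * x) = c * x" for c x by auto
  have "norm (of_real (A1.m n) * (LINT p|(mm n). A1.X z p * A2.X w p) - of_real (A1.m n) * J n)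
   = A1.m n * norm ((LINT p|(mm n). A1.X z p * A2.X w p) - J n)"
   unfolding right_diff_distrib[symmetric] norm_mult norm_of_real by simp
  also have "... <= A1.m n * ((?c / A1.m n) * (LINT p|(mm n). norm (A2.Y n w p)) + (?d / A1.m n) * (LINT p|(mm n). norm (A1.X z p)))"
   by (rule mult_left_mono[OF *]) simp
  also have "... = ?c * (LINT p|(mm n). norm (A2.Y n w p)) + ?d * (LINT p|(mm n). norm (A1.X z p))"
   unfolding distrib_left cancel ..
  finally show ?thesis .
 qed
 have "(%n. ?c * (LINT p|(mm n). norm (A2.Y n w p)) + ?d * (LINT p|(mm n). norm (A1.X z p))) ----> ?c * 0 + ?d * 0"
  by (intro tendsto_intros A2.mean_Y_tendsto_0 A1.mean_X_tendsto_0 z w)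
 hence "(%n. ?c * (LINT p|(mm n). norm (A2.Y n w p)) + ?d * (LINT p|(mm n). norm (A1.X z p))) ----> 0" by simp
 from Lim_null_comparison[OF always_eventually[OF allI[OF le]] this] lim
 have "(%n. of_real (A1.m n) * (LINT p|(mm n). A1.X z p * A2.X w p) - of_real (A1.m n) * J n + of_real (A1.m n) * J n) ----> 0 + Q z w"
  by (rule tendsto_add)
 thus ?thesis by simp
qed

abbreviation sh :: "plane => real" where "sh p == ratio (fst p)"
abbreviation th :: "plane => real" where "th p == ratio (snd p)"

definition weighted :: "(plane => real) => nat => plane measure" where
 "weighted d n = dens (mm n) (%p. A1.m n * d p)"

lemma integral_weighted:
 fixes h :: "plane => 'c::{banach, second_countable_topology}"
 assumes [measurable]: "d \<in> bor" "h \<in> bor" and "!!p. 0 <= d p"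
 shows "(LINT p|(weighted d n). h p) = A1.m n *\<^sub>R (LINT p|(mm n). d p *\<^sub>R h p)"
proof -
 have "(LINT p|(weighted d n). h p) = (LINT p|(mm n). (A1.m n * d p) *\<^sub>R h p)"
  unfolding weighted_def using assms(3) by (subst integral_density) auto
 also have "... = A1.m n *\<^sub>R (LINT p|(mm n). d p *\<^sub>R h p)" by (simp only: scaleR_scaleR[symmetric] integral_scaleR_right)
 finally show ?thesis .
qed

text \<open>The bound 4 fits the largest density used, the square of a sum of two ratios. The index
  map \<open>k\<close> lets the lemma be applied repeatedly along subsequences already
  chosen.\<close>

lemma weighted_limit:
 fixes k :: "nat => nat"
 assumes [measurable]: "d \<in> bor" and d: "!!p. 0 <= d p" "!!p. d p <= 4"
  and mass: "!!n. A1.m n * (LINT p|(mm n). d p) <= C"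
 obtains r tt where "strict_mono (r :: nat => nat)" "finite_borel tt" "weakly_converges (%n. weighted d (k (r n))) tt"
proof -
 have fb: "finite_borel (weighted d n)" for n unfolding weighted_def
 proof (rule finite_borel_density_bounded)
  show "finite_borel (mm n)" using A1.fin_mm by (simp add: finite_borel_def)
  show "A1.m n * d p <= A1.m n * 4" for p using d(2) by (rule mult_left_mono) simp
 qed measurable
 have mass': "measure (weighted d n) UNIV <= C" for n
 proof -
  have "space (weighted d n) = UNIV" using sets_eq_imp_space_eq[of "weighted d n" borel] fb by (simp add: finite_borel_def)
  hence "measure (weighted d n) UNIV = (LINT p|(weighted d n). 1)" by simp
  also have "... = A1.m n * (LINT p|(mm n). d p)" by (subst integral_weighted) (auto simp: d)
  finally show ?thesis using mass by simp
 qed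
 have tail: "(LINT p|(weighted d n). (f p)^2 / (N^2 + (f p)^2)) <= 4 * (A1.m n * (LINT p|(mm n). (f p)^2 / (N^2 + (f p)^2)))"
  if [measurable]: "f \<in> bor" for f N n
 proof -
  have "y / (x + y) <= 1" if "0 <= x" "0 <= y" for x y :: real using that by (cases "x + y = 0") auto
  hence b: "0 <= (f p)^2 / (N^2 + (f p)^2)" "(f p)^2 / (N^2 + (f p)^2) <= 1" for p by simp_all
  have i: "integrable (mm n) (%p. (f p)^2 / (N^2 + (f p)^2))" using b by (intro integrable_bounded[OF A1.fin_mm, of _ _ 1]) auto
  have "(LINT p|(mm n). d p * ((f p)^2 / (N^2 + (f p)^2))) <= (LINT p|(mm n). 4 * ((f p)^2 / (N^2 + (f p)^2)))"
  proof (intro integral_mono integrable_mult_right i)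
   show "integrable (mm n) (%p. d p * ((f p)^2 / (N^2 + (f p)^2)))"
   proof (rule integrable_bounded[OF A1.fin_mm])
    show "norm (d p * ((f p)^2 / (N^2 + (f p)^2))) <= 4 * 1" for p
     unfolding norm_mult using b[of p] d[of p] by (intro mult_mono) auto
   qed measurable
   show "d p * ((f p)^2 / (N^2 + (f p)^2)) <= 4 * ((f p)^2 / (N^2 + (f p)^2))" for p
    by (rule mult_right_mono[OF d(2) b(1)])
  qed
  hence "A1.m n * (LINT p|(mm n). d p * ((f p)^2 / (N^2 + (f p)^2))) <= A1.m n * (4 * (LINT p|(mm n). (f p)^2 / (N^2 + (f p)^2)))"
   unfolding integral_mult_right_zero by simp
  moreover have "(LINT p|(weighted d n). (f p)^2 / (N^2 + (f p)^2)) = A1.m n * (LINT p|(mm n). d p * ((f p)^2 / (N^2 + (f p)^2)))"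
   by (subst integral_weighted) (auto simp: d)
  ultimately show ?thesis by simp
 qed
 have tight: "\<exists>N>0. \<forall>n. (LINT p|(weighted d (k n)). (fst p)^2 / (N^2 + (fst p)^2)) <= e & (LINT p|(weighted d (k n)). (snd p)^2 / (N^2 + (snd p)^2)) <= e"
  if e: "e > 0" for e
 proof -
  obtain N1 where N1: "N1 > 0" "!!N n. N \<ge> N1 ==> A1.m n * (LINT p|(mm n). (fst p)^2 / (N^2 + (fst p)^2)) <= e / 4"
   using A1.tail_small[of "e / 4"] e by auto
  obtain N2 where N2: "N2 > 0" "!!N n. N \<ge> N2 ==> A1.m n * (LINT p|(mm n). (snd p)^2 / (N^2 + (snd p)^2)) <= e / 4"
   using A2.tail_small[of "e / 4"] e by auto
  show ?thesis
  proof (intro exI[of _ "max N1 N2"] conjI allI)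
   show "(LINT p|(weighted d (k n)). (fst p)^2 / ((max N1 N2)^2 + (fst p)^2)) <= e" for n
    using tail[where N="max N1 N2" and n="k n", OF measurable_fst_borel] N1(2)[where n="k n", OF max.cobounded1[of N1 N2]] by linarith
   show "(LINT p|(weighted d (k n)). (snd p)^2 / ((max N1 N2)^2 + (snd p)^2)) <= e" for n
    using tail[where N="max N1 N2" and n="k n", OF measurable_snd_borel] N2(2)[where n="k n", OF max.cobounded2[of N2 N1]] by linarith
  qed (use N1 in auto)
 qed
 show ?thesis by (rule finite_weak_limit[where tt="%n. weighted d (k n)", OF fb mass' tight]) (assumption, rule that)
qed

end

context bifree_array
begin

text \<open>Three positive families converge along nested subsequences, and polarisation gives the
  limit of the signed one. A common dominating measure \<open>L\<close> turns all limits into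
  densities that can be combined pointwise.\<close>

lemma weak_limits:
 obtains r :: "nat => nat" and L :: "plane measure" and p q c :: "plane => real"
 where "strict_mono r" "finite_borel L"
  "p \<in> bor" "q \<in> bor" "c \<in> bor"
  "!!x. 0 <= p x & p x <= 1 & 0 <= q x & q x <= 1 & abs (c x) <= 1"
  "!!h K. continuous_on UNIV h ==> (!!x. norm (h x) <= K) ==>
   (%n. of_real (A1.m (r n)) * (LINT x|(mm (r n)). of_real ((sh x)^2) * h x)) ----> ((LINT x|L. of_real (p x) * h x) :: complex)"
  "!!h K. continuous_on UNIV h ==> (!!x. norm (h x) <= K) ==>
   (%n. of_real (A1.m (r n)) * (LINT x|(mm (r n)). of_real ((th x)^2) * h x)) ----> ((LINT x|L. of_real (q x) * h x) :: complex)"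
  "!!h K. continuous_on UNIV h ==> (!!x. norm (h x) <= K) ==>
   (%n. of_real (A1.m (r n)) * (LINT x|(mm (r n)). of_real (sh x * th x) * h x)) ----> ((LINT x|L. of_real (c x) * h x) :: complex)"
proof -
 let ?S = "%x. (sh x + th x)^2"
 have sq1: "(sh x)^2 <= 1" "(th x)^2 <= 1" "0 <= (sh x)^2" "0 <= (th x)^2" for x :: "plane"
  by (rule abs_ratio_power2_le zero_le_power2)+
 have S_le: "?S x <= 2 * (sh x)^2 + 2 * (th x)^2" for x :: "plane"
 proof -
  have "(a + b)^2 <= 2 * a^2 + 2 * b^2" for a b :: real using zero_le_power2[of "a - b"] by (simp add: power2_eq_square algebra_simps)
  thus ?thesis .
 qed
 have S4: "?S x <= 4" for x :: "plane" using S_le[of x] sq1[of x] by linarith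
 obtain C1 where C1: "!!n. A1.m n * (LINT x|(mm n). (sh x)^2) <= C1" using A1.mass_bounded by blast
 obtain C2 where C2: "!!n. A1.m n * (LINT x|(mm n). (th x)^2) <= C2" using A2.mass_bounded by blast
 have CS: "A1.m n * (LINT x|(mm n). ?S x) <= 2 * C1 + 2 * C2" for n
 proof -
  have "(LINT x|(mm n). ?S x) <= (LINT x|(mm n). 2 * (sh x)^2 + 2 * (th x)^2)"
  proof (intro integral_mono S_le Bochner_Integration.integrable_add integrable_mult_right A1.integrable_ratio_square A2.integrable_ratio_square)
   show "integrable (mm n) ?S" using S4 by (intro integrable_bounded[OF A1.fin_mm, of _ _ 4]) auto
  qed
  also have "... = 2 * (LINT x|(mm n). (sh x)^2) + 2 * (LINT x|(mm n). (th x)^2)"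
   using A1.integrable_ratio_square[of n] A2.integrable_ratio_square[of n] by simp
  finally have "A1.m n * (LINT x|(mm n). ?S x) <= A1.m n * (2 * (LINT x|(mm n). (sh x)^2) + 2 * (LINT x|(mm n). (th x)^2))"
   by simp
  also have "... = 2 * (A1.m n * (LINT x|(mm n). (sh x)^2)) + 2 * (A1.m n * (LINT x|(mm n). (th x)^2))"
   by (simp only: distrib_left mult.left_commute)
  also have "... <= 2 * C1 + 2 * C2" using C1[of n] C2[of n] by linarith
  finally show ?thesis .
 qed
 have meas [measurable]: "(%x. (sh x)^2) \<in> bor" "(%x. (th x)^2) \<in> bor" "?S \<in> bor" by measurable
 have le4: "(sh x)^2 <= 4" "(th x)^2 <= 4" for x :: "plane" using sq1[of x] by linarith+
 obtain r1 P where 1: "strict_mono r1" "finite_borel P" "weakly_converges (%n. weighted (%x. (sh x)^2) (r1 n)) P"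
  by (rule weighted_limit[where k="%n. n", OF meas(1) zero_le_power2 le4(1) C1]) (rule that)
 obtain r2 Q' where 2: "strict_mono r2" "finite_borel Q'" "weakly_converges (%n. weighted (%x. (th x)^2) (r1 (r2 n))) Q'"
  by (rule weighted_limit[where k=r1, OF meas(2) zero_le_power2 le4(2) C2]) (rule that)
 obtain r3 S' where 3: "strict_mono r3" "finite_borel S'" "weakly_converges (%n. weighted ?S (r1 (r2 (r3 n)))) S'"
  by (rule weighted_limit[where k="%n. r1 (r2 n)", OF meas(3) zero_le_power2 S4 CS]) (rule that)
 define r where "r n = r1 (r2 (r3 n))" for n
 have r: "strict_mono r" using 1(1) 2(1) 3(1) unfolding r_def strict_mono_def by blast
 have w1: "weakly_converges (%n. weighted (%x. (sh x)^2) (r n)) P"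
  unfolding r_def using weakly_converges_subseq[OF weakly_converges_subseq[OF 1(3) 2(1)] 3(1)] .
 have w2: "weakly_converges (%n. weighted (%x. (th x)^2) (r n)) Q'"
  unfolding r_def using weakly_converges_subseq[OF 2(3) 3(1)] .
 have w3: "weakly_converges (%n. weighted ?S (r n)) S'" unfolding r_def using 3(3) .
 obtain L p q s where L: "finite_borel L" and dens: "P = dens L p" "Q' = dens L q" "S' = dens L s"
  and pqs [measurable]: "p \<in> bor" "q \<in> bor" "s \<in> bor"
  and b: "!!x. 0 <= p x & p x <= 1 & 0 <= q x & q x <= 1 & 0 <= s x & s x <= 1"
  by (rule common_density3[OF 1(2) 2(2) 3(2)]) (rule that)
 have sL [measurable_cong]: "sets L = sets borel" and fL: "finite_measure L" using L by (auto simp: finite_borel_def)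
 have conv: "(%n. of_real (A1.m (r n)) * (LINT x|(mm (r n)). of_real (d x) * h x)) ----> (LINT x|L. of_real (D x) * h x)"
  if w: "weakly_converges (%n. weighted d (r n)) (dens L D)" and h: "continuous_on UNIV h" "!!x. norm (h x) <= K"
   and [measurable]: "d \<in> bor" "D \<in> bor" and d: "!!x. 0 <= d x" and D: "!!x. 0 <= D x"
  for d D and h :: "plane => complex" and K
 proof -
  have hb [measurable]: "h \<in> bor" using h(1) by (rule borel_measurable_continuous_onI)
  have "(LINT x|(weighted d (r n)). h x) = of_real (A1.m (r n)) * (LINT x|(mm (r n)). of_real (d x) * h x)" for n
   by (subst integral_weighted) (simp_all only: scaleR_conv_of_real d, measurable)
  moreover have "(LINT x|(dens L D). h x) = (LINT x|L. of_real (D x) * h x)"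
   using D by (subst integral_density) (auto simp: scaleR_conv_of_real)
  ultimately show ?thesis using weakly_convergesD[OF w h] by simp
 qed
 \<comment> \<open>Half of a number between -2 and 1, hence bounded by 1.\<close>
 define c where "c x = (s x - p x - q x) / 2" for x
 have c [measurable]: "c \<in> bor" unfolding c_def[abs_def] by measurable
 have c1: "abs (c x) <= 1" for x using b[of x] unfolding c_def by auto
 have conv12: "(%n. of_real (A1.m (r n)) * (LINT x|(mm (r n)). of_real (sh x * th x) * h x)) ----> (LINT x|L. of_real (c x) * h x)"
  if h: "continuous_on UNIV h" "!!x. norm (h x) <= K" for h :: "plane => complex" and K
 proof -
  have hb [measurable]: "h \<in> bor" using h(1) by (rule borel_measurable_continuous_onI)
  have int: "integrable N (%x. of_real (d x) * h x)" if "finite_measure N" and [measurable_cong]: "sets N = sets borel"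
   and [measurable]: "d \<in> bor" and d: "!!x. abs (d x) <= 4" for N and d :: "plane => real"
  proof (rule integrable_bounded[OF that(1)])
   show "norm (of_real (d x) * h x) <= 4 * K" for x unfolding norm_mult using d h(2) by (intro mult_mono) auto
  qed measurable
  have comb: "(LINT x|N. of_real ((d3 x - d1 x - d2 x) / 2) * h x) = ((LINT x|N. of_real (d3 x) * h x) - (LINT x|N. of_real (d1 x) * h x) - (LINT x|N. of_real (d2 x) * h x)) / 2"
   if N: "finite_measure N" "sets N = sets borel"
   and [measurable]: "d1 \<in> bor" "d2 \<in> bor" "d3 \<in> bor"
   and d: "!!x. abs (d1 x) <= 4" "!!x. abs (d2 x) <= 4" "!!x. abs (d3 x) <= 4"
   for N and d1 d2 d3 :: "plane => real"
  proof -
   have "(LINT x|N. of_real ((d3 x - d1 x - d2 x) / 2) * h x) = (LINT x|N. (of_real (d3 x) * h x - of_real (d1 x) * h x - of_real (d2 x) * h x) / 2)"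
    by (intro Bochner_Integration.integral_cong) (simp_all add: left_diff_distrib)
   also have "... = ((LINT x|N. of_real (d3 x) * h x) - (LINT x|N. of_real (d1 x) * h x) - (LINT x|N. of_real (d2 x) * h x)) / 2"
    using int[OF N that(3) d(1)] int[OF N that(4) d(2)] int[OF N that(5) d(3)] by simp
   finally show ?thesis .
  qed
  have st: "sh x * th x = (?S x - (sh x)^2 - (th x)^2) / 2" for x :: "plane"
  proof -
   have "a * b = ((a + b)^2 - a^2 - b^2) / 2" for a b :: real by (simp add: power2_eq_square algebra_simps)
   thus ?thesis .
  qed
  have ab4: "abs ((sh x)^2) <= 4" "abs ((th x)^2) <= 4" "abs (?S x) <= 4" for x :: "plane"
   unfolding abs_power2 by (rule le4 S4)+
  have pq4: "abs (p x) <= 4" "abs (q x) <= 4" "abs (s x) <= 4" for x using b[of x] by simp_all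
  have "(%n. (of_real (A1.m (r n)) * (LINT x|(mm (r n)). of_real (?S x) * h x) - of_real (A1.m (r n)) * (LINT x|(mm (r n)). of_real ((sh x)^2) * h x)
    - of_real (A1.m (r n)) * (LINT x|(mm (r n)). of_real ((th x)^2) * h x)) / 2)
   ----> ((LINT x|L. of_real (s x) * h x) - (LINT x|L. of_real (p x) * h x) - (LINT x|L. of_real (q x) * h x)) / 2"
   by (intro tendsto_divide tendsto_diff tendsto_const conv[OF w1[unfolded dens] h] conv[OF w2[unfolded dens] h] conv[OF w3[unfolded dens] h] meas pqs zero_le_power2)
    (use b in auto)
  moreover have "(of_real (A1.m (r n)) * (LINT x|(mm (r n)). of_real (?S x) * h x) - of_real (A1.m (r n)) * (LINT x|(mm (r n)). of_real ((sh x)^2) * h x)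
    - of_real (A1.m (r n)) * (LINT x|(mm (r n)). of_real ((th x)^2) * h x)) / 2 = of_real (A1.m (r n)) * (LINT x|(mm (r n)). of_real (sh x * th x) * h x)" for n
   unfolding st comb[OF A1.fin_mm A1.sets_mm meas ab4] by (simp only: right_diff_distrib times_divide_eq_right)
  moreover have "((LINT x|L. of_real (s x) * h x) - (LINT x|L. of_real (p x) * h x) - (LINT x|L. of_real (q x) * h x)) / 2 = (LINT x|L. of_real (c x) * h x)"
   unfolding c_def comb[OF fL sL pqs pq4] ..
  ultimately show ?thesis by simp
 qed
 show thesis
 proof (rule that[OF r L pqs(1,2) c])
  show "0 <= p x & p x <= 1 & 0 <= q x & q x <= 1 & abs (c x) <= 1" for x using b[of x] c1[of x] by blast
  fix h :: "plane => complex" and K assume h: "continuous_on UNIV h" "!!x. norm (h x) <= K"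
  show "(%n. of_real (A1.m (r n)) * (LINT x|(mm (r n)). of_real ((sh x)^2) * h x)) ----> (LINT x|L. of_real (p x) * h x)"
   by (rule conv[OF w1[unfolded dens] h meas(1) pqs(1) zero_le_power2]) (use b in auto)
  show "(%n. of_real (A1.m (r n)) * (LINT x|(mm (r n)). of_real ((th x)^2) * h x)) ----> (LINT x|L. of_real (q x) * h x)"
   by (rule conv[OF w2[unfolded dens] h meas(2) pqs(2) zero_le_power2]) (use b in auto)
  show "(%n. of_real (A1.m (r n)) * (LINT x|(mm (r n)). of_real (sh x * th x) * h x)) ----> (LINT x|L. of_real (c x) * h x)"
   by (rule conv12[OF h])
 qed
qed

end

section \<open>The drift terms\<close>

context root_array
begin

text \<open>The compensation in the Levy-Khintchine formula: a term linear in \<open>z\<close>,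
  which becomes the drift, and a rest from which the weight \<open>ratio (f p)^2\<close> of the
  convergent measures can be taken out.\<close>

lemma X_split:
 assumes z: "z \<in> stolz_domain al be"
 shows "X z p = z * of_real (f p / (1 + (f p)^2)) + of_real (ratio (f p)^2) * lkern z (f p)"
proof -
 define s where "s = cor (f p)"
 have d: "1 - z * s ~= 0" unfolding s_def by (rule nonreal_1_minus_mult[OF stolz_domain_nonreal(1)[OF z]])
 have "1 + s^2 = cor (1 + (f p)^2)" by (simp add: s_def)
 moreover have "1 + (f p)^2 ~= 0" using zero_le_power2[of "f p"] by linarith
 ultimately have e: "1 + s^2 ~= 0" by (simp only: of_real_eq_0_iff not_False_eq_True)
 have "ratio (f p)^2 = (f p)^2 / (1 + (f p)^2)" by (simp add: power_divide)
 hence r: "cor (ratio (f p)^2) = s^2 / (1 + s^2)" by (simp add: s_def)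
 have "z * s / (1 - z * s) = z * (s / (1 + s^2)) + s^2 / (1 + s^2) * ((z^2 + z * s) / (1 - z * s))"
  using d e by (simp add: divide_simps) (simp add: power2_eq_square algebra_simps)
 thus ?thesis unfolding X_def r by (simp add: s_def)
qed

lemma norm_levy_kernel_le:
 assumes z: "z \<in> stolz_domain al be"
 shows "norm (lkern z s) <= (norm (z^2) + 1) * K + 1"
proof -
 have d: "1 - z * of_real s ~= 0" by (rule nonreal_1_minus_mult[OF stolz_domain_nonreal(1)[OF z]])
 have "norm (1 / (1 - z * of_real s)) <= K"
  using stolz_denominator[OF z, of s] by (simp add: norm_divide divide_le_eq)
 hence "norm ((z^2 + 1) * (1 / (1 - z * of_real s))) <= (norm (z^2) + 1) * K"
  unfolding norm_mult using norm_triangle_ineq[of "z^2" 1] by (intro mult_mono) auto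
 moreover have "lkern z s = (z^2 + 1) * (1 / (1 - z * of_real s)) - 1" using d by (simp add: divide_simps)
 ultimately show ?thesis using norm_triangle_ineq4[of "(z^2 + 1) * (1 / (1 - z * of_real s))" 1] by simp
qed

text \<open>The coefficients of \<open>z\<close> are real and independent of \<open>z\<close>.
  Convergence at a single point gives them a real limit, which then serves at every point.\<close>

lemma drift:
 assumes r: "strict_mono r"
  and I: "!!z. z \<in> stolz_domain al be ==> (%n. of_real (m (r n)) * (LINT x|(mm (r n)). of_real (ratio (f x)^2) * lkern z (f x))) ----> I z"
 shows "\<exists>ga::real. \<forall>z\<in>stolz_domain al be. z * R z = of_real ga * z + I z"
proof -
 define g where "g n = m n * (LINT x|(mm n). f x / (1 + (f x)^2))" for n
 have zg: "(%n. z * of_real (g (r n))) ----> z * R z - I z" if z: "z \<in> stolz_domain al be" for z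
 proof -
  let ?h = "%x. of_real (ratio (f x)^2) * lkern z (f x)"
  have i2: "integrable (mm n) ?h" for n
  proof (rule integrable_bounded[OF fin_mm])
   show "norm (?h x) <= 1 * ((norm (z^2) + 1) * K + 1)" for x
    unfolding norm_mult norm_of_real abs_power2 by (intro mult_mono norm_levy_kernel_le z abs_ratio_power2_le) auto
  qed measurable
  have i1: "integrable (mm n) (%x. f x / (1 + (f x)^2))" for n
  proof (rule integrable_bounded[OF fin_mm])
   have "abs x <= 1 + x^2" for x :: real using zero_le_power2[of "1 - abs x"] by (simp add: power2_eq_square algebra_simps)
   thus "norm (f x / (1 + (f x)^2)) <= 1" for x by (simp add: add_pos_nonneg)
  qed measurable
  have "of_real (m n) * (LINT x|(mm n). X z x) - of_real (m n) * (LINT x|(mm n). ?h x) = z * of_real (g n)" for n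
  proof -
   have i1': "integrable (mm n) (%x. z * of_real (f x / (1 + (f x)^2)))"
    by (rule integrable_mult_right) (simp only: complex_of_real_integrable_eq i1)
   have "(LINT x|(mm n). X z x) = (LINT x|(mm n). z * of_real (f x / (1 + (f x)^2))) + (LINT x|(mm n). ?h x)"
    unfolding X_split[OF z] by (rule Bochner_Integration.integral_add[OF i1' i2])
   also have "(LINT x|(mm n). z * of_real (f x / (1 + (f x)^2))) = z * of_real (LINT x|(mm n). f x / (1 + (f x)^2))"
    unfolding integral_mult_right_zero integral_complex_of_real ..
   finally show ?thesis by (simp add: g_def distrib_left)
  qed
  moreover have "(%n. of_real (m (r n)) * (LINT x|(mm (r n)). X z x)) ----> z * R z"
   using LIMSEQ_subseq_LIMSEQ[OF average_X_tendsto[OF z] r] by (simp only: comp_def)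
  ultimately show ?thesis using tendsto_diff[OF _ I[OF z]] by (metis (no_types, lifting) LIMSEQ_def)
 qed
 define z0 where "z0 = Complex 0 (- be / 2)"
 have z0: "z0 \<in> stolz_domain al be" unfolding z0_def using ab by (intro axis_in_stolz_domain) auto
 have nz: "z0 ~= 0" using stolz_domain_nonreal(1)[OF z0] by auto
 define ga where "ga = Re ((z0 * R z0 - I z0) / z0)"
 have "(%n. z0 * of_real (g (r n)) / z0) ----> (z0 * R z0 - I z0) / z0" by (intro tendsto_divide zg z0 tendsto_const nz)
 hence "(%n. Re (z0 * of_real (g (r n)) / z0)) ----> ga" unfolding ga_def by (rule tendsto_Re)
 hence g: "(%n. g (r n)) ----> ga" using nz by simp
 have "z * R z = of_real ga * z + I z" if z: "z \<in> stolz_domain al be" for z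
 proof -
  have "(%n. z * of_real (g (r n))) ----> z * of_real ga" by (intro tendsto_intros g)
  from LIMSEQ_unique[OF this zg[OF z]] show ?thesis by (simp add: algebra_simps)
 qed
 thus ?thesis by blast
qed

end

section \<open>The limiting Levy triple\<close>

context bifree_array
begin

theorem levy_limit:
 obtains ga1 ga2 ro1 ro2 ro where "finite_borel ro1" "finite_borel ro2" "signed_measure_on borel ro" "levy_compatible ro1 ro2 ro"
  "!!z w. z \<in> stolz_domain al be ==> w \<in> stolz_domain al be ==> z * R1 z + w * R2 w + Q z w = levy_khintchine ga1 ga2 ro1 ro2 ro (z, w)"
proof (rule weak_limits)
 fix r :: "nat => nat" and L :: "plane measure" and p q c :: "plane => real"
 assume r: "strict_mono r" and L: "finite_borel L"
  and pqc [measurable]: "p \<in> bor" "q \<in> bor" "c \<in> bor"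
  and b: "!!x. 0 <= p x & p x <= 1 & 0 <= q x & q x <= 1 & abs (c x) <= 1"
  and W1: "!!h K. continuous_on UNIV h ==> (!!x. norm (h x) <= K) ==>
   (%n. of_real (A1.m (r n)) * (LINT x|(mm (r n)). of_real ((sh x)^2) * h x)) ----> ((LINT x|L. of_real (p x) * h x) :: complex)"
  and W2: "!!h K. continuous_on UNIV h ==> (!!x. norm (h x) <= K) ==>
   (%n. of_real (A1.m (r n)) * (LINT x|(mm (r n)). of_real ((th x)^2) * h x)) ----> ((LINT x|L. of_real (q x) * h x) :: complex)"
  and W12: "!!h K. continuous_on UNIV h ==> (!!x. norm (h x) <= K) ==>
   (%n. of_real (A1.m (r n)) * (LINT x|(mm (r n)). of_real (sh x * th x) * h x)) ----> ((LINT x|L. of_real (c x) * h x) :: complex)"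
 have sL [measurable_cong]: "sets L = sets borel" and fL: "finite_measure L" using L by (auto simp: finite_borel_def)
 interpret L: finite_measure L by (rule fL)
 let ?U = "dens L (%x. max 0 (c x))" and ?V = "dens L (%x. max 0 (- c x))"
 define ro where "ro A = measure ?U A - measure ?V A" for A
 have c1: "abs (c x) <= 1" "max 0 (c x) <= 1" "max 0 (- c x) <= 1" for x using b[of x] by auto
 have fb: "finite_borel ?U" "finite_borel ?V"
  by (rule finite_borel_density_bounded[OF L _ c1(2)] finite_borel_density_bounded[OF L _ c1(3)]; measurable)+
 have sgn: "signed_measure_on borel ro"
  unfolding ro_def using fb by (intro signed_measure_diff) (auto simp: finite_borel_def)
 have sint: "signed_integral borel ro h = (LINT x|L. c x *\<^sub>R h x)" if h: "h \<in> bor" "!!x. norm (h x) <= B"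
  for h :: "plane => 'c::{banach, second_countable_topology}" and B
  using signed_integral_eq_diff[OF sgn, of ?U ?V h B] integral_density_pos_neg[OF L pqc(3) c1(1) h] fb h
  by (simp add: ro_def finite_borel_def)
 have fb12: "finite_borel (dens L p)" "finite_borel (dens L q)" using b by (intro finite_borel_density_bounded[OF L, of _ 1]; simp)+
 have i12: "(LINT x|(dens L p). h x) = (LINT x|L. p x *\<^sub>R h x)" "(LINT x|(dens L q). h x) = (LINT x|L. q x *\<^sub>R h x)"
  if [measurable]: "h \<in> bor" for h :: "plane => 'c::{banach, second_countable_topology}"
  using b by (subst integral_density; simp)+
 have shc: "continuous_on UNIV (%x. of_real (sh x) :: complex)" "continuous_on UNIV (%x. of_real (th x) :: complex)"
  by (intro continuous_on_of_real continuous_ratio continuous_intros)+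
 have sh1: "abs (sh x) <= 1" "abs (th x) <= 1" for x :: "plane" by (rule abs_ratio_le_1)+
 \<comment> \<open>Before the limit both sides integrate the same function, as
   \<open>u^2 * v\<close> is \<open>sh * th\<close> times \<open>u\<close>. Both compatibility
   conditions are instances, with the coordinates in either role;
   \<open>kernel_functional_zero\<close> passes from kernels to bounded functions.\<close>
 have compat: "(LINT x|L. g x * (D x * v x - c x * u x)) = (0 :: real)"
  if WD: "!!h K. continuous_on UNIV h ==> (!!x. norm (h x) <= K) ==>
    (%n. of_real (A1.m (r n)) * (LINT x|(mm (r n)). of_real ((u x)^2) * h x)) ----> ((LINT x|L. of_real (D x) * h x) :: complex)"
   and uv: "!!x. u x * v x = sh x * th x" and cont: "continuous_on UNIV (%x. of_real (u x) :: complex)" "continuous_on UNIV (%x. of_real (v x) :: complex)"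
   and [measurable]: "D \<in> bor" "u \<in> bor" "v \<in> bor" "g \<in> bor"
   and bD: "!!x. abs (D x) <= 1" "!!x. abs (u x) <= 1" "!!x. abs (v x) <= 1" and g: "!!x. abs (g x) <= 1"
  for D u v g :: "plane => real"
 proof (rule kernel_functional_zero[OF L _ _ _ _ g])
  have m1: "abs (a * b) <= 1" if "abs a <= 1" "abs b <= 1" for a b :: real using mult_mono[OF that] by (simp add: abs_mult)
  show "abs (D x * v x - c x * u x) <= 2" for x
   using m1[OF bD(1,3), of x x] m1[OF c1(1) bD(2), of x x] by linarith
  fix ze om :: complex assume nz: "Im ze ~= 0" "Im om ~= 0"
  define h where "h x = skern ze (fst x) * skern om (snd x)" for x :: "plane"
  define B where "B = kernel_bound ze * kernel_bound om"
  have hB: "norm (h x) <= B" for x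
   unfolding h_def B_def norm_mult using nz kernel_bound_ge_1[of ze] by (intro mult_mono norm_sqrt_kernel_le) auto
  have hc: "continuous_on UNIV h" unfolding h_def using nz by (intro continuous_intros) auto
  have hm [measurable]: "h \<in> bor" using hc by (rule borel_measurable_continuous_onI)
  have bd: "norm (of_real a * h x) <= B" if "abs a <= 1" for a x
   using mult_mono[OF that hB[of x]] by (simp add: norm_mult)
  have l1: "(%n. of_real (A1.m (r n)) * (LINT x|(mm (r n)). of_real ((u x)^2) * (of_real (v x) * h x))) ----> (LINT x|L. of_real (D x) * (of_real (v x) * h x))"
   by (rule WD[OF continuous_on_mult[OF cont(2) hc] bd[OF bD(3)]])
  have l2: "(%n. of_real (A1.m (r n)) * (LINT x|(mm (r n)). of_real (sh x * th x) * (of_real (u x) * h x))) ----> (LINT x|L. of_real (c x) * (of_real (u x) * h x))"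
   by (rule W12[OF continuous_on_mult[OF cont(1) hc] bd[OF bD(2)]])
  have "of_real ((u x)^2) * (of_real (v x) * h x) = of_real (sh x * th x) * (of_real (u x) * h x)" for x
   unfolding uv[symmetric] by (simp add: power2_eq_square)
  hence e: "(LINT x|L. of_real (D x) * (of_real (v x) * h x)) = (LINT x|L. of_real (c x) * (of_real (u x) * h x))"
   using LIMSEQ_unique[OF l1] l2 by simp
  have i: "integrable L (%x. of_real (D x) * (of_real (v x) * h x))" "integrable L (%x. of_real (c x) * (of_real (u x) * h x))"
   using bd[OF m1[OF bD(1,3)]] bd[OF m1[OF c1(1) bD(2)]] by (intro integrable_bounded[OF fL, of _ B]; simp add: mult.assoc)+
  have "(LINT x|L. (D x * v x - c x * u x) *\<^sub>R h x) = (LINT x|L. of_real (D x) * (of_real (v x) * h x) - of_real (c x) * (of_real (u x) * h x))"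
   by (intro Bochner_Integration.integral_cong) (auto simp: scaleR_conv_of_real left_diff_distrib mult.assoc)
  also have "... = 0" unfolding Bochner_Integration.integral_diff[OF i] e by simp
  finally show "(LINT p|L. (D p * v p - c p * u p) *\<^sub>R (skern ze (fst p) *
    skern om (snd p))) = 0" unfolding h_def .
 qed measurable
 have ibd: "integrable L (%x. indicator A x * (d x * v x))" if [measurable]: "A \<in> sets borel" "d \<in> bor" "v \<in> bor"
  and "!!x. abs (d x) <= 1" "!!x. abs (v x) <= 1" for A and d v :: "plane => real"
  using mult_mono[OF that(4) that(5)] by (intro integrable_bounded[OF fL, of _ 1]) (auto simp: indicator_def abs_mult)
 have p1: "abs (p x) <= 1" "abs (q x) <= 1" for x using b[of x] by auto
 have ind1: "abs (indicator A x) <= (1 :: real)" for A and x :: "plane" by simp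
 have indv: "norm (indicator A x * v) <= 1" if "abs v <= 1" for A and x :: "plane" and v :: real using that by (simp add: indicator_def)
 have eq1: "(LINT x|(dens L p). indicator A x * th x) = signed_integral borel ro (%x. indicator A x * sh x)"
  and eq2: "(LINT x|(dens L q). indicator A x * sh x) = signed_integral borel ro (%x. indicator A x * th x)"
  if A [measurable]: "A \<in> sets borel" for A
 proof -
  have m [measurable]: "(%x :: plane. sh x) \<in> bor" "(%x :: plane. th x) \<in> bor"
   "(indicator A :: _ => real) \<in> bor" by measurable
  have "(LINT x|L. indicator A x * (p x * th x - c x * sh x)) = 0"
   by (rule compat[OF W1 refl shc pqc(1) m p1(1) sh1 ind1])
  moreover have "(LINT x|L. indicator A x * (p x * th x) - indicator A x * (c x * sh x)) = (LINT x|L. indicator A x * (p x * th x)) - (LINT x|L. indicator A x * (c x * sh x))"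
   by (rule Bochner_Integration.integral_diff) (rule ibd[OF A pqc(1) m(2) p1(1) sh1(2)], rule ibd[OF A pqc(3) m(1) c1(1) sh1(1)])
  ultimately have "(LINT x|L. indicator A x * (p x * th x)) = (LINT x|L. indicator A x * (c x * sh x))" by (simp add: right_diff_distrib)
  thus "(LINT x|(dens L p). indicator A x * th x) = signed_integral borel ro (%x. indicator A x * sh x)"
   by (subst i12(1), measurable, subst sint[OF _ indv[OF sh1(1)]], measurable) (simp add: mult.left_commute)
  have "(LINT x|L. indicator A x * (q x * sh x - c x * th x)) = 0"
   by (rule compat[OF W2 mult.commute shc(2,1) pqc(2) m(2,1,3) p1(2) sh1(2,1) ind1])
  moreover have "(LINT x|L. indicator A x * (q x * sh x) - indicator A x * (c x * th x)) = (LINT x|L. indicator A x * (q x * sh x)) - (LINT x|L. indicator A x * (c x * th x))"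
   by (rule Bochner_Integration.integral_diff) (rule ibd[OF A pqc(2) m(1) p1(2) sh1(1)], rule ibd[OF A pqc(3) m(2) c1(1) sh1(2)])
  ultimately have "(LINT x|L. indicator A x * (q x * sh x)) = (LINT x|L. indicator A x * (c x * th x))" by (simp add: right_diff_distrib)
  thus "(LINT x|(dens L q). indicator A x * sh x) = signed_integral borel ro (%x. indicator A x * th x)"
   by (subst i12(2), measurable, subst sint[OF _ indv[OF sh1(2)]], measurable) (simp add: mult.left_commute)
 qed
 define l where "l = measure L {(0, 0)}"
 have atom: "(LINT x|L. d x * indicator {(0, 0)} x) = d (0, 0) * l" for d :: "plane => real"
 proof -
  have "(LINT x|L. d x * indicator {(0, 0)} x) = (LINT x|L. d (0, 0) * indicator {(0, 0)} x)"
   by (intro Bochner_Integration.integral_cong) (auto simp: indicator_def)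
  thus ?thesis by (simp add: l_def)
 qed
 have meas_atom: "measure (dens L p) {(0, 0)} = p (0, 0) * l" "measure (dens L q) {(0, 0)} = q (0, 0) * l" "ro {(0, 0)} = c (0, 0) * l"
 proof -
  have m: "(%x :: plane. indicator {(0, 0)} x :: real) \<in> bor" by simp
  have n1: "norm (indicator {(0, 0)} x :: real) <= 1" for x :: "plane" by simp
  show "measure (dens L p) {(0, 0)} = p (0, 0) * l" "measure (dens L q) {(0, 0)} = q (0, 0) * l"
   using i12(1)[OF m] i12(2)[OF m] atom[of p] atom[of q] by simp_all
  show "ro {(0, 0)} = c (0, 0) * l"
   using integral_density_pos_neg[OF L pqc(3) c1(1) m n1] atom[of c] by (simp add: ro_def)
 qed
 \<comment> \<open>An atom is invisible to weak convergence. The square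
   \<open>(x * sh + y * th)^2\<close> is integrated against bumps \<open>h k\<close>, where
   positivity survives the limit in \<open>n\<close>; only afterwards do the bumps shrink to the
   origin.\<close>
 have form: "0 <= x^2 * (p (0, 0) * l) + 2 * x * y * (c (0, 0) * l) + y^2 * (q (0, 0) * l)" for x y :: real
 proof -
  let ?F = "%v. x^2 * p v + 2 * x * y * c v + y^2 * q v"
  define h where "h k v = 1 / (1 + real k * ((fst v)^2 + (snd v)^2))" for k and v :: "plane"
  have nn: "0 <= real k * ((fst v)^2 + (snd v)^2)" for k and v :: "plane" by simp
  have den: "1 + real k * ((fst v)^2 + (snd v)^2) ~= 0" for k and v :: "plane" using nn[of k v] by linarith
  have h01: "0 <= h k v" "h k v <= 1" for k v
   using nn[of k v] by (simp_all only: h_def) (simp_all only: divide_le_eq_1 zero_le_divide_iff, linarith+)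
  have hc: "continuous_on UNIV (%v. cor (h k v))" for k
   unfolding h_def using den by (intro continuous_intros) auto
  have hm [measurable]: "h k \<in> bor" for k unfolding h_def[abs_def] by measurable
  have hn: "norm (cor (h k v)) <= 1" for k v using h01 by simp
  have ii: "integrable L (%v. d v * h k v)" if [measurable]: "d \<in> bor" and "!!v. abs (d v) <= 1" for d k
  proof (rule integrable_bounded[OF fL])
   show "norm (d v * h k v) <= 1 * 1" for v unfolding norm_mult using that(2)[of v] h01[of k v] by (intro mult_mono) auto
  qed measurable
  have pos: "0 <= (LINT v|L. ?F v * h k v)" for k
  proof -
   have cr: "of_real a * (LINT v|N. of_real (d v) * of_real (h k v)) = cor (a * (LINT v|N. d v * h k v))" for a d and N :: "plane measure"
    by (simp only: of_real_mult[symmetric] integral_complex_of_real)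
   have cL: "(LINT v|L. of_real (d v) * of_real (h k v)) = cor (LINT v|L. d v * h k v)" for d
    by (simp only: of_real_mult[symmetric] integral_complex_of_real)
   have l: "(%n. A1.m (r n) * (LINT v|(mm (r n)). (sh v)^2 * h k v)) ----> (LINT v|L. p v * h k v)"
    "(%n. A1.m (r n) * (LINT v|(mm (r n)). (th v)^2 * h k v)) ----> (LINT v|L. q v * h k v)"
    "(%n. A1.m (r n) * (LINT v|(mm (r n)). (sh v * th v) * h k v)) ----> (LINT v|L. c v * h k v)"
    using W1[OF hc hn, of k] W2[OF hc hn, of k] W12[OF hc hn, of k] unfolding cr cL by (simp_all only: tendsto_of_real_iff)
   have limF: "(%n. x^2 * (A1.m (r n) * (LINT v|(mm (r n)). (sh v)^2 * h k v)) + 2 * x * y * (A1.m (r n) * (LINT v|(mm (r n)). (sh v * th v) * h k v))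
     + y^2 * (A1.m (r n) * (LINT v|(mm (r n)). (th v)^2 * h k v)))
    ----> x^2 * (LINT v|L. p v * h k v) + 2 * x * y * (LINT v|L. c v * h k v) + y^2 * (LINT v|L. q v * h k v)"
    by (intro tendsto_intros l)
   have posF: "0 <= x^2 * (A1.m n * (LINT v|(mm n). (sh v)^2 * h k v)) + 2 * x * y * (A1.m n * (LINT v|(mm n). (sh v * th v) * h k v))
     + y^2 * (A1.m n * (LINT v|(mm n). (th v)^2 * h k v))" for n
   proof -
    have j: "integrable (mm n) (%v. d v * h k v)" if [measurable]: "d \<in> bor" and "!!v. abs (d v) <= 1" for d
    proof (rule integrable_bounded[OF A1.fin_mm])
     show "norm (d v * h k v) <= 1 * 1" for v unfolding norm_mult using that(2)[of v] h01[of k v] by (intro mult_mono) auto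
    qed measurable
    have sh1': "abs ((sh v)^2) <= 1" "abs ((th v)^2) <= 1" "abs (sh v * th v) <= 1" for v :: "plane"
     using mult_mono[OF sh1(1) sh1(2), of v v] abs_ratio_power2_le by (simp_all only: abs_power2 abs_mult mult_1 abs_ge_zero zero_le_one)
    have j3: "integrable (mm n) (%v. (sh v)^2 * h k v)" "integrable (mm n) (%v. (sh v * th v) * h k v)" "integrable (mm n) (%v. (th v)^2 * h k v)"
     by (rule j[OF _ sh1'(1)] j[OF _ sh1'(3)] j[OF _ sh1'(2)]; measurable)+
    have "0 <= (LINT v|(mm n). (x * sh v + y * th v)^2 * h k v)" by (intro Bochner_Integration.integral_nonneg mult_nonneg_nonneg zero_le_power2 h01)
    also have "... = (LINT v|(mm n). x^2 * ((sh v)^2 * h k v) + 2 * x * y * ((sh v * th v) * h k v) + y^2 * ((th v)^2 * h k v))"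
    proof -
     have "(x * a + y * b)^2 * e = x^2 * (a^2 * e) + 2 * x * y * ((a * b) * e) + y^2 * (b^2 * e)" for a b e :: real
      by (simp add: power2_eq_square algebra_simps)
     thus ?thesis by (simp only:)
    qed
    also have "... = x^2 * (LINT v|(mm n). (sh v)^2 * h k v) + 2 * x * y * (LINT v|(mm n). (sh v * th v) * h k v) + y^2 * (LINT v|(mm n). (th v)^2 * h k v)"
    proof -
     have "(LINT v|(mm n). a * f v + b * g v + e * j v) = a * (LINT v|(mm n). f v) + b * (LINT v|(mm n). g v) + e * (LINT v|(mm n). j v)"
      if "integrable (mm n) f" "integrable (mm n) g" "integrable (mm n) j" for a b e :: real and f g j using that by simp
     from this[OF j3] show ?thesis .
    qed
    finally have "0 <= A1.m n * (x^2 * (LINT v|(mm n). (sh v)^2 * h k v) + 2 * x * y * (LINT v|(mm n). (sh v * th v) * h k v) + y^2 * (LINT v|(mm n). (th v)^2 * h k v))"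
     by simp
    thus ?thesis by (simp only: distrib_left mult.left_commute)
   qed
   have "0 <= x^2 * (LINT v|L. p v * h k v) + 2 * x * y * (LINT v|L. c v * h k v) + y^2 * (LINT v|L. q v * h k v)"
    by (rule LIMSEQ_le_const[OF limF]) (intro exI allI impI posF)
   also have "... = (LINT v|L. x^2 * (p v * h k v) + 2 * x * y * (c v * h k v) + y^2 * (q v * h k v))"
   proof -
    have "(LINT v|L. a * f v + b * g v + e * j v) = a * (LINT v|L. f v) + b * (LINT v|L. g v) + e * (LINT v|L. j v)"
     if "integrable L f" "integrable L g" "integrable L j" for a b e :: real and f g j using that by simp
    from this[OF ii[OF pqc(1) p1(1)] ii[OF pqc(3) c1(1)] ii[OF pqc(2) p1(2)]] show ?thesis by simp
   qed
   also have "... = (LINT v|L. ?F v * h k v)" by (simp only: distrib_right mult.assoc)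
   finally show ?thesis .
  qed
  have limL: "(%k. \<integral>v. ?F v * h k v \<partial>L) ----> (LINT v|L. ?F v * indicator {(0, 0)} v)"
  proof (rule integral_dominated_convergence[where w="%_. x^2 + abs (2 * x * y) + y^2"])
   show "AE v in L. (%k. ?F v * h k v) ----> ?F v * indicator {(0, 0)} v"
   proof (intro AE_I2 tendsto_mult tendsto_const)
    fix v :: "plane"
    show "(%k. h k v) ----> indicator {(0, 0)} v"
    proof (cases "v = (0, 0)")
     case False
     hence "(fst v)^2 + (snd v)^2 > 0" by (cases v) (auto simp: sum_power2_gt_zero_iff)
     moreover have "(%k. 1 / (1 + real k * a)) ----> 0" if "a > 0" for a :: real using that by real_asymp
     ultimately have "(%k. 1 / (1 + real k * ((fst v)^2 + (snd v)^2))) ----> 0" by blast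
     thus ?thesis using False by (simp add: h_def)
    qed (simp add: h_def)
   qed
   show "AE v in L. norm (?F v * h k v) <= x^2 + abs (2 * x * y) + y^2" for k
   proof (rule AE_I2)
    fix v
    have "abs (a + b + e) <= abs a + abs b + abs e" for a b e :: real by linarith
    hence "abs (?F v) <= abs (x^2 * p v) + abs (2 * x * y * c v) + abs (y^2 * q v)" .
    also have "... = x^2 * abs (p v) + abs (2 * x * y) * abs (c v) + y^2 * abs (q v)" by (simp only: abs_mult abs_power2)
    also have "... <= x^2 * 1 + abs (2 * x * y) * 1 + y^2 * 1" by (intro add_mono mult_left_mono p1 c1(1)) auto
    finally have "abs (?F v) * abs (h k v) <= (x^2 + abs (2 * x * y) + y^2) * 1" using h01[of k v] by (intro mult_mono) auto
    thus "norm (?F v * h k v) <= x^2 + abs (2 * x * y) + y^2" by (simp only: real_norm_def abs_mult mult_1_right)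
   qed
  qed simp_all
  have "0 <= (LINT v|L. ?F v * indicator {(0, 0)} v)"
   by (rule LIMSEQ_le_const[OF limL]) (intro exI allI impI pos)
  hence "0 <= ?F (0, 0) * l" unfolding atom[of ?F] .
  thus ?thesis by (simp only: distrib_right mult.assoc)
 qed
 have "abs (ro {(0, 0)})^2 <= measure (dens L p) {(0, 0)} * measure (dens L q) {(0, 0)}"
  unfolding meas_atom power2_abs by (rule quadratic_form_nonneg_imp[OF form])
 hence "levy_compatible (dens L p) (dens L q) ro" unfolding levy_compatible_def using eq1 eq2 by blast
 moreover obtain ga1 where ga1: "!!z. z \<in> stolz_domain al be ==> z * R1 z = of_real ga1 * z + (LINT x|L. of_real (p x) * lkern z (fst x))"
 proof -
  have "\<exists>ga::real. \<forall>z\<in>stolz_domain al be. z * R1 z = of_real ga * z + (LINT x|L. of_real (p x) * lkern z (fst x))"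
  proof (rule A1.drift[OF r], rule W1)
   fix z assume z: "z \<in> stolz_domain al be"
   show "norm (lkern z (fst x)) <= (norm (z^2) + 1) * A1.K + 1" for x :: "plane"
    by (rule A1.norm_levy_kernel_le[OF z])
   show "continuous_on UNIV (%x :: plane. lkern z (fst x))"
    using nonreal_1_minus_mult[OF stolz_domain_nonreal(1)[OF z]] by (intro continuous_intros) auto
  qed
  thus ?thesis using that by blast
 qed
 moreover obtain ga2 where ga2: "!!z. z \<in> stolz_domain al be ==> z * R2 z = of_real ga2 * z + (LINT x|L. of_real (q x) * lkern z (snd x))"
 proof -
  have "\<exists>ga::real. \<forall>z\<in>stolz_domain al be. z * R2 z = of_real ga * z + (LINT x|L. of_real (q x) * lkern z (snd x))"
  proof (rule A2.drift[OF r], rule W2)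
   fix z assume z: "z \<in> stolz_domain al be"
   show "norm (lkern z (snd x)) <= (norm (z^2) + 1) * A1.K + 1" for x :: "plane"
    by (rule A1.norm_levy_kernel_le[OF z])
   show "continuous_on UNIV (%x :: plane. lkern z (snd x))"
    using nonreal_1_minus_mult[OF stolz_domain_nonreal(1)[OF z]] by (intro continuous_intros) auto
  qed
  thus ?thesis using that by blast
 qed
 moreover have "z * R1 z + w * R2 w + Q z w = levy_khintchine ga1 ga2 (dens L p) (dens L q) ro (z, w)"
  if z: "z \<in> stolz_domain al be" and w: "w \<in> stolz_domain al be" for z w
 proof -
  define h where "h x = z * w * of_real (sqrt (1 + (fst x)^2)) * of_real (sqrt (1 + (snd x)^2)) / ((1 - z * of_real (fst x)) * (1 - w * of_real (snd x)))" for x :: "plane"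
  have nz: "Im z ~= 0" "Im w ~= 0" "Im (1 / z) ~= 0" "Im (1 / w) ~= 0" using stolz_domain_nonreal(1)[OF z] stolz_domain_nonreal(1)[OF w] by simp_all
  have z0: "z ~= 0" "w ~= 0" using nz by auto
  have d: "1 - z * of_real s ~= 0" "1 - w * of_real s ~= 0" for s using nonreal_1_minus_mult nz by blast+
  have d': "1 - z * of_real s = z * (1 / z - of_real s)" "1 - w * of_real s = w * (1 / w - of_real s)" for s
   using z0 by (simp_all add: right_diff_distrib)
  have hf: "h x = skern (1 / z) (fst x) * skern (1 / w) (snd x)" for x using z0 by (simp add: h_def d')
  have hB: "norm (h x) <= kernel_bound (1 / z) * kernel_bound (1 / w)" for x
   unfolding hf norm_mult using kernel_bound_ge_1[of "1 / z"] by (intro mult_mono norm_sqrt_kernel_le nz) auto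
  have hc: "continuous_on UNIV h" unfolding h_def using d by (intro continuous_intros) auto
  have hm [measurable]: "h \<in> bor" using hc by (rule borel_measurable_continuous_onI)
  \<comment> \<open>The product of the two \<open>X\<close> is \<open>sh * th\<close> times the
    mixed Levy-Khintchine kernel, so \<open>product_limit\<close> identifies \<open>Q\<close> with
    the integral of that kernel.\<close>
  have XX: "A1.X z x * A2.X w x = of_real (sh x * th x) * h x" for x
  proof -
   have "cor (sqrt (1 + s^2)) ~= 0" for s using sqrt_1_sq_pos[of s] by simp
   thus ?thesis unfolding A1.X_def A2.X_def h_def by simp
  qed
  have "(%n. of_real (A1.m (r n)) * (LINT x|(mm (r n)). of_real (sh x * th x) * h x)) ----> Q z w"
   using LIMSEQ_subseq_LIMSEQ[OF product_limit[OF z w] r] unfolding XX by (simp only: comp_def)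
  hence "Q z w = (LINT x|L. of_real (c x) * h x)" by (rule LIMSEQ_unique[OF _ W12[OF hc hB]])
  also have "... = signed_integral borel ro h" by (subst sint[OF hm hB]) (simp add: scaleR_conv_of_real)
  finally have "Q z w = signed_integral borel ro (%(s, t). z * w * of_real (sqrt (1 + s^2)) * of_real (sqrt (1 + t^2)) / ((1 - z * of_real s) * (1 - w * of_real t)))"
   unfolding h_def by (simp only: case_prod_beta')
  moreover have "(LINT (s, t)|(dens L p). lkern z s) = (LINT x|L. of_real (p x) * lkern z (fst x))"
   "(LINT (s, t)|(dens L q). lkern w t) = (LINT x|L. of_real (q x) * lkern w (snd x))"
   unfolding case_prod_beta' by (subst i12; simp add: scaleR_conv_of_real)+
  ultimately show ?thesis unfolding levy_khintchine_def ga1[OF z] ga2[OF w] by simp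
 qed
 ultimately show thesis using that[OF fb12 sgn] by blast
qed

end

lemma stolz_angle_connected: "connected (stolz_angle al be)"
proof (rule convex_connected)
 have "stolz_angle al be = {z. Im z < 0} \<inter> {z. Complex 1 al \<bullet> z < 0} \<inter> {z. Complex (-1) al \<bullet> z < 0} \<inter> {z. - be < Im z}"
  by (auto simp: stolz_angle_def inner_complex_def)
 thus "convex (stolz_angle al be)"
  by (simp add: convex_Int convex_halfspace_lt convex_halfspace_Im_lt convex_halfspace_Im_gt)
qed

section \<open>Identity theorem and uniqueness\<close>

text \<open>Covers Stolz domains and the complement of the real axis. Neither is connected, but the
  parts in the two half planes are, so the identity theorem can be applied on each side.\<close>

definition two_sided :: "complex set => bool" where
 "two_sided A \<longleftrightarrow> open A & connected (A \<inter> {z. Im z < 0}) & connected (A \<inter> {z. Im z > 0}) & A \<subseteq> - \<real>"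

lemma two_sided_stolz_domain: "two_sided (stolz_domain al be)"
proof -
 have "stolz_domain al be \<inter> {z. Im z < 0} = stolz_angle al be" "stolz_domain al be \<inter> {z. Im z > 0} = cnj ` stolz_angle al be"
  by (auto simp: stolz_domain_def stolz_angle_def)
 thus ?thesis using stolz_angle_connected[of al be] open_stolz_domain stolz_domain_nonreal(2)
  by (auto simp: two_sided_def intro!: connected_continuous_image)
qed

lemma two_sided_nonreal: "two_sided (- \<real>)"
proof -
 have "- \<real> \<inter> {z. Im z < 0} = {z. Im z < 0}" "- \<real> \<inter> {z. Im z > 0} = {z. Im z > 0}" by (auto simp: complex_is_Real_iff)
 thus ?thesis by (simp add: two_sided_def convex_connected convex_halfspace_Im_gt convex_halfspace_Im_lt)
qed

lemma stolz_identity: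
 assumes A: "two_sided A" and sub: "stolz_domain al be \<subseteq> A" and ab: "0 < al" "0 < be"
  and fg: "f holomorphic_on A" "g holomorphic_on A" and eq: "!!z. z \<in> stolz_domain al be ==> f z = g z" and z: "z \<in> A"
 shows "f z = g z"
proof -
 have pts: "Complex 0 (- be / 2) \<in> stolz_domain al be" "Complex 0 (be / 2) \<in> stolz_domain al be"
  using ab by (intro axis_in_stolz_domain; simp)+
 have main: "f z = g z" if H: "open H" "connected (A \<inter> H)" "p \<in> H" "p \<in> stolz_domain al be" "z \<in> H" for H p
 proof (rule analytic_continuation_open[of "stolz_domain al be \<inter> H" "A \<inter> H" f g])
  show "open (stolz_domain al be \<inter> H)" "open (A \<inter> H)" using A H(1) open_stolz_domain by (auto simp: two_sided_def)
 qed (use H sub eq z fg in \<open>auto intro: holomorphic_on_subset\<close>)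
 have "Im z < 0 \<or> Im z > 0" using A z by (force simp: two_sided_def complex_is_Real_iff)
 thus ?thesis
  using main[of "{z. Im z < 0}" "Complex 0 (- be / 2)"] main[of "{z. Im z > 0}" "Complex 0 (be / 2)"] A pts ab
  by (auto simp: two_sided_def open_halfspace_Im_lt open_halfspace_Im_gt)
qed

lemma stolz_identity2:
 assumes A: "two_sided A" and sub: "stolz_domain al be \<subseteq> A" and ab: "0 < al" "0 < be"
  and f: "!!w. w \<in> A ==> (%z. f z w) holomorphic_on A" "!!z. z \<in> A ==> (%w. f z w) holomorphic_on A"
  and g: "!!w. w \<in> A ==> (%z. g z w) holomorphic_on A" "!!z. z \<in> A ==> (%w. g z w) holomorphic_on A"
  and eq: "!!z w. z \<in> stolz_domain al be ==> w \<in> stolz_domain al be ==> f z w = g z w" and zw: "z \<in> A" "w \<in> A"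
 shows "f z w = g z w"
proof (rule stolz_identity[OF A sub ab f(2)[OF zw(1)] g(2)[OF zw(1)] _ zw(2)])
 fix w assume w: "w \<in> stolz_domain al be"
 hence wA: "w \<in> A" using sub by auto
 show "f z w = g z w" by (rule stolz_identity[OF A sub ab f(1)[OF wA] g(1)[OF wA] eq[OF _ w] zw(1)])
qed

text \<open>At \<open>\<i>\<close> the integrand of \<open>phi\<close> is the constant
  \<open>- \<i>\<close>, so the real part there is \<open>ga\<close>. Above the real axis
  \<open>- Im phi\<close> is the Poisson integral of the measure with weight \<open>1 + s^2\<close>,
  which \<open>poisson_determines\<close> inverts.\<close>

lemma nevanlinna_unique:
 assumes "nevanlinna_pair si" "nevanlinna_pair si'" and ab: "0 < al" "0 < be"
  and eq: "!!z. z \<in> stolz_domain al be ==> nevanlinna_pair.R ga si z = nevanlinna_pair.R ga' si' z"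
 shows "ga = ga'" "si = si'"
proof -
 interpret N: nevanlinna_pair ga si by fact
 interpret N': nevanlinna_pair ga' si' by fact
 have R: "N.R z = N'.R z" if "Im z ~= 0" for z
  using stolz_identity[OF two_sided_nonreal stolz_domain_nonreal(2) ab N.R_holomorphic N'.R_holomorphic eq] that by (simp add: nonreal_iff)
 have phi: "N.phi ze = N'.phi ze" if "Im ze ~= 0" for ze
  using R[of "1 / ze"] that by (simp add: N.R_def N'.R_def)
 have at_i: "nevanlinna_pair.phi g s \<i> = Complex g (- measure s (space s))" if "nevanlinna_pair s" for g s
 proof -
  interpret nevanlinna_pair g s by fact
  have "(1 + \<i> * cor t) / (\<i> - of_real t) = - \<i>" for t
  proof -
   have "\<i> - cor t ~= 0" by (intro nonreal_diff_nonzero) simp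
   thus ?thesis by (simp add: divide_eq_eq algebra_simps)
  qed
  hence "phi \<i> = of_real g + (LINT t|s. - \<i>)" by (simp only: phi_def)
  thus ?thesis by (simp add: complex_eq_iff)
 qed
 have "Complex ga (- measure si (space si)) = Complex ga' (- measure si' (space si'))"
  using phi[of \<i>] by (simp add: at_i assms)
 thus "ga = ga'" by simp
 show "si = si'"
 proof (rule measure_eqI)
  fix A assume "A \<in> sets si"
  hence A [measurable]: "A \<in> sets borel" by simp
  have P: "nn_integral s' (%s. ennreal ((1 + s^2) * poisson et (x - s))) = ennreal (- Im (nevanlinna_pair.phi g s' (Complex x et)))"
   if N: "nevanlinna_pair s'" and et: "0 < et" for g s' et x
  proof -
   interpret nevanlinna_pair g s' by fact
   have nz: "Im (Complex x et) ~= 0" using et by simp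
   have e: "(1 + s^2) * poisson et (x - s) = et * ((1 + s^2) / (norm (Complex x et - of_real s))^2)" for s
    unfolding norm_Complex_minus_of_real by (simp add: poisson_def)
   have "nn_integral s' (%s. ennreal ((1 + s^2) * poisson et (x - s))) = ennreal (LINT s|s'. et * ((1 + s^2) / (norm (Complex x et - of_real s))^2))"
    unfolding e using et by (intro nn_integral_eq_integral integrable_mult_right integrable_X[OF nz]) auto
   also have "... = ennreal (et * X (Complex x et))" by (simp only: X_def integral_mult_right_zero)
   also have "et * X (Complex x et) = - Im (phi (Complex x et))" using Im_H[OF nz] by (simp add: H_def algebra_simps)
   finally show ?thesis .
  qed
  have "nn_integral si (%s. ennreal ((1 + s^2) * (indicator A s / (1 + s^2)))) = nn_integral si' (%s. ennreal ((1 + s^2) * (indicator A s / (1 + s^2))))"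
  proof (rule poisson_determines[where g="%s. s" and c="%s. 1 + s^2" and K=1 and h="%s. indicator A s / (1 + s^2)", OF N.finite_si N'.finite_si])
   show "nn_integral si (%s. ennreal ((1 + s^2) * poisson et (x - s))) = nn_integral si' (%s. ennreal ((1 + s^2) * poisson et (x - s)))" if "0 < et" for et x
    using that phi[of "Complex x et"] by (simp add: P[OF assms(1) that, of _ ga] P[OF assms(2) that, of _ ga'])
  qed auto
  moreover have "(1 + s^2) * (indicator A s / (1 + s^2)) = indicator A s" for s :: real
    by (simp add: add_nonneg_eq_0_iff)
  ultimately show "emeasure si A = emeasure si' A" by (simp add: ennreal_indicator)
 qed simp
qed

text \<open>The first compatibility condition determines \<open>\<rho>\<^sub>1\<close> off the axis \<open>t = 0\<close>, and there it is
 determined by its marginal; \<open>f\<close> and \<open>g\<close> are the coordinates and \<open>e\<close> parametrises the axis.\<close>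

lemma measure_determined_by_axis:
 fixes M N :: "plane measure" and f g :: "plane => real"
 assumes fb: "finite_borel M" "finite_borel N"
  and [measurable]: "f \<in> bor" "g \<in> bor" "e \<in> bor"
  and e: "!!p. g p = 0 ==> e (f p) = p"
  and ratio: "!!A. A \<in> sets borel ==> (LINT p|M. indicator A p * ratio (g p)) = (LINT p|N. indicator A p * ratio (g p))"
  and marg: "distr M borel f = distr N borel f"
 shows "M = N"
proof -
 obtain L p q s where L: "finite_borel L" and dens: "M = dens L p" "N = dens L q" "N = dens L s"
  and pq [measurable]: "p \<in> bor" "q \<in> bor"
  and b: "!!x. 0 <= p x & p x <= 1 & 0 <= q x & q x <= 1 & 0 <= s x & s x <= 1"
  by (rule common_density3[OF fb fb(2)]) (rule that)
 have sL [measurable_cong, simp]: "sets L = sets borel" and fL: "finite_measure L" using L by (auto simp: finite_borel_def)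
 have r1: "abs (ratio (g x) * d x) <= 1" if "0 <= d x" "d x <= 1" for d x
  using mult_mono[OF abs_ratio_le_1[of "g x"], of "abs (d x)" 1] that by (simp add: abs_mult)
 have "AE x in L. ratio (g x) * p x = ratio (g x) * q x"
 proof (rule density_unique_real)
  show "integrable L (%x. ratio (g x) * p x)" "integrable L (%x. ratio (g x) * q x)"
   using r1 b by (intro integrable_bounded[OF fL, of _ 1]; simp)+
  fix A assume "A \<in> sets L"
  hence A [measurable]: "A \<in> sets borel" by simp
  have "(LINT x|(dens L d). indicator A x * ratio (g x)) = (LINT x:A|L. ratio (g x) * d x)"
   if [measurable]: "d \<in> bor" and "!!x. 0 <= d x" for d
   using that(2) unfolding set_lebesgue_integral_def by (subst integral_density) (auto simp: mult_ac)
  thus "(LINT x:A|L. ratio (g x) * p x) = (LINT x:A|L. ratio (g x) * q x)"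
   using ratio[OF A, unfolded dens(1,2)] b by simp
 qed
 hence AE: "AE x in L. g x ~= 0 --> p x = q x"
 proof eventually_elim
  case (elim x)
  have "1 + (g x)^2 ~= 0" using zero_le_power2[of "g x"] by linarith
  thus ?case using elim by auto
 qed
 have off: "emeasure M A = emeasure N A" if [measurable]: "A \<in> sets borel" and A: "A \<subseteq> {x. g x ~= 0}" for A
 proof -
  have "nn_integral L (%x. ennreal (p x) * indicator A x) = nn_integral L (%x. ennreal (q x) * indicator A x)"
   using AE A by (intro nn_integral_cong_AE) (auto simp: indicator_def)
  thus ?thesis unfolding dens(1,2) by (simp add: emeasure_density)
 qed
 have s [simp, measurable_cong]: "sets M = sets borel" "sets N = sets borel" using fb by (auto simp: finite_borel_def)
 have sp [simp]: "space M = UNIV" "space N = UNIV" using sets_eq_imp_space_eq[OF s(1)] sets_eq_imp_space_eq[OF s(2)] by auto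
 show ?thesis
 proof (rule measure_eqI)
  fix A assume "A \<in> sets M"
  hence A [measurable]: "A \<in> sets borel" by simp
  define B where "B = f -` (e -` A)"
  have Z [measurable]: "{x. g x ~= 0} \<in> sets borel" by measurable
  have B [measurable]: "B \<in> sets borel"
   unfolding B_def using measurable_sets_borel[OF `f \<in> _`] measurable_sets_borel[OF `e \<in> _` A] by blast
  have MB: "emeasure M B = emeasure N B"
  proof -
   have eB: "e -` A \<in> sets borel" using measurable_sets_borel[OF `e \<in> _` A] .
   show ?thesis using arg_cong[OF marg, of "%D. emeasure D (e -` A)"] eB by (simp add: emeasure_distr B_def)
  qed
  \<comment> \<open>\<open>A\<close> and \<open>B\<close> agree on the axis, and \<open>B\<close> is
    a preimage under \<open>f\<close>, where the marginals decide. The identity is written with sums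
    because extended values cannot be subtracted freely.\<close>
  have split: "emeasure X A + emeasure X (B \<inter> {x. g x ~= 0}) = emeasure X (A \<inter> {x. g x ~= 0}) + emeasure X B" if X [simp]: "sets X = sets borel" for X
  proof -
   have 1: "A - {x. g x ~= 0} = B - {x. g x ~= 0}" using e by (auto simp: B_def)
   have 2: "emeasure X S = emeasure X (S \<inter> {x. g x ~= 0}) + emeasure X (S - {x. g x ~= 0})" if [measurable]: "S \<in> sets borel" for S
   proof -
    have "emeasure X S = emeasure X (S \<inter> {x. g x ~= 0} \<union> (S - {x. g x ~= 0}))" by (rule arg_cong[where f="emeasure X"]) auto
    also have "... = emeasure X (S \<inter> {x. g x ~= 0}) + emeasure X (S - {x. g x ~= 0})" by (intro plus_emeasure[symmetric]) auto
    finally show ?thesis .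
   qed
   show ?thesis unfolding 2[OF A] 2[OF B] 1 by simp
  qed
  have "emeasure N (B \<inter> {x. g x ~= 0}) + emeasure M A = emeasure N (B \<inter> {x. g x ~= 0}) + emeasure N A"
   using split[OF s(1)] split[OF s(2)] off[of "B \<inter> {x. g x ~= 0}"] off[of "A \<inter> {x. g x ~= 0}"] MB by (simp add: add.commute)
  moreover have "emeasure N (B \<inter> {x. g x ~= 0}) ~= \<top>"
   using fb(2) by (simp add: finite_borel_def finite_measure.emeasure_finite)
  ultimately show "emeasure M A = emeasure N A" by simp
 qed simp
qed

text \<open>Crossed sums of the Jordan parts are positive measures with equal Cauchy integrals, so
  uniqueness for positive measures applies.\<close>

lemma signed_measure_determined:
 assumes ro: "signed_measure_on borel ro" and ro': "signed_measure_on borel ro'"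
  and eq: "!!ze om. Im ze ~= 0 ==> Im om ~= 0 ==>
   signed_integral borel ro (%p. skern ze (fst p) * skern om (snd p))
   = signed_integral borel ro' (%p. skern ze (fst p) * skern om (snd p))"
 shows "ro = ro'"
proof (rule ext)
 fix A :: "plane set"
 let ?u = "%ro. upper_variation borel ro :: plane measure" and ?n = "%ro A :: plane set. - ro A :: real"
 have fb: "finite_borel (?u ro)" "finite_borel (?u (?n ro))" "finite_borel (?u ro')" "finite_borel (?u (?n ro'))"
  using jordan_decomposition[OF ro] jordan_decomposition[OF ro'] by (auto simp: finite_borel_def)
 hence f: "finite_measure (?u ro)" "finite_measure (?u (?n ro))" "finite_measure (?u ro')" "finite_measure (?u (?n ro'))"
  by (auto simp: finite_borel_def)
 have fb2: "finite_borel (add_measure (?u ro) (?u (?n ro')))" "finite_borel (add_measure (?u ro') (?u (?n ro)))"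
  using fb by (auto simp: finite_borel_def intro!: finite_measure_add_measure)
 have "add_measure (?u ro) (?u (?n ro')) = add_measure (?u ro') (?u (?n ro))"
 proof (rule cauchy_kernel_determines[OF fb2])
  fix ze om :: complex assume nz: "Im ze ~= 0" "Im om ~= 0"
  let ?k = "%p :: plane. skern ze (fst p) * skern om (snd p)"
  have i: "integrable X ?k" if "finite_borel X" for X using that nz by (rule cauchy_kernel_integrable)
  have sum: "(LINT p|(add_measure X Y). ?k p) = (LINT p|X. ?k p) + (LINT p|Y. ?k p)" if "finite_borel X" "finite_borel Y" for X Y
   using that by (intro integral_add_measure i) (auto simp: finite_borel_def)
  have "a - b = c - d ==> a + d = c + b" for a b c d :: complex by (simp add: algebra_simps)
  from this[OF eq[OF nz, unfolded signed_integral_def]]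
  show "(LINT p|(add_measure (?u ro) (?u (?n ro'))). ?k p) = (LINT p|(add_measure (?u ro') (?u (?n ro))). ?k p)"
   unfolding sum[OF fb(1,4)] sum[OF fb(3,2)] .
 qed
 hence eqA: "emeasure (?u ro) A + emeasure (?u (?n ro')) A = emeasure (?u ro') A + emeasure (?u (?n ro)) A" if "A \<in> sets borel"
  using that emeasure_add_measure[of "?u (?n ro')" "?u ro" A] emeasure_add_measure[of "?u (?n ro)" "?u ro'" A] by simp
 show "ro A = ro' A"
 proof (cases "A \<in> sets borel")
  case True
  have "measure (?u ro) A + measure (?u (?n ro')) A = measure (?u ro') A + measure (?u (?n ro)) A"
   using eqA[OF True] by (simp add: finite_measure.emeasure_eq_measure f ennreal_plus[symmetric] del: ennreal_plus)
  thus ?thesis using jordan_decomposition(3)[OF ro True] jordan_decomposition(3)[OF ro' True] by linarith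
 next
  case False
  thus ?thesis using ro ro' by (simp add: signed_measure_on_def)
 qed
qed

section \<open>Assembling equivalence, uniqueness and marginals\<close>

lemma bifree_R_transform_onD:
 assumes "borel_law vv" "bifree_R_transform_on vv D R"
 obtains al be R1 R2 where "al > 0" "be > 0" "product_domain al be \<subseteq> D" "bifree_local vv al be R1 R2 R"
 using assms unfolding bifree_R_transform_on_def bifree_local_def by blast

lemma bifree_localD:
 assumes "bifree_local mm al be R1 R2 R"
 shows "borel_law mm" "R_transform (marginal1 mm) al be R1" "R_transform (marginal2 mm) al be R2"
  "!!z w. z \<in> stolz_domain al be ==> w \<in> stolz_domain al be ==> bifree_h mm R1 R2 z w ~= 0"
  "!!z w. z \<in> stolz_domain al be ==> w \<in> stolz_domain al be ==> R (z, w) = z * R1 z + w * R2 w + (1 - 1 / bifree_h mm R1 R2 z w)"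
 using assms unfolding bifree_local_def product_domain_def by auto

lemma borel_law_marginal:
 assumes "borel_law vv" shows "borel_law (marginal1 vv)" "borel_law (marginal2 vv)"
 using assms by (auto simp: borel_law_def marginal1_def marginal2_def intro!: prob_space.prob_space_distr)

lemma levy_representation_eq:
 assumes "levy_representation (product_domain al be) R ga1 ga2 ro1 ro2 ro" "p \<in> product_domain al be"
 shows "R p = levy_khintchine ga1 ga2 ro1 ro2 ro p" "p \<in> (- \<real>) \<times> (- \<real>)"
 using assms product_domain_subset(2)[of al be] by (auto simp: levy_representation_def)

lemma bifree_local_cong:
 assumes "bifree_local mm al be R1 R2 R" "!!p. p \<in> product_domain al be ==> R p = R' p"
 shows "bifree_local mm al be R1 R2 R'" using assms by (force simp: bifree_local_def)

lemma bifree_R_transform_on_cong: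
 assumes "borel_law vv" "bifree_R_transform_on vv D R" "R' holomorphic2_on D" "!!p. p \<in> D ==> R' p = R p"
 shows "bifree_R_transform_on vv D R'"
proof (rule bifree_R_transform_onD[OF assms(1,2)])
 fix al be R1 R2 assume *: "al > 0" "be > 0" "product_domain al be \<subseteq> D" "bifree_local vv al be R1 R2 R"
 have "bifree_local vv al be R1 R2 R'" by (rule bifree_local_cong[OF *(4)]) (use *(3) assms(4) in auto)
 thus ?thesis using * assms(3) unfolding bifree_R_transform_on_def bifree_local_def by auto
qed

text \<open>One variable runs to 0 along the imaginary axis, which isolates a marginal transform on
  each side. Used with \<open>c = 1\<close> to compare two laws and with \<open>c = m\<close> to
  compare a law with its root.\<close>

lemma bifree_local_proportional:
 assumes loc: "bifree_local mm al be R1 R2 R" and loc': "bifree_local mm' al be R1' R2' R'"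
  and ab: "0 < al" "0 < be" and eq: "!!p. p \<in> product_domain al be ==> R p = c * R' p" and z: "z \<in> stolz_domain al be"
 shows "R1 z = c * R1' z" "R2 z = c * R2' z"
proof -
 define X where "X i = Complex 0 (be / (real i + 2))" for i
 have X: "X i \<in> stolz_domain al be" for i
  unfolding X_def using ab by (intro axis_in_stolz_domain) (auto simp: divide_less_eq)
 have "(%i. be / (real i + 2)) ----> 0" by real_asymp
 hence X0: "X ----> 0" unfolding X_def using tendsto_Complex[OF tendsto_const[of 0]] by (fastforce simp: zero_complex.code)
 have p: "(z, X i) \<in> product_domain al be" "(X i, z) \<in> product_domain al be" for i using X z by (auto simp: product_domain_def)
 have z0: "z ~= 0" using stolz_domain_nonreal(1)[OF z] by auto
 have "(%i. R (z, X i)) ----> c * (z * R1' z)" "(%i. R (X i, z)) ----> c * (z * R2' z)"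
  unfolding eq[OF p(1)] eq[OF p(2)] by (intro tendsto_mult tendsto_const bifree_local_tendsto[OF loc' z X X0])+
 hence "z * R1 z = c * (z * R1' z)" "z * R2 z = c * (z * R2' z)"
  using LIMSEQ_unique bifree_local_tendsto[OF loc z X X0] by blast+
 thus "R1 z = c * R1' z" "R2 z = c * R2' z" using z0 by simp_all
qed

lemma stolz_subset_of_product_subset:
 "product_domain al be \<subseteq> product_domain al' be' ==> stolz_domain al be \<subseteq> stolz_domain al' be'"
 by (auto simp: product_domain_def)

lemma holomorphic2_stolz_identity:
 assumes A: "two_sided A" and sub: "stolz_domain al be \<subseteq> A" and ab: "0 < al" "0 < be"
  and f: "f holomorphic2_on A \<times> A" and g: "g holomorphic2_on A \<times> A"
  and eq: "!!p. p \<in> product_domain al be ==> f p = g p" and p: "p \<in> A \<times> A"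
 shows "f p = g p"
proof -
 have "f (fst p, snd p) = g (fst p, snd p)"
  by (rule stolz_identity2[where f="%z w. f (z, w)" and g="%z w. g (z, w)", OF A sub ab
     holomorphic2_imp_holomorphic_fst[OF f] holomorphic2_imp_holomorphic_snd[OF f]
     holomorphic2_imp_holomorphic_fst[OF g] holomorphic2_imp_holomorphic_snd[OF g] eq])
   (use p in \<open>auto simp: product_domain_def\<close>)
 thus ?thesis by simp
qed

lemma (in levy_data) exists_local:
 obtains vv b where "0 < b" "!!be. be <= b ==> bifree_local vv al be N1.R N2.R lk"
proof (rule law_with_R_transform)
 fix vv assume vv: "borel_law vv" and ex: "!!al. \<exists>be0>0. \<forall>be\<le>be0. R_transform (marginal1 vv) al be N1.R & R_transform (marginal2 vv) al be N2.R \<and>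
   (\<forall>(z, w)\<in>product_domain al be. bifree_h vv N1.R N2.R z w ~= 0 \<and>
    lk (z, w) = z * N1.R z + w * N2.R w + (1 - 1 / bifree_h vv N1.R N2.R z w))"
 have "\<exists>b>0. \<forall>be\<le>b. bifree_local vv al be N1.R N2.R lk" using ex[of al] vv by (simp only: bifree_local_def simp_thms)
 thus thesis using that by blast
qed

text \<open>The densities do not depend on the constants, which are therefore quantified in the
  conclusion. The clause on the mixed kernel is what uniqueness of \<open>ro\<close> starts
  from.\<close>

lemma levy_data_of_representation:
 assumes "finite_borel ro1" "finite_borel ro2" "signed_measure_on borel ro" "levy_compatible ro1 ro2 ro"
 obtains L A B C where "levy_data L A B C" "ro1 = dens L A" "ro2 = dens L B"
  "!!ga1 ga2 p. p \<in> (- \<real>) \<times> (- \<real>) ==> levy_khintchine ga1 ga2 ro1 ro2 ro p = levy_data.lk ga1 ga2 L A B C p"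
  "!!ze om. Im ze ~= 0 ==> Im om ~= 0 ==> signed_integral borel ro (%p. skern ze (fst p) * skern om (snd p))
   = levy_data.q L C ze om"
proof (rule levy_density_exists[OF assms])
 fix L A B C assume ld: "levy_density L A B C" and ro12: "ro1 = dens L A" "ro2 = dens L B"
  and sgn: "!!(f :: plane => complex) K. f \<in> bor ==> (!!p. norm (f p) <= K) ==>
   signed_integral borel ro f = (LINT p|L. C p *\<^sub>R f p)"
 have LD: "levy_data L A B C" by (rule levy_data.intro[OF ld])
 show thesis
 proof (rule that[OF LD ro12])
  fix ga1 ga2 :: real and p :: "complex \<times> complex" assume p: "p \<in> (- \<real>) \<times> (- \<real>)"
  interpret levy_data ga1 ga2 L A B C by (rule LD)
  have "levy_khintchine ga1 ga2 ro1 ro2 ro (fst p, snd p) = lk (fst p, snd p)" unfolding ro12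
  proof (rule levy_khintchine_eq_lk)
   fix f :: "plane => complex" and K assume "f \<in> bor" "!!p. norm (f p) <= K"
   thus "signed_integral borel ro f = (LINT p|L. C p *\<^sub>R f p)" by (rule sgn)
  qed (use p in \<open>auto simp: nonreal_iff\<close>)
  thus "levy_khintchine ga1 ga2 ro1 ro2 ro p = lk p" by simp
 next
  fix ze om :: complex assume nz: "Im ze ~= 0" "Im om ~= 0"
  interpret levy_data 0 0 L A B C by (rule LD)
  let ?k = "%p :: plane. skern ze (fst p) * skern om (snd p)"
  have "norm (?k p) <= kernel_bound ze * kernel_bound om" for p
   unfolding norm_mult using nz kernel_bound_ge_1[of ze] by (intro mult_mono norm_sqrt_kernel_le) auto
  hence "signed_integral borel ro ?k = (LINT p|L. C p *\<^sub>R ?k p)" by (rule sgn[rotated]) measurable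
  thus "signed_integral borel ro ?k = q ze om" by (simp add: q_def cauchy2_def c_def scaleR_conv_of_real)
 qed
qed

lemma representation_imp_inf_divisible:
 assumes ab: "al > 0" "be > 0" and R: "R holomorphic2_on product_domain al be"
  and rep: "levy_representation (product_domain al be) R ga1 ga2 ro1 ro2 ro"
 shows "\<exists>vv. bifree_inf_divisible vv & bifree_R_transform_on vv (product_domain al be) R"
proof (rule levy_data_of_representation)
 show "finite_borel ro1" "finite_borel ro2" "signed_measure_on borel ro" "levy_compatible ro1 ro2 ro"
  using rep by (auto simp: levy_representation_def)
 fix L A B C assume LD: "levy_data L A B C"
  and lk: "!!ga1 ga2 p. p \<in> (- \<real>) \<times> (- \<real>) ==> levy_khintchine ga1 ga2 ro1 ro2 ro p = levy_data.lk ga1 ga2 L A B C p"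
 interpret levy_data ga1 ga2 L A B C by (rule LD)
 have Rlk: "R p = lk p" if "p \<in> product_domain al be" for p
  using lk levy_representation_eq[OF rep that] by simp
 obtain vv where vv: "borel_law vv" "bifree_R_transform_on vv (product_domain al be) lk"
  by (rule law_bifree_R_transform) (use ab in blast)
 have "\<exists>mm S. borel_law mm & bifree_R_transform_on mm (product_domain al be) S & (\<forall>p\<in>product_domain al be. lk p = of_nat m * S p)"
  if m: "m \<ge> 2" for m :: nat
 proof -
  let ?r = "1 / real m"
  have r: "0 <= ?r" "?r <= 1" using m by auto
  interpret S: levy_data "?r * ga1" "?r * ga2" L "%p. ?r * A p" "%p. ?r * B p" "%p. ?r * C p"
   by (rule levy_data_scale(1)[OF LD r])
  have "lk p = of_nat m * S.lk p" for p unfolding levy_data_scale(2)[OF LD r] using m by simp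
  moreover obtain mm where "borel_law mm" "bifree_R_transform_on mm (product_domain al be) S.lk"
   by (rule S.law_bifree_R_transform) (use ab in blast)
  ultimately show ?thesis by blast
 qed
 hence "bifree_inf_divisible vv" unfolding bifree_inf_divisible_def using vv ab by blast
 moreover have "bifree_R_transform_on vv (product_domain al be) R"
  by (rule bifree_R_transform_on_cong[OF vv R Rlk])
 ultimately show ?thesis by blast
qed

text \<open>Two descriptions of transforms of one law come with unrelated domains and marginal
  transforms. Uniqueness identifies the marginal transforms near 0, and with them \<open>R\<close>
  and \<open>R'\<close>, on a common Stolz domain.\<close>

lemma common_stolz:
 assumes "bifree_local vv al be R1 R2 R" "bifree_local vv al' be' R1' R2' R'" "al > 0" "be > 0" "al' > 0" "be' > 0"
 obtains b where "0 < b" "b <= min be be'" "bifree_local vv (min al al') b R1 R2 R" "bifree_local vv (min al al') b R1 R2 R'"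
proof -
 let ?a = "min al al'" and ?b = "min be be'"
 have l: "bifree_local vv ?a ?b R1 R2 R" "bifree_local vv ?a ?b R1' R2' R'"
  using bifree_local_subset[OF assms(1), of ?a ?b] bifree_local_subset[OF assms(2), of ?a ?b] by simp_all
 note law = borel_law_marginal[OF bifree_localD(1)[OF l(1)]]
 have b0: "0 < ?b" using assms by simp
 obtain b1 where b1: "0 < b1" "b1 <= ?b" "!!z. z \<in> stolz_domain ?a b1 ==> R1 z = R1' z"
  by (rule R_transform_unique[OF law(1) bifree_localD(2)[OF l(1)] bifree_localD(2)[OF l(2)] b0]) (rule that)
 obtain b2 where b2: "0 < b2" "b2 <= ?b" "!!z. z \<in> stolz_domain ?a b2 ==> R2 z = R2' z"
  by (rule R_transform_unique[OF law(2) bifree_localD(3)[OF l(1)] bifree_localD(3)[OF l(2)] b0]) (rule that)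
 let ?c = "min b1 b2"
 have c: "?c <= ?b" using b2(2) by linarith
 note l1 = bifree_local_subset[OF l(1) order_refl c] bifree_local_subset[OF l(2) order_refl c]
 have e: "R1 z = R1' z & R2 z = R2' z" if "z \<in> stolz_domain ?a ?c" for z
  using that b1(3) b2(3) stolz_domain_mono[of ?c b1 ?a] stolz_domain_mono[of ?c b2 ?a] by auto
 have "R p = R' p" if "p \<in> product_domain ?a ?c" for p
 proof -
  obtain z w where p: "p = (z, w)" "z \<in> stolz_domain ?a ?c" "w \<in> stolz_domain ?a ?c" using `p \<in> _` by (auto simp: product_domain_def)
  show ?thesis
   unfolding p(1) bifree_localD(5)[OF l1(1) p(2,3)] bifree_localD(5)[OF l1(2) p(2,3)] using e[OF p(2)] e[OF p(3)] by (simp add: bifree_h_def)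
 qed
 hence "bifree_local vv ?a ?c R1 R2 R'" by (rule bifree_local_cong[OF l1(1)])
 thus thesis using that[OF _ c l1(1)] b1(1) b2(1) by simp
qed

text \<open>The given law is not known to be the one constructed from the triple, but both have the
  same bi-free transform near 0, and this already determines the marginal transforms.\<close>

lemma representation_marginals:
 assumes ab: "al > 0" "be > 0" and vv: "borel_law vv" "bifree_R_transform_on vv (product_domain al be) R"
  and rep: "levy_representation (product_domain al be) R ga1 ga2 ro1 ro2 ro"
 shows "free_inf_div_law ga1 (marginal1 ro1) = marginal1 vv & free_inf_div_law ga2 (marginal2 ro2) = marginal2 vv"
proof (rule levy_data_of_representation)
 show "finite_borel ro1" "finite_borel ro2" "signed_measure_on borel ro" "levy_compatible ro1 ro2 ro"
  using rep by (auto simp: levy_representation_def)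
 fix L A B C assume LD: "levy_data L A B C" and ro12: "ro1 = dens L A" "ro2 = dens L B"
  and lk: "!!ga1 ga2 p. p \<in> (- \<real>) \<times> (- \<real>) ==> levy_khintchine ga1 ga2 ro1 ro2 ro p = levy_data.lk ga1 ga2 L A B C p"
 interpret levy_data ga1 ga2 L A B C by (rule LD)
 obtain a b R1 R2 where loc: "a > 0" "b > 0" "product_domain a b \<subseteq> product_domain al be" "bifree_local vv a b R1 R2 R"
  by (rule bifree_R_transform_onD[OF vv])
 have Rlk: "R p = lk p" if "p \<in> product_domain a b" for p
  using lk levy_representation_eq[OF rep, of p] that loc(3) by auto
 obtain vv0 b0 where b0: "b0 > 0" "!!be. be <= b0 ==> bifree_local vv0 a be N1.R N2.R lk"
  by (rule exists_local[where al=a]) (rule that)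
 let ?b = "min b b0"
 have l: "bifree_local vv a ?b R1 R2 R" "bifree_local vv0 a ?b N1.R N2.R lk"
  using bifree_local_subset[OF loc(4), of a ?b] b0 by simp_all
 have pos: "0 < ?b" using loc b0 by simp
 have eq: "R p = 1 * lk p" if "p \<in> product_domain a ?b" for p
  using Rlk[of p] that product_domain_subset(1)[of ?b b a] by auto
 have e: "R1 z = N1.R z" "R2 z = N2.R z" if "z \<in> stolz_domain a ?b" for z
  using bifree_local_proportional[OF l loc(1) pos eq that] by simp_all
 note law = borel_law_marginal[OF vv(1)]
 show ?thesis
  using N1.free_inf_div_law_eqI[OF law(1) loc(1) pos _ e(1)] N2.free_inf_div_law_eqI[OF law(2) loc(1) pos _ e(2)] l(1)
  by (simp add: bifree_local_def ro12)
qed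

text \<open>The order is forced: the mixed term can be isolated only once the marginal terms agree,
  and \<open>ro1\<close>, \<open>ro2\<close> can be compared through compatibility only once
  \<open>ro\<close> is known. The marginal terms themselves come from the local transforms of the
  two constructed laws.\<close>

lemma representation_unique:
 assumes ab: "al > 0" "be > 0"
  and rep: "levy_representation (product_domain al be) R ga1 ga2 ro1 ro2 ro" "levy_representation (product_domain al be) R ga1' ga2' ro1' ro2' ro'"
 shows "ga1 = ga1' & ga2 = ga2' & ro1 = ro1' & ro2 = ro2' & ro = ro'"
proof -
 have r: "finite_borel ro1" "finite_borel ro2" "signed_measure_on borel ro" "levy_compatible ro1 ro2 ro"
  and r': "finite_borel ro1'" "finite_borel ro2'" "signed_measure_on borel ro'" "levy_compatible ro1' ro2' ro'"
  using rep by (auto simp: levy_representation_def)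
 obtain L A B C where LD: "levy_data L A B C" and ro12: "ro1 = dens L A" "ro2 = dens L B"
  and lk: "!!ga1 ga2 p. p \<in> (- \<real>) \<times> (- \<real>) ==> levy_khintchine ga1 ga2 ro1 ro2 ro p = levy_data.lk ga1 ga2 L A B C p"
  and sq: "!!ze om. Im ze ~= 0 ==> Im om ~= 0 ==> signed_integral borel ro (%p. skern ze (fst p) * skern om (snd p))
   = levy_data.q L C ze om" by (rule levy_data_of_representation[OF r]) (rule that)
 obtain L' A' B' C' where LD': "levy_data L' A' B' C'" and ro12': "ro1' = dens L' A'" "ro2' = dens L' B'"
  and lk': "!!ga1 ga2 p. p \<in> (- \<real>) \<times> (- \<real>) ==> levy_khintchine ga1 ga2 ro1' ro2' ro' p = levy_data.lk ga1 ga2 L' A' B' C' p"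
  and sq': "!!ze om. Im ze ~= 0 ==> Im om ~= 0 ==> signed_integral borel ro' (%p. skern ze (fst p) * skern om (snd p))
   = levy_data.q L' C' ze om" by (rule levy_data_of_representation[OF r']) (rule that)
 interpret D: levy_data ga1 ga2 L A B C by (rule LD)
 interpret D': levy_data ga1' ga2' L' A' B' C' by (rule LD')
 have lkeq: "D.lk p = D'.lk p" if "p \<in> (- \<real>) \<times> (- \<real>)" for p
 proof (rule holomorphic2_stolz_identity[OF two_sided_nonreal stolz_domain_nonreal(2) ab D.lk_holomorphic2 D'.lk_holomorphic2 _ that])
  fix p assume "p \<in> product_domain al be"
  thus "D.lk p = D'.lk p"
   using levy_representation_eq[OF rep(1), of p] levy_representation_eq[OF rep(2), of p] lk[of p ga1 ga2] lk'[of p ga1' ga2'] by simp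
 qed
 obtain vv b where b: "b > 0" "!!be. be <= b ==> bifree_local vv 1 be D.N1.R D.N2.R D.lk" by (rule D.exists_local[where al=1]) (rule that)
 obtain vv' b' where b': "b' > 0" "!!be. be <= b' ==> bifree_local vv' 1 be D'.N1.R D'.N2.R D'.lk" by (rule D'.exists_local[where al=1]) (rule that)
 let ?b = "min b b'"
 have l: "bifree_local vv 1 ?b D.N1.R D.N2.R D.lk" "bifree_local vv' 1 ?b D'.N1.R D'.N2.R D'.lk" using b b' by auto
 have pos: "0 < ?b" using b b' by simp
 have "D.lk p = 1 * D'.lk p" if "p \<in> product_domain 1 ?b" for p
  using lkeq[of p] that product_domain_subset(2)[of 1 ?b] by auto
 from bifree_local_proportional[OF l zero_less_one pos this]
 have R12: "D.N1.R z = D'.N1.R z" "D.N2.R z = D'.N2.R z" if "z \<in> stolz_domain 1 ?b" for z using that by simp_all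
 have g1: "ga1 = ga1'" "marginal1 ro1 = marginal1 ro1'" unfolding ro12 ro12'
  using nevanlinna_unique[OF D.N1.nevanlinna_pair_axioms D'.N1.nevanlinna_pair_axioms zero_less_one pos R12(1)] by blast+
 have g2: "ga2 = ga2'" "marginal2 ro2 = marginal2 ro2'" unfolding ro12 ro12'
  using nevanlinna_unique[OF D.N2.nevanlinna_pair_axioms D'.N2.nevanlinna_pair_axioms zero_less_one pos R12(2)] by blast+
 have RR: "D.N1.R z = D'.N1.R z" "D.N2.R z = D'.N2.R z" for z using g1 g2 unfolding ro12 ro12' by simp_all
 have q: "D.q ze om = D'.q ze om" if "Im ze ~= 0" "Im om ~= 0" for ze om
  using lkeq[of "(1 / ze, 1 / om)"] that by (simp add: D.lk_def D'.lk_def RR nonreal_iff)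
 have ro: "ro = ro'" by (rule signed_measure_determined[OF r(3) r'(3)]) (simp only: sq sq' q simp_thms)
 have "ro1 = ro1'" using r(4) r'(4) g1(2) unfolding ro levy_compatible_def marginal1_def
  by (intro measure_determined_by_axis[OF r(1) r'(1), of fst snd "%x. (x, 0)"]) auto
 moreover have "ro2 = ro2'" using r(4) r'(4) g2(2) unfolding ro levy_compatible_def marginal2_def
  by (intro measure_determined_by_axis[OF r(2) r'(2), of snd fst "%x. (0, x)"]) auto
 ultimately show ?thesis using g1 g2 ro by simp
qed

lemma cauchy_transform2_holomorphic2:
 assumes "borel_law mm"
 shows "(%(z, w). cauchy_transform2 mm z w) holomorphic2_on (- \<real>) \<times> (- \<real>)"
proof -
 have [measurable_cong]: "sets mm = sets borel" and f: "finite_measure mm" using assms by (auto simp: borel_law_def prob_space.finite_measure)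
 interpret cauchy2_kernel mm "%_. 1" fst snd 1
 proof (intro cauchy2_kernel.intro cauchy2_kernel_axioms.intro f)
  have "1 * 1 <= sqrt (1 + (fst p)^2) * sqrt (1 + (snd p)^2)" for p :: "plane" by (intro mult_mono) auto
  thus "norm (1 :: complex) <= 1 * (sqrt (1 + (fst p)^2) * sqrt (1 + (snd p)^2))" for p :: "plane" by simp
 qed measurable
 show ?thesis using cauchy2_holomorphic2 unfolding cauchy2_def cauchy_transform2_eq .
qed

lemma holomorphic2_cong:
 assumes "f holomorphic2_on S" and eq: "!!p. p \<in> S ==> g p = f p"
 shows "g holomorphic2_on S" unfolding holomorphic2_on_def
proof
 fix p assume p: "p \<in> S"
 then obtain a b where "(f has_derivative (%(h, k). a * h + b * k)) (at p within S)"
  using assms(1) unfolding holomorphic2_on_def by blast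
 from has_derivative_transform[OF p eq this]
 show "\<exists>a b. (g has_derivative (%(h, k). a * h + b * k)) (at p within S)" by blast
qed

text \<open>A real value of \<open>1 / z + a\<close> would be a zero of a denominator that
  \<open>stolz_kernel\<close> excludes.\<close>

lemma shifted_inverse:
 assumes z: "z \<in> stolz_domain al be" and a: "norm (z * a) * sqrt (1 + al^2) <= 1 / 2"
 shows "Im (1 / z + a) ~= 0" "1 / (1 / z + a - of_real s) = z * (1 / (1 + z * a - z * of_real s))"
proof -
 have z0: "z ~= 0" using stolz_domain_nonreal(1)[OF z] by auto
 have e: "1 + z * a - z * of_real s = z * (1 / z + a - of_real s)" for s using z0 by (simp add: algebra_simps)
 thus "1 / (1 / z + a - of_real s) = z * (1 / (1 + z * a - z * of_real s))" using z0 by simp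
 show "Im (1 / z + a) ~= 0"
 proof
  assume "Im (1 / z + a) = 0"
  hence "1 / z + a - of_real (Re (1 / z + a)) = 0" by (simp add: complex_eq_iff)
  thus False using stolz_kernel(1)[OF z a, of "Re (1 / z + a)"] unfolding e by simp
 qed
qed

text \<open>The local description of a root may live on a Stolz domain that depends on its order.
  Close to 0 its marginal transforms are those of \<open>vv\<close> divided by the order, and the
  latter are defined on one domain \<open>?S\<close>. So the equations of every root, written with
  them, continue to \<open>?S\<close>, where the array can be formed.\<close>

theorem inf_divisible_imp_representation:
 assumes ab: "al > 0" "be > 0" and R: "R holomorphic2_on product_domain al be"
  and vv: "bifree_inf_divisible vv" "bifree_R_transform_on vv (product_domain al be) R"
 shows "\<exists>ga1 ga2 ro1 ro2 ro. levy_representation (product_domain al be) R ga1 ga2 ro1 ro2 ro"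
proof -
 have law: "borel_law vv" using vv(1) by (simp add: bifree_inf_divisible_def)
 obtain al0 be0 R0 where 0: "al0 > 0" "be0 > 0" "bifree_R_transform_on vv (product_domain al0 be0) R0"
  and root: "\<forall>m\<ge>2. \<exists>mm S. borel_law mm & bifree_R_transform_on mm (product_domain al0 be0) S & (\<forall>p\<in>product_domain al0 be0. R0 p = of_nat m * S p)"
  using vv(1) unfolding bifree_inf_divisible_def by blast
 obtain a1 b1 R1 R2 where 1: "a1 > 0" "b1 > 0" "product_domain a1 b1 \<subseteq> product_domain al0 be0" "bifree_local vv a1 b1 R1 R2 R0"
  by (rule bifree_R_transform_onD[OF law 0(3)])
 obtain a2 b2 R1' R2' where 2: "a2 > 0" "b2 > 0" "product_domain a2 b2 \<subseteq> product_domain al be" "bifree_local vv a2 b2 R1' R2' R"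
  by (rule bifree_R_transform_onD[OF law vv(2)])
 define a where "a = min a1 a2"
 \<comment> \<open>\<open>R0\<close>, which comes with divisibility, and the given \<open>R\<close>
   are transforms of the same law; they are reconciled on a common Stolz domain.\<close>
 obtain d where "0 < d" "d <= min b1 b2" "bifree_local vv (min a1 a2) d R1 R2 R0" "bifree_local vv (min a1 a2) d R1 R2 R"
  by (rule common_stolz[OF 1(4) 2(4) 1(1,2) 2(1,2)]) (rule that)
 hence d: "0 < d" "d <= min b1 b2" "bifree_local vv a d R1 R2 R0" "bifree_local vv a d R1 R2 R" by (simp_all only: a_def)
 have a: "a > 0" "a <= a1" "a <= a2" using 1 2 by (auto simp: a_def)
 define K where "K = sqrt (1 + a^2)"
 have K: "K > 0" unfolding K_def by (rule sqrt_1_sq_pos)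
 have lim: "((%z. z * R1 z) ---> 0) (at 0 within stolz_domain a d)" "((%z. z * R2 z) ---> 0) (at 0 within stolz_domain a d)"
  and hol: "R1 holomorphic_on stolz_domain a d" "R2 holomorphic_on stolz_domain a d"
  using bifree_localD(2,3)[OF d(3)] by (simp_all add: R_transform_def)
 \<comment> \<open>A height at which the shifts of all roots satisfy the smallness condition of
   \<open>stolz_kernel\<close> at once.\<close>
 obtain b where b: "0 < b" "b <= d" "!!z. z \<in> stolz_domain a b ==> norm (z * R1 z) * K <= 1 / 2 & norm (z * R2 z) * K <= 1 / 2"
 proof -
  have "\<forall>\<^sub>F z in at 0 within stolz_domain a d. dist (z * R1 z) 0 < 1 / (2 * K) & dist (z * R2 z) 0 < 1 / (2 * K)"
   using K by (intro eventually_conj tendstoD lim) auto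
  then obtain e where e: "e > 0" "!!z. z \<in> stolz_domain a d ==> z ~= 0 ==> dist z 0 < e ==> dist (z * R1 z) 0 < 1 / (2 * K) & dist (z * R2 z) 0 < 1 / (2 * K)"
   unfolding eventually_at by blast
  show thesis
  proof (rule that)
   show "0 < min d (e / K)" "min d (e / K) <= d" using d(1) e(1) K by auto
   fix z assume z: "z \<in> stolz_domain a (min d (e / K))"
   have "norm z <= K * abs (Im z)" using norm_stolz_domain_le[OF z] by (simp add: K_def)
   also have "... < K * (e / K)" using z K by (intro mult_strict_left_mono) (auto simp: stolz_domain_iff)
   finally have "norm z < e" using K by simp
   moreover have "z \<in> stolz_domain a d" "z ~= 0" using z stolz_domain_mono[of "min d (e / K)" d a] stolz_domain_nonreal(1)[OF z] by auto
   ultimately have "norm (z * R1 z) < 1 / (2 * K) & norm (z * R2 z) < 1 / (2 * K)" using e(2)[of z] by simp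
   thus "norm (z * R1 z) * K <= 1 / 2 & norm (z * R2 z) * K <= 1 / 2" using K by (simp add: field_simps)
  qed
 qed
 let ?S = "stolz_domain a b"
 have S: "?S \<subseteq> stolz_domain a d" "?S \<subseteq> stolz_domain al be" "?S \<subseteq> stolz_domain al0 be0"
  using stolz_domain_mono2[of a a b d] stolz_domain_mono2[of a a2 b b2] stolz_domain_mono2[of a a1 b b1]
   stolz_subset_of_product_subset[OF 1(3)] stolz_subset_of_product_subset[OF 2(3)] a b(2) d(2) by auto
 define Q where "Q z w = R (z, w) - z * R1 z - w * R2 w" for z w
 have R0R: "R0 (z, w) = R (z, w)" if "z \<in> ?S" "w \<in> ?S" for z w
 proof -
  have zw: "z \<in> stolz_domain a d" "w \<in> stolz_domain a d" using that S(1) by blast+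
  show ?thesis unfolding bifree_localD(5)[OF d(3) zw] bifree_localD(5)[OF d(4) zw] ..
 qed
 let ?P = "%n mm. borel_law mm & (\<forall>z\<in>?S. (LINT p|mm. 1 / (1 + z * R1 z / of_nat (n + 2) - z * of_real (fst p))) = 1)
   & (\<forall>z\<in>?S. (LINT p|mm. 1 / (1 + z * R2 z / of_nat (n + 2) - z * of_real (snd p))) = 1)
   & (\<forall>z\<in>?S. \<forall>w\<in>?S. (LINT p|mm. 1 / ((1 + z * R1 z / of_nat (n + 2) - z * of_real (fst p)) * (1 + w * R2 w / of_nat (n + 2) - w * of_real (snd p))))
     * (1 - Q z w / of_nat (n + 2)) = 1)"
 have ex: "\<exists>mm. ?P n mm" for n
 proof -
  define m :: complex where "m = of_nat (n + 2)"
  have m0: "m ~= 0" unfolding m_def by (simp only: of_nat_eq_0_iff)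
  obtain mm T where mm: "borel_law mm" "bifree_R_transform_on mm (product_domain al0 be0) T" and T: "!!p. p \<in> product_domain al0 be0 ==> R0 p = m * T p"
   using root[rule_format, of "n + 2"] unfolding m_def by auto
  obtain a3 b3 r1 r2 where 3: "a3 > 0" "b3 > 0" "product_domain a3 b3 \<subseteq> product_domain al0 be0" "bifree_local mm a3 b3 r1 r2 T"
   by (rule bifree_R_transform_onD[OF mm])
  define a' b' where "a' = min a a3" and "b' = min b b3"
  have pos: "0 < a'" "0 < b'" using a b 3 by (auto simp: a'_def b'_def)
  have l: "bifree_local vv a' b' R1 R2 R0" "bifree_local mm a' b' r1 r2 T"
   using b(2) by (intro bifree_local_subset[OF d(3)] bifree_local_subset[OF 3(4)]; simp add: a'_def b'_def)+
  have S': "stolz_domain a' b' \<subseteq> ?S" unfolding a'_def b'_def by (intro stolz_domain_mono2) auto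
  have P': "product_domain a' b' \<subseteq> product_domain al0 be0" using S' S(3) by (auto simp: product_domain_def)
  have roots: "R1 z = m * r1 z" "R2 z = m * r2 z" if "z \<in> stolz_domain a' b'" for z
   using bifree_local_proportional[OF l pos T that] P' by auto
  have s1: "norm (z * (R1 z / m)) * sqrt (1 + a^2) <= 1 / 2" "norm (z * (R2 z / m)) * sqrt (1 + a^2) <= 1 / 2" if "z \<in> ?S" for z
  proof -
   have le: "norm (y / m) * K <= norm y * K" for y
   proof (rule mult_right_mono)
    have "norm y / norm m <= norm y / 1" unfolding m_def norm_of_nat by (intro divide_left_mono) auto
    thus "norm (y / m) <= norm y" by (simp add: norm_divide)
   qed (use K in simp)
   show "norm (z * (R1 z / m)) * sqrt (1 + a^2) <= 1 / 2" "norm (z * (R2 z / m)) * sqrt (1 + a^2) <= 1 / 2"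
    unfolding times_divide_eq_right K_def[symmetric]
    by (rule order_trans[OF le conjunct1[OF b(3)[OF that]]], rule order_trans[OF le conjunct2[OF b(3)[OF that]]])
  qed
  let ?u = "%z. 1 / z + R1 z / m" and ?v = "%w. 1 / w + R2 w / m"
  have uv: "?u z \<in> - \<real>" "?v z \<in> - \<real>" if "z \<in> ?S" for z
   using shifted_inverse(1)[OF that s1(1)[OF that]] shifted_inverse(1)[OF that s1(2)[OF that]] by (simp_all add: complex_is_Real_iff)
  have z0: "z ~= 0" if "z \<in> ?S" for z using stolz_domain_nonreal(1)[OF that] by auto
  have hu: "?u holomorphic_on ?S" "?v holomorphic_on ?S"
   by (intro holomorphic_intros holomorphic_on_subset[OF hol(1) S(1)] holomorphic_on_subset[OF hol(2) S(1)]; use z0 m0 in simp)+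
  have f0: "sets mm = sets borel" using mm(1) by (simp add: borel_law_def)
  have loc_eq: "cauchy_transform (marginal1 mm) (?u z) = z" "cauchy_transform (marginal2 mm) (?v z) = z" if "z \<in> stolz_domain a' b'" for z
   using bifree_localD(2,3)[OF l(2)] that m0 by (auto simp: R_transform_def roots)
  have G1: "cauchy_transform (marginal1 mm) (?u z) = z" "cauchy_transform (marginal2 mm) (?v z) = z" if z: "z \<in> ?S" for z
  proof -
   have c: "(%z. cauchy_transform (marginal1 mm) (?u z)) holomorphic_on ?S" "(%z. cauchy_transform (marginal2 mm) (?v z)) holomorphic_on ?S"
    using holomorphic_on_compose_gen[OF hu(1) cauchy_transform_holomorphic[OF borel_law_marginal(1)[OF mm(1)]]]
     holomorphic_on_compose_gen[OF hu(2) cauchy_transform_holomorphic[OF borel_law_marginal(2)[OF mm(1)]]] uv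
    by (auto simp: comp_def)
   show "cauchy_transform (marginal1 mm) (?u z) = z"
    by (rule stolz_identity[OF two_sided_stolz_domain S' pos c(1) holomorphic_on_ident loc_eq(1) z])
   show "cauchy_transform (marginal2 mm) (?v z) = z"
    by (rule stolz_identity[OF two_sided_stolz_domain S' pos c(2) holomorphic_on_ident loc_eq(2) z])
  qed
  \<comment> \<open>Multiplied out, so that zeros of the Cauchy transform cannot obstruct the
    continuation to \<open>?S\<close>.\<close>
  have G2: "cauchy_transform2 mm (?u z) (?v w) * (1 - Q z w / m) = z * w" if zw: "z \<in> ?S" "w \<in> ?S" for z w
  proof -
   let ?G = "%z w. cauchy_transform2 mm (?u z) (?v w) * (1 - Q z w / m)"
   note G = cauchy_transform2_holomorphic2[OF mm(1)]
   have Rh: "(%z. R (z, w)) holomorphic_on ?S" "(%z. R (w, z)) holomorphic_on ?S" if "w \<in> ?S" for w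
    using holomorphic2_imp_holomorphic_fst[OF R[unfolded product_domain_def], of w] holomorphic2_imp_holomorphic_snd[OF R[unfolded product_domain_def], of w]
     that S(2) by (auto intro: holomorphic_on_subset)
   have gh: "(%z. cauchy_transform2 mm (?u z) (?v w)) holomorphic_on ?S" "(%z. cauchy_transform2 mm (?u w) (?v z)) holomorphic_on ?S" if "w \<in> ?S" for w
    using holomorphic_on_compose_gen[OF hu(1) holomorphic2_imp_holomorphic_fst[OF G, of "?v w"]] holomorphic_on_compose_gen[OF hu(2) holomorphic2_imp_holomorphic_snd[OF G, of "?u w"]]
     uv[OF that] uv by (auto simp: comp_def)
   note sub = holomorphic_on_subset[OF hol(1) S(1)] holomorphic_on_subset[OF hol(2) S(1)]
   have eqs: "?G z w = z * w" if z: "z \<in> stolz_domain a' b'" and w: "w \<in> stolz_domain a' b'" for z w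
   proof -
    have zS: "z \<in> ?S" "w \<in> ?S" using z w S' by auto
    have h: "bifree_h mm r1 r2 z w = cauchy_transform2 mm (?u z) (?v w) / (z * w)"
     using m0 by (simp add: bifree_h_def roots[OF z] roots[OF w])
    have "R (z, w) = m * T (z, w)" using T[of "(z, w)"] R0R[OF zS] P' z w by (auto simp: product_domain_def)
    also have "... = z * R1 z + w * R2 w + m * (1 - 1 / bifree_h mm r1 r2 z w)"
     unfolding bifree_localD(5)[OF l(2) z w] roots[OF z] roots[OF w] by (simp add: algebra_simps)
    finally have "Q z w / m = 1 - 1 / bifree_h mm r1 r2 z w" using m0 by (simp add: Q_def)
    thus ?thesis using bifree_localD(4)[OF l(2) z w] unfolding h by simp
   qed
   show ?thesis
   proof (rule stolz_identity2[OF two_sided_stolz_domain S' pos _ _ _ _ eqs zw])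
    show "(%z. ?G z w) holomorphic_on ?S" "(%w'. ?G w w') holomorphic_on ?S" if "w \<in> ?S" for w
     unfolding Q_def  by (intro holomorphic_intros gh Rh sub that; simp)+
    show "(%z. z * w) holomorphic_on ?S" "(%w'. w * w') holomorphic_on ?S" for w by (intro holomorphic_intros)+
   qed
  qed
  have e: "(LINT p|mm. 1 / (1 + z * R1 z / m - z * of_real (fst p))) = 1" "(LINT p|mm. 1 / (1 + z * R2 z / m - z * of_real (snd p))) = 1" if z: "z \<in> ?S" for z
   using G1[OF z] z0[OF z] unfolding cauchy_transform_marginal[OF f0] shifted_inverse(2)[OF z s1(1)[OF z]] shifted_inverse(2)[OF z s1(2)[OF z]] integral_mult_right_zero
   by simp_all
  have e2: "(LINT p|mm. 1 / ((1 + z * R1 z / m - z * of_real (fst p)) * (1 + w * R2 w / m - w * of_real (snd p)))) * (1 - Q z w / m) = 1"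
   if z: "z \<in> ?S" and w: "w \<in> ?S" for z w
  proof -
   have k: "1 / ((?u z - of_real (fst p)) * (?v w - of_real (snd p))) = (z * w) * (1 / ((1 + z * R1 z / m - z * of_real (fst p)) * (1 + w * R2 w / m - w * of_real (snd p))))" for p :: "plane"
    using shifted_inverse(2)[OF z s1(1)[OF z], of "fst p"] shifted_inverse(2)[OF w s1(2)[OF w], of "snd p"]
    by (simp only: times_divide_times_eq[of 1 _ 1, symmetric, unfolded mult_1] times_divide_eq_right) simp
   show ?thesis using G2[OF z w] z0[OF z] z0[OF w] unfolding cauchy_transform2_eq k integral_mult_right_zero by simp
  qed
  show ?thesis using mm(1) e e2 unfolding m_def by blast
 qed
 from choice[OF allI[OF ex]] obtain mm where "\<forall>n. ?P n (mm n)" ..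
 hence mm: "!!n. borel_law (mm n)"
  "!!n z. z \<in> ?S ==> (LINT p|(mm n). 1 / (1 + z * R1 z / of_nat (n + 2) - z * of_real (fst p))) = 1"
  "!!n z. z \<in> ?S ==> (LINT p|(mm n). 1 / (1 + z * R2 z / of_nat (n + 2) - z * of_real (snd p))) = 1"
  "!!n z w. z \<in> ?S ==> w \<in> ?S ==> (LINT p|(mm n). 1 / ((1 + z * R1 z / of_nat (n + 2) - z * of_real (fst p)) * (1 + w * R2 w / of_nat (n + 2) - w * of_real (snd p))))
     * (1 - Q z w / of_nat (n + 2)) = 1" by blast+
 have limS: "((%z. z * R1 z) ---> 0) (at 0 within ?S)" "((%z. z * R2 z) ---> 0) (at 0 within ?S)"
  using lim S(1) by (auto intro: tendsto_within_subset)
 interpret bifree_array a b R1 R2 mm Q using a(1) b mm limS unfolding K_def by unfold_locales auto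
 obtain ga1 ga2 ro1 ro2 ro where rep: "finite_borel ro1" "finite_borel ro2" "signed_measure_on borel ro" "levy_compatible ro1 ro2 ro"
  and eq: "!!z w. z \<in> ?S ==> w \<in> ?S ==> z * R1 z + w * R2 w + Q z w = levy_khintchine ga1 ga2 ro1 ro2 ro (z, w)"
  by (rule levy_limit) (rule that)
 obtain L A B C where LD: "levy_data L A B C"
  and lk: "!!ga1 ga2 p. p \<in> (- \<real>) \<times> (- \<real>) ==> levy_khintchine ga1 ga2 ro1 ro2 ro p = levy_data.lk ga1 ga2 L A B C p"
  by (rule levy_data_of_representation[OF rep]) (rule that)
 interpret D: levy_data ga1 ga2 L A B C by (rule LD)
 have hol: "levy_khintchine ga1 ga2 ro1 ro2 ro holomorphic2_on (- \<real>) \<times> (- \<real>)"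
  by (rule holomorphic2_cong[OF D.lk_holomorphic2 lk])
 \<comment> \<open>The limit gives the formula only on the small domain; both sides are holomorphic
   on the whole product domain.\<close>
 have "R p = levy_khintchine ga1 ga2 ro1 ro2 ro p" if "p \<in> product_domain al be" for p
 proof (rule holomorphic2_stolz_identity[OF two_sided_stolz_domain S(2) a(1) b(1)])
  show "R holomorphic2_on stolz_domain al be \<times> stolz_domain al be" using R by (simp add: product_domain_def)
  show "levy_khintchine ga1 ga2 ro1 ro2 ro holomorphic2_on stolz_domain al be \<times> stolz_domain al be"
   using holomorphic2_subset[OF hol product_domain_subset(2)[of al be]] by (simp add: product_domain_def)
  show "p \<in> stolz_domain al be \<times> stolz_domain al be" using that by (simp add: product_domain_def)
  fix p assume "p \<in> product_domain a b"
  thus "R p = levy_khintchine ga1 ga2 ro1 ro2 ro p"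
   using eq[of "fst p" "snd p"] by (auto simp: product_domain_def Q_def)
 qed
 thus ?thesis using rep hol unfolding levy_representation_def by blast
qed

theorem theorem4p3:
  fixes \<alpha> \<beta> :: real and R :: "complex \<times> complex \<Rightarrow> complex"
  assumes "\<alpha> > 0" and "\<beta> > 0"
    and "R holomorphic2_on product_domain \<alpha> \<beta>"
  shows
    "((\<exists>\<nu>. bifree_inf_divisible \<nu> \<and> bifree_R_transform_on \<nu> (product_domain \<alpha> \<beta>) R)
       \<longleftrightarrow> (\<exists>\<gamma>1 \<gamma>2 \<rho>1 \<rho>2 \<rho>. levy_representation (product_domain \<alpha> \<beta>) R \<gamma>1 \<gamma>2 \<rho>1 \<rho>2 \<rho>))
     \<and> (\<forall>\<gamma>1 \<gamma>2 \<rho>1 \<rho>2 \<rho> \<gamma>1' \<gamma>2' \<rho>1' \<rho>2' \<rho>'.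
          levy_representation (product_domain \<alpha> \<beta>) R \<gamma>1 \<gamma>2 \<rho>1 \<rho>2 \<rho> \<longrightarrow>
          levy_representation (product_domain \<alpha> \<beta>) R \<gamma>1' \<gamma>2' \<rho>1' \<rho>2' \<rho>' \<longrightarrow>
          \<gamma>1 = \<gamma>1' \<and> \<gamma>2 = \<gamma>2' \<and> \<rho>1 = \<rho>1' \<and> \<rho>2 = \<rho>2' \<and> \<rho> = \<rho>')
     \<and> (\<forall>\<nu> \<gamma>1 \<gamma>2 \<rho>1 \<rho>2 \<rho>.
          bifree_inf_divisible \<nu> \<longrightarrow>
          bifree_R_transform_on \<nu> (product_domain \<alpha> \<beta>) R \<longrightarrow>
          levy_representation (product_domain \<alpha> \<beta>) R \<gamma>1 \<gamma>2 \<rho>1 \<rho>2 \<rho> \<longrightarrow>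
          marginal1 \<nu> = free_inf_div_law \<gamma>1 (marginal1 \<rho>1) \<and>
          marginal2 \<nu> = free_inf_div_law \<gamma>2 (marginal2 \<rho>2))"
proof (intro conjI allI impI iffI)
  assume "\<exists>\<nu>. bifree_inf_divisible \<nu> \<and> bifree_R_transform_on \<nu> (product_domain \<alpha> \<beta>) R"
  then show "\<exists>\<gamma>1 \<gamma>2 \<rho>1 \<rho>2 \<rho>. levy_representation (product_domain \<alpha> \<beta>) R \<gamma>1 \<gamma>2 \<rho>1 \<rho>2 \<rho>"
    using inf_divisible_imp_representation[OF assms] by blast
next
  assume "\<exists>\<gamma>1 \<gamma>2 \<rho>1 \<rho>2 \<rho>. levy_representation (product_domain \<alpha> \<beta>) R \<gamma>1 \<gamma>2 \<rho>1 \<rho>2 \<rho>"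
  then show "\<exists>\<nu>. bifree_inf_divisible \<nu> \<and> bifree_R_transform_on \<nu> (product_domain \<alpha> \<beta>) R"
    using representation_imp_inf_divisible[OF assms] by blast
next
  fix \<gamma>1 \<gamma>2 \<rho>1 \<rho>2 \<rho> \<gamma>1' \<gamma>2' \<rho>1' \<rho>2' \<rho>'
  assume "levy_representation (product_domain \<alpha> \<beta>) R \<gamma>1 \<gamma>2 \<rho>1 \<rho>2 \<rho>" "levy_representation (product_domain \<alpha> \<beta>) R \<gamma>1' \<gamma>2' \<rho>1' \<rho>2' \<rho>'"
  note u = representation_unique[OF assms(1,2) this]
  show "\<gamma>1 = \<gamma>1'" "\<gamma>2 = \<gamma>2'" "\<rho>1 = \<rho>1'" "\<rho>2 = \<rho>2'" "\<rho> = \<rho>'" using u by simp_all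
next
  fix \<nu> \<gamma>1 \<gamma>2 \<rho>1 \<rho>2 \<rho>
  assume \<nu>: "bifree_inf_divisible \<nu>" "bifree_R_transform_on \<nu> (product_domain \<alpha> \<beta>) R"
    and rep: "levy_representation (product_domain \<alpha> \<beta>) R \<gamma>1 \<gamma>2 \<rho>1 \<rho>2 \<rho>"
  have "borel_law \<nu>" using \<nu>(1) by (simp add: bifree_inf_divisible_def)
  then show "marginal1 \<nu> = free_inf_div_law \<gamma>1 (marginal1 \<rho>1)" "marginal2 \<nu> = free_inf_div_law \<gamma>2 (marginal2 \<rho>2)"
    using representation_marginals[OF assms(1,2) _ \<nu>(2) rep] by simp_all
qed

end
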